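(* Let $n\ge 2$ be an integer and let $2<p<\infty$. There exist a bounded domain $\Omega\subset\mathbb{R}^{n}$ with smooth boundary and a function $v_{0}\in C^{\infty}(\bar{\Omega})$ such that the following holds. The Dirichlet problem $$\min_{w\in v_{0}+W^{1,1}_{0}(\Omega)}\mathcal{A}_{p}(w;\Omega),\qquad \mathcal{A}_{p}(w;\Omega):=\int_{\Omega}(1+|Dw|^{p})^{1/p}\,dx,$$ has a unique solution $v\in v_{0}+W^{1,1}_{0}(\Omega)$; this $v$ is also the unique generalized minimizer of $\mathcal{A}_{p}$ in the class $v_{0}+W^{1,1}_{0}(\Omega)$; and $$v\in \left(C^{0,1-\frac{2}{p}}(\bar{\Omega})\cap W^{1;\frac{p}{2},\infty}(\Omega)\right)\setminus W^{1,\infty}_{\mathrm{loc}}(\Omega).$$ In particular, the set of non-Lebesgue points of $Dv$ in $\Omega$ has positive $\mathcal{H}^{n-1}$-measure.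
   Context: $\mathcal{H}^{n-1}$ is the $(n-1)$-dimensional Hausdorff measure and $|E|$ denotes the Lebesgue measure of a measurable set $E$. A solution of the Dirichlet problem is a function $v\in v_{0}+W^{1,1}_{0}(\Omega)$ with $\mathcal{A}_{p}(v;\Omega)\le \mathcal{A}_{p}(w;\Omega)$ for all $w\in v_{0}+W^{1,1}_{0}(\Omega)$. Generalized minimizers: put $\mathcal{D}_{0}(v_{0};\Omega):=v_{0}+W^{1,1}_{0}(\Omega)$. For $w\in BV(\Omega)$ the relaxed functional is $$\bar{\mathcal{A}}_{p}(w;\mathcal{D}_{0}(v_{0};\Omega)):=\inf\left\{\liminf_{i\to\infty}\mathcal{A}_{p}(w_{i};\Omega)\colon \{w_{i}\}_{i\in\mathbb{N}}\subset \mathcal{D}_{0}(v_{0};\Omega),\ w_{i}\to w \text{ in } L^{1}(\Omega)\right\}.$$ A generalized minimizer of $\mathcal{A}_{p}$ in class $\mathcal{D}_{0}(v_{0};\Omega)$ is a function $\bar{v}\in BV(\Omega)$ with $\bar{\mathcal{A}}_{p}(\bar{v};\mathcal{D}_{0}(v_{0};\Omega))\le \bar{\mathcal{A}}_{p}(w;\mathcal{D}_{0}(v_{0};\Omega))$ for all $w\in BV(\Omega)$. Sobolev-Marcinkiewicz space: for $1<m<\infty$, $W^{1;m,\infty}(\Omega)$ is the set of $w\in W^{1,1}(\Omega)$ with $$[Dw]_{m,\infty;\Omega}:=\sup_{\lambda>0}\lambda\,|\{x\in\Omega\colon |Dw(x)|>\lambda\}|^{1/m}<\infty.$$ Lebesgue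 points are understood in the standard sense: $x_{0}\in\Omega$ is a Lebesgue point of $f\in L^{1}_{\mathrm{loc}}(\Omega,\mathbb{R}^{n})$ if there is $a\in\mathbb{R}^{n}$ such that the averages of $|f-a|$ over the balls $B_{r}(x_{0})$ tend to $0$ as $r\to 0$; otherwise it is a non-Lebesgue point. *)

theory Defs
  imports "HOL-Analysis.Analysis"
begin

text \<open>
  Functions on \<open>\<Omega>\<close> are total functions on \<open>real ^ 'n\<close> whose values outside \<open>\<Omega>\<close>
  (outside \<open>closure \<Omega>\<close>, where the closure is mentioned) are irrelevant. Elements of the spaces
  of integrable functions below are functions, not classes, so uniqueness in these spaces has to
  be stated almost everywhere.
\<close>

section \<open>Smooth functions and smooth domains\<close>

definition pdiff :: "'n \<Rightarrow> (real ^ 'n \<Rightarrow> real) \<Rightarrow> real ^ ('n::finite) \<Rightarrow> real" where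
  "pdiff i f x = frechet_derivative f (at x) (axis i 1)"

primrec pdiffs :: "'n list \<Rightarrow> (real ^ 'n \<Rightarrow> real) \<Rightarrow> real ^ ('n::finite) \<Rightarrow> real" where
  "pdiffs [] f = f"
| "pdiffs (i # is) f = pdiff i (pdiffs is f)"

text \<open>To be used for open \<open>U\<close> only.\<close>

definition smooth_on :: "(real ^ ('n::finite)) set \<Rightarrow> (real ^ 'n \<Rightarrow> real) \<Rightarrow> bool" where
  "smooth_on U f \<longleftrightarrow> (\<forall>is. \<forall>x\<in>U. pdiffs is f differentiable (at x))"

text \<open>\<open>C\<^sup>\<infinity>\<close> up to the boundary: all partial derivatives extend continuously to the closure.\<close>

definition smooth_closure :: "(real ^ ('n::finite)) set \<Rightarrow> (real ^ 'n \<Rightarrow> real) set" where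
  "smooth_closure \<Omega> = {f. smooth_on \<Omega> f \<and> continuous_on (closure \<Omega>) f \<and>
     (\<forall>is. \<exists>g. continuous_on (closure \<Omega>) g \<and> (\<forall>x\<in>\<Omega>. g x = pdiffs is f x))}"

definition bounded_domain :: "(real ^ ('n::finite)) set \<Rightarrow> bool" where
  "bounded_domain \<Omega> \<longleftrightarrow> open \<Omega> \<and> connected \<Omega> \<and> \<Omega> \<noteq> {} \<and> bounded \<Omega>"

text \<open>
  Near each boundary point, \<open>\<Omega>\<close> lies strictly on one side of the graph of a smooth function
  \<open>\<gamma>\<close> of the coordinates other than the \<open>i\<close>-th one; \<open>\<gamma>\<close> is written as a function on the whole
  space that does not depend on the \<open>i\<close>-th coordinate.
\<close>

definition smooth_boundary :: "(real ^ ('n::finite)) set \<Rightarrow> bool" where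
  "smooth_boundary \<Omega> \<longleftrightarrow> (\<forall>x0 \<in> frontier \<Omega>. \<exists>r>0. \<exists>i. \<exists>\<sigma>\<in>{-1, 1}. \<exists>\<gamma>.
     (\<forall>x t. \<gamma> (x + t *\<^sub>R axis i 1) = \<gamma> x) \<and> smooth_on (ball x0 r) \<gamma> \<and>
     \<Omega> \<inter> ball x0 r = {x \<in> ball x0 r. \<sigma> * x $ i > \<gamma> x})"

text \<open>\<open>C\<^sub>c\<^sup>\<infinity>(\<Omega>)\<close>, extended by zero.\<close>

definition test_functions :: "(real ^ ('n::finite)) set \<Rightarrow> (real ^ 'n \<Rightarrow> real) set" where
  "test_functions \<Omega> = {\<phi>. smooth_on UNIV \<phi> \<and>
     compact (closure {x. \<phi> x \<noteq> 0}) \<and> closure {x. \<phi> x \<noteq> 0} \<subseteq> \<Omega>}"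

section \<open>Sobolev spaces\<close>

definition locally_integrable :: "(real ^ ('n::finite)) set \<Rightarrow>
    (real ^ 'n \<Rightarrow> 'b::{banach, second_countable_topology}) \<Rightarrow> bool" where
  "locally_integrable \<Omega> f \<longleftrightarrow> (\<forall>K. compact K \<and> K \<subseteq> \<Omega> \<longrightarrow> integrable (lebesgue_on K) f)"

definition weak_gradient :: "(real ^ ('n::finite)) set \<Rightarrow> (real ^ 'n \<Rightarrow> real) \<Rightarrow>
    (real ^ 'n \<Rightarrow> real ^ 'n) \<Rightarrow> bool" where
  "weak_gradient \<Omega> u g \<longleftrightarrow> locally_integrable \<Omega> u \<and> locally_integrable \<Omega> g \<and>
     (\<forall>\<phi> \<in> test_functions \<Omega>. \<forall>i.
        (LINT x|lebesgue_on \<Omega>. u x * pdiff i \<phi> x) = - (LINT x|lebesgue_on \<Omega>. g x $ i * \<phi> x))"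

text \<open>\<open>Du\<close>; a weak gradient is unique up to a null set, and everything below depends only on its
  almost everywhere class.\<close>

definition wgrad :: "(real ^ ('n::finite)) set \<Rightarrow> (real ^ 'n \<Rightarrow> real) \<Rightarrow> real ^ 'n \<Rightarrow> real ^ 'n" where
  "wgrad \<Omega> u = (SOME g. weak_gradient \<Omega> u g)"

definition W11 :: "(real ^ ('n::finite)) set \<Rightarrow> (real ^ 'n \<Rightarrow> real) set" where
  "W11 \<Omega> = {u. integrable (lebesgue_on \<Omega>) u \<and>
     (\<exists>g. weak_gradient \<Omega> u g \<and> integrable (lebesgue_on \<Omega>) g)}"

definition W11_norm :: "(real ^ ('n::finite)) set \<Rightarrow> (real ^ 'n \<Rightarrow> real) \<Rightarrow> real" where
  "W11_norm \<Omega> u = (LINT x|lebesgue_on \<Omega>. \<bar>u x\<bar>) + (LINT x|lebesgue_on \<Omega>. norm (wgrad \<Omega> u x))"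

definition W11_0 :: "(real ^ ('n::finite)) set \<Rightarrow> (real ^ 'n \<Rightarrow> real) set" where
  "W11_0 \<Omega> = {u \<in> W11 \<Omega>. \<exists>\<phi> :: nat \<Rightarrow> real ^ 'n \<Rightarrow> real. (\<forall>k. \<phi> k \<in> test_functions \<Omega>) \<and>
     (\<lambda>k. W11_norm \<Omega> (\<lambda>x. u x - \<phi> k x)) \<longlonglongrightarrow> 0}"

definition W1inf_loc :: "(real ^ ('n::finite)) set \<Rightarrow> (real ^ 'n \<Rightarrow> real) set" where
  "W1inf_loc \<Omega> = {u. \<exists>g. weak_gradient \<Omega> u g \<and>
     (\<forall>K. compact K \<and> K \<subseteq> \<Omega> \<longrightarrow>
        (\<exists>M. AE x in lebesgue_on K. \<bar>u x\<bar> \<le> M \<and> norm (g x) \<le> M))}"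

definition marcinkiewicz :: "real \<Rightarrow> (real ^ ('n::finite)) set \<Rightarrow> (real ^ 'n \<Rightarrow> real ^ 'n) \<Rightarrow> ennreal" where
  "marcinkiewicz m \<Omega> f = (SUP t\<in>{0<..}.
     ennreal (t * measure lebesgue {x \<in> \<Omega>. norm (f x) > t} powr (1 / m)))"

definition W1_marcinkiewicz :: "real \<Rightarrow> (real ^ ('n::finite)) set \<Rightarrow> (real ^ 'n \<Rightarrow> real) set" where
  "W1_marcinkiewicz m \<Omega> = {w \<in> W11 \<Omega>. marcinkiewicz m \<Omega> (wgrad \<Omega> w) < \<infinity>}"

text \<open>\<open>C\<^sup>0\<^sup>,\<^sup>\<alpha>\<close> of the closure of a bounded \<open>\<Omega>\<close> (boundedness of the function is then automatic).\<close>

definition holder_closure :: "real \<Rightarrow> (real ^ ('n::finite)) set \<Rightarrow> (real ^ 'n \<Rightarrow> real) set" where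
  "holder_closure \<alpha> \<Omega> = {u. \<exists>C. \<forall>x \<in> closure \<Omega>. \<forall>y \<in> closure \<Omega>.
     \<bar>u x - u y\<bar> \<le> C * dist x y powr \<alpha>}"

definition BV :: "(real ^ ('n::finite)) set \<Rightarrow> (real ^ 'n \<Rightarrow> real) set" where
  "BV \<Omega> = {w. integrable (lebesgue_on \<Omega>) w \<and>
     (\<exists>M. \<forall>\<phi> :: real ^ 'n \<Rightarrow> real ^ 'n.
        (\<forall>i. (\<lambda>x. \<phi> x $ i) \<in> test_functions \<Omega>) \<and> (\<forall>x. norm (\<phi> x) \<le> 1) \<longrightarrow>
        (LINT x|lebesgue_on \<Omega>. w x * (\<Sum>i\<in>UNIV. pdiff i (\<lambda>y. \<phi> y $ i) x)) \<le> M)}"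

section \<open>The variational problem\<close>

definition A_fun :: "real \<Rightarrow> (real ^ ('n::finite)) set \<Rightarrow> (real ^ 'n \<Rightarrow> real) \<Rightarrow> ennreal" where
  "A_fun p \<Omega> w = (\<integral>\<^sup>+ x. ennreal ((1 + norm (wgrad \<Omega> w x) powr p) powr (1 / p)) \<partial>lebesgue_on \<Omega>)"

definition dirichlet_class :: "(real ^ 'n \<Rightarrow> real) \<Rightarrow> (real ^ ('n::finite)) set \<Rightarrow>
    (real ^ 'n \<Rightarrow> real) set" where
  "dirichlet_class v0 \<Omega> = {w. (\<lambda>x. w x - v0 x) \<in> W11_0 \<Omega>}"

definition dirichlet_solution :: "real \<Rightarrow> (real ^ 'n \<Rightarrow> real) \<Rightarrow> (real ^ ('n::finite)) set \<Rightarrow>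
    (real ^ 'n \<Rightarrow> real) \<Rightarrow> bool" where
  "dirichlet_solution p v0 \<Omega> v \<longleftrightarrow> v \<in> dirichlet_class v0 \<Omega> \<and>
     (\<forall>w \<in> dirichlet_class v0 \<Omega>. A_fun p \<Omega> v \<le> A_fun p \<Omega> w)"

definition A_relaxed :: "real \<Rightarrow> (real ^ 'n \<Rightarrow> real) \<Rightarrow> (real ^ ('n::finite)) set \<Rightarrow>
    (real ^ 'n \<Rightarrow> real) \<Rightarrow> ennreal" where
  "A_relaxed p v0 \<Omega> w = Inf {liminf (\<lambda>k. A_fun p \<Omega> (W k)) | W :: nat \<Rightarrow> real ^ 'n \<Rightarrow> real.
     (\<forall>k. W k \<in> dirichlet_class v0 \<Omega>) \<and>
     (\<lambda>k. LINT x|lebesgue_on \<Omega>. \<bar>W k x - w x\<bar>) \<longlonglongrightarrow> 0}"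

definition generalized_minimizer :: "real \<Rightarrow> (real ^ 'n \<Rightarrow> real) \<Rightarrow> (real ^ ('n::finite)) set \<Rightarrow>
    (real ^ 'n \<Rightarrow> real) \<Rightarrow> bool" where
  "generalized_minimizer p v0 \<Omega> v \<longleftrightarrow> v \<in> BV \<Omega> \<and>
     (\<forall>w \<in> BV \<Omega>. A_relaxed p v0 \<Omega> v \<le> A_relaxed p v0 \<Omega> w)"

section \<open>Hausdorff measure and Lebesgue points\<close>

text \<open>
  Coverings by bounded sets, since \<open>diameter\<close> is unspecified for unbounded ones. The empty set
  is singled out so that it contributes \<open>0\<close> also for \<open>k = 0\<close>.
\<close>

definition hausdorff_pre :: "nat \<Rightarrow> real \<Rightarrow> (real ^ ('n::finite)) set \<Rightarrow> ennreal" where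
  "hausdorff_pre k \<delta> A = Inf {\<Sum>j. (if C j = {} then 0
       else ennreal (unit_ball_vol (real k) * (diameter (C j) / 2) ^ k)) | C :: nat \<Rightarrow> (real ^ 'n) set.
     A \<subseteq> (\<Union>j. C j) \<and> (\<forall>j. bounded (C j) \<and> diameter (C j) \<le> \<delta>)}"

definition hausdorff_measure :: "nat \<Rightarrow> (real ^ ('n::finite)) set \<Rightarrow> ennreal" where
  "hausdorff_measure k A = (SUP \<delta>\<in>{0<..}. hausdorff_pre k \<delta> A)"

definition lebesgue_point :: "(real ^ 'n \<Rightarrow> real ^ 'n) \<Rightarrow> real ^ ('n::finite) \<Rightarrow> bool" where
  "lebesgue_point f x0 \<longleftrightarrow> (\<exists>a.
     ((\<lambda>r. (LINT x|lebesgue_on (ball x0 r). norm (f x - a)) / measure lebesgue (ball x0 r))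
        \<longlongrightarrow> 0) (at_right 0))"

end

theory Submission
  imports Defs
begin

text \<open>
  The minimizer is a function \<open>v\<close> of two coordinates \<open>x\<^sub>a, x\<^sub>b\<close> whose gradient blows up exactly on the
  hyperplane \<open>x\<^sub>a = 0\<close>. Writing \<open>Dv = |\<epsilon>| powr (- 2/p) *\<^sub>R (cos \<omega>, sin \<omega>)\<close>, the Euler field
  \<open>\<sigma> = (1 + \<epsilon>\<^sup>2) powr (1/p - 1) *\<^sub>R (cos \<omega>, sin \<omega>)\<close> is smooth across the hyperplane as soon as \<open>\<epsilon>\<close> and \<open>\<omega>\<close> are.
  In the variables \<open>\<epsilon>\<close> and \<open>u = \<omega>/\<epsilon>\<close> the Legendre transform turns \<open>div \<sigma> = 0\<close> into a linear equation,
  which is solved by a power series in \<open>u\<close>; inverting the Legendre map and rescaling yields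
  \<open>v = sgn x\<^sub>a * |x\<^sub>a| powr (1 - 2/p) * g\<close> on a large ball, with \<open>g > 0\<close> smooth and \<open>\<epsilon>\<close> comparable to \<open>x\<^sub>a\<close>.

  The domain is chosen such that its boundary crosses the hyperplane with infinite order of contact;
  the boundary values of \<open>v\<close> are then smooth. Since \<open>\<sigma>\<close> is bounded and
  divergence free, convexity shows that \<open>v\<close> minimizes, and that for any competitor the excess
  energy controls the difference of the gradients away from the hyperplane. The Poincare inequality
  along \<open>x\<^sub>b\<close>, which respects the sets \<open>\<bar>x\<^sub>a\<bar> \<ge> \<delta>\<close>, turns this into uniqueness, also for limits of
  minimizing sequences. The remaining claims follow from \<open>|Dv| \<approx> \<bar>x\<^sub>a\<bar> powr (- 2/p)\<close>.
\<close>

section \<open>Smooth functions\<close>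

text \<open>The exponent \<open>- 2/p\<close> comes from the integrand: if |Dv| = |eps| powr (-2/p),
  then |Dv|^p / (1 + |Dv|^p) = 1 / (1 + eps^2), so that infinite slope corresponds to the regular
  value eps = 0 of the Euler field. On the hyperplane Dv is infinite with constant direction, a
  single point at infinity of the gradient plane; dividing the angle by eps spreads this point over
  the line eps = 0, along which u is a coordinate. Boundary values of v inherit the factor |x_a|
  powr (1 - 2/p), which is not smooth at a transversal crossing. If x_a behaves like exp (-1/t)
  along the boundary, this power is exp (-c/t) with another c > 0. The integrand has linear growth,
  so minimizing sequences have no weakly convergent gradients to work with, and its slope tends to 1
  as |Dv| grows, so coercivity around Dv degenerates at the hyperplane. Uniqueness is therefore
  obtained strip by strip, with constants that depend on the strip, and the hyperplane itself is a
  null set.\<close>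

lemma pdiff_eq: "(f has_derivative f') (at x) \<Longrightarrow> pdiff i f x = f' (axis i 1)"
  unfolding pdiff_def by (metis frechet_derivative_at)

lemma has_derivative_pdiff:
  fixes f :: "real ^ 'n::finite \<Rightarrow> real"
  assumes "f differentiable (at x)"
  shows "(f has_derivative (\<lambda>h. \<Sum>i\<in>UNIV. pdiff i f x * h $ i)) (at x)"
proof -
  let ?D = "frechet_derivative f (at x)"
  have D: "(f has_derivative ?D) (at x)" using assms frechet_derivative_works by blast
  then have lin: "linear ?D" by (rule has_derivative_linear)
  have "?D h = (\<Sum>i\<in>UNIV. pdiff i f x * h $ i)" for h
  proof -
    have "?D h = ?D (\<Sum>i\<in>UNIV. h $ i *s axis i 1)" by (simp only: basis_expansion)
    also have "\<dots> = (\<Sum>i\<in>UNIV. ?D (h $ i *\<^sub>R axis i 1))"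
      by (simp add: linear_sum[OF lin] scalar_mult_eq_scaleR)
    also have "\<dots> = (\<Sum>i\<in>UNIV. pdiff i f x * h $ i)"
      by (intro sum.cong) (auto simp: linear_cmul[OF lin] pdiff_def)
    finally show ?thesis .
  qed
  then have "?D = (\<lambda>h. \<Sum>i\<in>UNIV. pdiff i f x * h $ i)" by auto
  then show ?thesis using D by simp
qed

lemma has_derivative_cong_open:
  assumes "open U" "x \<in> U" "\<And>y. y \<in> U \<Longrightarrow> f y = g y"
  shows "(f has_derivative f') (at x) \<longleftrightarrow> (g has_derivative f') (at x)"
  using has_derivative_transform_within_open[OF _ assms(1,2)] assms(3) by metis

lemma pdiff_cong_open:
  assumes "open U" "x \<in> U" "\<And>y. y \<in> U \<Longrightarrow> f y = g y"
  shows "pdiff i f x = pdiff i g x"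
  unfolding pdiff_def frechet_derivative_def
  using has_derivative_cong_open[OF assms] by simp

lemma differentiable_cong_open:
  assumes "open U" "x \<in> U" "\<And>y. y \<in> U \<Longrightarrow> f y = g y"
  shows "f differentiable (at x) \<longleftrightarrow> g differentiable (at x)"
  unfolding differentiable_def using has_derivative_cong_open[OF assms] by simp

lemma pdiffs_cong_open:
  assumes "open U" "x \<in> U" "\<And>y. y \<in> U \<Longrightarrow> f y = g y"
  shows "pdiffs is f x = pdiffs is g x"
  using assms(2)
proof (induction "is" arbitrary: x)
  case (Cons i "is")
  then show ?case
    using pdiff_cong_open[OF assms(1), of x "pdiffs is f" "pdiffs is g"] by auto
qed (use assms in auto)

lemma pdiff_const [simp]: "pdiff i (\<lambda>x. c) x = 0"
  by (subst pdiff_eq[where f' = "\<lambda>h. 0"]) auto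

lemma pdiff_nth: "pdiff i (\<lambda>x. x $ j) x = (if i = j then 1 else 0)"
  by (subst pdiff_eq[where f' = "\<lambda>h. h $ j"])
    (auto intro!: bounded_linear_imp_has_derivative bounded_linear_vec_nth simp: axis_def)

lemma pdiff_add:
  "f differentiable (at x) \<Longrightarrow> g differentiable (at x) \<Longrightarrow>
    pdiff i (\<lambda>x. f x + g x) x = pdiff i f x + pdiff i g x"
  by (subst pdiff_eq[OF has_derivative_add])
    (auto simp: frechet_derivative_works pdiff_def)

lemma pdiff_mult:
  "f differentiable (at x) \<Longrightarrow> g differentiable (at x) \<Longrightarrow>
    pdiff i (\<lambda>x. f x * g x) x = f x * pdiff i g x + pdiff i f x * g x"
  by (subst pdiff_eq[OF has_derivative_mult])
    (auto simp: frechet_derivative_works pdiff_def)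

lemma pdiff_diff:
  "f differentiable (at x) \<Longrightarrow> g differentiable (at x) \<Longrightarrow>
    pdiff i (\<lambda>x. f x - g x) x = pdiff i f x - pdiff i g x"
  by (subst pdiff_eq[OF has_derivative_diff])
    (auto simp: frechet_derivative_works pdiff_def)

text \<open>A family of functions is smooth as soon as its first partial derivatives lie in the algebra that it generates on \<open>U\<close>.\<close>

inductive alg :: "(real ^ 'n::finite) set \<Rightarrow> (real ^ 'n \<Rightarrow> real) set \<Rightarrow> (real ^ 'n \<Rightarrow> real) \<Rightarrow> bool"
  for U B where
  base: "f \<in> B \<Longrightarrow> alg U B f"
| const: "alg U B (\<lambda>x. c)"
| add: "alg U B f \<Longrightarrow> alg U B g \<Longrightarrow> alg U B (\<lambda>x. f x + g x)"
| mult: "alg U B f \<Longrightarrow> alg U B g \<Longrightarrow> alg U B (\<lambda>x. f x * g x)"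
| cong: "alg U B f \<Longrightarrow> (\<And>x. x \<in> U \<Longrightarrow> g x = f x) \<Longrightarrow> alg U B g"

lemma alg_sum:
  assumes "\<And>k. k \<in> S \<Longrightarrow> alg U B (f k)"
  shows "alg U B (\<lambda>x. \<Sum>k\<in>S. f k x)"
  using assms by (induction S rule: infinite_finite_induct) (auto intro: alg.intros)

text \<open>By the product rule the algebra is closed under partial differentiation, hence contains
  all iterated partial derivatives, and all its members are differentiable. The rule
  \<open>cong\<close> matters here: formulas for derivatives hold on the open set U only.\<close>

lemma alg_smooth:
  assumes "open U"
    and diff: "\<And>f x. f \<in> B \<Longrightarrow> x \<in> U \<Longrightarrow> f differentiable (at x)"
    and pdiff: "\<And>f i. f \<in> B \<Longrightarrow> alg U B (pdiff i f)"
    and f: "alg U B f"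
  shows "smooth_on U f"
proof -
  have step: "(\<forall>x\<in>U. f differentiable (at x)) \<and> (\<forall>i. alg U B (pdiff i f))" if "alg U B f" for f
    using that
  proof (induction rule: alg.induct)
    case (base f) then show ?case using diff pdiff by blast
  next
    case (const c)
    have "alg U B (pdiff i (\<lambda>x. c))" for i by (rule alg.cong[OF alg.const[where c = 0]]) simp
    then show ?case by (intro conjI ballI allI differentiable_const)
  next
    case (add f g)
    have "alg U B (pdiff i (\<lambda>x. f x + g x))" for i
      by (rule alg.cong[OF alg.add[of _ _ "pdiff i f" "pdiff i g"]]) (use add in \<open>auto simp: pdiff_add\<close>)
    then show ?case using add by (auto intro: differentiable_add)
  next
    case (mult f g)
    have "alg U B (pdiff i (\<lambda>x. f x * g x))" for i
      by (rule alg.cong[OF alg.add[OF alg.mult[of _ _ f "pdiff i g"] alg.mult[of _ _ "pdiff i f" g]]])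
        (use mult in \<open>auto simp: pdiff_mult\<close>)
    then show ?case using mult by (auto intro: differentiable_mult)
  next
    case (cong f g)
    have "pdiff i g x = pdiff i f x" if "x \<in> U" for i x
      using cong(2) by (rule pdiff_cong_open[OF \<open>open U\<close> that])
    then have "alg U B (pdiff i g)" for i using cong(3)
      by - (rule alg.cong[of U B "pdiff i f"], auto)
    moreover have "g differentiable (at x)" if "x \<in> U" for x
      using differentiable_cong_open[OF \<open>open U\<close> that cong(2)] cong(3) that by simp
    ultimately show ?case by simp
  qed
  have "alg U B (pdiffs is f)" for "is"
  proof (induction "is")
    case (Cons i "is") then show ?case using step[of "pdiffs is f"] by simp
  qed (simp add: f)
  then show ?thesis unfolding smooth_on_def using step by simp
qed

section \<open>Closure properties of smooth functions\<close>

lemma smooth_on_imp_differentiable: "smooth_on U f \<Longrightarrow> x \<in> U \<Longrightarrow> f differentiable (at x)"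
  unfolding smooth_on_def by (metis pdiffs.simps(1))

lemma smooth_on_pdiffs:
  assumes "smooth_on U f" shows "smooth_on U (pdiffs is f)"
proof -
  have "pdiffs js (pdiffs is f) = pdiffs (js @ is) f" for js by (induction js) auto
  then show ?thesis using assms unfolding smooth_on_def by simp
qed

lemma smooth_on_pdiff: "smooth_on U f \<Longrightarrow> smooth_on U (pdiff i f)"
  using smooth_on_pdiffs[of U f "[i]"] by simp

lemma smooth_on_subset: "smooth_on U f \<Longrightarrow> V \<subseteq> U \<Longrightarrow> smooth_on V f"
  unfolding smooth_on_def by blast

lemma smooth_on_local:
  assumes "\<And>x. x \<in> U \<Longrightarrow> \<exists>V g. open V \<and> x \<in> V \<and> smooth_on V g \<and> (\<forall>y\<in>V. f y = g y)"
  shows "smooth_on U f"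
  unfolding smooth_on_def
proof (intro allI ballI)
  fix "is" x assume "x \<in> U"
  from assms[OF this] obtain V g
    where V: "open V" "x \<in> V" "smooth_on V g" "\<And>y. y \<in> V \<Longrightarrow> f y = g y"
    by auto
  have "pdiffs is g differentiable (at x)" using V(2,3) unfolding smooth_on_def by simp
  moreover have "pdiffs is f y = pdiffs is g y" if "y \<in> V" for y
    using V(1) that V(4) by (rule pdiffs_cong_open)
  ultimately show "pdiffs is f differentiable (at x)"
    using differentiable_cong_open[OF V(1,2), of "pdiffs is f" "pdiffs is g"] by simp
qed

lemma smooth_on_cong:
  "open U \<Longrightarrow> smooth_on U g \<Longrightarrow> (\<And>x. x \<in> U \<Longrightarrow> f x = g x) \<Longrightarrow> smooth_on U f"
  by (rule smooth_on_local, rule exI[of _ U], rule exI[of _ g]) simp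

lemma smooth_on_continuous: "smooth_on U f \<Longrightarrow> continuous_on U f"
  by (meson continuous_at_imp_continuous_on differentiable_imp_continuous_within
      smooth_on_imp_differentiable)

text \<open>All functions already known to be smooth may serve as coefficients, so only the
  derivatives of the new functions in B have to be computed.\<close>

lemma alg_smooth_union:
  assumes "open U" "\<And>f x. f \<in> B \<Longrightarrow> x \<in> U \<Longrightarrow> f differentiable (at x)"
    and "\<And>f i. f \<in> B \<Longrightarrow> alg U (B \<union> {f. smooth_on U f}) (pdiff i f)"
    and "alg U (B \<union> {f. smooth_on U f}) f"
  shows "smooth_on U f"
proof (rule alg_smooth[OF assms(1) _ _ assms(4)])
  fix f i assume "f \<in> B \<union> {f. smooth_on U f}"
  then show "alg U (B \<union> {f. smooth_on U f}) (pdiff i f)"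
    using assms(3) by (auto intro: alg.base smooth_on_pdiff)
qed (use assms(2) smooth_on_imp_differentiable in auto)

lemma smooth_on_const [intro, simp]: "open U \<Longrightarrow> smooth_on U (\<lambda>x. c)"
  by (rule alg_smooth[where B = "{}"]) (auto intro: alg.intros)

lemma smooth_on_nth [intro, simp]: "open U \<Longrightarrow> smooth_on U (\<lambda>x. x $ i)"
proof (rule alg_smooth[where B = "{\<lambda>x. x $ i}"])
  show "alg U {\<lambda>x. x $ i} (pdiff j f)" if "f \<in> {\<lambda>x. x $ i}" for f j
    by (rule alg.cong[OF alg.const[where c = "if j = i then 1 else 0"]])
      (use that in \<open>auto simp: pdiff_nth\<close>)
qed (auto intro: alg.intros intro!: bounded_linear_imp_differentiable bounded_linear_vec_nth)

lemma smooth_on_add: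
  "open U \<Longrightarrow> smooth_on U f \<Longrightarrow> smooth_on U g \<Longrightarrow> smooth_on U (\<lambda>x. f x + g x)"
  by (rule alg_smooth_union[where B = "{}", OF _ _ _ alg.add[OF alg.base alg.base]]) auto

lemma smooth_on_mult:
  "open U \<Longrightarrow> smooth_on U f \<Longrightarrow> smooth_on U g \<Longrightarrow> smooth_on U (\<lambda>x. f x * g x)"
  by (rule alg_smooth_union[where B = "{}", OF _ _ _ alg.mult[OF alg.base alg.base]]) auto

lemma smooth_on_minus: "open U \<Longrightarrow> smooth_on U f \<Longrightarrow> smooth_on U (\<lambda>x. - f x)"
  using smooth_on_mult[of U "\<lambda>x. - 1" f] by simp

lemma smooth_on_diff:
  "open U \<Longrightarrow> smooth_on U f \<Longrightarrow> smooth_on U g \<Longrightarrow> smooth_on U (\<lambda>x. f x - g x)"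
  using smooth_on_add[of U f "\<lambda>x. - g x"] smooth_on_minus[of U g] by simp

lemma smooth_on_sum:
  "open U \<Longrightarrow> (\<And>k. k \<in> S \<Longrightarrow> smooth_on U (f k)) \<Longrightarrow> smooth_on U (\<lambda>x. \<Sum>k\<in>S. f k x)"
  by (induction S rule: infinite_finite_induct) (auto intro!: smooth_on_add)

lemma smooth_on_prod:
  "open U \<Longrightarrow> (\<And>k. k \<in> S \<Longrightarrow> smooth_on U (f k)) \<Longrightarrow> smooth_on U (\<lambda>x. \<Prod>k\<in>S. f k x)"
  by (induction S rule: infinite_finite_induct) (auto intro!: smooth_on_mult)

lemma smooth_on_power: "open U \<Longrightarrow> smooth_on U f \<Longrightarrow> smooth_on U (\<lambda>x. f x ^ n)"
  by (induction n) (auto intro!: smooth_on_mult)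

lemma has_derivative_vec_lambda_pdiff:
  fixes g :: "'m::finite \<Rightarrow> real ^ 'n::finite \<Rightarrow> real"
  assumes "\<And>k. g k differentiable (at x)"
  shows "((\<lambda>x. \<chi> k. g k x) has_derivative (\<lambda>h. \<chi> k. \<Sum>i\<in>UNIV. pdiff i (g k) x * h $ i)) (at x)"
proof -
  have "((\<lambda>x. (\<chi> k. g k x) \<bullet> b) has_derivative
      (\<lambda>h. (\<chi> k. \<Sum>i\<in>UNIV. pdiff i (g k) x * h $ i) \<bullet> b)) (at x)" if b': "b \<in> Basis" for b
  proof -
    obtain k where b: "b = axis k 1" using b' by (auto simp: Basis_vec_def)
    show ?thesis unfolding b inner_axis by (simp add: has_derivative_pdiff[OF assms])
  qed
  then show ?thesis using has_derivative_componentwise_within by blast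
qed

lemma pdiff_compose:
  fixes F :: "real ^ 'm::finite \<Rightarrow> real" and g :: "'m \<Rightarrow> real ^ 'n::finite \<Rightarrow> real"
  assumes "F differentiable (at (\<chi> k. g k x))" "\<And>k. g k differentiable (at x)"
  shows "(\<lambda>x. F (\<chi> k. g k x)) differentiable (at x)"
    and "pdiff i (\<lambda>x. F (\<chi> k. g k x)) x = (\<Sum>k\<in>UNIV. pdiff k F (\<chi> k. g k x) * pdiff i (g k) x)"
proof -
  have D: "((\<lambda>x. F (\<chi> k. g k x)) has_derivative
      (\<lambda>h. \<Sum>k\<in>UNIV. pdiff k F (\<chi> k. g k x) * (\<chi> k. \<Sum>i\<in>UNIV. pdiff i (g k) x * h $ i) $ k)) (at x)"
    using has_derivative_compose[OF has_derivative_vec_lambda_pdiff[of g x] has_derivative_pdiff[OF assms(1)]]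
      assms(2) by simp
  show "(\<lambda>x. F (\<chi> k. g k x)) differentiable (at x)" using D differentiableI by blast
  have "(\<Sum>j\<in>UNIV. pdiff j (g k) x * axis i 1 $ j) = pdiff i (g k) x" for k
    by (simp add: axis_def if_distrib cong: if_cong)
  then show "pdiff i (\<lambda>x. F (\<chi> k. g k x)) x = (\<Sum>k\<in>UNIV. pdiff k F (\<chi> k. g k x) * pdiff i (g k) x)"
    by (simp add: pdiff_eq[OF D])
qed

lemma smooth_on_compose:
  fixes F :: "real ^ 'm::finite \<Rightarrow> real" and g :: "'m \<Rightarrow> real ^ 'n::finite \<Rightarrow> real"
  assumes "open U" and F: "smooth_on V F" and g: "\<And>k. smooth_on U (g k)"
    and maps: "\<And>x. x \<in> U \<Longrightarrow> (\<chi> k. g k x) \<in> V"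
  shows "smooth_on U (\<lambda>x. F (\<chi> k. g k x))"
proof -
  \<comment> \<open>All smooth outer functions are taken at once, because the chain rule replaces F
    by its partial derivatives, composed with the same inner map.\<close>
  define B where "B = {\<lambda>x. G (\<chi> k. g k x) | G. smooth_on V G}"
  have gd: "g k differentiable (at x)" if "x \<in> U" for k x
    using g that by (rule smooth_on_imp_differentiable)
  have Gd: "G differentiable (at (\<chi> k. g k x))" if "smooth_on V G" "x \<in> U" for G x
    using that(1) maps[OF that(2)] by (rule smooth_on_imp_differentiable)
  note diff = pdiff_compose[OF Gd gd]
  show ?thesis
  proof (rule alg_smooth_union[where B = B])
    fix f i assume "f \<in> B"
    then obtain G where G: "f = (\<lambda>x. G (\<chi> k. g k x))" "smooth_on V G" unfolding B_def by blast
    have "alg U (B \<union> {f. smooth_on U f}) (\<lambda>x. \<Sum>k\<in>UNIV. pdiff k G (\<chi> k. g k x) * pdiff i (g k) x)"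
      by (intro alg_sum alg.mult alg.base) (auto simp: B_def smooth_on_pdiff[OF g] intro!: exI[of _ "pdiff _ G"] smooth_on_pdiff[OF G(2)])
    then show "alg U (B \<union> {f. smooth_on U f}) (pdiff i f)"
      by (rule alg.cong) (auto simp: G(1) diff[OF G(2)])
  next
    show "f differentiable (at x)" if "f \<in> B" "x \<in> U" for f x
      using that diff by (auto simp: B_def)
    show "alg U (B \<union> {f. smooth_on U f}) (\<lambda>x. F (\<chi> k. g k x))"
      using F by (intro alg.base) (auto simp: B_def)
  qed (rule \<open>open U\<close>)
qed

text \<open>Encoded through \<open>real ^ 1\<close>, so that the algebra argument and the
  composition theorem serve functions of one variable as well.\<close>

definition smooth1 :: "real set \<Rightarrow> (real \<Rightarrow> real) \<Rightarrow> bool" where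
  "smooth1 I h \<longleftrightarrow> smooth_on {x :: real ^ 1. x $ 1 \<in> I} (\<lambda>x. h (x $ 1))"

lemma open_nth_vimage: "open I \<Longrightarrow> open {x :: real ^ 'n::finite. x $ k \<in> I}"
  using open_vimage[of I "\<lambda>x. x $ k"] by (simp add: vimage_def continuous_on_component)

lemma smooth_on_compose1:
  assumes "open U" "smooth1 I h" "smooth_on U f" "\<And>x. x \<in> U \<Longrightarrow> f x \<in> I"
  shows "smooth_on U (\<lambda>x. h (f x))"
  using smooth_on_compose[OF assms(1) assms(2)[unfolded smooth1_def], of "\<lambda>_. f"] assms(3,4)
  by simp

lemma smooth1_compose:
  assumes "open I" "smooth1 J h" "smooth1 I f" "\<And>x. x \<in> I \<Longrightarrow> f x \<in> J"
  shows "smooth1 I (\<lambda>x. h (f x))"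
  unfolding smooth1_def
  by (rule smooth_on_compose1[OF _ assms(2)])
    (use assms in \<open>auto simp: smooth1_def intro: open_nth_vimage\<close>)

lemma has_derivative_nth_compose:
  assumes "(h has_real_derivative D) (at (x $ k))"
  shows "((\<lambda>x::real^'n::finite. h (x $ k)) has_derivative (\<lambda>y. D * y $ k)) (at x)"
  using has_derivative_compose[OF bounded_linear_imp_has_derivative[OF bounded_linear_vec_nth]
      assms[unfolded has_field_derivative_def]] .

text \<open>For functions whose derivatives stay in a countable explicit family: negative powers
  times an exponential, shifted sines, falling factorials times powers.\<close>

lemma smooth1_family:
  assumes "open I" "\<And>k t. t \<in> I \<Longrightarrow> (D k has_real_derivative D' k t) (at t)"
    and "\<And>k. alg {x :: real ^ 1. x $ 1 \<in> I} {\<lambda>x. D k (x $ 1) | k. True} (\<lambda>x. D' k (x $ 1))"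
  shows "smooth1 I (D k)"
  unfolding smooth1_def
proof (rule alg_smooth[where B = "{\<lambda>x. D k (x $ 1) | k. True}"])
  let ?B = "{\<lambda>x :: real ^ 1. D k (x $ 1) | k. True}"
  have D: "((\<lambda>x::real^1. D k (x $ 1)) has_derivative (\<lambda>y. D' k (x $ 1) * y $ 1)) (at x)"
    if "x $ 1 \<in> I" for k x
    by (rule has_derivative_nth_compose) (use assms(2) that in auto)
  show "f differentiable (at x)" if "f \<in> ?B" "x \<in> {x. x $ 1 \<in> I}" for f x
    using that D differentiableI by blast
  show "alg {x. x $ 1 \<in> I} ?B (pdiff i f)" if f: "f \<in> ?B" for f i
  proof -
    obtain k where k: "f = (\<lambda>x. D k (x $ 1))" using f by blast
    have "i = 1" by (metis (full_types) num1_eq1)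
    then show ?thesis
      by - (rule alg.cong[OF assms(3)[of k]], auto simp: k pdiff_eq[OF D] axis_def)
  qed
qed (use assms in \<open>auto intro: open_nth_vimage alg.base\<close>)

lemma smooth1I:
  assumes "open I" "\<And>k t. t \<in> I \<Longrightarrow> (D k has_real_derivative D (Suc k) t) (at t)"
  shows "smooth1 I (D k)"
  by (rule smooth1_family[where D' = "\<lambda>k. D (Suc k)"]) (use assms in \<open>auto intro: alg.base\<close>)

lemma smooth1_subset: "smooth1 I h \<Longrightarrow> J \<subseteq> I \<Longrightarrow> smooth1 J h"
  unfolding smooth1_def by (erule smooth_on_subset) auto

lemma smooth1_local:
  assumes "\<And>x. x \<in> I \<Longrightarrow> \<exists>J g. open J \<and> x \<in> J \<and> smooth1 J g \<and> (\<forall>y\<in>J. f y = g y)"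
  shows "smooth1 I f"
  unfolding smooth1_def
proof (rule smooth_on_local)
  fix x :: "real ^ 1" assume "x \<in> {x. x $ 1 \<in> I}"
  then obtain J g where "open J" "x $ 1 \<in> J" "smooth1 J g" "\<forall>y\<in>J. f y = g y" using assms[of "x $ 1"] by auto
  then show "\<exists>V g. open V \<and> x \<in> V \<and> smooth_on V g \<and> (\<forall>y\<in>V. f (y $ 1) = g y)"
    by (intro exI[of _ "{x. x $ 1 \<in> J}"] exI[of _ "\<lambda>x. g (x $ 1)"])
      (auto simp: smooth1_def intro: open_nth_vimage)
qed

lemma smooth1_const [intro, simp]: "open I \<Longrightarrow> smooth1 I (\<lambda>t. c)"
  unfolding smooth1_def by (auto intro: open_nth_vimage)

lemma smooth1_ident [intro, simp]: "open I \<Longrightarrow> smooth1 I (\<lambda>t. t)"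
  unfolding smooth1_def by (auto intro: open_nth_vimage)

lemma smooth1_add: "open I \<Longrightarrow> smooth1 I f \<Longrightarrow> smooth1 I g \<Longrightarrow> smooth1 I (\<lambda>t. f t + g t)"
  unfolding smooth1_def by (auto intro!: smooth_on_add open_nth_vimage)

lemma smooth1_mult: "open I \<Longrightarrow> smooth1 I f \<Longrightarrow> smooth1 I g \<Longrightarrow> smooth1 I (\<lambda>t. f t * g t)"
  unfolding smooth1_def by (auto intro!: smooth_on_mult open_nth_vimage)

lemma smooth1_minus: "open I \<Longrightarrow> smooth1 I f \<Longrightarrow> smooth1 I (\<lambda>t. - f t)"
  unfolding smooth1_def by (auto intro!: smooth_on_minus open_nth_vimage)

lemma smooth1_diff: "open I \<Longrightarrow> smooth1 I f \<Longrightarrow> smooth1 I g \<Longrightarrow> smooth1 I (\<lambda>t. f t - g t)"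
  unfolding smooth1_def by (auto intro!: smooth_on_diff open_nth_vimage)

section \<open>Powers, trigonometric functions, flat functions and steps\<close>

lemma smooth1_powr: "smooth1 {0<..} (\<lambda>t. t powr r)"
proof -
  define q where "q = (\<lambda>k t. (\<Prod>j<k. r - real j) * t powr (r - real k))"
  have "smooth1 {0<..} (q 0)"
  proof (rule smooth1I)
    fix k and t :: real assume "t \<in> {0<..}"
    then have "(q k has_real_derivative (\<Prod>j<k. r - real j) * ((r - real k) * t powr (r - real k - 1))) (at t)"
      unfolding q_def by (intro DERIV_cmult has_real_derivative_powr) auto
    then show "(q k has_real_derivative q (Suc k) t) (at t)"
      by (simp add: q_def algebra_simps)
  qed simp
  then show ?thesis by (simp add: q_def)
qed

lemma smooth1_cong:
  "open I \<Longrightarrow> smooth1 I g \<Longrightarrow> (\<And>x. x \<in> I \<Longrightarrow> f x = g x) \<Longrightarrow> smooth1 I f"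
  by (rule smooth1_local, rule exI[of _ I], rule exI[of _ g]) simp

lemma smooth1_sqrt: "smooth1 {0<..} sqrt"
  by (rule smooth1_cong[OF _ smooth1_powr[of "1/2"]]) (auto simp: powr_half_sqrt)

lemma smooth1_inverse: "smooth1 {0<..} inverse"
  by (rule smooth1_cong[OF _ smooth1_powr[of "-1"]]) (auto simp: powr_minus)

lemma smooth1_sin_cos: "smooth1 UNIV sin" "smooth1 UNIV cos"
proof -
  \<comment> \<open>Differentiating the sine shifts its argument by pi/2, so \<open>q k\<close> is
    the k-th derivative of \<open>sin\<close>, and \<open>q 1\<close> is \<open>cos\<close>.\<close>
  define q :: "nat \<Rightarrow> real \<Rightarrow> real" where "q = (\<lambda>k t. sin (t + real k * (pi / 2)))"
  have "smooth1 UNIV (q k)" for k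
  proof (rule smooth1I)
    fix k and t :: real
    have "(q k has_real_derivative cos (t + real k * (pi / 2))) (at t)"
      unfolding q_def by (auto intro!: derivative_eq_intros)
    moreover have "cos (t + real k * (pi / 2)) = q (Suc k) t"
    proof -
      have *: "t + real (Suc k) * (pi / 2) = (t + real k * (pi / 2)) + pi / 2" by (simp add: field_simps)
      show ?thesis unfolding q_def * by (simp only: sin_add[of _ "pi / 2"]) simp
    qed
    ultimately show "(q k has_real_derivative q (Suc k) t) (at t)" by simp
  qed simp
  from this[of 0] this[of 1] show "smooth1 UNIV sin" "smooth1 UNIV cos"
    by (simp_all add: q_def sin_add)
qed

lemma smooth1_deriv:
  assumes "smooth1 I h" "t \<in> I"
  shows "(h has_real_derivative deriv h t) (at t)"
    and "open I \<Longrightarrow> smooth1 I (deriv h)"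
proof -
  have *: "(h has_real_derivative pdiff 1 (\<lambda>x::real^1. h (x $ 1)) (vec t)) (at t)" if "t \<in> I" for t
  proof -
    have "((\<lambda>t. vec t :: real^1) has_derivative vec) (at t)"
      by (rule bounded_linear_imp_has_derivative) (auto intro!: linear_conv_bounded_linear[THEN iffD1] linearI simp: vec_eq_iff)
    moreover have "(\<lambda>x::real^1. h (x $ 1)) differentiable (at (vec t))"
      using assms(1) that unfolding smooth1_def by (auto intro: smooth_on_imp_differentiable)
    ultimately have "((\<lambda>t. h ((vec t :: real^1) $ 1)) has_derivative
       (\<lambda>s. \<Sum>i\<in>UNIV. pdiff i (\<lambda>x. h (x $ 1)) (vec t) * (vec s :: real^1) $ i)) (at t)"
      using has_derivative_compose[OF _ has_derivative_pdiff] by blast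
    then show ?thesis by (simp add: has_field_derivative_def sum_1)
  qed
  then show "(h has_real_derivative deriv h t) (at t)"
    using *[OF assms(2)] DERIV_imp_deriv[OF *[OF assms(2)]] by simp
  assume "open I"
  have smooth: "smooth_on {x::real^1. x $ 1 \<in> I} (pdiff 1 (\<lambda>x::real^1. h (x $ 1)))"
    using assms(1) unfolding smooth1_def by (rule smooth_on_pdiff)
  have eq: "deriv h (x $ 1) = pdiff 1 (\<lambda>x. h (x $ 1)) x" if "x $ 1 \<in> I" for x :: "real^1"
  proof -
    have "vec (x $ 1) = x" by (simp add: vec_eq_iff)
    then show ?thesis using DERIV_imp_deriv[OF *[OF that]] by simp
  qed
  show "smooth1 I (deriv h)" unfolding smooth1_def
    by (rule smooth_on_cong[OF open_nth_vimage[OF \<open>open I\<close>] smooth]) (simp add: eq)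
qed

lemma smooth1_continuous_on:
  assumes "smooth1 I h" shows "continuous_on I h"
proof (rule DERIV_continuous_on)
  show "(h has_real_derivative deriv h t) (at t within I)" if "t \<in> I" for t
    using smooth1_deriv(1)[OF assms that] by (rule has_field_derivative_at_within)
qed

text \<open>The parameter c is kept because a positive power d of \<open>flat 1\<close> is
  \<open>flat d\<close>; this is what makes the boundary values of the singular solution
  smooth.\<close>

definition flat :: "real \<Rightarrow> real \<Rightarrow> real" where
  "flat c t = (if t > 0 then exp (- c / t) else 0)"

lemma flat_power_tendsto:
  assumes "c > 0" shows "((\<lambda>t. flat c t / t ^ k) \<longlongrightarrow> 0) (at 0)"
proof -
  have "((\<lambda>t. flat c t / t ^ k) \<longlongrightarrow> 0) (at_right 0)"
  proof (rule Lim_transform_eventually)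
    have "((\<lambda>y. y ^ k / exp (c * y)) \<longlongrightarrow> 0) at_top"
    proof -
      have "((\<lambda>y. ((c * y) ^ k / exp (c * y)) * (1 / c ^ k)) \<longlongrightarrow> 0 * (1 / c ^ k)) at_top"
        by (intro tendsto_mult tendsto_const filterlim_compose[OF tendsto_power_div_exp_0]
            filterlim_tendsto_pos_mult_at_top[OF tendsto_const assms filterlim_ident])
      then show ?thesis using assms by (simp add: power_mult_distrib)
    qed
    then show "((\<lambda>t. inverse t ^ k / exp (c * inverse t)) \<longlongrightarrow> 0) (at_right 0)"
      by (rule filterlim_compose[OF _ filterlim_inverse_at_top_right])
    show "\<forall>\<^sub>F t in at_right 0. inverse t ^ k / exp (c * inverse t) = flat c t / t ^ k"
      by (auto simp: eventually_at_filter flat_def exp_minus field_simps power_inverse)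
  qed
  moreover have "((\<lambda>t. flat c t / t ^ k) \<longlongrightarrow> 0) (at_left 0)"
    by (rule Lim_transform_eventually[OF tendsto_const]) (auto simp: eventually_at_filter flat_def)
  ultimately show ?thesis by (simp add: filterlim_at_split)
qed

lemma smooth1_flat:
  assumes "c > 0" shows "smooth1 UNIV (flat c)"
proof -
  \<comment> \<open>Differentiation maps this family to linear combinations of its members. At t = 0
    the value \<open>q k 0\<close> is 0 since the numerator vanishes, and the difference quotient of
    \<open>q k\<close> there is the next quotient, with exponent k + 1, which tends to 0.\<close>
  define q where "q = (\<lambda>k t. flat c t / t ^ k)"
  define q' where "q' = (\<lambda>k t. c * q (k + 2) t + (- real k) * q (k + 1) t)"
  have "smooth1 UNIV (q 0)"
  proof (rule smooth1_family[where D' = q'])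
    fix k and t :: real
    consider "t > 0" | "t < 0" | "t = 0" by linarith
    then show "(q k has_real_derivative q' k t) (at t)"
    proof cases
      case 1
      have "((\<lambda>t. t ^ k) has_real_derivative real k * t ^ k / t) (at t)"
        using DERIV_pow[of k t UNIV] 1 by (cases k) auto
      moreover have "((\<lambda>t. exp (- c / t)) has_real_derivative exp (- c / t) * (c / t ^ 2)) (at t)"
        using 1 by (auto intro!: derivative_eq_intros simp: power2_eq_square)
      ultimately have "((\<lambda>t. exp (- c / t) / t ^ k) has_real_derivative q' k t) (at t)"
        using 1 by (rule_tac DERIV_cong[OF DERIV_divide])
          (auto simp: q'_def q_def flat_def field_simps power2_eq_square)
      then show ?thesis
        by (rule has_field_derivative_transform_within_open[where S = "{0<..}"])
          (use 1 in \<open>auto simp: q_def flat_def\<close>)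
    next
      case 2
      have "((\<lambda>t. 0) has_real_derivative q' k t) (at t)"
        using 2 by (simp add: q'_def q_def flat_def)
      then show ?thesis
        by (rule has_field_derivative_transform_within_open[where S = "{..<0}"])
          (use 2 in \<open>auto simp: q_def flat_def\<close>)
    next
      case 3
      have "((\<lambda>h. (q k (0 + h) - q k 0) / h) \<longlongrightarrow> 0) (at 0)"
        using flat_power_tendsto[OF assms, of "Suc k"]
        by (simp add: q_def flat_def field_simps cong: if_cong)
      then show ?thesis unfolding 3 DERIV_def by (simp add: q'_def q_def flat_def)
    qed
  next
    fix k
    let ?B = "{\<lambda>x. q k (x $ 1) | k. True} :: (real^1 \<Rightarrow> real) set"
    have "\<And>k. alg {x :: real ^ 1. x $ 1 \<in> UNIV} ?B (\<lambda>x. q k (x $ 1))" by (rule alg.base) auto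
    then show "alg {x :: real ^ 1. x $ 1 \<in> UNIV} ?B (\<lambda>x. q' k (x $ 1))"
      unfolding q'_def by (intro alg.add alg.mult alg.const)
  qed simp
  then show ?thesis by (simp add: q_def)
qed

definition smooth_step :: "real \<Rightarrow> real" where
  "smooth_step t = flat 1 t * inverse (flat 1 t + flat 1 (1 - t))"

lemma flat_nonneg: "flat c t \<ge> 0" by (simp add: flat_def)

lemma flat_sum_pos: "flat c t + flat c (1 - t) > 0"
  using flat_nonneg[of c t] flat_nonneg[of c "1 - t"]
  by (cases "t > 0") (auto simp: flat_def add_pos_nonneg)

lemma smooth1_smooth_step: "smooth1 UNIV smooth_step"
  unfolding smooth_step_def[abs_def]
  by (intro smooth1_mult smooth1_flat smooth1_compose[OF _ smooth1_inverse] smooth1_add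
      smooth1_compose[OF _ smooth1_flat[of 1], of UNIV "\<lambda>t. 1 - t"] smooth1_diff)
    (auto simp: flat_sum_pos)

lemma smooth_step_0: "t \<le> 0 \<Longrightarrow> smooth_step t = 0" by (simp add: smooth_step_def flat_def)
lemma smooth_step_1: "t \<ge> 1 \<Longrightarrow> smooth_step t = 1" by (simp add: smooth_step_def flat_def)

lemma smooth_step_bounds: "0 \<le> smooth_step t" "smooth_step t \<le> 1"
  using flat_sum_pos[of 1 t] flat_nonneg[of 1 t] flat_nonneg[of 1 "1 - t"]
  by (auto simp: smooth_step_def divide_inverse[symmetric])

section \<open>Power series with smooth coefficients\<close>

text \<open>The majorant of a polynomial: absolute values of the coefficients, evaluated at a
  radius. It dominates the values and, at a larger radius, the derivative.\<close>

definition pnorm :: "real poly \<Rightarrow> real \<Rightarrow> real" where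
  "pnorm p t = poly (map_poly abs p) t"

lemma pnorm_0 [simp]: "pnorm 0 t = 0"
  by (simp add: pnorm_def)

lemma pnorm_pCons [simp]: "pnorm (pCons c p) t = \<bar>c\<bar> + t * pnorm p t"
  by (simp add: pnorm_def map_poly_pCons)

lemma pnorm_nonneg: "t \<ge> 0 \<Longrightarrow> pnorm p t \<ge> 0"
  by (induction p) auto

lemma pnorm_mono: "0 \<le> t \<Longrightarrow> t \<le> t' \<Longrightarrow> pnorm p t \<le> pnorm p t'"
  by (induction p) (auto intro!: mult_mono pnorm_nonneg)

lemma abs_poly_le_pnorm: "\<bar>x\<bar> \<le> t \<Longrightarrow> \<bar>poly p x\<bar> \<le> pnorm p t"
proof (induction p)
  case (pCons c p)
  have "\<bar>x * poly p x\<bar> \<le> t * pnorm p t"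
    unfolding abs_mult using pCons by (intro mult_mono) auto
  then show ?case by (simp add: abs_triangle_ineq[THEN order_trans])
qed simp

lemma pnorm_add: "t \<ge> 0 \<Longrightarrow> pnorm (p + q) t \<le> pnorm p t + pnorm q t"
proof (induction p arbitrary: q)
  case (pCons c p)
  obtain d q' where q: "q = pCons d q'" by (cases q)
  have "t * pnorm (p + q') t \<le> t * pnorm p t + t * pnorm q' t"
    using pCons by (metis distrib_left mult_left_mono)
  then show ?case using abs_triangle_ineq[of c d] by (simp add: q)
qed simp

lemma pnorm_smult [simp]: "pnorm (smult c p) t = \<bar>c\<bar> * pnorm p t"
  by (induction p) (auto simp: abs_mult algebra_simps)

lemma pnorm_minus: "pnorm (- p) t = pnorm p t"
  using pnorm_smult[of "-1" p t] by simp

lemma pnorm_diff: "t \<ge> 0 \<Longrightarrow> pnorm (p - q) t \<le> pnorm p t + pnorm q t"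
  using pnorm_add[of t p "- q"] by (simp add: pnorm_minus)

text \<open>A Cauchy estimate for majorants: enlarging the radius pays for a derivative. The
  induction uses the Horner form, where x * p has derivative p + x * p'.\<close>

lemma pnorm_pderiv:
  "0 \<le> t \<Longrightarrow> t < t' \<Longrightarrow> pnorm (pderiv p) t * (t' - t) \<le> pnorm p t'"
proof (induction p)
  case (pCons c p)
  have "pnorm (p + pCons 0 (pderiv p)) t * (t' - t) \<le> (pnorm p t + t * pnorm (pderiv p) t) * (t' - t)"
    using pnorm_add[of t p "pCons 0 (pderiv p)"] pCons by (intro mult_right_mono) auto
  also have "\<dots> = pnorm p t * (t' - t) + t * (pnorm (pderiv p) t * (t' - t))"
    by (simp add: algebra_simps)
  also have "\<dots> \<le> pnorm p t' * (t' - t) + t * pnorm p t'"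
    using pCons pnorm_mono[of t t' p] by (intro add_mono mult_right_mono mult_left_mono) auto
  finally show ?case by (simp add: pderiv_pCons algebra_simps)
qed simp

lemma pnorm_eq_sum: "degree p \<le> n \<Longrightarrow> pnorm p t = (\<Sum>k\<le>n. \<bar>coeff p k\<bar> * t ^ k)"
proof (induction p arbitrary: n)
  case (pCons c p)
  show ?case
  proof (cases n)
    case 0
    then have "p = 0" using pCons by (auto split: if_splits)
    then show ?thesis using 0 by simp
  next
    case (Suc m)
    then have "degree p \<le> m" using pCons by (auto split: if_splits)
    then show ?thesis using pCons.IH[of m]
      by (simp add: Suc sum.atMost_Suc_shift sum_distrib_left mult_ac del: sum.atMost_Suc)
  qed
qed simp

lemma pnorm_pcompose_square: "t \<ge> 0 \<Longrightarrow> pnorm (pcompose p [:0, 0, 1:]) t \<le> pnorm p (t ^ 2)"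
proof (induction p)
  case (pCons c p)
  have "pnorm (pcompose (pCons c p) [:0, 0, 1:]) t = pnorm ([:c:] + pCons 0 (pCons 0 (pcompose p [:0, 0, 1:]))) t"
    by (simp add: pcompose_pCons)
  also have "\<dots> \<le> \<bar>c\<bar> + t * (t * pnorm (pcompose p [:0, 0, 1:]) t)"
    using pnorm_add[OF pCons.prems, of "[:c:]"] by (metis (no_types, lifting) abs_0 add_0 mult_zero_right add.right_neutral pnorm_0 pnorm_pCons)
  also have "\<dots> \<le> \<bar>c\<bar> + t * (t * pnorm p (t ^ 2))"
    using pCons by (intro add_left_mono mult_left_mono) auto
  finally show ?case by (simp add: power2_eq_square)
qed simp

text \<open>The exponents form a free sequence because differentiation in \<open>x $ b\<close>
  lowers them by one; with them the class is closed under both partial derivatives.\<close>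

definition psum :: "'n \<Rightarrow> 'n \<Rightarrow> (nat \<Rightarrow> real poly) \<Rightarrow> (nat \<Rightarrow> nat) \<Rightarrow> real ^ 'n::finite \<Rightarrow> real" where
  "psum a b p e x = (\<Sum>i. poly (p i) (x $ a) * (x $ b) ^ e i)"

text \<open>Absolute convergence on all smaller bidiscs, expressed by majorants. The open range of
  radii leaves room for the loss of radius in each derivative, so the same \<rho> survives
  arbitrarily many of them.\<close>

definition adm :: "real \<Rightarrow> (nat \<Rightarrow> real poly) \<Rightarrow> (nat \<Rightarrow> nat) \<Rightarrow> bool" where
  "adm \<rho> p e \<longleftrightarrow> (\<forall>t. 0 < t \<and> t < \<rho> \<longrightarrow> summable (\<lambda>i. pnorm (p i) t * t ^ e i))"

text \<open>The Cauchy estimate for monomials. At k = 0 the truncated exponent is harmless, since it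
  is multiplied by \<open>real k\<close>.\<close>

lemma power_pred_bound:
  assumes "0 \<le> t" "t < t'" shows "real k * t ^ (k - 1) * (t' - t) \<le> (t' :: real) ^ k"
proof (induction k)
  case (Suc k)
  have *: "real k * t ^ k = t * (real k * t ^ (k - 1))" by (cases k) auto
  have "real (Suc k) * t ^ (Suc k - 1) * (t' - t) = (real k * t ^ k) * (t' - t) + t ^ k * (t' - t)"
    by (simp add: algebra_simps)
  also have "\<dots> = t * (real k * t ^ (k - 1) * (t' - t)) + t ^ k * (t' - t)"
    unfolding * by (simp only: mult.assoc)
  also have "\<dots> \<le> t * t' ^ k + t' ^ k * (t' - t)"
    using Suc assms by (intro add_mono mult_left_mono mult_right_mono power_mono) auto
  finally show ?case by (simp add: algebra_simps)
qed simp

lemma adm_pderiv: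
  assumes "adm \<rho> p e" shows "adm \<rho> (\<lambda>i. pderiv (p i)) e"
  unfolding adm_def
proof (intro allI impI)
  fix t assume t: "0 < t \<and> t < \<rho>"
  obtain t' where t': "t < t'" "t' < \<rho>" using t dense by blast
  have "summable (\<lambda>i. inverse (t' - t) * (pnorm (p i) t' * t' ^ e i))"
    using assms t t' unfolding adm_def by (intro summable_mult) auto
  moreover have "norm (pnorm (pderiv (p i)) t * t ^ e i) \<le> inverse (t' - t) * (pnorm (p i) t' * t' ^ e i)" for i
  proof -
    have "pnorm (pderiv (p i)) t \<le> inverse (t' - t) * pnorm (p i) t'"
      using pnorm_pderiv[of t t' "p i"] t t' by (simp add: field_simps)
    then have "pnorm (pderiv (p i)) t * t ^ e i \<le> (inverse (t' - t) * pnorm (p i) t') * t' ^ e i"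
      using t t' by (intro mult_mono power_mono mult_nonneg_nonneg pnorm_nonneg) auto
    then show ?thesis using t pnorm_nonneg[of t "pderiv (p i)"] by (simp add: mult.assoc)
  qed
  ultimately show "summable (\<lambda>i. pnorm (pderiv (p i)) t * t ^ e i)"
    by (rule summable_comparison_test'[where N = 0])
qed

lemma adm_power_deriv:
  assumes "adm \<rho> p e" shows "adm \<rho> (\<lambda>i. smult (real (e i)) (p i)) (\<lambda>i. e i - 1)"
  unfolding adm_def
proof (intro allI impI)
  fix t assume t: "0 < t \<and> t < \<rho>"
  obtain t' where t': "t < t'" "t' < \<rho>" using t dense by blast
  have "summable (\<lambda>i. inverse (t' - t) * (pnorm (p i) t' * t' ^ e i))"
    using assms t t' unfolding adm_def by (intro summable_mult) auto
  moreover have "norm (pnorm (smult (real (e i)) (p i)) t * t ^ (e i - 1))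
      \<le> inverse (t' - t) * (pnorm (p i) t' * t' ^ e i)" for i
  proof -
    have "real (e i) * t ^ (e i - 1) \<le> inverse (t' - t) * t' ^ e i"
      using power_pred_bound[of t t' "e i"] t t' by (simp add: field_simps)
    moreover have "pnorm (p i) t \<le> pnorm (p i) t'" using t t' by (intro pnorm_mono) auto
    ultimately have "pnorm (p i) t * (real (e i) * t ^ (e i - 1)) \<le> pnorm (p i) t' * (inverse (t' - t) * t' ^ e i)"
      using t t' by (intro mult_mono[OF _ _ _ mult_nonneg_nonneg] pnorm_nonneg) auto
    then show ?thesis using t pnorm_nonneg[of t "p i"] by (simp add: mult_ac)
  qed
  ultimately show "summable (\<lambda>i. pnorm (smult (real (e i)) (p i)) t * t ^ (e i - 1))"
    by (rule summable_comparison_test'[where N = 0])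
qed

lemma psum_bound:
  assumes "\<bar>x $ a\<bar> \<le> t" "\<bar>x $ b\<bar> \<le> t"
  shows "norm (poly p (x $ a) * (x $ b) ^ k) \<le> pnorm p t * t ^ k"
proof -
  have "t \<ge> 0" using assms by linarith
  then show ?thesis
    unfolding real_norm_def abs_mult power_abs
    using assms by (intro mult_mono abs_poly_le_pnorm power_mono pnorm_nonneg) auto
qed

lemma psum_summable:
  assumes "adm \<rho> p e" "\<bar>x $ a\<bar> < \<rho>" "\<bar>x $ b\<bar> < \<rho>"
  shows "summable (\<lambda>i. poly (p i) (x $ a) * (x $ b) ^ e i)"
proof -
  have "max \<bar>x $ a\<bar> \<bar>x $ b\<bar> < \<rho>" using assms by simp
  then obtain t where t: "max \<bar>x $ a\<bar> \<bar>x $ b\<bar> < t" "t < \<rho>" using dense by blast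
  have "summable (\<lambda>i. pnorm (p i) t * t ^ e i)" using assms(1) t unfolding adm_def by auto
  then show ?thesis
    by (rule summable_comparison_test'[where N = 0]) (use t in \<open>auto intro!: psum_bound[unfolded real_norm_def]\<close>)
qed

lemma psum_uniform:
  assumes "adm \<rho> p e" "0 < t" "t < \<rho>"
  shows "uniform_limit {x. \<bar>x $ a\<bar> < t \<and> \<bar>x $ b\<bar> < t}
    (\<lambda>n x. \<Sum>i<n. poly (p i) (x $ a) * (x $ b) ^ e i) (psum a b p e) sequentially"
  unfolding psum_def[abs_def]
proof (rule Weierstrass_m_test)
  show "summable (\<lambda>i. pnorm (p i) t * t ^ e i)" using assms unfolding adm_def by blast
qed (auto intro!: psum_bound[unfolded real_norm_def])

abbreviation psum_da where "psum_da a b p e \<equiv> psum a b (\<lambda>i. pderiv (p i)) e"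
abbreviation psum_db where "psum_db a b p e \<equiv> psum a b (\<lambda>i. smult (real (e i)) (p i)) (\<lambda>i. e i - 1)"

text \<open>Termwise differentiation on a smaller square around x, where the two differentiated
  series converge uniformly by the Weierstrass test. The square is convex, so uniform convergence of
  the derivatives and convergence at the point x suffice.\<close>

lemma psum_has_derivative:
  fixes x :: "real ^ 'n::finite"
  assumes adm: "adm \<rho> p e" and x: "\<bar>x $ a\<bar> < \<rho>" "\<bar>x $ b\<bar> < \<rho>"
  shows "(psum a b p e has_derivative (\<lambda>h. psum_da a b p e x * h $ a + psum_db a b p e x * h $ b)) (at x)"
proof -
  have "max \<bar>x $ a\<bar> \<bar>x $ b\<bar> < \<rho>" using x by simp
  then obtain t where t: "max \<bar>x $ a\<bar> \<bar>x $ b\<bar> < t" "t < \<rho>" using dense by blast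
  then have "t > 0" by auto
  define S where "S = {x :: real ^ 'n. \<bar>x $ a\<bar> < t \<and> \<bar>x $ b\<bar> < t}"
  have S_eq: "S = {x. x $ a \<in> {-t<..<t}} \<inter> {x. x $ b \<in> {-t<..<t}}" unfolding S_def by auto
  have "open S" unfolding S_eq by (intro open_Int open_nth_vimage) auto
  have "convex S" unfolding S_eq
    using convex_linear_vimage[OF bounded_linear.linear[OF bounded_linear_vec_nth], of "{-t<..<t}"]
    by (intro convex_Int) (simp_all add: vimage_def)
  have "x \<in> S" using t unfolding S_def by auto
  define f where "f = (\<lambda>i (x::real^'n). poly (p i) (x $ a) * (x $ b) ^ e i)"
  define f' where "f' = (\<lambda>i (x::real^'n) h. poly (pderiv (p i)) (x $ a) * (x $ b) ^ e i * h $ a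
     + poly (smult (real (e i)) (p i)) (x $ a) * (x $ b) ^ (e i - 1) * h $ b)"
  define g' where "g' = (\<lambda>x h. psum_da a b p e x * h $ a + psum_db a b p e x * h $ b)"
  have "\<exists>g. \<forall>x\<in>S. (\<lambda>n. f n x) sums (g x) \<and> (g has_derivative g' x) (at x within S)"
  proof (rule has_derivative_series[OF \<open>convex S\<close> _ _ \<open>x \<in> S\<close>])
    show "(f n has_derivative f' n x) (at x within S)" for n x
    proof -
      have 1: "((\<lambda>x::real^'n. poly (p n) (x $ a)) has_derivative (\<lambda>h. poly (pderiv (p n)) (x $ a) * h $ a)) (at x)"
        by (rule has_derivative_nth_compose) (rule poly_DERIV)
      have 2: "((\<lambda>x::real^'n. (x $ b) ^ e n) has_derivative (\<lambda>h. real (e n) * (x $ b) ^ (e n - 1) * h $ b)) (at x)"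
        by (rule has_derivative_nth_compose[where h = "\<lambda>t. t ^ e n"]) (use DERIV_pow[of "e n"] in simp)
      have "(f n has_derivative f' n x) (at x)"
        using has_derivative_mult[OF 1 2] unfolding f_def f'_def
        by (simp add: algebra_simps)
      then show ?thesis by (rule has_derivative_at_withinI)
    qed
    show "(\<lambda>n. f n x) sums psum a b p e x"
      unfolding f_def psum_def by (rule summable_sums[OF psum_summable[OF adm x]])
    fix \<epsilon> :: real assume "\<epsilon> > 0"
    then have "\<epsilon> / 2 > 0" by simp
    have "\<forall>\<^sub>F n in sequentially. \<forall>x\<in>S. dist (\<Sum>i<n. poly (pderiv (p i)) (x $ a) * (x $ b) ^ e i) (psum_da a b p e x) < \<epsilon> / 2"
      "\<forall>\<^sub>F n in sequentially. \<forall>x\<in>S. dist (\<Sum>i<n. poly (smult (real (e i)) (p i)) (x $ a) * (x $ b) ^ (e i - 1)) (psum_db a b p e x) < \<epsilon> / 2"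
      using psum_uniform[OF adm_pderiv[OF adm] \<open>t > 0\<close> t(2)] psum_uniform[OF adm_power_deriv[OF adm] \<open>t > 0\<close> t(2)] \<open>\<epsilon> / 2 > 0\<close>
      unfolding S_def uniform_limit_iff by blast+
    then show "\<forall>\<^sub>F n in sequentially. \<forall>x\<in>S. \<forall>h. norm (sum (\<lambda>i. f' i x h) {..<n} - g' x h) \<le> \<epsilon> * norm h"
    proof eventually_elim
      case (elim n)
      show ?case
      proof (intro ballI allI)
        fix x h assume "x \<in> S"
        let ?A = "(\<Sum>i<n. poly (pderiv (p i)) (x $ a) * (x $ b) ^ e i) - psum_da a b p e x"
        let ?B = "(\<Sum>i<n. poly (smult (real (e i)) (p i)) (x $ a) * (x $ b) ^ (e i - 1)) - psum_db a b p e x"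
        have "sum (\<lambda>i. f' i x h) {..<n} - g' x h = ?A * h $ a + ?B * h $ b"
          unfolding f'_def g'_def sum.distrib sum_distrib_right[symmetric] by (simp add: left_diff_distrib)
        then have "norm (sum (\<lambda>i. f' i x h) {..<n} - g' x h) = \<bar>?A * h $ a + ?B * h $ b\<bar>"
          by (simp only: real_norm_def)
        also have "\<dots> \<le> \<bar>?A\<bar> * \<bar>h $ a\<bar> + \<bar>?B\<bar> * \<bar>h $ b\<bar>"
          unfolding abs_mult[symmetric] by (rule abs_triangle_ineq)
        also have "\<dots> \<le> \<epsilon> / 2 * norm h + \<epsilon> / 2 * norm h"
          using elim \<open>x \<in> S\<close> \<open>\<epsilon> > 0\<close>
          by (intro add_mono mult_mono component_le_norm_cart) (auto simp: dist_real_def less_imp_le)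
        finally show "norm (sum (\<lambda>i. f' i x h) {..<n} - g' x h) \<le> \<epsilon> * norm h" by simp
      qed
    qed
  qed
  then obtain g where g: "\<And>x. x \<in> S \<Longrightarrow> (\<lambda>n. f n x) sums (g x)"
      "\<And>x. x \<in> S \<Longrightarrow> (g has_derivative g' x) (at x within S)" by blast
  have "g y = psum a b p e y" if "y \<in> S" for y
    using sums_unique[OF g(1)[OF that]] unfolding psum_def f_def by simp
  moreover have "(g has_derivative g' x) (at x)"
    using g(2)[OF \<open>x \<in> S\<close>] at_within_open[OF \<open>x \<in> S\<close> \<open>open S\<close>] by simp
  ultimately have "(psum a b p e has_derivative g' x) (at x)"
    using has_derivative_cong_open[OF \<open>open S\<close> \<open>x \<in> S\<close>, of g] by blast
  then show ?thesis unfolding g'_def .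
qed

lemma open_square: "open {x :: real ^ 'n::finite. \<bar>x $ a\<bar> < r \<and> \<bar>x $ b\<bar> < r}"
proof -
  have "{x :: real ^ 'n. \<bar>x $ a\<bar> < r \<and> \<bar>x $ b\<bar> < r} = {x. x $ a \<in> {-r<..<r}} \<inter> {x. x $ b \<in> {-r<..<r}}"
    by auto
  then show ?thesis by (simp only: open_Int open_nth_vimage open_greaterThanLessThan)
qed

lemma psum_pdiff:
  assumes "adm \<rho> p e" "\<bar>x $ a\<bar> < \<rho>" "\<bar>x $ b\<bar> < \<rho>" "a \<noteq> b"
  shows "pdiff a (psum a b p e) x = psum_da a b p e x"
    and "pdiff b (psum a b p e) x = psum_db a b p e x"
    and "i \<noteq> a \<Longrightarrow> i \<noteq> b \<Longrightarrow> pdiff i (psum a b p e) x = 0"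
  using assms(4) by (auto simp: pdiff_eq[OF psum_has_derivative[OF assms(1-3)]] axis_def)

lemma smooth_on_psum:
  fixes a b :: "'n::finite"
  assumes "adm \<rho> p e" "a \<noteq> b"
  shows "smooth_on {x. \<bar>x $ a\<bar> < \<rho> \<and> \<bar>x $ b\<bar> < \<rho>} (psum a b p e)" (is "smooth_on ?U _")
proof (rule alg_smooth[where B = "{psum a b p e | p e. adm \<rho> p e}"])
  let ?B = "{psum a b p e | p e. adm \<rho> p e}"
  show "f differentiable (at x)" if "f \<in> ?B" and x: "x \<in> ?U" for f x
  proof -
    from \<open>f \<in> ?B\<close> obtain p e where f: "f = psum a b p e" "adm \<rho> p e" by blast
    show ?thesis using psum_has_derivative[OF f(2), of x a b] x unfolding f(1) differentiable_def by auto
  qed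
  show "alg ?U ?B (pdiff i f)" if "f \<in> ?B" for f i
  proof -
    from \<open>f \<in> ?B\<close> obtain p e where f: "f = psum a b p e" "adm \<rho> p e" by blast
    note pd = psum_pdiff[OF f(2) _ _ assms(2)]
    consider "i = a" | "i = b" | "i \<noteq> a" "i \<noteq> b" by blast
    then show ?thesis
    proof cases
      case 1
      have "alg ?U ?B (psum_da a b p e)" by (rule alg.base) (use adm_pderiv[OF f(2)] in blast)
      then show ?thesis by (rule alg.cong) (use pd(1) in \<open>simp add: f 1\<close>)
    next
      case 2
      have "alg ?U ?B (psum_db a b p e)" by (rule alg.base) (use adm_power_deriv[OF f(2)] in blast)
      then show ?thesis by (rule alg.cong) (use pd(2) in \<open>simp add: f 2\<close>)
    next
      case 3
      have "alg ?U ?B (\<lambda>x. 0)" by (rule alg.const)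
      then show ?thesis by (rule alg.cong) (use pd(3)[OF _ _ 3] in \<open>simp add: f\<close>)
    qed
  qed
  show "alg ?U ?B (psum a b p e)" by (rule alg.base) (use assms in blast)
qed (rule open_square)

section \<open>The Legendre transform of the singular solution\<close>

text \<open>The Legendre transform of the singular solution, in the variables \<open>\<epsilon> = |Dv| powr (- p/2)\<close> and
  \<open>u = \<omega>/\<epsilon>\<close> (\<open>\<omega>\<close> being the angle of \<open>Dv\<close>), is \<open>\<epsilon> powr (1 - 2/p)\<close> times a power series
  \<open>H = \<Sum>\<^sub>i u\<^sup>2\<^sup>i P\<^sub>i(\<epsilon>\<^sup>2)\<close> solving a linear Cauchy problem in \<open>u\<close>.
  \<open>euler_op i\<close> represents \<open>\<epsilon> \<partial>\<^sub>\<epsilon> - u \<partial>\<^sub>u\<close> on the \<open>i\<close>-th term.\<close>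

definition euler_op :: "nat \<Rightarrow> real poly \<Rightarrow> real poly" where
  "euler_op i P = smult 2 (pCons 0 (pderiv P)) - smult (2 * real i) P"

text \<open>The position x is the gradient of the Legendre transform in the gradient plane. Since
  eps = |Dv| powr (-p/2), the chain rule gives eps * K for the component of x along Dv; the
  orthogonal component is the u-derivative of H.\<close>

definition legendre_K :: "real \<Rightarrow> nat \<Rightarrow> real poly \<Rightarrow> real poly" where
  "legendre_K p i P = smult (- (p / 2)) (euler_op i P + smult (1 - 2 / p) P)"

text \<open>With D = eps d/deps - u d/du, the condition div sigma = 0 reads (1 + eps^2) (D K + K) -
  2 (1 - 1/p) eps^2 K = 2 (1 - 1/p) H_uu. This is the left side; the polynomials are in the variable
  eps^2, so \<open>pCons 0\<close> multiplies by eps^2.\<close>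

definition legendre_rhs :: "real \<Rightarrow> nat \<Rightarrow> real poly \<Rightarrow> real poly" where
  "legendre_rhs p i K = [:1, 1:] * (euler_op i K + K) - smult (2 * (1 - 1 / p)) (pCons 0 K)"

text \<open>Cauchy data H = -1 and H_u = 0 on u = 0. Comparing the coefficients of u^(2i) gives the
  recursion, the factor (2i + 1) (2i + 2) being due to H_uu. With the value -1 both K and K - H are
  positive at the origin.\<close>

primrec legendre_H :: "real \<Rightarrow> nat \<Rightarrow> real poly" where
  "legendre_H p 0 = [:- 1:]"
| "legendre_H p (Suc i) = smult (1 / (2 * (1 - 1 / p) * (real (2 * i + 1) * real (2 * i + 2))))
     (legendre_rhs p i (legendre_K p i (legendre_H p i)))"

abbreviation sq_poly :: "real poly \<Rightarrow> real poly" where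
  "sq_poly P \<equiv> pcompose P [:0, 0, 1:]"

section \<open>Majorant estimates for the recursion\<close>

lemma coeff_euler_op: "coeff (euler_op i P) k = (2 * real k - 2 * real i) * coeff P k"
  by (cases k) (auto simp: euler_op_def coeff_pderiv algebra_simps)

lemma degree_euler_op: "degree P \<le> n \<Longrightarrow> degree (euler_op i P) \<le> n"
  by (rule degree_le) (auto simp: coeff_euler_op coeff_eq_0)

text \<open>The operator multiplies the k-th coefficient by 2k - 2i. As the degree is at most i,
  this factor is at most 2i in absolute value, so the estimate costs no radius although the operator
  contains a derivative.\<close>

lemma pnorm_euler_op:
  assumes "degree P \<le> i" "t \<ge> 0"
  shows "pnorm (euler_op i P) t \<le> 2 * real i * pnorm P t"
proof -
  have "pnorm (euler_op i P) t = (\<Sum>k\<le>i. \<bar>2 * real k - 2 * real i\<bar> * \<bar>coeff P k\<bar> * t ^ k)"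
    unfolding pnorm_eq_sum[OF degree_euler_op[OF assms(1)]] coeff_euler_op abs_mult ..
  also have "\<dots> \<le> (\<Sum>k\<le>i. 2 * real i * \<bar>coeff P k\<bar> * t ^ k)"
    using assms(2) by (intro sum_mono mult_right_mono) auto
  also have "\<dots> = 2 * real i * pnorm P t"
    using assms(1) by (simp add: pnorm_eq_sum sum_distrib_left mult.assoc)
  finally show ?thesis .
qed

lemma degree_legendre_K: "degree P \<le> n \<Longrightarrow> degree (legendre_K p i P) \<le> n"
  unfolding legendre_K_def
  by (intro degree_smult_le[THEN order_trans] degree_add_le degree_euler_op)

lemma pnorm_legendre_K:
  assumes "degree P \<le> i" "t \<ge> 0" "p > 2"
  shows "pnorm (legendre_K p i P) t \<le> p / 2 * (2 * real i + 1) * pnorm P t"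
proof -
  have d: "\<bar>1 - 2 / p\<bar> \<le> 1" using assms by (auto simp: field_simps)
  have "pnorm (euler_op i P + smult (1 - 2 / p) P) t \<le> 2 * real i * pnorm P t + 1 * pnorm P t"
    using pnorm_euler_op[OF assms(1,2)] d pnorm_nonneg[OF assms(2), of P]
    by (intro pnorm_add[THEN order_trans] add_mono) (auto intro!: mult_right_mono assms mult_left_le_one_le)
  then have "p / 2 * pnorm (euler_op i P + smult (1 - 2 / p) P) t \<le> p / 2 * (2 * real i * pnorm P t + 1 * pnorm P t)"
    using assms(3) by (intro mult_left_mono) auto
  then show ?thesis using assms(3) by (simp add: legendre_K_def pnorm_minus algebra_simps)
qed

lemma pnorm_legendre_rhs:
  assumes "degree K \<le> i" "p > 2"
  shows "pnorm (legendre_rhs p i K) 1 \<le> (4 * real i + 4) * pnorm K 1"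
proof -
  let ?M = "euler_op i K + K"
  have M: "pnorm ?M 1 \<le> (2 * real i + 1) * pnorm K 1"
    using pnorm_add[of 1 "euler_op i K" K] pnorm_euler_op[OF assms(1), of 1] by (simp add: algebra_simps)
  have "[:1, 1:] * ?M = ?M + pCons 0 ?M" by simp
  then have "pnorm ([:1, 1:] * ?M) 1 \<le> 2 * pnorm ?M 1"
    using pnorm_add[of 1 ?M "pCons 0 ?M"] by simp
  moreover have "pnorm (smult (2 * (1 - 1 / p)) (pCons 0 K)) 1 \<le> 2 * pnorm K 1"
    using assms pnorm_nonneg[of 1 K] by (auto simp: field_simps abs_if)
  ultimately have "pnorm (legendre_rhs p i K) 1 \<le> 2 * pnorm ?M 1 + 2 * pnorm K 1"
    unfolding legendre_rhs_def by (intro pnorm_diff[THEN order_trans] add_mono) auto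
  then show ?thesis using M by (simp add: algebra_simps)
qed

lemma degree_legendre_H: "degree (legendre_H p i) \<le> i"
proof (induction i)
  case (Suc i)
  let ?K = "legendre_K p i (legendre_H p i)"
  have K: "degree ?K \<le> i" by (rule degree_legendre_K[OF Suc])
  then have "degree ([:1, 1:] * (euler_op i ?K + ?K)) \<le> Suc i"
    by (intro degree_mult_le[THEN order_trans]) (auto intro!: degree_add_le degree_euler_op)
  moreover have "degree (smult (2 * (1 - 1 / p)) (pCons 0 ?K)) \<le> Suc i"
    using K by (intro degree_smult_le[THEN order_trans] degree_pCons_le[THEN order_trans]) auto
  ultimately have "degree (legendre_rhs p i ?K) \<le> Suc i"
    unfolding legendre_rhs_def by (rule degree_diff_le)
  then show ?case by simp
qed simp

text \<open>The bounds for \<open>legendre_K\<close> and \<open>legendre_rhs\<close> multiply to p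
  (2i + 1) (2i + 2), and the recursion divides by 2 (1 - 1/p) (2i + 1) (2i + 2). The quadratic
  factors cancel and geometric growth remains, so the series has a positive radius of
  convergence.\<close>

lemma pnorm_legendre_H:
  assumes "p > 2" shows "pnorm (legendre_H p i) 1 \<le> (p / (2 * (1 - 1 / p))) ^ i"
proof (induction i)
  case (Suc i)
  let ?c = "1 - 1 / p" let ?H = "legendre_H p i" let ?K = "legendre_K p i ?H"
  have c: "?c > 0" using assms by simp
  have K: "degree ?K \<le> i" by (rule degree_legendre_K[OF degree_legendre_H])
  have r: "real (2 * i + 1) * real (2 * i + 2) > 0" by (intro mult_pos_pos) simp_all
  have "pnorm (legendre_rhs p i ?K) 1 \<le> (4 * real i + 4) * (p / 2 * (2 * real i + 1) * pnorm ?H 1)"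
    using pnorm_legendre_rhs[OF K assms] pnorm_legendre_K[OF degree_legendre_H, of 1 p i p] assms
    by (meson add_nonneg_nonneg mult_left_mono mult_nonneg_nonneg of_nat_0_le_iff order_trans zero_le_numeral zero_le_one)
  also have "\<dots> = p * (real (2 * i + 1) * real (2 * i + 2)) * pnorm ?H 1"
    by (simp add: algebra_simps)
  finally have "1 / (2 * ?c * (real (2 * i + 1) * real (2 * i + 2))) * pnorm (legendre_rhs p i ?K) 1
      \<le> 1 / (2 * ?c * (real (2 * i + 1) * real (2 * i + 2))) * (p * (real (2 * i + 1) * real (2 * i + 2)) * pnorm ?H 1)"
    using c r by (intro mult_left_mono) (auto simp del: of_nat_mult of_nat_add)
  also have "\<dots> = p / (2 * ?c) * pnorm ?H 1"
  proof -
    have "1 / (2 * c * r) * (p * r * n) = p / (2 * c) * n" if "c > 0" "r > 0" for c r n :: real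
      using that by (simp add: field_simps)
    from this[OF c r] show ?thesis .
  qed
  also have "\<dots> \<le> p / (2 * ?c) * (p / (2 * ?c)) ^ i"
    using c assms by (intro mult_left_mono[OF Suc] divide_nonneg_nonneg mult_nonneg_nonneg less_imp_le[OF c]) simp_all
  finally show ?case using c r by (simp add: abs_mult del: of_nat_mult of_nat_add)
qed simp

text \<open>Radii at most 1 allow the majorants of P i to be taken at 1, once and for all; the
  powers u^(2i) then compensate C^i.\<close>

lemma adm_geometric:
  assumes "C > 0" "M \<ge> 0" "\<And>i. pnorm (P i) 1 \<le> M * C ^ i" "\<rho> \<le> 1" "C * \<rho>\<^sup>2 \<le> 1"
  shows "adm \<rho> (\<lambda>i. sq_poly (P i)) (\<lambda>i. 2 * i)"
  unfolding adm_def
proof (intro allI impI)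
  fix t assume t: "0 < t \<and> t < \<rho>"
  have "t\<^sup>2 < \<rho>\<^sup>2" using t by (intro power_strict_mono) auto
  then have "C * t\<^sup>2 < C * \<rho>\<^sup>2" using assms(1) by simp
  then have "C * t\<^sup>2 < 1" using assms(5) by linarith
  then have "summable (\<lambda>i. M * (C * t\<^sup>2) ^ i)" using assms(1) t by (intro summable_mult summable_geometric) auto
  moreover have "norm (pnorm (sq_poly (P i)) t * t ^ (2 * i)) \<le> M * (C * t\<^sup>2) ^ i" for i
  proof -
    have "pnorm (sq_poly (P i)) t \<le> pnorm (P i) (t\<^sup>2)" using t by (intro pnorm_pcompose_square) auto
    also have "\<dots> \<le> pnorm (P i) 1" using t assms(4) by (intro pnorm_mono) (auto intro: power_le_one)
    also have "\<dots> \<le> M * C ^ i" by (rule assms)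
    finally have "pnorm (sq_poly (P i)) t * t ^ (2 * i) \<le> (M * C ^ i) * t ^ (2 * i)"
      using t by (intro mult_right_mono) auto
    then show ?thesis using t pnorm_nonneg[of t "sq_poly (P i)"]
      by (simp add: power_mult power_mult_distrib mult.assoc)
  qed
  ultimately show "summable (\<lambda>i. pnorm (sq_poly (P i)) t * t ^ (2 * i))"
    by (rule summable_comparison_test'[where N = 0])
qed

lemma psum_euler:
  assumes adm: "adm \<rho> (\<lambda>i. sq_poly (P i)) (\<lambda>i. 2 * i)" (is "adm \<rho> ?Q ?e")
    and x: "\<bar>x $ a\<bar> < \<rho>" "\<bar>x $ b\<bar> < \<rho>" and ab: "a \<noteq> b"
  shows "(\<lambda>i. poly (euler_op i (P i)) ((x $ a)\<^sup>2) * (x $ b) ^ (2 * i)) sums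
    (x $ a * pdiff a (psum a b ?Q ?e) x - x $ b * pdiff b (psum a b ?Q ?e) x)"
proof -
  note s1 = summable_sums[OF psum_summable[OF adm_pderiv[OF adm] x]]
  note s2 = summable_sums[OF psum_summable[OF adm_power_deriv[OF adm] x]]
  have "poly (euler_op i (P i)) ((x $ a)\<^sup>2) * (x $ b) ^ (2 * i) =
     x $ a * (poly (pderiv (?Q i)) (x $ a) * (x $ b) ^ ?e i) -
     x $ b * (poly (smult (real (?e i)) (?Q i)) (x $ a) * (x $ b) ^ (?e i - 1))" for i
  proof -
    have pw: "x $ b * (real (2 * i) * (x $ b) ^ (2 * i - 1)) = real (2 * i) * (x $ b) ^ (2 * i)"
      by (cases i) auto
    then have *: "x $ b * (poly (smult (real (?e i)) (?Q i)) (x $ a) * (x $ b) ^ (?e i - 1)) =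
        poly (P i) ((x $ a)\<^sup>2) * (real (2 * i) * (x $ b) ^ (2 * i))"
    proof -
      have "x $ b * (poly (smult r Q) y * w) = poly Q y * (x $ b * (r * w))" for r Q y w
        by (simp add: mult_ac)
      then show ?thesis
        using pw by (simp only: poly_pcompose) (simp add: power2_eq_square)
    qed
    show ?thesis unfolding *
      by (simp add: euler_op_def pderiv_pcompose poly_pcompose pderiv_pCons power2_eq_square algebra_simps)
  qed
  then show ?thesis
    using sums_diff[OF sums_mult[OF s1, of "x $ a"] sums_mult[OF s2, of "x $ b"]]
    by (simp only: psum_pdiff[OF adm x ab] psum_def)
qed

text \<open>Division of sin (eps * u) by eps without loss of smoothness; it shows that
  \<open>x $ a\<close> is eps times a smooth function.\<close>

lemma smooth_sinc:
  fixes a b :: "'n::finite"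
  assumes "a \<noteq> b"
  obtains S :: "real ^ 'n \<Rightarrow> real" where "smooth_on {x. \<bar>x $ a\<bar> < 1 \<and> \<bar>x $ b\<bar> < 1} S"
    "\<And>x. \<bar>x $ a\<bar> < 1 \<Longrightarrow> \<bar>x $ b\<bar> < 1 \<Longrightarrow> sin (x $ a * x $ b) = x $ a * x $ b * S x"
proof
  define q where "q = (\<lambda>k :: nat. monom ((- 1) ^ k / fact (2 * k + 1)) (2 * k) :: real poly)"
  have adm: "adm 1 q (\<lambda>k. 2 * k)"
    unfolding adm_def
  proof (intro allI impI)
    fix t :: real assume t: "0 < t \<and> t < 1"
    have "summable (\<lambda>k. t ^ k)" using t by (intro summable_geometric) auto
    moreover have "norm (pnorm (q k) t * t ^ (2 * k)) \<le> t ^ k" for k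
    proof -
      have "pnorm (q k) t = t ^ (2 * k) / fact (2 * k + 1)"
        unfolding q_def pnorm_def by (simp add: map_poly_monom poly_monom abs_mult)
      also have "\<dots> \<le> 1 / 1"
        using t fact_ge_1[of "2 * k + 1", where 'a = real] by (intro frac_le power_le_one) simp_all
      finally have "pnorm (q k) t \<le> 1" by simp
      moreover have "t ^ (2 * k) \<le> t ^ k" using t by (intro power_decreasing) auto
      ultimately have "pnorm (q k) t * t ^ (2 * k) \<le> 1 * t ^ k"
        using t by (intro mult_mono) auto
      then show ?thesis using t pnorm_nonneg[of t "q k"] by simp
    qed
    ultimately show "summable (\<lambda>k. pnorm (q k) t * t ^ (2 * k))"
      by (rule summable_comparison_test'[where N = 0])
  qed
  show "smooth_on {x. \<bar>x $ a\<bar> < 1 \<and> \<bar>x $ b\<bar> < 1} (psum a b q (\<lambda>k. 2 * k))"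
    by (rule smooth_on_psum[OF adm assms])
  show "sin (x $ a * x $ b) = x $ a * x $ b * psum a b q (\<lambda>k. 2 * k) x"
    if "\<bar>x $ a\<bar> < 1" "\<bar>x $ b\<bar> < 1" for x
  proof -
    have "(\<lambda>k. x $ a * x $ b * (poly (q k) (x $ a) * (x $ b) ^ (2 * k))) sums
        (x $ a * x $ b * psum a b q (\<lambda>k. 2 * k) x)"
      unfolding psum_def by (intro sums_mult summable_sums psum_summable[OF adm that])
    moreover have "x $ a * x $ b * (poly (q k) (x $ a) * (x $ b) ^ (2 * k)) =
       (- 1) ^ k / fact (2 * k + 1) * (x $ a * x $ b) ^ (2 * k + 1)" for k
      by (simp add: q_def poly_monom power_mult_distrib)
    ultimately show ?thesis using sin_paired[of "x $ a * x $ b"] sums_unique2 by simp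
  qed
qed

lemma legendre_data:
  fixes a b :: "'n::finite"
  assumes "p > 2" "a \<noteq> b"
  obtains \<rho> and H K :: "real ^ 'n \<Rightarrow> real" where "0 < \<rho>" "\<rho> \<le> 1"
    "smooth_on {x. \<bar>x $ a\<bar> < \<rho> \<and> \<bar>x $ b\<bar> < \<rho>} H" "smooth_on {x. \<bar>x $ a\<bar> < \<rho> \<and> \<bar>x $ b\<bar> < \<rho>} K"
    "\<And>x. \<bar>x $ a\<bar> < \<rho> \<Longrightarrow> \<bar>x $ b\<bar> < \<rho> \<Longrightarrow>
       K x = - (p / 2) * ((1 - 2 / p) * H x + x $ a * pdiff a H x - x $ b * pdiff b H x)"
    "\<And>x. \<bar>x $ a\<bar> < \<rho> \<Longrightarrow> \<bar>x $ b\<bar> < \<rho> \<Longrightarrow>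
       (1 + (x $ a)\<^sup>2) * (K x + x $ a * pdiff a K x - x $ b * pdiff b K x) - 2 * (1 - 1 / p) * (x $ a)\<^sup>2 * K x
         = 2 * (1 - 1 / p) * pdiff b (pdiff b H) x"
    "\<And>i x. i \<noteq> a \<Longrightarrow> i \<noteq> b \<Longrightarrow> \<bar>x $ a\<bar> < \<rho> \<Longrightarrow> \<bar>x $ b\<bar> < \<rho> \<Longrightarrow>
       pdiff i H x = 0 \<and> pdiff i K x = 0 \<and> pdiff i (pdiff b H) x = 0"
    "H 0 = - 1" "pdiff b H 0 = 0" "pdiff a (pdiff b H) 0 = 0"
proof
  define c where "c = 1 - 1 / p"
  \<comment> \<open>Twice the growth rate of P: the additional 2^i absorbs the factor 2i + 1 in the
    bound for \<open>legendre_K\<close>, so one rate and one radius serve both series.\<close>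
  define C where "C = 2 * (p / (2 * c))"
  have c: "c > 0" using assms by (simp add: c_def)
  have C: "C > 0" using assms c by (simp add: C_def)
  define \<rho> where "\<rho> = min 1 (1 / sqrt C)"
  show "0 < \<rho>" "\<rho> \<le> 1" using C by (auto simp: \<rho>_def)
  have "\<rho>\<^sup>2 \<le> (1 / sqrt C)\<^sup>2" using \<open>0 < \<rho>\<close> by (intro power_mono) (auto simp: \<rho>_def)
  then have \<rho>2: "C * \<rho>\<^sup>2 \<le> 1" using C by (simp add: power_divide field_simps)
  define P where "P = legendre_H p"
  define L where "L = (\<lambda>i. legendre_K p i (P i))"
  have P1: "pnorm (P i) 1 \<le> (C / 2) ^ i" for i
  proof -
    have "C / 2 = p / (2 * (1 - 1 / p))" unfolding C_def c_def by (rule nonzero_mult_div_cancel_left) simp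
    show ?thesis unfolding P_def \<open>C / 2 = _\<close> by (rule pnorm_legendre_H[OF assms(1)])
  qed
  have "pnorm (P i) 1 \<le> 1 * C ^ i" for i
  proof -
    have "(C / 2) ^ i \<le> C ^ i" using C by (intro power_mono) auto
    then show ?thesis using P1[of i] by simp
  qed
  then have admH: "adm \<rho> (\<lambda>i. sq_poly (P i)) (\<lambda>i. 2 * i)"
    by (intro adm_geometric[OF C _ _ \<open>\<rho> \<le> 1\<close> \<rho>2, of 1]) auto
  have "pnorm (L i) 1 \<le> p * C ^ i" for i
  proof -
    have "pnorm (L i) 1 \<le> p / 2 * (2 * real i + 1) * pnorm (P i) 1"
      unfolding L_def P_def by (intro pnorm_legendre_K degree_legendre_H assms) simp
    also have "\<dots> \<le> p / 2 * (2 * 2 ^ i) * (C / 2) ^ i"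
    proof -
      have "real (i + 1) \<le> 2 ^ i" by (metis Suc_eq_plus1 Suc_leI less_exp of_nat_le_iff of_nat_numeral of_nat_power)
      then have "2 * real i + 1 \<le> 2 * 2 ^ i" by simp
      then show ?thesis using P1[of i] assms(1) C pnorm_nonneg[of 1 "P i"]
        by (intro mult_mono mult_nonneg_nonneg mult_left_mono) auto
    qed
    also have "\<dots> = p * C ^ i" by (simp add: power_divide)
    finally show ?thesis .
  qed
  then have admK: "adm \<rho> (\<lambda>i. sq_poly (L i)) (\<lambda>i. 2 * i)"
    using assms(1) by (intro adm_geometric[OF C _ _ \<open>\<rho> \<le> 1\<close> \<rho>2, of p]) auto
  let ?e = "\<lambda>i :: nat. 2 * i"
  define H where "H = psum a b (\<lambda>i. sq_poly (P i)) ?e"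
  define K where "K = psum a b (\<lambda>i. sq_poly (L i)) ?e"
  show "smooth_on {x. \<bar>x $ a\<bar> < \<rho> \<and> \<bar>x $ b\<bar> < \<rho>} H" "smooth_on {x. \<bar>x $ a\<bar> < \<rho> \<and> \<bar>x $ b\<bar> < \<rho>} K"
    unfolding H_def K_def by (intro smooth_on_psum admH admK assms)+
  have sums: "(\<lambda>i. poly (P i) ((x $ a)\<^sup>2) * (x $ b) ^ (2 * i)) sums H x"
    "(\<lambda>i. poly (L i) ((x $ a)\<^sup>2) * (x $ b) ^ (2 * i)) sums K x"
    "(\<lambda>i. poly (euler_op i (P i)) ((x $ a)\<^sup>2) * (x $ b) ^ (2 * i)) sums (x $ a * pdiff a H x - x $ b * pdiff b H x)"
    "(\<lambda>i. poly (euler_op i (L i)) ((x $ a)\<^sup>2) * (x $ b) ^ (2 * i)) sums (x $ a * pdiff a K x - x $ b * pdiff b K x)"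
    if x: "\<bar>x $ a\<bar> < \<rho>" "\<bar>x $ b\<bar> < \<rho>" for x
    using summable_sums[OF psum_summable[OF admH x]] summable_sums[OF psum_summable[OF admK x]]
      psum_euler[OF admH x assms(2)] psum_euler[OF admK x assms(2)]
    by (simp_all add: H_def K_def psum_def poly_pcompose power2_eq_square)
  show "K x = - (p / 2) * ((1 - 2 / p) * H x + x $ a * pdiff a H x - x $ b * pdiff b H x)"
    if x: "\<bar>x $ a\<bar> < \<rho>" "\<bar>x $ b\<bar> < \<rho>" for x
  proof -
    have "(\<lambda>i. - (p / 2) * ((1 - 2 / p) * (poly (P i) ((x $ a)\<^sup>2) * (x $ b) ^ (2 * i))
         + poly (euler_op i (P i)) ((x $ a)\<^sup>2) * (x $ b) ^ (2 * i))) sums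
       (- (p / 2) * ((1 - 2 / p) * H x + (x $ a * pdiff a H x - x $ b * pdiff b H x)))"
      by (intro sums_mult sums_add sums x)
    moreover have "- (p / 2) * ((1 - 2 / p) * (poly (P i) ((x $ a)\<^sup>2) * (x $ b) ^ (2 * i))
         + poly (euler_op i (P i)) ((x $ a)\<^sup>2) * (x $ b) ^ (2 * i)) = poly (L i) ((x $ a)\<^sup>2) * (x $ b) ^ (2 * i)" for i
      unfolding L_def legendre_K_def by (simp add: algebra_simps)
    ultimately show ?thesis using sums(2)[OF x] sums_unique2 by fastforce
  qed
  have pdb: "pdiff b H x = psum_db a b (\<lambda>i. sq_poly (P i)) ?e x"
    if x: "\<bar>x $ a\<bar> < \<rho>" "\<bar>x $ b\<bar> < \<rho>" for x
    unfolding H_def by (rule psum_pdiff(2)[OF admH x assms(2)])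
  have pdb2: "pdiff i (pdiff b H) x = pdiff i (psum_db a b (\<lambda>i. sq_poly (P i)) ?e) x"
    if x: "\<bar>x $ a\<bar> < \<rho>" "\<bar>x $ b\<bar> < \<rho>" for x i
    by (rule pdiff_cong_open[OF open_square[of a \<rho> b]]) (use x pdb in auto)
  show "(1 + (x $ a)\<^sup>2) * (K x + x $ a * pdiff a K x - x $ b * pdiff b K x) - 2 * (1 - 1 / p) * (x $ a)\<^sup>2 * K x
         = 2 * (1 - 1 / p) * pdiff b (pdiff b H) x" if x: "\<bar>x $ a\<bar> < \<rho>" "\<bar>x $ b\<bar> < \<rho>" for x
  proof -
    let ?s = "(x $ a)\<^sup>2"
    let ?t = "\<lambda>i. poly (smult (real (2 * i - 1)) (smult (real (2 * i)) (sq_poly (P i)))) (x $ a) * (x $ b) ^ (2 * i - 1 - 1)"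
    have "?t sums pdiff b (pdiff b H) x"
      unfolding pdb2[OF x] psum_pdiff(2)[OF adm_power_deriv[OF admH] x assms(2)]
      using summable_sums[OF psum_summable[OF adm_power_deriv[OF adm_power_deriv[OF admH]] x]]
      by (simp only: psum_def)
    \<comment> \<open>The term i = 0 vanishes through its factor \<open>real (2 * 0)\<close>.
      Dropping it aligns the power u^(2i) with P (Suc i).\<close>
    then have "(\<lambda>i. ?t (Suc i)) sums pdiff b (pdiff b H) x"
      using sums_Suc_iff[of ?t "pdiff b (pdiff b H) x"] by simp
    then have A: "(\<lambda>i. 2 * c * ?t (Suc i)) sums (2 * c * pdiff b (pdiff b H) x)" by (rule sums_mult)
    have B: "2 * c * ?t (Suc i) = (1 + ?s) * (poly (L i) ?s * (x $ b) ^ (2 * i) + poly (euler_op i (L i)) ?s * (x $ b) ^ (2 * i))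
        - 2 * c * ?s * (poly (L i) ?s * (x $ b) ^ (2 * i))" for i
    proof -
      have "?t (Suc i) = (real (2 * i + 1) * real (2 * i + 2)) * poly (P (Suc i)) ?s * (x $ b) ^ (2 * i)"
        by (simp add: poly_pcompose power2_eq_square algebra_simps)
      moreover have "2 * c * ((real (2 * i + 1) * real (2 * i + 2)) * poly (P (Suc i)) ?s) = poly (legendre_rhs p i (L i)) ?s"
      proof -
        have "real (2 * i + 1) * real (2 * i + 2) > 0" by (intro mult_pos_pos) simp_all
        moreover have "poly (P (Suc i)) ?s = poly (legendre_rhs p i (L i)) ?s / (2 * c * (real (2 * i + 1) * real (2 * i + 2)))"
          unfolding P_def L_def c_def by simp
        ultimately show ?thesis using c by (simp del: of_nat_mult of_nat_add)
      qed
      ultimately have "2 * c * ?t (Suc i) = poly (legendre_rhs p i (L i)) ?s * (x $ b) ^ (2 * i)"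
        by (metis (no_types, opaque_lifting) mult.assoc)
      also have "\<dots> = (1 + ?s) * (poly (L i) ?s * (x $ b) ^ (2 * i) + poly (euler_op i (L i)) ?s * (x $ b) ^ (2 * i))
        - 2 * c * ?s * (poly (L i) ?s * (x $ b) ^ (2 * i))"
        unfolding legendre_rhs_def c_def[symmetric] by (simp add: algebra_simps)
      finally show ?thesis .
    qed
    have C: "(\<lambda>i. (1 + ?s) * (poly (L i) ?s * (x $ b) ^ (2 * i) + poly (euler_op i (L i)) ?s * (x $ b) ^ (2 * i))
        - 2 * c * ?s * (poly (L i) ?s * (x $ b) ^ (2 * i))) sums
        ((1 + ?s) * (K x + (x $ a * pdiff a K x - x $ b * pdiff b K x)) - 2 * c * ?s * K x)"
      by (intro sums_diff sums_mult sums_add sums x)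
    have "2 * c * pdiff b (pdiff b H) x =
        (1 + ?s) * (K x + (x $ a * pdiff a K x - x $ b * pdiff b K x)) - 2 * c * ?s * K x"
      by (rule sums_unique2[OF A[unfolded B] C])
    then show ?thesis unfolding c_def[symmetric] by (simp add: add_diff_eq)
  qed
  show "pdiff i H x = 0 \<and> pdiff i K x = 0 \<and> pdiff i (pdiff b H) x = 0"
    if i: "i \<noteq> a" "i \<noteq> b" and x: "\<bar>x $ a\<bar> < \<rho>" "\<bar>x $ b\<bar> < \<rho>" for i x
    unfolding pdb2[OF x] unfolding H_def K_def
    using psum_pdiff(3)[OF admH x assms(2) i] psum_pdiff(3)[OF admK x assms(2) i]
      psum_pdiff(3)[OF adm_power_deriv[OF admH] x assms(2) i] by simp
  have "(\<lambda>i. poly (P i) 0 * 0 ^ (2 * i)) sums (poly (P 0) 0)"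
    using sums_single[of 0 "\<lambda>i. poly (P i) 0"] by (rule sums_cong[THEN iffD1, rotated]) (simp add: power_0_left)
  then show "H 0 = - 1" using sums_unique2[OF sums(1)[of 0]] \<open>0 < \<rho>\<close> by (simp add: P_def)
  have z: "poly (smult (real (2 * i)) (sq_poly (P i))) 0 * 0 ^ (2 * i - 1) = (0 :: real)" for i
    by (cases i) auto
  have "pdiff b H 0 = psum_db a b (\<lambda>i. sq_poly (P i)) ?e 0"
    by (rule pdb) (use \<open>0 < \<rho>\<close> in simp_all)
  also have "\<dots> = 0" unfolding psum_def zero_index z by simp
  finally show "pdiff b H 0 = 0" .
  have za: "poly (pderiv (smult (real (2 * i)) (sq_poly (P i)))) 0 * 0 ^ (2 * i - 1) = (0 :: real)" for i
    by (cases i) auto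
  have "pdiff a (pdiff b H) 0 = psum_da a b (\<lambda>i. smult (real (2 * i)) (sq_poly (P i))) (\<lambda>i. 2 * i - 1) 0"
    unfolding pdb2[of 0, simplified, OF \<open>0 < \<rho>\<close>]
    using psum_pdiff(1)[OF adm_power_deriv[OF admH], of 0 a b] \<open>0 < \<rho>\<close> assms(2) by simp
  also have "\<dots> = 0" unfolding psum_def zero_index za by simp
  finally show "pdiff a (pdiff b H) 0 = 0" .
qed

section \<open>The smooth inverse function theorem\<close>

lemma smooth_on_det:
  fixes A :: "'n::finite \<Rightarrow> 'n \<Rightarrow> real ^ 'm::finite \<Rightarrow> real"
  assumes "open U" "\<And>i j. smooth_on U (A i j)"
  shows "smooth_on U (\<lambda>x. det (\<chi> i j. A i j x))"
  unfolding det_def by (auto intro!: smooth_on_sum smooth_on_mult smooth_on_prod assms)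

lemma smooth_on_divide:
  assumes "open U" "smooth_on U f" "smooth_on U g" "\<And>x. x \<in> U \<Longrightarrow> g x \<noteq> 0"
  shows "smooth_on U (\<lambda>x. f x / g x)"
proof -
  have "g x * g x \<in> {0<..}" if "x \<in> U" for x
    using assms(4)[OF that] by (auto simp: zero_less_mult_iff)
  then have "smooth_on U (\<lambda>x. f x * g x * inverse (g x * g x))"
    by (intro smooth_on_mult assms smooth_on_compose1[OF _ smooth1_inverse])
  then show ?thesis
    by (rule smooth_on_cong[OF assms(1)]) (use assms(4) in \<open>simp add: field_simps\<close>)
qed

definition jacobian :: "('n \<Rightarrow> real ^ 'n \<Rightarrow> real) \<Rightarrow> real ^ 'n::finite \<Rightarrow> real ^ 'n ^ 'n" where
  "jacobian \<Psi> x = (\<chi> k i. pdiff i (\<Psi> k) x)"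

text \<open>The first-order theorem yields a differentiable local inverse g. By Cramer's rule its
  partial derivatives are smooth functions composed with g, so the family of all such compositions
  is closed under differentiation, and g is smooth.\<close>

lemma smooth_inverse_function:
  fixes \<Psi> :: "'n::finite \<Rightarrow> real ^ 'n \<Rightarrow> real"
  assumes "open U" "\<And>k. smooth_on U (\<Psi> k)" "x0 \<in> U" "det (jacobian \<Psi> x0) \<noteq> 0"
  obtains W V g where "open W" "x0 \<in> W" "W \<subseteq> U" "open V" "(\<chi> k. \<Psi> k x0) \<in> V"
    "\<And>y. y \<in> V \<Longrightarrow> g y \<in> W" "\<And>y k. y \<in> V \<Longrightarrow> \<Psi> k (g y) = y $ k"
    "\<And>k. smooth_on V (\<lambda>y. g y $ k)"
proof -
  let ?J = "jacobian \<Psi>"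
  have smJ: "smooth_on U (\<lambda>x. det (?J x))" unfolding jacobian_def
    by (intro smooth_on_det assms smooth_on_pdiff)
  define U0 where "U0 = {x \<in> U. det (?J x) \<noteq> 0}"
  have "U0 = U \<inter> (\<lambda>x. det (?J x)) -` (- {0})" unfolding U0_def by auto
  then have "open U0"
    using continuous_open_preimage[OF smooth_on_continuous[OF smJ] assms(1), of "- {0}"] by auto
  define f where "f x = (\<chi> k. \<Psi> k x)" for x
  define f' where "f' x = Blinfun (\<lambda>h. ?J x *v h)" for x
  have f': "blinfun_apply (f' x) = (\<lambda>h. ?J x *v h)" for x
    unfolding f'_def by (rule bounded_linear_Blinfun_apply) (rule matrix_vector_mul_bounded_linear)
  have diff: "\<Psi> k differentiable (at x)" if "x \<in> U" for k x
    using assms(2) that by (rule smooth_on_imp_differentiable)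
  have deriv: "(f has_derivative blinfun_apply (f' x)) (at x)" if "x \<in> U0" for x
  proof -
    have "(f has_derivative (\<lambda>h. \<chi> k. \<Sum>i\<in>UNIV. pdiff i (\<Psi> k) x * h $ i)) (at x)"
      unfolding f_def by (rule has_derivative_vec_lambda_pdiff) (use diff that U0_def in auto)
    moreover have "(\<lambda>h. ?J x *v h) = (\<lambda>h. \<chi> k. \<Sum>i\<in>UNIV. pdiff i (\<Psi> k) x * h $ i)"
      by (auto simp: jacobian_def matrix_vector_mult_def fun_eq_iff)
    ultimately show ?thesis unfolding f' by simp
  qed
  have "continuous_on U (pdiff i (\<Psi> k))" for i k
    by (rule smooth_on_continuous[OF smooth_on_pdiff[OF assms(2)]])
  then have "continuous_on U0 (pdiff i (\<Psi> k))" for i k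
    by (rule continuous_on_subset) (auto simp: U0_def)
  then have contf': "continuous_on U0 f'"
    by (intro continuous_on_blinfun_componentwise)
      (auto simp: f' jacobian_def matrix_vector_mult_def intro!: continuous_on_vec_lambda continuous_on_sum continuous_on_mult)
  obtain B where B: "B ** ?J x0 = mat 1"
    using assms(4) invertible_det_nz[of "?J x0"] unfolding invertible_def by blast
  have "Blinfun (\<lambda>h. B *v h) o\<^sub>L f' x0 = id_blinfun"
  proof (rule blinfun_eqI)
    fix h
    have "blinfun_apply (Blinfun (\<lambda>h. B *v h)) = (\<lambda>h. B *v h)"
      by (rule bounded_linear_Blinfun_apply) (rule matrix_vector_mul_bounded_linear)
    then show "blinfun_apply (Blinfun (\<lambda>h. B *v h) o\<^sub>L f' x0) h = blinfun_apply id_blinfun h"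
      by (simp add: f' matrix_vector_mul_assoc B)
  qed
  moreover have "x0 \<in> U0" using assms unfolding U0_def by simp
  ultimately obtain W V g g' where W: "open W" "W \<subseteq> U0" "x0 \<in> W" "open V" "f x0 \<in> V"
    and hom: "homeomorphism W V f g" and g': "\<And>y. y \<in> V \<Longrightarrow> (g has_derivative g' y) (at y)"
    using inverse_function_theorem[OF \<open>open U0\<close> deriv contf'] by metis
  have gW: "g y \<in> W" and fg: "f (g y) = y" if "y \<in> V" for y
    using hom that unfolding homeomorphism_def by auto
  have \<Psi>g: "\<Psi> k (g y) = y $ k" if "y \<in> V" for y k
    using fg[OF that] unfolding f_def by (metis vec_lambda_beta)
  have gdiff: "(\<lambda>y. g y $ k) differentiable (at y)" if "y \<in> V" for y k
    using has_derivative_compose[OF g'[OF that] bounded_linear_imp_has_derivative[OF bounded_linear_vec_nth]]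
    unfolding differentiable_def by blast
  \<comment> \<open>Entry (k, i) of the inverse Jacobian, by Cramer's rule: column k is replaced by
    the i-th unit vector.\<close>
  define M where "M k i x = det (\<chi> r s. if s = k then axis i 1 $ r else pdiff s (\<Psi> r) x) / det (?J x)" for k i x
  have smW: "smooth_on W (pdiff i (\<Psi> k))" for i k
    by (rule smooth_on_subset[OF smooth_on_pdiff[OF assms(2)]]) (use W(2) U0_def in auto)
  have smM: "smooth_on W (M k i)" for k i
    unfolding M_def
  proof (rule smooth_on_divide)
    show "smooth_on W (\<lambda>x. det (\<chi> r s. if s = k then axis i 1 $ r else pdiff s (\<Psi> r) x))"
    proof (rule smooth_on_det)
      show "smooth_on W (\<lambda>x. if s = k then axis i 1 $ r else pdiff s (\<Psi> r) x)" for r s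
        using smW W(1) by (cases "s = k") auto
    qed (rule W)
    show "smooth_on W (\<lambda>x. det (?J x))" by (rule smooth_on_subset[OF smJ]) (use W(2) U0_def in auto)
  qed (use W U0_def in auto)
  have pdg: "pdiff i (\<lambda>y. g y $ k) y = M k i (g y)" if y: "y \<in> V" for i k y
  proof -
    define z where "z = (\<chi> j. pdiff i (\<lambda>y. g y $ j) y)"
    have gy: "(\<chi> k. g y $ k) = g y" for y by (simp add: vec_eq_iff)
    have gU: "g y \<in> U" using gW[OF y] W(2) U0_def by auto
    have "(?J (g y) *v z) $ r = axis i 1 $ r" for r
    proof -
      have "(\<Sum>j\<in>UNIV. pdiff j (\<Psi> r) (g y) * pdiff i (\<lambda>y. g y $ j) y) = pdiff i (\<lambda>y. \<Psi> r (g y)) y"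
        using pdiff_compose(2)[where F = "\<Psi> r" and g = "\<lambda>k y. g y $ k" and x = y and i = i]
          diff[OF gU, of r] gdiff[OF y] by (simp add: gy)
      also have "\<dots> = pdiff i (\<lambda>y. y $ r) y"
        using \<open>open V\<close> y by (rule pdiff_cong_open) (rule \<Psi>g)
      finally show ?thesis by (simp add: jacobian_def z_def matrix_vector_mult_def pdiff_nth axis_def)
    qed
    then have "?J (g y) *v z = axis i 1" by (simp add: vec_eq_iff)
    moreover have "det (?J (g y)) \<noteq> 0" using gW[OF y] W(2) U0_def by auto
    ultimately have "z = (\<chi> k. det (\<chi> r s. if s = k then axis i 1 $ r else ?J (g y) $ r $ s) / det (?J (g y)))"
      using cramer by blast
    then have "z $ k = M k i (g y)" by (simp add: M_def jacobian_def cong: if_cong)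
    then show ?thesis by (simp add: z_def)
  qed
  define B where "B = {\<lambda>y. F (g y) | F. smooth_on W F}"
  have gy: "(\<chi> k. g y $ k) = g y" for y by (simp add: vec_eq_iff)
  have sm: "smooth_on V (\<lambda>y. F (g y))" if F: "smooth_on W F" for F
  proof (rule alg_smooth[where B = B])
    have comp: "(\<lambda>y. G (g y)) differentiable (at y)"
      "pdiff i (\<lambda>y. G (g y)) y = (\<Sum>k\<in>UNIV. pdiff k G (g y) * M k i (g y))"
      if G: "smooth_on W G" and y: "y \<in> V" for G y i
      using pdiff_compose(1)[where F = G and g = "\<lambda>k y. g y $ k" and x = y]
        pdiff_compose(2)[where F = G and g = "\<lambda>k y. g y $ k" and x = y and i = i]
        smooth_on_imp_differentiable[OF G gW[OF y]] gdiff[OF y] pdg[OF y] by (simp_all add: gy)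
    show "f differentiable (at y)" if "f \<in> B" "y \<in> V" for f y
      using that comp unfolding B_def by auto
    show "alg V B (pdiff i f)" if "f \<in> B" for f i
    proof -
      from \<open>f \<in> B\<close> obtain G where G: "f = (\<lambda>y. G (g y))" "smooth_on W G" unfolding B_def by blast
      have "\<And>k. (\<lambda>y. pdiff k G (g y)) \<in> B" "\<And>k. (\<lambda>y. M k i (g y)) \<in> B"
        unfolding B_def using smooth_on_pdiff[OF G(2)] smM by blast+
      then have "alg V B (\<lambda>y. \<Sum>k\<in>UNIV. pdiff k G (g y) * M k i (g y))"
        by (intro alg_sum alg.mult alg.base) auto
      then show ?thesis by (rule alg.cong) (simp add: G(1) comp[OF G(2)])
    qed
    show "alg V B (\<lambda>y. F (g y))" by (rule alg.base) (use F B_def in auto)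
  qed (rule W)
  show thesis
  proof (rule that)
    show "smooth_on V (\<lambda>y. g y $ k)" for k by (rule sm) (use W in auto)
  qed (use W gW \<Psi>g U0_def f_def in auto)
qed

section \<open>The singular solution\<close>

text \<open>\<open>zeta p t = sgn t * \<bar>t\<bar> powr (1 - 2/p)\<close>; at \<open>t = 0\<close> the factor \<open>0 powr (- 2 / p)\<close> is the junk value \<open>0\<close>.\<close>

definition zeta :: "real \<Rightarrow> real \<Rightarrow> real" where
  "zeta p t = t * \<bar>t\<bar> powr (- 2 / p)"

lemma zeta_0 [simp]: "zeta p 0 = 0" by (simp add: zeta_def)

lemma zeta_pos: "t > 0 \<Longrightarrow> zeta p t = t powr (1 - 2 / p)"
  by (simp add: zeta_def powr_diff powr_minus divide_inverse)

lemma zeta_minus: "zeta p (- t) = - zeta p t"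
  by (simp add: zeta_def)

lemma zeta_mult: "s > 0 \<Longrightarrow> zeta p (t * s) = zeta p t * s powr (1 - 2 / p)"
  by (simp add: zeta_def abs_mult powr_mult powr_diff powr_minus divide_inverse)

lemma zeta_eq_0_iff: "zeta p t = 0 \<longleftrightarrow> t = 0"
  by (simp add: zeta_def)

lemma zeta_deriv:
  assumes "t \<noteq> 0"
  shows "(zeta p has_real_derivative (1 - 2 / p) * \<bar>t\<bar> powr (- 2 / p)) (at t)"
proof (cases "t > 0")
  case True
  have "((\<lambda>t. t powr (1 - 2 / p)) has_real_derivative (1 - 2 / p) * t powr (1 - 2 / p - 1)) (at t)"
    using True by (intro has_real_derivative_powr) auto
  then have "((\<lambda>t. t powr (1 - 2 / p)) has_real_derivative (1 - 2 / p) * \<bar>t\<bar> powr (- 2 / p)) (at t)"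
    using True by simp
  then show ?thesis
    by (rule has_field_derivative_transform_within_open[where S = "{0<..}"])
      (use True zeta_pos in auto)
next
  case False
  then have t: "- t > 0" using assms by simp
  have "((\<lambda>t. - ((- t) powr (1 - 2 / p))) has_real_derivative - ((1 - 2 / p) * (- t) powr (1 - 2 / p - 1) * - 1)) (at t)"
    using t by (intro DERIV_minus DERIV_chain2[OF has_real_derivative_powr]) (auto intro!: derivative_eq_intros)
  then have "((\<lambda>t. - ((- t) powr (1 - 2 / p))) has_real_derivative (1 - 2 / p) * \<bar>t\<bar> powr (- 2 / p)) (at t)"
    using t by simp
  then show ?thesis
  proof (rule has_field_derivative_transform_within_open[where S = "{..<0}"])
    fix x :: real assume "x \<in> {..<0}"
    then show "- ((- x) powr (1 - 2 / p)) = zeta p x" using zeta_pos[of "- x" p] zeta_minus[of p x] by simp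
  qed (use t in auto)
qed

lemma has_derivative_pdiff2:
  assumes "f differentiable (at x)" "a \<noteq> b" "\<And>i. i \<noteq> a \<Longrightarrow> i \<noteq> b \<Longrightarrow> pdiff i f x = 0"
  shows "(f has_derivative (\<lambda>h. pdiff a f x * h $ a + pdiff b f x * h $ b)) (at x)"
proof -
  have "(\<Sum>i\<in>UNIV. pdiff i f x * h $ i) = pdiff a f x * h $ a + pdiff b f x * h $ b" for h
  proof -
    have "(\<Sum>i\<in>UNIV. pdiff i f x * h $ i) = (\<Sum>i\<in>{a, b}. pdiff i f x * h $ i)"
      by (rule sum.mono_neutral_right) (use assms(3) in auto)
    then show ?thesis using assms(2) by simp
  qed
  then show ?thesis using has_derivative_pdiff[OF assms(1)] by simp
qed

text \<open>The Jacobian L (A B; C D) of the position map and the derivatives e, u of (eps, u) in x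
  are inverse to each other. Up to the nonzero factor L (A D - B C), the divergence of a field with
  eps-derivatives s and u-derivatives t is then linear in A, B, C, D. This is the hodograph step: it
  makes the equation linear.\<close>

lemma divergence_from_inverse:
  fixes L A B C D e1 e2 u1 u2 s1 s2 t1 t2 :: real
  assumes "L * (A * e1 + B * u1) = 1" "L * (A * e2 + B * u2) = 0"
    "L * (C * e1 + D * u1) = 0" "L * (C * e2 + D * u2) = 1"
    "s1 * D - t1 * C - s2 * B + t2 * A = 0"
  shows "s1 * e1 + t1 * u1 + s2 * e2 + t2 * u2 = 0"
proof -
  let ?D = "A * D - B * C"
  have "L * ?D * e1 = D * (L * (A * e1 + B * u1)) - B * (L * (C * e1 + D * u1))"
    "L * ?D * u1 = A * (L * (C * e1 + D * u1)) - C * (L * (A * e1 + B * u1))"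
    "L * ?D * e2 = D * (L * (A * e2 + B * u2)) - B * (L * (C * e2 + D * u2))"
    "L * ?D * u2 = A * (L * (C * e2 + D * u2)) - C * (L * (A * e2 + B * u2))"
    by (simp_all add: algebra_simps)
  then have e: "L * ?D * e1 = D" "L * ?D * u1 = - C" "L * ?D * e2 = - B" "L * ?D * u2 = A"
    unfolding assms(1-4) by simp_all
  have "L * L * ?D * (e1 * u2 - e2 * u1) = (L * (A * e1 + B * u1)) * (L * (C * e2 + D * u2))
      - (L * (A * e2 + B * u2)) * (L * (C * e1 + D * u1))"
    by (simp add: algebra_simps)
  then have "L * L * ?D * (e1 * u2 - e2 * u1) = 1" unfolding assms(1-4) by simp
  then have "L * ?D \<noteq> 0" by auto
  moreover have "L * ?D * (s1 * e1 + t1 * u1 + s2 * e2 + t2 * u2) =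
      s1 * (L * ?D * e1) + t1 * (L * ?D * u1) + s2 * (L * ?D * e2) + t2 * (L * ?D * u2)"
    by (simp add: algebra_simps)
  ultimately show ?thesis unfolding e using assms(5) by auto
qed

lemma singular_solution:
  fixes a b :: "'n::finite"
  assumes p: "p > 2" and ab: "a \<noteq> b"
  obtains eps om mm g :: "real ^ 'n \<Rightarrow> real"
  where "smooth_on (ball 0 4) eps" "smooth_on (ball 0 4) om" "smooth_on (ball 0 4) mm" "smooth_on (ball 0 4) g"
    "\<And>x. x \<in> ball 0 4 \<Longrightarrow> x $ a = eps x * mm x \<and> mm x > 0 \<and> g x > 0"
    "\<And>x. x \<in> ball 0 4 \<Longrightarrow> x $ a \<noteq> 0 \<Longrightarrow> ((\<lambda>x. zeta p (x $ a) * g x) has_derivative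
        (\<lambda>h. \<bar>eps x\<bar> powr (- 2 / p) * (cos (om x) * h $ a + sin (om x) * h $ b))) (at x)"
    "\<And>x. x \<in> ball 0 4 \<Longrightarrow> pdiff a (\<lambda>x. (1 + (eps x)\<^sup>2) powr (1 / p - 1) * cos (om x)) x
        + pdiff b (\<lambda>x. (1 + (eps x)\<^sup>2) powr (1 / p - 1) * sin (om x)) x = 0"
proof -
  obtain \<rho> and H K :: "real ^ 'n \<Rightarrow> real" where \<rho>: "0 < \<rho>" "\<rho> \<le> 1"
    and smH: "smooth_on {x. \<bar>x $ a\<bar> < \<rho> \<and> \<bar>x $ b\<bar> < \<rho>} H"
    and smK: "smooth_on {x. \<bar>x $ a\<bar> < \<rho> \<and> \<bar>x $ b\<bar> < \<rho>} K"
    and K_eq: "\<And>x. \<bar>x $ a\<bar> < \<rho> \<Longrightarrow> \<bar>x $ b\<bar> < \<rho> \<Longrightarrow>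
       K x = - (p / 2) * ((1 - 2 / p) * H x + x $ a * pdiff a H x - x $ b * pdiff b H x)"
    and PDE: "\<And>x. \<bar>x $ a\<bar> < \<rho> \<Longrightarrow> \<bar>x $ b\<bar> < \<rho> \<Longrightarrow>
       (1 + (x $ a)\<^sup>2) * (K x + x $ a * pdiff a K x - x $ b * pdiff b K x) - 2 * (1 - 1 / p) * (x $ a)\<^sup>2 * K x
         = 2 * (1 - 1 / p) * pdiff b (pdiff b H) x"
    and off: "\<And>i x. i \<noteq> a \<Longrightarrow> i \<noteq> b \<Longrightarrow> \<bar>x $ a\<bar> < \<rho> \<Longrightarrow> \<bar>x $ b\<bar> < \<rho> \<Longrightarrow>
       pdiff i H x = 0 \<and> pdiff i K x = 0 \<and> pdiff i (pdiff b H) x = 0"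
    and H0: "H 0 = - 1" and Hb0: "pdiff b H 0 = 0" and Hab0: "pdiff a (pdiff b H) 0 = 0"
    by (rule legendre_data[OF p ab]) (rule that)
  obtain S :: "real ^ 'n \<Rightarrow> real" where smS: "smooth_on {x. \<bar>x $ a\<bar> < 1 \<and> \<bar>x $ b\<bar> < 1} S"
    and S: "\<And>x. \<bar>x $ a\<bar> < 1 \<Longrightarrow> \<bar>x $ b\<bar> < 1 \<Longrightarrow> sin (x $ a * x $ b) = x $ a * x $ b * S x"
    by (rule smooth_sinc[OF ab]) (rule that)
  define d where "d = 1 - 2 / p"
  define c where "c = 1 - 1 / p"
  have d: "d > 0" "1 - d = 2 / p" and c: "c > 0" using p by (auto simp: d_def c_def)
  let ?Q = "{x :: real ^ 'n. \<bar>x $ a\<bar> < \<rho> \<and> \<bar>x $ b\<bar> < \<rho>}"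
  have oQ: "open ?Q" by (rule open_square)
  define T where "T = pdiff b H"
  have smT: "smooth_on ?Q T" unfolding T_def by (rule smooth_on_pdiff[OF smH])
  have smS': "smooth_on ?Q S" by (rule smooth_on_subset[OF smS]) (use \<rho> in auto)
  \<comment> \<open>X1 and X2 below are the position, composed of y_a * K along (cos omega, sin
    omega) and T along (- sin omega, cos omega), where omega = y_a * y_b. The function m is X1
    divided by y_a, with the sine divided by means of S.\<close>
  define m where "m y = K y * cos (y $ a * y $ b) - T y * (y $ b * S y)" for y
  define X1 where "X1 y = y $ a * K y * cos (y $ a * y $ b) - T y * sin (y $ a * y $ b)" for y
  define X2 where "X2 y = y $ a * K y * sin (y $ a * y $ b) + T y * cos (y $ a * y $ b)" for y
  note smi = smooth_on_add smooth_on_diff smooth_on_mult smooth_on_nth smooth_on_compose1[OF _ smooth1_sin_cos(1)]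
    smooth_on_compose1[OF _ smooth1_sin_cos(2)]
  have sm_m: "smooth_on ?Q m" unfolding m_def[abs_def] by (intro smi oQ smK smT smS' UNIV_I)
  have sm_X1: "smooth_on ?Q X1" unfolding X1_def[abs_def] by (intro smi oQ smK smT smS' UNIV_I)
  have sm_X2: "smooth_on ?Q X2" unfolding X2_def[abs_def] by (intro smi oQ smK smT smS' UNIV_I)
  have X1m: "X1 y = y $ a * m y" if "y \<in> ?Q" for y
    using S[of y] that \<rho> by (simp add: X1_def m_def algebra_simps)
  define Ka Kb Ta Tb where "Ka = pdiff a K" and "Kb = pdiff b K" and "Ta = pdiff a T" and "Tb = pdiff b T"
  have DH: "(H has_derivative (\<lambda>h. pdiff a H y * h $ a + T y * h $ b)) (at y)"
    and DK: "(K has_derivative (\<lambda>h. Ka y * h $ a + Kb y * h $ b)) (at y)"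
    and DT: "(T has_derivative (\<lambda>h. Ta y * h $ a + Tb y * h $ b)) (at y)" if y: "y \<in> ?Q" for y
    using has_derivative_pdiff2[OF smooth_on_imp_differentiable[OF smH y] ab]
      has_derivative_pdiff2[OF smooth_on_imp_differentiable[OF smK y] ab]
      has_derivative_pdiff2[OF smooth_on_imp_differentiable[OF smT y] ab] off y
    by (simp_all add: T_def Ka_def Kb_def Ta_def Tb_def)
  define X1a where "X1a y = K y * cos (y $ a * y $ b) + y $ a * Ka y * cos (y $ a * y $ b)
     - y $ a * K y * sin (y $ a * y $ b) * y $ b - Ta y * sin (y $ a * y $ b) - T y * cos (y $ a * y $ b) * y $ b" for y
  define X1b where "X1b y = y $ a * Kb y * cos (y $ a * y $ b)
     - y $ a * K y * sin (y $ a * y $ b) * y $ a - Tb y * sin (y $ a * y $ b) - T y * cos (y $ a * y $ b) * y $ a" for y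
  define X2a where "X2a y = K y * sin (y $ a * y $ b) + y $ a * Ka y * sin (y $ a * y $ b)
     + y $ a * K y * cos (y $ a * y $ b) * y $ b + Ta y * cos (y $ a * y $ b) - T y * sin (y $ a * y $ b) * y $ b" for y
  define X2b where "X2b y = y $ a * Kb y * sin (y $ a * y $ b)
     + y $ a * K y * cos (y $ a * y $ b) * y $ a + Tb y * cos (y $ a * y $ b) - T y * sin (y $ a * y $ b) * y $ a" for y
  have nth: "((\<lambda>y :: real^'n. y $ i) has_derivative (\<lambda>h. h $ i)) (at y)" for i y
    by (rule bounded_linear_imp_has_derivative[OF bounded_linear_vec_nth])
  have DX1: "(X1 has_derivative (\<lambda>h. X1a y * h $ a + X1b y * h $ b)) (at y)" if y: "y \<in> ?Q" for y
    unfolding X1_def[abs_def] X1a_def X1b_def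
    by (auto intro!: derivative_eq_intros nth DK[OF y] DT[OF y] ext simp: algebra_simps)
  have DX2: "(X2 has_derivative (\<lambda>h. X2a y * h $ a + X2b y * h $ b)) (at y)" if y: "y \<in> ?Q" for y
    unfolding X2_def[abs_def] X2a_def X2b_def
    by (auto intro!: derivative_eq_intros nth DK[OF y] DT[OF y] ext simp: algebra_simps)
  have "K 0 = p / 2 * (1 - 2 / p)" using K_eq[of 0] \<rho> H0 by (simp add: right_diff_distrib)
  also have "\<dots> = (p - 2) / 2" using p by (simp add: field_simps)
  finally have K0: "K 0 = (p - 2) / 2" .
  have Tb0: "Tb 0 = K 0 / (2 * c)" using PDE[of 0] \<rho> c by (simp add: Tb_def T_def c_def)
  have T0: "T 0 = 0" "Ta 0 = 0" using Hb0 Hab0 by (simp_all add: T_def Ta_def)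
  \<comment> \<open>At the origin m = (p - 2)/2 and K - H = p/2. Positivity of both near the origin
    yields \<open>mm > 0\<close> and \<open>g > 0\<close>.\<close>
  define U where "U = ?Q \<inter> ?Q \<inter> {y \<in> ?Q. m y > 0} \<inter> {y \<in> ?Q. K y - H y > 0}"
  have opn: "open {y \<in> ?Q. f y > 0}" if "smooth_on ?Q f" for f
    using continuous_open_preimage[OF smooth_on_continuous[OF that] oQ, of "{0<..}"]
    by (simp add: vimage_def Int_def conj_commute)
  have oU: "open U" unfolding U_def by (intro open_Int opn oQ sm_m smooth_on_diff smK smH)
  have UQ: "U \<subseteq> ?Q" unfolding U_def by auto
  have "0 \<in> U" using \<rho> p by (auto simp: U_def m_def K0 T0 H0)
  \<comment> \<open>The position map in the coordinates a and b and the identity in all others, so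
    that the inverse function theorem applies in the full dimension.\<close>
  define \<Psi> where "\<Psi> k = (if k = a then X1 else if k = b then X2 else (\<lambda>y. y $ k))" for k
  have sm\<Psi>: "smooth_on U (\<Psi> k)" for k
    unfolding \<Psi>_def using smooth_on_subset[OF sm_X1 UQ] smooth_on_subset[OF sm_X2 UQ] oU by auto
  have \<Psi>0: "(\<chi> k. \<Psi> k 0) = 0" by (simp add: \<Psi>_def vec_eq_iff X1_def X2_def T0)
  have Q0: "0 \<in> ?Q" using \<rho> by simp
  have J: "jacobian \<Psi> 0 $ k $ i = (if k = i then (if k = a then K 0 else if k = b then Tb 0 else 1) else 0)" for k i
    using ab unfolding jacobian_def \<Psi>_def
    by (auto simp: pdiff_eq[OF DX1[OF Q0]] pdiff_eq[OF DX2[OF Q0]] pdiff_nth axis_def X1a_def X1b_def X2a_def X2b_def T0)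
  have "det (jacobian \<Psi> 0) = (\<Prod>i\<in>UNIV. jacobian \<Psi> 0 $ i $ i)"
    by (rule det_diagonal) (simp add: J)
  also have "\<dots> \<noteq> 0" using p c by (auto simp: J K0 Tb0)
  finally have det: "det (jacobian \<Psi> 0) \<noteq> 0" .
  obtain W V g0 where W: "open W" "0 \<in> W" "W \<subseteq> U" "open V" "(\<chi> k. \<Psi> k 0) \<in> V"
    and g0: "\<And>y. y \<in> V \<Longrightarrow> g0 y \<in> W" "\<And>y k. y \<in> V \<Longrightarrow> \<Psi> k (g0 y) = y $ k" "\<And>k. smooth_on V (\<lambda>y. g0 y $ k)"
    by (rule smooth_inverse_function[OF oU sm\<Psi> \<open>0 \<in> U\<close> det]) (rule that)
  obtain \<delta> where \<delta>: "\<delta> > 0" "ball 0 \<delta> \<subseteq> V" using W(4,5) unfolding \<Psi>0 open_contains_ball by blast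
  \<comment> \<open>The inverse is available on \<open>ball 0 \<delta>\<close> only. Passing from v
    (x) to L v (x / L) preserves the gradient values and the equation, and stretches this ball to
    radius 4.\<close>
  define L where "L = 4 / \<delta>"
  have L: "L > 0" using \<delta> by (simp add: L_def)
  define Y where "Y x = g0 (\<chi> k. x $ k * inverse L)" for x
  let ?O = "ball 0 4 :: (real ^ 'n) set"
  have mapsV: "(\<chi> k. x $ k * inverse L) \<in> V" if "x \<in> ?O" for x
  proof -
    have "(\<chi> k. x $ k * inverse L) = inverse L *\<^sub>R x" by (simp add: vec_eq_iff)
    moreover have "norm (inverse L *\<^sub>R x) < \<delta>" using that \<delta> by (simp add: L_def field_simps)
    ultimately show ?thesis using \<delta>(2) by auto
  qed
  have smY: "smooth_on ?O (\<lambda>x. Y x $ k)" for k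
    unfolding Y_def by (rule smooth_on_compose[OF _ g0(3)]) (auto intro!: smooth_on_mult mapsV simp: mapsV)
  have YW: "Y x \<in> W" if "x \<in> ?O" for x unfolding Y_def by (rule g0(1)[OF mapsV[OF that]])
  then have YU: "Y x \<in> U" and YQ: "Y x \<in> ?Q" if "x \<in> ?O" for x using that W(3) UQ by blast+
  have X1Y: "L * X1 (Y x) = x $ a" and X2Y: "L * X2 (Y x) = x $ b" if "x \<in> ?O" for x
    using g0(2)[OF mapsV[OF that], of a] g0(2)[OF mapsV[OF that], of b] ab L
    by (auto simp: Y_def \<Psi>_def field_simps)
  have Yv: "(\<chi> k. Y x $ k) = Y x" for x by (simp add: vec_eq_iff)
  have smF: "smooth_on ?O (\<lambda>x. F (Y x))" if "smooth_on ?Q F" for F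
    using smooth_on_compose[OF open_ball that, of 0 4 "\<lambda>k x. Y x $ k"] smY YQ by (simp add: Yv)
  define Y' where "Y' x h = (\<chi> k. \<Sum>i\<in>UNIV. pdiff i (\<lambda>x. Y x $ k) x * h $ i)" for x h
  have DY: "(Y has_derivative Y' x) (at x)" if "x \<in> ?O" for x
    using has_derivative_vec_lambda_pdiff[of "\<lambda>k x. Y x $ k" x] smooth_on_imp_differentiable[OF smY that]
    unfolding Y'_def by (simp add: Yv)
  have DYk: "((\<lambda>x. Y x $ k) has_derivative (\<lambda>h. Y' x h $ k)) (at x)" if "x \<in> ?O" for x k
    using has_derivative_compose[OF DY[OF that] nth] .
  have N1: "L * (X1a (Y x) * Y' x h $ a + X1b (Y x) * Y' x h $ b) = h $ a"
    and N2: "L * (X2a (Y x) * Y' x h $ a + X2b (Y x) * Y' x h $ b) = h $ b" if x: "x \<in> ?O" for x h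
  proof -
    have A1: "((\<lambda>x. L * X1 (Y x)) has_derivative (\<lambda>h. L * (X1a (Y x) * Y' x h $ a + X1b (Y x) * Y' x h $ b))) (at x)"
      by (intro has_derivative_mult_right has_derivative_compose[OF DY[OF x] DX1[OF YQ[OF x]]])
    have B1: "((\<lambda>x. L * X1 (Y x)) has_derivative (\<lambda>h. h $ a)) (at x)"
      by (subst has_derivative_cong_open[OF open_ball x, of _ "\<lambda>x. x $ a"]) (simp_all add: X1Y nth)
    show "L * (X1a (Y x) * Y' x h $ a + X1b (Y x) * Y' x h $ b) = h $ a"
      using fun_cong[OF has_derivative_unique[OF A1 B1], of h] .
    have A2: "((\<lambda>x. L * X2 (Y x)) has_derivative (\<lambda>h. L * (X2a (Y x) * Y' x h $ a + X2b (Y x) * Y' x h $ b))) (at x)"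
      by (intro has_derivative_mult_right has_derivative_compose[OF DY[OF x] DX2[OF YQ[OF x]]])
    have B2: "((\<lambda>x. L * X2 (Y x)) has_derivative (\<lambda>h. h $ b)) (at x)"
      by (subst has_derivative_cong_open[OF open_ball x, of _ "\<lambda>x. x $ b"]) (simp_all add: X2Y nth)
    show "L * (X2a (Y x) * Y' x h $ a + X2b (Y x) * Y' x h $ b) = h $ b"
      using fun_cong[OF has_derivative_unique[OF A2 B2], of h] .
  qed
  define mm where "mm x = L * m (Y x)" for x
  define eps where "eps x = Y x $ a" for x
  define om where "om x = Y x $ a * Y x $ b" for x
  \<comment> \<open>Legendre duality: v = x . Dv minus the transform, which is L * zeta (eps) * (K -
    H). Dividing by zeta (x_a) = zeta (eps) * mm powr d leaves g.\<close>
  define g where "g x = L * (mm x powr (- d) * (K (Y x) - H (Y x)))" for x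
  have mm: "x $ a = eps x * mm x" "mm x > 0" if "x \<in> ?O" for x
    using X1Y[OF that] X1m[OF YQ[OF that]] YU[OF that] L unfolding U_def by (auto simp: eps_def mm_def mult.left_commute)
  show thesis
  proof (rule that)
    show "smooth_on ?O eps" "smooth_on ?O om" unfolding eps_def[abs_def] om_def[abs_def]
      by (intro smooth_on_mult smY open_ball)+
    show smmm: "smooth_on ?O mm" unfolding mm_def[abs_def] by (intro smooth_on_mult smooth_on_const smF sm_m open_ball)
    show "smooth_on ?O g" unfolding g_def[abs_def]
      by (intro smooth_on_mult smooth_on_const smooth_on_diff smF smK smH open_ball
          smooth_on_compose1[OF _ smooth1_powr smmm]) (use mm in auto)
    show "x $ a = eps x * mm x \<and> mm x > 0 \<and> g x > 0" if "x \<in> ?O" for x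
      using mm[OF that] YU[OF that] L by (auto simp: g_def U_def)
  next
    fix x assume x: "x \<in> ?O" and xa: "x $ a \<noteq> 0"
    let ?y = "Y x"
    have e0: "?y $ a \<noteq> 0" using mm[OF x] xa by (auto simp: eps_def)
    have veq: "zeta p (x $ a) * g x = L * (zeta p (Y x $ a) * (K (Y x) - H (Y x)))" if "x \<in> ?O" for x
    proof -
      have "mm x powr (1 - 2 / p) * mm x powr (- d) = 1"
        using mm(2)[OF that] by (simp add: powr_add[symmetric] d_def)
      then have z: "zeta p (x $ a) * mm x powr (- d) = zeta p (Y x $ a)"
        using zeta_mult[OF mm(2)[OF that], of p "eps x"] mm(1)[OF that] by (simp add: eps_def mult.assoc)
      have "zeta p (x $ a) * g x = L * ((zeta p (x $ a) * mm x powr (- d)) * (K (Y x) - H (Y x)))"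
        unfolding g_def by (simp only: mult_ac)
      then show ?thesis unfolding z .
    qed
    let ?R = "\<bar>?y $ a\<bar> powr (- 2 / p)"
    have "((\<lambda>x. L * (zeta p (Y x $ a) * (K (Y x) - H (Y x)))) has_derivative
       (\<lambda>h. L * (zeta p (?y $ a) * ((Ka ?y * Y' x h $ a + Kb ?y * Y' x h $ b) - (pdiff a H ?y * Y' x h $ a + T ?y * Y' x h $ b))
         + (d * ?R * Y' x h $ a) * (K ?y - H ?y)))) (at x)"
    proof (intro has_derivative_mult_right has_derivative_mult has_derivative_diff)
      show "((\<lambda>x. zeta p (Y x $ a)) has_derivative (\<lambda>h. d * ?R * Y' x h $ a)) (at x)"
        using has_derivative_compose[OF DYk[OF x, of a] zeta_deriv[OF e0, of p, unfolded has_field_derivative_def]]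
        by (simp add: d_def)
      show "((\<lambda>x. K (Y x)) has_derivative (\<lambda>h. Ka ?y * Y' x h $ a + Kb ?y * Y' x h $ b)) (at x)"
        by (rule has_derivative_compose[OF DY[OF x] DK[OF YQ[OF x]]])
      show "((\<lambda>x. H (Y x)) has_derivative (\<lambda>h. pdiff a H ?y * Y' x h $ a + T ?y * Y' x h $ b)) (at x)"
        by (rule has_derivative_compose[OF DY[OF x] DH[OF YQ[OF x]]])
    qed
    moreover have "L * (zeta p (?y $ a) * ((Ka ?y * Y' x h $ a + Kb ?y * Y' x h $ b) - (pdiff a H ?y * Y' x h $ a + T ?y * Y' x h $ b))
         + (d * ?R * Y' x h $ a) * (K ?y - H ?y)) =
        \<bar>eps x\<bar> powr (- 2 / p) * (cos (om x) * h $ a + sin (om x) * h $ b)" for h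
    proof -
      let ?ya = "?y $ a" let ?yb = "?y $ b"
      let ?C = "cos (?ya * ?yb)" let ?S = "sin (?ya * ?yb)"
      have CS: "?C * ?C + ?S * ?S = 1" by (rule sin_cos_squared_add3)
      have P: "p * ((1 - d) / 2) = 1" using p by (simp add: d(2))
      \<comment> \<open>The definition of K, solved for the combination that the derivative of K - H
        produces. Because of it the derivatives of K cancel against those of the position, as they
        must for a Legendre transform.\<close>
      have Kd: "K ?y - T ?y * ?yb = d * (K ?y - H ?y) - ?ya * pdiff a H ?y"
      proof -
        have "(1 - d) * K ?y = - (p * ((1 - d) / 2)) * (d * H ?y + ?ya * pdiff a H ?y - ?yb * T ?y)"
          using K_eq[of ?y] YQ[OF x] by (simp add: T_def d_def)
        then show ?thesis unfolding P by (simp add: algebra_simps)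
      qed
      have "?C * X1a ?y + ?S * X2a ?y = (?C * ?C + ?S * ?S) * (K ?y + ?ya * Ka ?y - T ?y * ?yb)"
        unfolding X1a_def X2a_def by (simp add: algebra_simps del: sin_cos_squared_add3)
      then have 1: "?C * X1a ?y + ?S * X2a ?y = K ?y + ?ya * Ka ?y - T ?y * ?yb" unfolding CS by simp
      have "?C * X1b ?y + ?S * X2b ?y = (?C * ?C + ?S * ?S) * (?ya * Kb ?y - T ?y * ?ya)"
        unfolding X1b_def X2b_def by (simp add: algebra_simps del: sin_cos_squared_add3)
      then have 2: "?C * X1b ?y + ?S * X2b ?y = ?ya * Kb ?y - T ?y * ?ya" unfolding CS by simp
      have "?C * h $ a + ?S * h $ b = L * ((?C * X1a ?y + ?S * X2a ?y) * Y' x h $ a + (?C * X1b ?y + ?S * X2b ?y) * Y' x h $ b)"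
        unfolding N1[OF x, of h, symmetric] N2[OF x, of h, symmetric] by (simp add: algebra_simps)
      then have E: "?C * h $ a + ?S * h $ b = L * ((d * (K ?y - H ?y) - ?ya * pdiff a H ?y + ?ya * Ka ?y) * Y' x h $ a + (?ya * Kb ?y - T ?y * ?ya) * Y' x h $ b)"
        unfolding 1 2 Kd[symmetric] by (simp add: algebra_simps)
      have "L * (zeta p (?y $ a) * ((Ka ?y * Y' x h $ a + Kb ?y * Y' x h $ b) - (pdiff a H ?y * Y' x h $ a + T ?y * Y' x h $ b))
          + (d * ?R * Y' x h $ a) * (K ?y - H ?y)) =
        ?R * (L * ((d * (K ?y - H ?y) - ?ya * pdiff a H ?y + ?ya * Ka ?y) * Y' x h $ a + (?ya * Kb ?y - T ?y * ?ya) * Y' x h $ b))"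
        unfolding zeta_def by (simp add: algebra_simps)
      then show ?thesis unfolding E[symmetric] eps_def om_def .
    qed
    ultimately have "((\<lambda>x. L * (zeta p (Y x $ a) * (K (Y x) - H (Y x)))) has_derivative
       (\<lambda>h. \<bar>eps x\<bar> powr (- 2 / p) * (cos (om x) * h $ a + sin (om x) * h $ b))) (at x)" by simp
    then show "((\<lambda>x. zeta p (x $ a) * g x) has_derivative
       (\<lambda>h. \<bar>eps x\<bar> powr (- 2 / p) * (cos (om x) * h $ a + sin (om x) * h $ b))) (at x)"
      by (subst has_derivative_cong_open[OF open_ball x, of _ "\<lambda>x. L * (zeta p (Y x $ a) * (K (Y x) - H (Y x)))"]) (simp_all add: veq)
  next
    fix x assume x: "x \<in> ?O"
    let ?y = "Y x" let ?ya = "?y $ a" let ?yb = "?y $ b"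
    let ?C = "cos (?ya * ?yb)" let ?S = "sin (?ya * ?yb)"
    have CS: "?C * ?C + ?S * ?S = 1" by (rule sin_cos_squared_add3)
    define q where "q = 1 + ?ya * ?ya"
    have q: "q > 0" unfolding q_def by (simp add: add_pos_nonneg)
    define r where "r = q powr (- c)"
    define r' where "r' = - (2 * c * ?ya * r) / q"
    have De: "(eps has_derivative (\<lambda>h. Y' x h $ a)) (at x)" unfolding eps_def[abs_def] by (rule DYk[OF x])
    have Do: "(om has_derivative (\<lambda>h. ?ya * Y' x h $ b + Y' x h $ a * ?yb)) (at x)"
      unfolding om_def[abs_def] by (intro has_derivative_mult DYk[OF x])
    have Dr: "((\<lambda>x. (1 + (eps x)\<^sup>2) powr (1 / p - 1)) has_derivative (\<lambda>h. Y' x h $ a * r')) (at x)"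
    proof -
      have "((\<lambda>t. (1 + t\<^sup>2) powr (- c)) has_real_derivative r') (at (eps x))"
        using q by (auto intro!: derivative_eq_intros simp: r'_def r_def q_def eps_def power2_eq_square powr_diff)
      then show ?thesis
        using has_derivative_compose[OF De, of "\<lambda>t. (1 + t\<^sup>2) powr (- c)"]
        by (simp add: has_field_derivative_def c_def mult.commute)
    qed
    have r: "(1 + (eps x)\<^sup>2) powr (1 / p - 1) = r" by (simp add: r_def q_def c_def eps_def power2_eq_square)
    have D1: "((\<lambda>x. (1 + (eps x)\<^sup>2) powr (1 / p - 1) * cos (om x)) has_derivative
        (\<lambda>h. r * (- ?S * (?ya * Y' x h $ b + Y' x h $ a * ?yb)) + Y' x h $ a * r' * ?C)) (at x)"
      using has_derivative_mult[OF Dr has_derivative_compose[OF Do DERIV_cos[unfolded has_field_derivative_def]]]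
      unfolding r by (simp add: om_def)
    have D2: "((\<lambda>x. (1 + (eps x)\<^sup>2) powr (1 / p - 1) * sin (om x)) has_derivative
        (\<lambda>h. r * (?C * (?ya * Y' x h $ b + Y' x h $ a * ?yb)) + Y' x h $ a * r' * ?S)) (at x)"
      using has_derivative_mult[OF Dr has_derivative_compose[OF Do DERIV_sin[unfolded has_field_derivative_def]]]
      unfolding r by (simp add: om_def)
    \<comment> \<open>The coefficients are the eps- and u-derivatives of the two components of the
      field. Rotating by omega combines the entries of the Jacobian into the identities 1, 2, 3, and
      what remains is a multiple of the linear equation for H and K.\<close>
    have "(r' * ?C - r * ?S * ?yb) * X2b ?y - (- (r * ?S * ?ya)) * X2a ?y
        - (r' * ?S + r * ?C * ?yb) * X1b ?y + (r * ?C * ?ya) * X1a ?y = 0"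
    proof -
      have "?C * X2b ?y - ?S * X1b ?y = (?C * ?C + ?S * ?S) * (?ya * ?ya * K ?y + Tb ?y)"
        unfolding X1b_def X2b_def by (simp add: algebra_simps del: sin_cos_squared_add3)
      then have 1: "?C * X2b ?y - ?S * X1b ?y = ?ya * ?ya * K ?y + Tb ?y" unfolding CS by simp
      have "?S * X2b ?y + ?C * X1b ?y = (?C * ?C + ?S * ?S) * (?ya * (Kb ?y - T ?y))"
        unfolding X1b_def X2b_def by (simp add: algebra_simps del: sin_cos_squared_add3)
      then have 2: "?S * X2b ?y + ?C * X1b ?y = ?ya * (Kb ?y - T ?y)" unfolding CS by simp
      have "?S * X2a ?y + ?C * X1a ?y = (?C * ?C + ?S * ?S) * (K ?y + ?ya * Ka ?y - ?yb * T ?y)"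
        unfolding X1a_def X2a_def by (simp add: algebra_simps del: sin_cos_squared_add3)
      then have 3: "?S * X2a ?y + ?C * X1a ?y = K ?y + ?ya * Ka ?y - ?yb * T ?y" unfolding CS by simp
      have pde: "q * (K ?y + ?ya * Ka ?y - ?yb * Kb ?y) = 2 * c * (Tb ?y + ?ya * ?ya * K ?y)"
        using PDE[of ?y] YQ[OF x] by (simp add: q_def Ka_def Kb_def Tb_def T_def c_def power2_eq_square algebra_simps)
      have "(r' * ?C - r * ?S * ?yb) * X2b ?y - (- (r * ?S * ?ya)) * X2a ?y
        - (r' * ?S + r * ?C * ?yb) * X1b ?y + (r * ?C * ?ya) * X1a ?y
        = r' * (?C * X2b ?y - ?S * X1b ?y) - r * ?yb * (?S * X2b ?y + ?C * X1b ?y) + r * ?ya * (?S * X2a ?y + ?C * X1a ?y)"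
        by (simp add: algebra_simps)
      also have "\<dots> = r' * (?ya * ?ya * K ?y + Tb ?y) + r * ?ya * (K ?y + ?ya * Ka ?y - ?yb * Kb ?y)"
        unfolding 1 2 3 by (simp add: algebra_simps)
      also have "q * \<dots> = (q * r') * (?ya * ?ya * K ?y + Tb ?y) + r * ?ya * (q * (K ?y + ?ya * Ka ?y - ?yb * Kb ?y))"
        by (simp add: algebra_simps)
      also have "\<dots> = 0"
      proof -
        have "q * r' = - (2 * c * ?ya * r)" using q by (simp add: r'_def)
        then show ?thesis unfolding pde by (simp add: algebra_simps)
      qed
      finally show ?thesis using q by simp
    qed
    from divergence_from_inverse[OF _ _ _ _ this, of L "Y' x (axis a 1) $ a" "Y' x (axis a 1) $ b" "Y' x (axis b 1) $ a" "Y' x (axis b 1) $ b"]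
    have "(r' * ?C - r * ?S * ?yb) * Y' x (axis a 1) $ a + - (r * ?S * ?ya) * Y' x (axis a 1) $ b
        + (r' * ?S + r * ?C * ?yb) * Y' x (axis b 1) $ a + (r * ?C * ?ya) * Y' x (axis b 1) $ b = 0"
      using N1[OF x, of "axis a 1"] N1[OF x, of "axis b 1"] N2[OF x, of "axis a 1"] N2[OF x, of "axis b 1"] ab
      by (simp add: axis_def)
    then show "pdiff a (\<lambda>x. (1 + (eps x)\<^sup>2) powr (1 / p - 1) * cos (om x)) x
        + pdiff b (\<lambda>x. (1 + (eps x)\<^sup>2) powr (1 / p - 1) * sin (om x)) x = 0"
      unfolding pdiff_eq[OF D1] pdiff_eq[OF D2] by (simp add: algebra_simps)
  qed
qed

section \<open>Integration along lines\<close>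

lemma nn_integral_translate:
  fixes f :: "'a::euclidean_space \<Rightarrow> ennreal"
  assumes [measurable]: "f \<in> borel_measurable borel"
  shows "(\<integral>\<^sup>+x. f (x + c) \<partial>lborel) = (\<integral>\<^sup>+x. f x \<partial>lborel)"
proof -
  have "(\<integral>\<^sup>+x. f x \<partial>lborel) = (\<integral>\<^sup>+x. f x \<partial>distr lborel borel ((+) c))"
    by (simp add: lborel_distr_plus)
  also have "\<dots> = (\<integral>\<^sup>+x. f (c + x) \<partial>lborel)" by (rule nn_integral_distr) auto
  finally show ?thesis by (simp add: add.commute)
qed

lemma integral_translate:
  fixes f :: "'a::euclidean_space \<Rightarrow> real"
  assumes [measurable]: "f \<in> borel_measurable borel"
  shows "(LINT x|lborel. f (x + c)) = (LINT x|lborel. f x)"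
proof -
  have "(LINT x|lborel. f x) = (LINT x|distr lborel borel ((+) c). f x)"
    by (simp add: lborel_distr_plus)
  also have "\<dots> = (LINT x|lborel. f (c + x))" by (rule integral_distr) auto
  finally show ?thesis by (simp add: add.commute)
qed

lemma integrable_translate:
  fixes f :: "'a::euclidean_space \<Rightarrow> real"
  assumes "integrable lborel f" shows "integrable lborel (\<lambda>x. f (x + c))"
proof -
  have "integrable (distr lborel borel ((+) c)) f" using assms by (simp add: lborel_distr_plus)
  then have "integrable lborel (\<lambda>x. f (c + x))" by (rule integrable_distr[rotated]) simp
  then show ?thesis by (simp add: add.commute)
qed

text \<open>Translation invariance replaces Fubini's theorem in Cartesian coordinates: averaging over the
  translates along \<open>e\<close> turns integrals over space into integrals along lines.\<close>

lemma nn_integral_lines: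
  fixes f :: "'a::euclidean_space \<Rightarrow> ennreal"
  assumes [measurable]: "f \<in> borel_measurable borel" "T \<in> sets borel"
  shows "(\<integral>\<^sup>+x. (\<integral>\<^sup>+t. f (x + t *\<^sub>R e) * indicator T t \<partial>lborel) \<partial>lborel) = emeasure lborel T * (\<integral>\<^sup>+x. f x \<partial>lborel)"
proof -
  have "(\<integral>\<^sup>+x. (\<integral>\<^sup>+t. f (x + t *\<^sub>R e) * indicator T t \<partial>lborel) \<partial>lborel)
      = (\<integral>\<^sup>+t. (\<integral>\<^sup>+x. f (x + t *\<^sub>R e) * indicator T t \<partial>lborel) \<partial>lborel)"
    by (rule lborel_pair.Fubini'[symmetric]) simp
  also have "\<dots> = (\<integral>\<^sup>+t. (\<integral>\<^sup>+x. f x \<partial>lborel) * indicator T t \<partial>lborel)"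
    by (intro nn_integral_cong) (simp add: nn_integral_multc nn_integral_translate)
  also have "\<dots> = emeasure lborel T * (\<integral>\<^sup>+x. f x \<partial>lborel)"
    by (simp add: nn_integral_cmult mult.commute[of "indicator T _"] mult.commute[of "emeasure _ _"])
  finally show ?thesis .
qed

text \<open>Serves for the hyperplane, which a transversal line meets once, and for zeros with
  nonvanishing derivative, which are isolated on each line.\<close>

lemma null_set_lines:
  fixes N :: "'a::euclidean_space set"
  assumes [measurable]: "N \<in> sets borel" and "\<And>x. countable {t. x + t *\<^sub>R e \<in> N}"
  shows "N \<in> null_sets lborel"
proof -
  have "(\<integral>\<^sup>+t. indicator N (x + t *\<^sub>R e) * indicator {0..1} t \<partial>lborel) = 0" for x
  proof -
    have "{t. x + t *\<^sub>R e \<in> N} \<in> null_sets lborel" by (rule countable_imp_null_set_lborel[OF assms(2)])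
    then have "AE t in lborel. x + t *\<^sub>R e \<notin> N" using AE_not_in by fastforce
    then have "AE t in lborel. indicator N (x + t *\<^sub>R e) * indicator {0..1} t = (0 :: ennreal)"
      by eventually_elim simp
    then show ?thesis by (subst nn_integral_0_iff_AE) auto
  qed
  then have "emeasure lborel {0..1 :: real} * (\<integral>\<^sup>+x. indicator N x \<partial>lborel) = 0"
    using nn_integral_lines[of "indicator N" "{0..1}" e] by simp
  then show ?thesis by (simp add: null_sets_def)
qed

text \<open>The integral of G is its average over the translates by t * e with t in {0..1}. By
  Fubini it equals the integral of F (x + e) - F (x), which is 0 by translation invariance. The
  fundamental theorem on almost every line suffices, so a singular hyperplane is admissible.\<close>

lemma integral_derivative_eq_0:
  fixes F G :: "'a::euclidean_space \<Rightarrow> real"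
  assumes F: "integrable lborel F" and G: "integrable lborel G"
    and FTC: "AE x in lborel. ((\<lambda>t. G (x + t *\<^sub>R e)) has_integral F (x + e) - F x) {0..1}"
  shows "(LINT x|lborel. G x) = 0"
proof -
  have [measurable]: "F \<in> borel_measurable borel" "G \<in> borel_measurable borel" using F G by auto
  let ?h = "\<lambda>x t. G (x + t *\<^sub>R e) * indicator {0..1} t"
  have int: "integrable (lborel \<Otimes>\<^sub>M lborel) (case_prod ?h)"
  proof (rule integrableI_bounded)
    have "(\<integral>\<^sup>+z. ennreal (norm (case_prod ?h z)) \<partial>(lborel \<Otimes>\<^sub>M lborel))
        = (\<integral>\<^sup>+x. (\<integral>\<^sup>+t. ennreal (norm (G (x + t *\<^sub>R e))) * indicator {0..1} t \<partial>lborel) \<partial>lborel)"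
      by (subst lborel.nn_integral_fst[symmetric])
        (auto intro!: nn_integral_cong simp: abs_mult ennreal_mult split: split_indicator)
    also have "\<dots> = emeasure lborel {0..1 :: real} * (\<integral>\<^sup>+x. ennreal (norm (G x)) \<partial>lborel)"
      by (rule nn_integral_lines) simp_all
    also have "\<dots> < \<infinity>" using G by (simp add: integrable_iff_bounded)
    finally show "(\<integral>\<^sup>+z. ennreal (norm (case_prod ?h z)) \<partial>(lborel \<Otimes>\<^sub>M lborel)) < \<infinity>" .
  qed simp
  have "(LINT x|lborel. G x) = (LINT t|lborel. (LINT x|lborel. ?h x t))"
  proof -
    have "(\<lambda>t. LINT x|lborel. ?h x t) = (\<lambda>t. (LINT x|lborel. G x) * indicator {0..1} t)"
      by (rule ext) (simp add: integral_translate)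
    then show ?thesis by simp
  qed
  also have "\<dots> = (LINT x|lborel. (LINT t|lborel. ?h x t))" by (rule lborel_pair.Fubini_integral[OF int])
  also have "\<dots> = (LINT x|lborel. F (x + e) - F x)"
  proof (rule integral_cong_AE)
    show "(\<lambda>x. LINT t|lborel. ?h x t) \<in> borel_measurable lborel" by measurable
    show "AE x in lborel. (LINT t|lborel. ?h x t) = F (x + e) - F x"
      using lborel_pair.AE_integrable_fst[OF int] FTC
    proof eventually_elim
      case (elim x)
      have si: "set_integrable lborel {0..1} (\<lambda>t. G (x + t *\<^sub>R e))"
        using elim(1) by (simp add: set_integrable_def mult.commute)
      have "(LINT t:{0..1}|lborel. G (x + t *\<^sub>R e)) = F (x + e) - F x"
        using set_borel_integral_eq_integral(2)[OF si] integral_unique[OF elim(2)] by simp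
      then show ?case by (simp add: set_lebesgue_integral_def mult.commute)
    qed
  qed simp
  also have "\<dots> = 0"
    using Bochner_Integration.integral_diff[OF integrable_translate[OF F] F, of e] integral_translate[of F e]
    by simp
  finally show ?thesis .
qed

section \<open>Test functions, integration by parts and Poincare inequality\<close>

lemma test_functionsD:
  assumes "\<phi> \<in> test_functions \<Omega>"
  shows "smooth_on UNIV \<phi>" "continuous_on UNIV \<phi>" "continuous_on UNIV (pdiff i \<phi>)"
    "\<phi> differentiable (at x)"
    "compact (closure {x. \<phi> x \<noteq> 0})" "closure {x. \<phi> x \<noteq> 0} \<subseteq> \<Omega>"
    "x \<notin> closure {x. \<phi> x \<noteq> 0} \<Longrightarrow> \<phi> x = 0" "x \<notin> closure {x. \<phi> x \<noteq> 0} \<Longrightarrow> pdiff i \<phi> x = 0"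
proof -
  show sm: "smooth_on UNIV \<phi>" and "compact (closure {x. \<phi> x \<noteq> 0})" "closure {x. \<phi> x \<noteq> 0} \<subseteq> \<Omega>"
    using assms unfolding test_functions_def by auto
  show "continuous_on UNIV \<phi>" "continuous_on UNIV (pdiff i \<phi>)" "\<phi> differentiable (at x)"
    using smooth_on_continuous[OF sm] smooth_on_continuous[OF smooth_on_pdiff[OF sm]]
      smooth_on_imp_differentiable[OF sm] by auto
  show z: "\<phi> x = 0" if "x \<notin> closure {x. \<phi> x \<noteq> 0}" for x
    using that closure_subset[of "{x. \<phi> x \<noteq> 0}"] by auto
  show "pdiff i \<phi> x = 0" if "x \<notin> closure {x. \<phi> x \<noteq> 0}"
  proof -
    have "pdiff i \<phi> x = pdiff i (\<lambda>x. 0) x"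
      by (rule pdiff_cong_open[of "- closure {x. \<phi> x \<noteq> 0}"]) (rule open_Compl[OF closed_closure], use that in blast, rule z, erule ComplD)
    then show ?thesis by (simp only: pdiff_const)
  qed
qed

lemma compact_support_continuous_integrable:
  fixes f :: "'a::euclidean_space \<Rightarrow> real"
  assumes "continuous_on UNIV f" "compact K" "\<And>x. x \<notin> K \<Longrightarrow> f x = 0"
  shows "integrable lborel f"
proof -
  have "integrable lborel (\<lambda>x. indicator K x *\<^sub>R f x)"
    by (rule borel_integrable_compact[OF assms(2) continuous_on_subset[OF assms(1)]]) simp
  moreover have "(\<lambda>x. indicator K x *\<^sub>R f x) = f"
    using assms(3) by (auto simp: fun_eq_iff split: split_indicator)
  ultimately show ?thesis by simp
qed

lemma continuous_on_extend_0:
  assumes "open \<Omega>" "continuous_on \<Omega> f" "closed K" "K \<subseteq> \<Omega>" "\<And>x. x \<notin> K \<Longrightarrow> f x = 0"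
  shows "continuous_on UNIV f"
proof -
  have "continuous_on (- K) f"
    by (rule continuous_on_cong[THEN iffD1, OF refl _ continuous_on_const[of _ 0]]) (use assms(5) in simp)
  then have "continuous_on (\<Omega> \<union> - K) f"
    using assms by (intro continuous_on_open_Un) auto
  moreover have "\<Omega> \<union> - K = UNIV" using assms(4) by auto
  ultimately show ?thesis by simp
qed

lemma hyperplane_null: "{x :: real ^ 'n::finite. x $ a = 0} \<in> null_sets lborel"
proof (rule null_set_lines[where e = "axis a 1"])
  show "countable {t. x + t *\<^sub>R axis a 1 \<in> {x :: real ^ 'n. x $ a = 0}}" for x :: "real ^ 'n"
  proof (rule countable_subset)
    show "{t. x + t *\<^sub>R axis a 1 \<in> {x :: real ^ 'n. x $ a = 0}} \<subseteq> {- x $ a}" by (auto simp: axis_def)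
  qed simp
  show "{x :: real ^ 'n. x $ a = 0} \<in> sets borel"
    by (intro borel_closed closed_Collect_eq) (auto intro!: continuous_intros)
qed

lemma integrable_lebesgue_on_iff:
  fixes f :: "'a::euclidean_space \<Rightarrow> 'b::{banach, second_countable_topology}"
  assumes "\<Omega> \<in> sets lebesgue"
  shows "integrable (lebesgue_on \<Omega>) f \<longleftrightarrow> integrable lebesgue (\<lambda>x. indicator \<Omega> x *\<^sub>R f x)"
  using assms by (subst integrable_restrict_space) auto

lemma LINT_lebesgue_on:
  fixes f :: "'a::euclidean_space \<Rightarrow> 'b::{banach, second_countable_topology}"
  assumes "\<Omega> \<in> sets lebesgue"
  shows "(LINT x|lebesgue_on \<Omega>. f x) = (LINT x|lebesgue. indicator \<Omega> x *\<^sub>R f x)"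
  using assms by (subst integral_restrict_space) auto

lemma integrable_imp_locally_integrable:
  assumes "open \<Omega>" "integrable (lebesgue_on \<Omega>) f"
  shows "locally_integrable \<Omega> f"
  unfolding locally_integrable_def
proof (intro allI impI)
  fix K assume K: "compact K \<and> K \<subseteq> \<Omega>"
  have m: "K \<in> sets lebesgue" "\<Omega> \<in> sets lebesgue" using K assms(1) lmeasurable_compact by auto
  have "integrable lebesgue (\<lambda>x. indicator K x *\<^sub>R (indicator \<Omega> x *\<^sub>R f x))"
    by (rule integrable_mult_indicator) (use assms m in \<open>auto simp: integrable_lebesgue_on_iff\<close>)
  moreover have "(\<lambda>x. indicator K x *\<^sub>R (indicator \<Omega> x *\<^sub>R f x)) = (\<lambda>x. indicator K x *\<^sub>R f x)"
    using K by (auto simp: fun_eq_iff split: split_indicator)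
  ultimately show "integrable (lebesgue_on K) f" using m by (simp add: integrable_lebesgue_on_iff)
qed

lemma line_has_vector_derivative:
  fixes f :: "real ^ 'n::finite \<Rightarrow> real"
  assumes "(f has_derivative (\<lambda>h. g \<bullet> h)) (at (x + t *\<^sub>R axis i 1))"
  shows "((\<lambda>t. f (x + t *\<^sub>R axis i 1)) has_vector_derivative g $ i) (at t)"
proof -
  have "((\<lambda>t. x + t *\<^sub>R axis i 1) has_derivative (\<lambda>s. s *\<^sub>R axis i 1)) (at t)"
    by (auto intro!: derivative_eq_intros)
  from has_derivative_compose[OF this assms] show ?thesis
    by (simp add: has_vector_derivative_def inner_axis mult.commute)
qed

text \<open>A coordinate line that is not contained in the hyperplane meets it at most once, and u
  is continuous there, so the fundamental theorem holds for u times the test function along almost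
  all lines. G may be unbounded near the hyperplane as long as it is integrable.\<close>

lemma weak_gradientI:
  fixes u :: "real ^ 'n::finite \<Rightarrow> real"
  assumes \<Omega>: "open \<Omega>" and u: "continuous_on \<Omega> u" "integrable (lebesgue_on \<Omega>) u"
    and G: "continuous_on (\<Omega> - {x. x $ a = 0}) G" "integrable (lebesgue_on \<Omega>) G"
    and deriv: "\<And>x. x \<in> \<Omega> \<Longrightarrow> x $ a \<noteq> 0 \<Longrightarrow> (u has_derivative (\<lambda>h. G x \<bullet> h)) (at x)"
  shows "weak_gradient \<Omega> u G"
  unfolding weak_gradient_def
proof (intro conjI ballI allI)
  show "locally_integrable \<Omega> u" "locally_integrable \<Omega> G"
    using integrable_imp_locally_integrable \<Omega> u G by blast+
  fix \<phi> i assume \<phi>: "\<phi> \<in> test_functions \<Omega>"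
  note \<phi>D = test_functionsD[OF \<phi>]
  define K where "K = closure {x. \<phi> x \<noteq> 0}"
  have K: "compact K" "closed K" "K \<subseteq> \<Omega>" using \<phi>D(5,6) by (auto simp: K_def)
  have \<phi>0: "\<phi> x = 0" "pdiff j \<phi> x = 0" if "x \<notin> K" for x j
    using that unfolding K_def by (rule \<phi>D(7), rule \<phi>D(8))
  have m\<Omega>: "\<Omega> \<in> sets lebesgue" "\<Omega> \<in> sets borel" using \<Omega> by auto
  define S where "S = \<Omega> - {x. x $ a = 0}"
  have "closed {x :: real ^ 'n. x $ a = 0}" by (intro closed_Collect_eq) (auto intro!: continuous_intros)
  then have oS: "open S" unfolding S_def using \<Omega> by auto
  then have mS: "S \<in> sets borel" by auto
  define F where "F x = (if x \<in> \<Omega> then u x * \<phi> x else 0)" for x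
  define U where "U x = (if x \<in> \<Omega> then u x * pdiff i \<phi> x else 0)" for x
  \<comment> \<open>Cut off to S, where G is continuous: this gives a Borel function that differs
    from the intended integrand on a null set only.\<close>
  define V where "V x = indicator S x *\<^sub>R (G x $ i * \<phi> x)" for x
  have cont: "continuous_on UNIV F" "continuous_on UNIV U"
  proof -
    note sub = continuous_on_subset[OF _ subset_UNIV]
    have "continuous_on \<Omega> F"
      by (rule continuous_on_eq[OF continuous_on_mult[OF u(1) sub[OF \<phi>D(2)]]]) (simp add: F_def)
    then show "continuous_on UNIV F"
      by (rule continuous_on_extend_0[OF \<Omega> _ K(2,3)]) (simp add: F_def \<phi>0)
    have "continuous_on \<Omega> U"
      by (rule continuous_on_eq[OF continuous_on_mult[OF u(1) sub[OF \<phi>D(3)[of i]]]]) (simp add: U_def)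
    then show "continuous_on UNIV U"
      by (rule continuous_on_extend_0[OF \<Omega> _ K(2,3)]) (simp add: U_def \<phi>0)
  qed
  have F0: "F x = 0" and U0: "U x = 0" if "x \<notin> K" for x
    unfolding F_def U_def \<phi>0[OF that] by simp_all
  have intF: "integrable lborel F" "integrable lborel U"
    by (rule compact_support_continuous_integrable[OF cont(1) K(1)], erule F0)
      (rule compact_support_continuous_integrable[OF cont(2) K(1)], erule U0)
  have mV: "V \<in> borel_measurable borel"
    unfolding V_def[abs_def]
    by (rule borel_measurable_continuous_on_indicator[OF mS])
      (intro continuous_on_mult continuous_on_component continuous_on_subset[OF \<phi>D(2) subset_UNIV] G(1)[folded S_def])
  have "bounded (\<phi> ` K)"
    by (rule compact_imp_bounded[OF compact_continuous_image[OF continuous_on_subset[OF \<phi>D(2)] K(1)]]) simp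
  then obtain B where B: "\<And>x. x \<in> K \<Longrightarrow> \<bar>\<phi> x\<bar> \<le> B" unfolding bounded_iff by auto
  have B': "\<bar>\<phi> x\<bar> \<le> max B 0" for x using B[of x] \<phi>0(1)[of x] by (cases "x \<in> K") auto
  have AE_a: "AE x in (lborel :: (real ^ 'n) measure). x $ a \<noteq> 0" using AE_not_in[OF hyperplane_null[of a]] by simp
  then have AE_a': "AE x in (lebesgue :: (real ^ 'n) measure). x $ a \<noteq> 0" by (simp add: AE_completion)
  have VAE: "AE x in lebesgue. V x = indicator \<Omega> x *\<^sub>R (G x $ i * \<phi> x)"
    using AE_a' by eventually_elim (auto simp: V_def S_def split: split_indicator)
  have intG: "integrable lebesgue (\<lambda>x. indicator \<Omega> x *\<^sub>R G x)" using G(2) m\<Omega> by (simp add: integrable_lebesgue_on_iff)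
  have intV': "integrable lebesgue V"
  proof (rule Bochner_Integration.integrable_bound)
    show "integrable lebesgue (\<lambda>x. max B 0 *\<^sub>R norm (indicator \<Omega> x *\<^sub>R G x))"
      by (intro integrable_scaleR_right integrable_norm intG)
    show "V \<in> borel_measurable lebesgue" using mV by (simp add: measurable_completion)
    have "\<bar>G x $ i\<bar> * \<bar>\<phi> x\<bar> \<le> max B 0 * norm (G x)" for x
      using B'[of x] component_le_norm_cart[of "G x" i] by (subst mult.commute) (intro mult_mono, auto)
    then show "AE x in lebesgue. norm (V x) \<le> norm (max B 0 *\<^sub>R norm (indicator \<Omega> x *\<^sub>R G x))"
      by (auto simp: V_def S_def abs_mult split: split_indicator)
  qed
  then have intV: "integrable lborel V" using mV integrable_completion[of V lborel] by simp
  have "(LINT x|lborel. U x + V x) = 0"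
  proof (rule integral_derivative_eq_0[OF intF(1), where e = "axis i 1"])
    show "integrable lborel (\<lambda>x. U x + V x)" using intF intV by simp
    show "AE x in lborel. ((\<lambda>t. U (x + t *\<^sub>R axis i 1) + V (x + t *\<^sub>R axis i 1)) has_integral F (x + axis i 1) - F x) {0..1}"
      using AE_a
    proof eventually_elim
      case (elim x)
      have "((\<lambda>t. U (x + t *\<^sub>R axis i 1) + V (x + t *\<^sub>R axis i 1)) has_integral F (x + 1 *\<^sub>R axis i 1) - F (x + 0 *\<^sub>R axis i 1)) {0..1}"
      proof (rule fundamental_theorem_of_calculus_interior_strong[where S = "{- x $ a}"])
        show "continuous_on {0..1} (\<lambda>t. F (x + t *\<^sub>R axis i 1))"
          by (rule continuous_on_compose2[OF cont(1)]) (auto intro!: continuous_intros)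
        fix t assume t: "t \<in> {0<..<1} - {- x $ a}"
        let ?y = "x + t *\<^sub>R axis i 1"
        have ya: "?y $ a \<noteq> 0" using t elim by (auto simp: axis_def)
        have "(F has_derivative (\<lambda>h. (if ?y \<in> \<Omega> then \<phi> ?y *\<^sub>R G ?y + u ?y *\<^sub>R (\<chi> j. pdiff j \<phi> ?y) else 0) \<bullet> h)) (at ?y)"
        proof (cases "?y \<in> \<Omega>")
          case True
          have "(\<phi> has_derivative (\<lambda>h. (\<chi> j. pdiff j \<phi> ?y) \<bullet> h)) (at ?y)"
            using has_derivative_pdiff[OF \<phi>D(4)] by (simp add: inner_vec_def)
          from has_derivative_mult[OF deriv[OF True ya] this]
          have "((\<lambda>x. u x * \<phi> x) has_derivative (\<lambda>h. (\<phi> ?y *\<^sub>R G ?y + u ?y *\<^sub>R (\<chi> j. pdiff j \<phi> ?y)) \<bullet> h)) (at ?y)"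
            by (simp add: inner_add_left algebra_simps)
          then show ?thesis using True
            by (subst has_derivative_cong_open[OF \<Omega> True, of _ "\<lambda>x. u x * \<phi> x"]) (auto simp: F_def)
        next
          case False
          then have "?y \<in> - K" using K(3) by auto
          have "((\<lambda>x :: real ^ 'n. 0 :: real) has_derivative (\<lambda>h. (0 :: real ^ 'n) \<bullet> h)) (at ?y)"
            by (simp only: inner_zero_left has_derivative_const)
          then have "(F has_derivative (\<lambda>h. (0 :: real ^ 'n) \<bullet> h)) (at ?y)"
            by (rule has_derivative_transform_within_open[OF _ open_Compl[OF K(2)] \<open>?y \<in> - K\<close>])
              (simp add: F0)
          then show ?thesis unfolding if_not_P[OF False] .
        qed
        from line_has_vector_derivative[OF this]
        show "((\<lambda>t. F (x + t *\<^sub>R axis i 1)) has_vector_derivative U ?y + V ?y) (at t)"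
          using ya by (auto simp: U_def V_def S_def algebra_simps split: if_splits)
      qed auto
      then show ?case by simp
    qed
  qed
  then have UV: "(LINT x|lborel. U x) = - (LINT x|lborel. V x)" using intF intV by simp
  have "(LINT x|lebesgue_on \<Omega>. u x * pdiff i \<phi> x) = (LINT x|lebesgue. U x)"
    unfolding LINT_lebesgue_on[OF m\<Omega>(1)] by (intro Bochner_Integration.integral_cong) (auto simp: U_def)
  also have "\<dots> = (LINT x|lborel. U x)" using intF by (intro integral_completion) auto
  also note UV
  also have "(LINT x|lborel. V x) = (LINT x|lebesgue. V x)" using mV by (intro integral_completion[symmetric]) auto
  also have "\<dots> = (LINT x|lebesgue. indicator \<Omega> x *\<^sub>R (G x $ i * \<phi> x))"
  proof (rule integral_cong_AE)
    show "V \<in> borel_measurable lebesgue" using mV by (simp add: measurable_completion)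
    have "(\<lambda>x. indicator \<Omega> x *\<^sub>R G x) \<in> borel_measurable lebesgue" using intG by auto
    then have "(\<lambda>x. (indicator \<Omega> x *\<^sub>R G x) \<bullet> axis i 1 * \<phi> x) \<in> borel_measurable lebesgue"
      using borel_measurable_continuous_onI[OF \<phi>D(2)] by (intro borel_measurable_times borel_measurable_inner) (auto simp: measurable_completion)
    then show "(\<lambda>x. indicator \<Omega> x *\<^sub>R (G x $ i * \<phi> x)) \<in> borel_measurable lebesgue"
      by (simp add: inner_axis mult.assoc)
  qed (rule VAE)
  also have "\<dots> = (LINT x|lebesgue_on \<Omega>. G x $ i * \<phi> x)" unfolding LINT_lebesgue_on[OF m\<Omega>(1)] ..
  finally show "(LINT x|lebesgue_on \<Omega>. u x * pdiff i \<phi> x) = - (LINT x|lebesgue_on \<Omega>. G x $ i * \<phi> x)" .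
qed

text \<open>From any point of the ball, the segment of length 2r in direction b ends outside the
  ball, where the test function vanishes. It stays in A by invariance, so the inequality holds on A
  alone, although the function need not vanish on the boundary of A.\<close>

lemma test_function_poincare:
  fixes \<phi> :: "real ^ 'n::finite \<Rightarrow> real"
  assumes \<phi>: "\<phi> \<in> test_functions \<Omega>" and \<Omega>: "\<Omega> \<subseteq> ball 0 r" and A: "A \<in> sets borel"
    and inv: "\<And>x t. x + t *\<^sub>R axis b 1 \<in> A \<longleftrightarrow> x \<in> A"
  shows "(\<integral>\<^sup>+x. ennreal \<bar>\<phi> x\<bar> * indicator A x \<partial>lborel) \<le> ennreal (2 * r) * (\<integral>\<^sup>+x. ennreal \<bar>pdiff b \<phi> x\<bar> * indicator A x \<partial>lborel)"
proof -
  note \<phi>D = test_functionsD[OF \<phi>]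
  note [measurable] = A
  have [measurable]: "\<phi> \<in> borel_measurable borel" "pdiff b \<phi> \<in> borel_measurable borel"
    using \<phi>D(2,3) by (auto intro!: borel_measurable_continuous_onI)
  have out: "\<phi> x = 0" if "norm x \<ge> r" for x
  proof (rule \<phi>D(7))
    show "x \<notin> closure {x. \<phi> x \<noteq> 0}" using subset_trans[OF \<phi>D(6) \<Omega>] that by auto
  qed
  have "ennreal \<bar>\<phi> x\<bar> * indicator A x \<le> (\<integral>\<^sup>+t. ennreal \<bar>pdiff b \<phi> (x + t *\<^sub>R axis b 1)\<bar> * indicator A (x + t *\<^sub>R axis b 1) * indicator {0..2 * r} t \<partial>lborel)" for x
  proof (cases "x \<in> A \<and> norm x < r")
    case True
    then have r: "r > 0" using norm_ge_zero[of x] by linarith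
    have "((\<lambda>t. pdiff b \<phi> (x + t *\<^sub>R axis b 1)) has_integral \<phi> (x + (2 * r) *\<^sub>R axis b 1) - \<phi> (x + 0 *\<^sub>R axis b 1)) {0..2 * r}"
    proof (rule fundamental_theorem_of_calculus)
      fix t
      have "(\<phi> has_derivative (\<lambda>h. (\<chi> j. pdiff j \<phi> (x + t *\<^sub>R axis b 1)) \<bullet> h)) (at (x + t *\<^sub>R axis b 1))"
        using has_derivative_pdiff[OF \<phi>D(4)] by (simp add: inner_vec_def)
      from line_has_vector_derivative[OF this]
      show "((\<lambda>t. \<phi> (x + t *\<^sub>R axis b 1)) has_vector_derivative pdiff b \<phi> (x + t *\<^sub>R axis b 1)) (at t within {0..2 * r})"
        by (simp add: has_vector_derivative_at_within)
    qed (use r in auto)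
    moreover have "\<phi> (x + (2 * r) *\<^sub>R axis b 1) = 0"
    proof (rule out)
      have "2 * r \<le> norm (x + (2 * r) *\<^sub>R axis b 1) + norm x"
        using norm_triangle_ineq4[of "x + (2 * r) *\<^sub>R axis b 1" x] r by (simp add: norm_axis_1)
      then show "r \<le> norm (x + (2 * r) *\<^sub>R axis b 1)" using True by linarith
    qed
    ultimately have hi: "((\<lambda>t. pdiff b \<phi> (x + t *\<^sub>R axis b 1)) has_integral - \<phi> x) {0..2 * r}" by simp
    have cont: "continuous_on {0..2 * r} (\<lambda>t. pdiff b \<phi> (x + t *\<^sub>R axis b 1))"
      by (rule continuous_on_compose2[OF \<phi>D(3)]) (auto intro!: continuous_intros)
    then have si: "set_integrable lborel {0..2 * r} (\<lambda>t. pdiff b \<phi> (x + t *\<^sub>R axis b 1))"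
      unfolding set_integrable_def by (rule borel_integrable_compact[rotated]) simp
    have "\<phi> x = - (LINT t:{0..2 * r}|lborel. pdiff b \<phi> (x + t *\<^sub>R axis b 1))"
      using set_borel_integral_eq_integral(2)[OF si] integral_unique[OF hi] by simp
    then have "ennreal \<bar>\<phi> x\<bar> \<le> (\<integral>\<^sup>+t. ennreal (norm (indicator {0..2 * r} t *\<^sub>R pdiff b \<phi> (x + t *\<^sub>R axis b 1))) \<partial>lborel)"
      using integral_norm_bound_ennreal[OF si[unfolded set_integrable_def]] by (simp add: set_lebesgue_integral_def)
    also have "\<dots> = (\<integral>\<^sup>+t. ennreal \<bar>pdiff b \<phi> (x + t *\<^sub>R axis b 1)\<bar> * indicator A (x + t *\<^sub>R axis b 1) * indicator {0..2 * r} t \<partial>lborel)"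
      using True inv by (intro nn_integral_cong) (auto split: split_indicator)
    finally show ?thesis using True by simp
  next
    case False
    then show ?thesis using out[of x] by (auto split: split_indicator)
  qed
  then have "(\<integral>\<^sup>+x. ennreal \<bar>\<phi> x\<bar> * indicator A x \<partial>lborel) \<le>
      (\<integral>\<^sup>+x. (\<integral>\<^sup>+t. ennreal \<bar>pdiff b \<phi> (x + t *\<^sub>R axis b 1)\<bar> * indicator A (x + t *\<^sub>R axis b 1) * indicator {0..2 * r} t \<partial>lborel) \<partial>lborel)"
    by (intro nn_integral_mono)
  also have "\<dots> = emeasure lborel {0..2 * r} * (\<integral>\<^sup>+x. ennreal \<bar>pdiff b \<phi> x\<bar> * indicator A x \<partial>lborel)"
    by (rule nn_integral_lines[where f = "\<lambda>x. ennreal \<bar>pdiff b \<phi> x\<bar> * indicator A x"]) simp_all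
  also have "emeasure lborel {0..2 * r} = ennreal (2 * r)"
    by (cases "r \<ge> 0") (auto simp: ennreal_neg)
  finally show ?thesis .
qed

text \<open>The positive and the negative part of h are densities of two measures that agree on
  boxes, an intersection-stable generator of the Borel sets; equal measures have almost everywhere
  equal densities.\<close>

lemma AE_zero_if_box_integrals_zero:
  fixes h :: "'a::euclidean_space \<Rightarrow> real"
  assumes h: "integrable lebesgue h" and z: "\<And>c d. (LINT x|lebesgue. indicator (box c d) x * h x) = 0"
  shows "AE x in lebesgue. h x = 0"
proof -
  obtain h' where h'm [measurable]: "h' \<in> borel_measurable lborel" and ae: "AE x in lborel. h x = h' x"
    using completion_ex_borel_measurable_real[of h lborel] borel_measurable_integrable[OF h] by blast
  have ae': "AE x in lebesgue. h x = h' x" using ae by (rule AE_completion)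
  have h'm' [measurable]: "h' \<in> borel_measurable borel" using h'm by simp
  have "integrable lebesgue h'"
    by (rule integrable_cong_AE_imp[OF h]) (use ae' in \<open>auto simp: measurable_completion\<close>)
  then have int': "integrable lborel h'" using integrable_completion[of h' lborel] h'm by simp
  have z': "(LINT x|lborel. indicator (box c d) x * h' x) = 0" for c d
  proof -
    have "(LINT x|lborel. indicator (box c d) x * h' x) = (LINT x|lebesgue. indicator (box c d) x * h' x)"
      by (rule integral_completion[symmetric]) measurable
    also have "\<dots> = (LINT x|lebesgue. indicator (box c d) x * h x)"
    proof (rule integral_cong_AE)
      show "(\<lambda>x. indicator (box c d) x * h' x) \<in> borel_measurable lebesgue"
        by (rule measurable_completion) measurable
      show "(\<lambda>x. indicator (box c d) x * h x) \<in> borel_measurable lebesgue"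
        by (intro borel_measurable_times borel_measurable_indicator borel_measurable_integrable[OF h]) auto
      show "AE x in lebesgue. indicator (box c d) x * h' x = indicator (box c d) x * h x"
        using ae' by eventually_elim simp
    qed
    finally show ?thesis by (simp add: z)
  qed
  define f g where "f x = ennreal (h' x)" and "g x = ennreal (- h' x)" for x
  have [measurable]: "f \<in> borel_measurable lborel" "g \<in> borel_measurable lborel"
    unfolding f_def[abs_def] g_def[abs_def] by measurable
  have fin: "(\<integral>\<^sup>+x. f x * indicator A x \<partial>lborel) < \<infinity>" for A
  proof -
    have "(\<integral>\<^sup>+x. f x * indicator A x \<partial>lborel) \<le> (\<integral>\<^sup>+x. ennreal (norm (h' x)) \<partial>lborel)"
      by (intro nn_integral_mono) (auto simp: f_def split: split_indicator intro!: ennreal_leI)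
    also have "\<dots> < \<infinity>" using int' by (simp add: integrable_iff_bounded)
    finally show ?thesis .
  qed
  have eqbox: "(\<integral>\<^sup>+x. f x * indicator (box c d) x \<partial>lborel) = (\<integral>\<^sup>+x. g x * indicator (box c d) x \<partial>lborel)" for c d
  proof -
    let ?k = "\<lambda>x. indicator (box c d) x * h' x"
    have k: "integrable lborel ?k" using integrable_mult_indicator[OF _ int', of "box c d"] by simp
    have 1: "(\<integral>\<^sup>+x. f x * indicator (box c d) x \<partial>lborel) = (\<integral>\<^sup>+x. ennreal (?k x) \<partial>lborel)"
      "(\<integral>\<^sup>+x. g x * indicator (box c d) x \<partial>lborel) = (\<integral>\<^sup>+x. ennreal (- ?k x) \<partial>lborel)"
      by (auto intro!: nn_integral_cong simp: f_def g_def split: split_indicator)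
    have "enn2real (\<integral>\<^sup>+x. ennreal (?k x) \<partial>lborel) - enn2real (\<integral>\<^sup>+x. ennreal (- ?k x) \<partial>lborel) = 0"
      using real_lebesgue_integral_def[OF k] z' by simp
    moreover have "(\<integral>\<^sup>+x. ennreal (?k x) \<partial>lborel) \<noteq> \<infinity>" "(\<integral>\<^sup>+x. ennreal (- ?k x) \<partial>lborel) \<noteq> \<infinity>"
      using k by (auto simp: real_integrable_def)
    moreover have "a = b" if "enn2real a - enn2real b = 0" "a \<noteq> \<infinity>" "b \<noteq> \<infinity>" for a b
    proof -
      have "ennreal (enn2real a) = ennreal (enn2real b)" using that(1) by simp
      then show ?thesis using that(2,3) by (simp add: ennreal_enn2real_if)
    qed
    ultimately show ?thesis unfolding 1 by simp
  qed
  have "density lborel f = density lborel g"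
  proof (rule measure_eqI_generator_eq[where E = "range (\<lambda>(a, b). box a b)" and \<Omega> = UNIV and A = "\<lambda>n. box (- (real n *\<^sub>R One)) (real n *\<^sub>R One)"])
    show "Int_stable (range (\<lambda>(a, b). box a b :: 'a set))"
      by (auto simp: Int_stable_def box_Int_box)
    show "emeasure (density lborel f) X = emeasure (density lborel g) X" if "X \<in> range (\<lambda>(a, b). box a b)" for X
      using that eqbox by (auto simp: emeasure_density)
    show "sets (density lborel f) = sigma_sets UNIV (range (\<lambda>(a, b). box a b))"
      "sets (density lborel g) = sigma_sets UNIV (range (\<lambda>(a, b). box a b))"
      by (simp_all add: borel_eq_box)
    show "(\<Union>n. box (- (real n *\<^sub>R One)) (real n *\<^sub>R One)) = (UNIV :: 'a set)" by (rule UN_box_eq_UNIV)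
    show "emeasure (density lborel f) (box (- (real n *\<^sub>R One)) (real n *\<^sub>R One)) \<noteq> \<infinity>" for n
      using fin[of "box (- (real n *\<^sub>R One)) (real n *\<^sub>R One)"] by (simp add: emeasure_density)
  qed auto
  then have "AE x in lborel. f x = g x"
    using finite_density_unique[of f lborel g] fin[of UNIV] by simp
  then have "AE x in lborel. h' x = 0"
  proof eventually_elim
    case (elim x)
    show ?case
    proof (cases "h' x \<ge> 0")
      case True then show ?thesis using elim by (simp add: f_def g_def ennreal_neg)
    next
      case False then show ?thesis using elim by (simp add: f_def g_def ennreal_neg)
    qed
  qed
  then have "AE x in lebesgue. h' x = 0" by (rule AE_completion)
  then show ?thesis using ae' by eventually_elim simp
qed

text \<open>Each factor passes from 0 to 1 within distance 1/k of a face, inside the box. Hence the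
  functions vanish outside the open box and converge to its indicator everywhere.\<close>

definition box_bump :: "real ^ 'n::finite \<Rightarrow> real ^ 'n \<Rightarrow> nat \<Rightarrow> real ^ 'n \<Rightarrow> real" where
  "box_bump c d k x = (\<Prod>i\<in>UNIV. smooth_step (real k * (x $ i - c $ i)) * smooth_step (real k * (d $ i - x $ i)))"

lemma box_bump_bounds: "0 \<le> box_bump c d k x" "box_bump c d k x \<le> 1"
  unfolding box_bump_def
  by (intro prod_nonneg prod_le_1; auto intro!: mult_nonneg_nonneg mult_le_one smooth_step_bounds)+

lemma box_bump_outside: "x \<notin> box c d \<Longrightarrow> box_bump c d k x = 0"
proof -
  assume "x \<notin> box c d"
  then obtain i where "\<not> (c $ i < x $ i \<and> x $ i < d $ i)" by (auto simp: mem_box_cart)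
  then have "smooth_step (real k * (x $ i - c $ i)) * smooth_step (real k * (d $ i - x $ i)) = 0"
    using smooth_step_0[of "real k * (x $ i - c $ i)"] smooth_step_0[of "real k * (d $ i - x $ i)"]
    by (auto simp: mult_le_0_iff not_less)
  then show ?thesis unfolding box_bump_def by (intro prod_zero) auto
qed

lemma box_bump_test_function:
  assumes "cbox c d \<subseteq> \<Omega>" shows "box_bump c d k \<in> test_functions \<Omega>"
proof -
  have "smooth_on UNIV (box_bump c d k)"
    unfolding box_bump_def[abs_def]
    by (intro smooth_on_prod smooth_on_mult smooth_on_compose1[OF _ smooth1_smooth_step] smooth_on_diff smooth_on_const smooth_on_nth UNIV_I open_UNIV)
  moreover have "{x. box_bump c d k x \<noteq> 0} \<subseteq> cbox c d"
    using box_bump_outside[of _ c d k] box_subset_cbox[of c d] by blast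
  then have "closure {x. box_bump c d k x \<noteq> 0} \<subseteq> cbox c d" by (rule closure_minimal) (rule closed_cbox)
  ultimately show ?thesis
    unfolding test_functions_def using assms compact_closure bounded_subset[OF bounded_cbox, of "{x. box_bump c d k x \<noteq> 0}" c d]
      \<open>{x. box_bump c d k x \<noteq> 0} \<subseteq> cbox c d\<close> by auto
qed

lemma box_bump_tendsto: "(\<lambda>k. box_bump c d k x) \<longlonglongrightarrow> indicator (box c d) x"
proof (cases "x \<in> box c d")
  case True
  have "\<forall>\<^sub>F k in sequentially. smooth_step (real k * t) = 1" if "t > 0" for t
  proof -
    have "\<forall>\<^sub>F k in sequentially. 1 / t \<le> real k"
      using filterlim_real_sequentially unfolding filterlim_at_top by simp
    then show ?thesis by eventually_elim (use that in \<open>auto simp: field_simps intro!: smooth_step_1\<close>)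
  qed
  then have step: "\<forall>\<^sub>F k in sequentially. smooth_step (real k * t) = 1" if "t > 0" for t using that by simp
  have "\<forall>\<^sub>F k in sequentially. \<forall>i\<in>UNIV. smooth_step (real k * (x $ i - c $ i)) * smooth_step (real k * (d $ i - x $ i)) = 1"
  proof (intro eventually_ball_finite ballI)
    fix i
    have "x $ i - c $ i > 0" "d $ i - x $ i > 0" using True unfolding mem_box_cart by auto
    from step[OF this(1)] step[OF this(2)]
    show "\<forall>\<^sub>F k in sequentially. smooth_step (real k * (x $ i - c $ i)) * smooth_step (real k * (d $ i - x $ i)) = 1"
      by eventually_elim simp
  qed simp
  then have "\<forall>\<^sub>F k in sequentially. box_bump c d k x = indicator (box c d) x"
    by eventually_elim (use True in \<open>simp add: box_bump_def\<close>)
  then show ?thesis by (rule tendsto_eventually)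
qed (simp add: box_bump_outside)

lemma locally_integrable_test:
  fixes g :: "real ^ 'n::finite \<Rightarrow> real"
  assumes "open \<Omega>" and g: "locally_integrable \<Omega> g" and K: "compact K" "K \<subseteq> \<Omega>"
    and \<phi>: "continuous_on UNIV \<phi>" "\<And>x. x \<notin> K \<Longrightarrow> \<phi> x = 0"
  shows "integrable (lebesgue_on \<Omega>) (\<lambda>x. g x * \<phi> x)"
proof -
  have m: "K \<in> sets lebesgue" "\<Omega> \<in> sets lebesgue" using K assms(1) lmeasurable_compact by auto
  have "integrable (lebesgue_on K) g" using g K unfolding locally_integrable_def by blast
  then have gK: "integrable lebesgue (\<lambda>x. indicator K x *\<^sub>R g x)" using m by (simp add: integrable_lebesgue_on_iff)
  have "bounded (\<phi> ` K)"
    by (rule compact_imp_bounded[OF compact_continuous_image[OF continuous_on_subset[OF \<phi>(1)] K(1)]]) simp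
  then obtain B where B: "\<And>x. x \<in> K \<Longrightarrow> \<bar>\<phi> x\<bar> \<le> B" unfolding bounded_iff by auto
  have \<phi>m: "\<phi> \<in> borel_measurable lebesgue"
    by (rule measurable_completion) (use borel_measurable_continuous_onI[OF \<phi>(1)] in simp)
  have eq: "indicator \<Omega> x *\<^sub>R (g x * \<phi> x) = indicator K x *\<^sub>R g x * \<phi> x" for x
    using K(2) \<phi>(2)[of x] by (cases "x \<in> K") (auto split: split_indicator)
  have "integrable lebesgue (\<lambda>x. indicator K x *\<^sub>R g x * \<phi> x)"
  proof (rule Bochner_Integration.integrable_bound)
    show "integrable lebesgue (\<lambda>x. max B 0 * (indicator K x *\<^sub>R g x))" by (intro integrable_mult_right gK)
    show "(\<lambda>x. indicator K x *\<^sub>R g x * \<phi> x) \<in> borel_measurable lebesgue"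
      by (intro borel_measurable_times borel_measurable_integrable[OF gK] \<phi>m)
    show "AE x in lebesgue. norm (indicator K x *\<^sub>R g x * \<phi> x) \<le> norm (max B 0 * (indicator K x *\<^sub>R g x))"
    proof (rule AE_I2)
      fix x show "norm (indicator K x *\<^sub>R g x * \<phi> x) \<le> norm (max B 0 * (indicator K x *\<^sub>R g x))"
      proof (cases "x \<in> K")
        case True
        then have "\<bar>g x\<bar> * \<bar>\<phi> x\<bar> \<le> \<bar>g x\<bar> * max B 0" using B[OF True] by (intro mult_left_mono) auto
        then show ?thesis using True by (simp add: abs_mult mult.commute)
      qed simp
    qed
  qed
  then show ?thesis unfolding integrable_lebesgue_on_iff[OF m(2)] eq .
qed

lemma locally_integrable_nth:
  "locally_integrable \<Omega> g \<Longrightarrow> locally_integrable \<Omega> (\<lambda>x. g x $ i)"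
  unfolding locally_integrable_def
  by (auto intro: integrable_bounded_linear[OF bounded_linear_vec_nth])

lemma AE_lebesgue_on_open:
  fixes \<Omega> :: "(real ^ 'n::finite) set"
  assumes "open \<Omega>" "\<And>c d. cbox c d \<subseteq> \<Omega> \<Longrightarrow> AE x in lebesgue. x \<in> cbox c d \<longrightarrow> P x"
  shows "AE x in lebesgue_on \<Omega>. P x"
proof -
  obtain D where D: "countable D" "D \<subseteq> Pow \<Omega>" "\<And>X. X \<in> D \<Longrightarrow> \<exists>a b. X = cbox a b" "\<Union>D = \<Omega>"
    by (rule open_countable_Union_open_cbox[OF assms(1)]) (rule that)
  have "AE x in lebesgue. \<forall>X\<in>D. x \<in> X \<longrightarrow> P x"
  proof (rule AE_ball_countable[THEN iffD2, OF D(1)], rule ballI)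
    fix X assume "X \<in> D"
    then obtain c d where "X = cbox c d" "cbox c d \<subseteq> \<Omega>" using D(2,3) by blast
    then show "AE x in lebesgue. x \<in> X \<longrightarrow> P x" using assms(2) by simp
  qed
  then have "AE x in lebesgue. x \<in> \<Omega> \<longrightarrow> P x" by eventually_elim (use D(4) in blast)
  then show ?thesis using assms(1) by (subst AE_restrict_space_iff) auto
qed

text \<open>On each closed box inside the set, g is integrable and the bumps are dominated, so g has
  integral 0 over every open box inside it. Intersections of boxes are boxes, which reduces the test
  with arbitrary boxes to these.\<close>

lemma fundamental_lemma:
  fixes g :: "real ^ 'n::finite \<Rightarrow> real"
  assumes \<Omega>: "open \<Omega>" and g: "locally_integrable \<Omega> g"
    and z: "\<And>\<phi>. \<phi> \<in> test_functions \<Omega> \<Longrightarrow> (LINT x|lebesgue_on \<Omega>. g x * \<phi> x) = 0"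
  shows "AE x in lebesgue_on \<Omega>. g x = 0"
proof (rule AE_lebesgue_on_open[OF \<Omega>])
  fix c d assume cd: "cbox c d \<subseteq> \<Omega>"
  have m\<Omega>: "\<Omega> \<in> sets lebesgue" using \<Omega> by auto
  have "integrable (lebesgue_on (cbox c d)) g" using g cd compact_cbox unfolding locally_integrable_def by simp
  then have int: "integrable lebesgue (\<lambda>x. indicator (cbox c d) x *\<^sub>R g x)" by (simp add: integrable_lebesgue_on_iff)
  have box0: "(LINT x|lebesgue. indicator (box e f) x * (indicator (cbox c d) x *\<^sub>R g x)) = 0" if ef: "cbox e f \<subseteq> cbox c d" for e f
  proof -
    have "(\<lambda>k. LINT x|lebesgue. box_bump e f k x * (indicator (cbox c d) x *\<^sub>R g x)) \<longlonglongrightarrow>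
        (LINT x|lebesgue. indicator (box e f) x * (indicator (cbox c d) x *\<^sub>R g x))"
    proof (rule integral_dominated_convergence[where w = "\<lambda>x. norm (indicator (cbox c d) x *\<^sub>R g x)"])
      have "box_bump e f k \<in> borel_measurable borel" for k
        using test_functionsD(2)[OF box_bump_test_function[of e f UNIV k]] by (auto intro: borel_measurable_continuous_onI)
      then have "box_bump e f k \<in> borel_measurable lebesgue" for k by (intro measurable_completion) simp
      then show "(\<lambda>x. box_bump e f k x * (indicator (cbox c d) x *\<^sub>R g x)) \<in> borel_measurable lebesgue" for k
        by (intro borel_measurable_times borel_measurable_integrable[OF int])
      show "(\<lambda>x. indicator (box e f) x * (indicator (cbox c d) x *\<^sub>R g x)) \<in> borel_measurable lebesgue"
        by (intro borel_measurable_times borel_measurable_integrable[OF int] borel_measurable_indicator) auto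
      show "integrable lebesgue (\<lambda>x. norm (indicator (cbox c d) x *\<^sub>R g x))" using int by (rule integrable_norm)
      show "AE x in lebesgue. (\<lambda>k. box_bump e f k x * (indicator (cbox c d) x *\<^sub>R g x)) \<longlonglongrightarrow> indicator (box e f) x * (indicator (cbox c d) x *\<^sub>R g x)"
        by (intro AE_I2 tendsto_mult box_bump_tendsto tendsto_const)
      show "AE x in lebesgue. norm (box_bump e f k x * (indicator (cbox c d) x *\<^sub>R g x)) \<le> norm (indicator (cbox c d) x *\<^sub>R g x)" for k
        unfolding norm_mult using box_bump_bounds[of e f k]
        by (intro AE_I2 mult_left_le_one_le) auto
    qed
    moreover have "(LINT x|lebesgue. box_bump e f k x * (indicator (cbox c d) x *\<^sub>R g x)) = 0" for k
    proof -
      have "(LINT x|lebesgue. box_bump e f k x * (indicator (cbox c d) x *\<^sub>R g x)) = (LINT x|lebesgue_on \<Omega>. g x * box_bump e f k x)"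
        unfolding LINT_lebesgue_on[OF m\<Omega>]
      proof (rule Bochner_Integration.integral_cong)
        fix x show "box_bump e f k x * (indicator (cbox c d) x *\<^sub>R g x) = indicator \<Omega> x *\<^sub>R (g x * box_bump e f k x)"
          using box_bump_outside[of x e f k] box_subset_cbox[of e f] ef cd
          by (cases "x \<in> box e f") (auto split: split_indicator)
      qed simp
      also have "\<dots> = 0" by (intro z box_bump_test_function order_trans[OF ef cd])
      finally show ?thesis .
    qed
    ultimately show ?thesis by (simp add: LIMSEQ_const_iff)
  qed
  have "AE x in lebesgue. indicator (box c d) x * (indicator (cbox c d) x *\<^sub>R g x) = 0"
  proof (rule AE_zero_if_box_integrals_zero)
    show "integrable lebesgue (\<lambda>x. indicator (box c d) x * (indicator (cbox c d) x *\<^sub>R g x))"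
      using integrable_mult_indicator[OF _ int, of "box c d"] by simp
    fix e f
    obtain e' f' where ef': "box e f \<inter> box c d = box e' f'" by (auto simp: box_Int_box)
    have eq: "indicator (box e f) x * (indicator (box c d) x * (indicator (cbox c d) x *\<^sub>R g x)) = indicator (box e' f') x * (indicator (cbox c d) x *\<^sub>R g x)" for x
      unfolding ef'[symmetric] by (auto split: split_indicator)
    have "(LINT x|lebesgue. indicator (box e' f') x * (indicator (cbox c d) x *\<^sub>R g x)) = 0"
    proof (cases "box e' f' = {}")
      case False
      then have "cbox e' f' = closure (box e' f')" by (simp add: closure_box)
      also have "\<dots> \<subseteq> closure (cbox c d)" using ef' box_subset_cbox[of c d] by (intro closure_mono) auto
      finally show ?thesis by (intro box0) simp
    qed simp
    then show "(LINT x|lebesgue. indicator (box e f) x * (indicator (box c d) x * (indicator (cbox c d) x *\<^sub>R g x))) = 0"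
      unfolding eq .
  qed
  moreover have "cbox c d - box c d \<in> null_sets lebesgue"
    using negligible_frontier_interval[of c d] by (simp add: negligible_iff_null_sets)
  then have "AE x in lebesgue. x \<notin> cbox c d - box c d" by (rule AE_not_in)
  ultimately show "AE x in lebesgue. x \<in> cbox c d \<longrightarrow> g x = 0"
  proof eventually_elim
    case (elim x)
    show ?case
    proof
      assume "x \<in> cbox c d"
      then have "x \<in> box c d" using elim(2) by simp
      then show "g x = 0" using elim(1) \<open>x \<in> cbox c d\<close> by simp
    qed
  qed
qed

section \<open>Weak gradients and approximation by test functions\<close>

definition grad :: "(real ^ 'n::finite \<Rightarrow> real) \<Rightarrow> real ^ 'n \<Rightarrow> real ^ 'n" where
  "grad f x = (\<chi> i. pdiff i f x)"

lemma has_derivative_grad: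
  "f differentiable (at x) \<Longrightarrow> (f has_derivative (\<lambda>h. grad f x \<bullet> h)) (at x)"
  using has_derivative_pdiff[of f x] by (simp add: grad_def inner_vec_def)

lemma smooth_on_grad_continuous: "smooth_on U f \<Longrightarrow> continuous_on U (grad f)"
  unfolding grad_def[abs_def]
  by (intro continuous_on_vec_lambda smooth_on_continuous smooth_on_pdiff)

lemma weak_gradient_diff:
  assumes \<Omega>: "open \<Omega>" and g: "weak_gradient \<Omega> u g" and h: "weak_gradient \<Omega> v h"
  shows "weak_gradient \<Omega> (\<lambda>x. u x - v x) (\<lambda>x. g x - h x)"
  unfolding weak_gradient_def
proof (intro conjI ballI allI)
  have l: "locally_integrable \<Omega> u" "locally_integrable \<Omega> v" "locally_integrable \<Omega> g" "locally_integrable \<Omega> h"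
    using g h unfolding weak_gradient_def by simp_all
  show "locally_integrable \<Omega> (\<lambda>x. u x - v x)" "locally_integrable \<Omega> (\<lambda>x. g x - h x)"
    using l unfolding locally_integrable_def by simp_all
  fix \<phi> i assume \<phi>: "\<phi> \<in> test_functions \<Omega>"
  note D = test_functionsD[OF \<phi>]
  note I = locally_integrable_test[OF \<Omega> _ D(5,6)]
  have 1: "integrable (lebesgue_on \<Omega>) (\<lambda>x. u x * pdiff i \<phi> x)" "integrable (lebesgue_on \<Omega>) (\<lambda>x. v x * pdiff i \<phi> x)"
    by (rule I[OF l(1) D(3) D(8)], assumption, rule I[OF l(2) D(3) D(8)], assumption)
  have 2: "integrable (lebesgue_on \<Omega>) (\<lambda>x. g x $ i * \<phi> x)" "integrable (lebesgue_on \<Omega>) (\<lambda>x. h x $ i * \<phi> x)"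
    by (rule I[OF locally_integrable_nth[OF l(3)] D(2) D(7)], assumption,
        rule I[OF locally_integrable_nth[OF l(4)] D(2) D(7)], assumption)
  have "(LINT x|lebesgue_on \<Omega>. u x * pdiff i \<phi> x) = - (LINT x|lebesgue_on \<Omega>. g x $ i * \<phi> x)"
    "(LINT x|lebesgue_on \<Omega>. v x * pdiff i \<phi> x) = - (LINT x|lebesgue_on \<Omega>. h x $ i * \<phi> x)"
    using g h \<phi> unfolding weak_gradient_def by simp_all
  then show "(LINT x|lebesgue_on \<Omega>. (u x - v x) * pdiff i \<phi> x) = - (LINT x|lebesgue_on \<Omega>. (g x - h x) $ i * \<phi> x)"
    using Bochner_Integration.integral_diff[OF 1] Bochner_Integration.integral_diff[OF 2]
    by (simp add: left_diff_distrib)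
qed

lemma weak_gradient_minus:
  assumes "weak_gradient \<Omega> u g" shows "weak_gradient \<Omega> (\<lambda>x. - u x) (\<lambda>x. - g x)"
  using assms unfolding weak_gradient_def locally_integrable_def by simp

lemma weak_gradient_add:
  assumes \<Omega>: "open \<Omega>" and g: "weak_gradient \<Omega> u g" and h: "weak_gradient \<Omega> v h"
  shows "weak_gradient \<Omega> (\<lambda>x. u x + v x) (\<lambda>x. g x + h x)"
  using weak_gradient_diff[OF \<Omega> g weak_gradient_minus[OF h]] by simp

text \<open>Makes the choice in \<open>wgrad\<close> immaterial up to null sets, so that it may be
  replaced by a classical gradient.\<close>

lemma weak_gradient_unique:
  assumes \<Omega>: "open \<Omega>" and g: "weak_gradient \<Omega> u g" and h: "weak_gradient \<Omega> u h"
  shows "AE x in lebesgue_on \<Omega>. g x = h x"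
proof -
  have w: "weak_gradient \<Omega> (\<lambda>x. u x - u x) (\<lambda>x. g x - h x)" by (rule weak_gradient_diff[OF \<Omega> g h])
  have "AE x in lebesgue_on \<Omega>. (g x - h x) $ i = 0" for i
  proof (rule fundamental_lemma[OF \<Omega>])
    show "locally_integrable \<Omega> (\<lambda>x. (g x - h x) $ i)"
      by (rule locally_integrable_nth) (use w in \<open>simp add: weak_gradient_def\<close>)
    show "(LINT x|lebesgue_on \<Omega>. (g x - h x) $ i * \<phi> x) = 0" if "\<phi> \<in> test_functions \<Omega>" for \<phi>
      using w that unfolding weak_gradient_def by simp
  qed
  then have "AE x in lebesgue_on \<Omega>. \<forall>i\<in>UNIV. (g x - h x) $ i = 0" by (intro AE_finite_allI) auto
  then show ?thesis by eventually_elim (simp add: vec_eq_iff)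
qed

lemma weak_gradient_wgrad: "weak_gradient \<Omega> u g \<Longrightarrow> weak_gradient \<Omega> u (wgrad \<Omega> u)"
  unfolding wgrad_def by (rule someI[of "weak_gradient \<Omega> u" g])

lemma wgrad_AE:
  "open \<Omega> \<Longrightarrow> weak_gradient \<Omega> u g \<Longrightarrow> AE x in lebesgue_on \<Omega>. wgrad \<Omega> u x = g x"
  by (rule weak_gradient_unique[OF _ weak_gradient_wgrad])

text \<open>Lebesgue measure is complete, so the measurability of g comes for free;
  \<open>wgrad\<close> is an arbitrary choice and may differ from the known gradient on any null
  set.\<close>

lemma integrable_AE_eq:
  fixes f g :: "'a::euclidean_space \<Rightarrow> 'b::euclidean_space"
  assumes S: "S \<in> sets lebesgue" and f: "integrable (lebesgue_on S) f" and ae: "AE x in lebesgue_on S. f x = g x"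
  shows "integrable (lebesgue_on S) g"
    "(LINT x|lebesgue_on S. g x) = (LINT x|lebesgue_on S. f x)"
proof -
  have f': "integrable lebesgue (\<lambda>x. indicator S x *\<^sub>R f x)" using f S by (simp add: integrable_lebesgue_on_iff)
  have "AE x in lebesgue. x \<in> S \<longrightarrow> f x = g x" using ae S by (subst (asm) AE_restrict_space_iff) auto
  then have ae': "AE x in lebesgue. indicator S x *\<^sub>R f x = indicator S x *\<^sub>R g x"
    by eventually_elim (auto split: split_indicator)
  have m: "(\<lambda>x. indicator S x *\<^sub>R g x) \<in> borel_measurable lebesgue"
    by (rule borel_measurable_AE[OF borel_measurable_integrable[OF f'] ae'])
  have "integrable lebesgue (\<lambda>x. indicator S x *\<^sub>R g x)"
    by (rule integrable_cong_AE_imp[OF f' m]) (use ae' in \<open>auto elim: eventually_mono\<close>)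
  then show "integrable (lebesgue_on S) g" using S by (simp add: integrable_lebesgue_on_iff)
  show "(LINT x|lebesgue_on S. g x) = (LINT x|lebesgue_on S. f x)"
    unfolding LINT_lebesgue_on[OF S]
    by (rule integral_cong_AE[OF m borel_measurable_integrable[OF f']]) (use ae' in \<open>auto elim: eventually_mono\<close>)
qed

lemma wgrad_integrable:
  assumes "open \<Omega>" "weak_gradient \<Omega> u g" "integrable (lebesgue_on \<Omega>) g"
  shows "integrable (lebesgue_on \<Omega>) (wgrad \<Omega> u)"
proof (rule integrable_AE_eq(1)[OF _ assms(3)])
  show "AE x in lebesgue_on \<Omega>. g x = wgrad \<Omega> u x"
    using wgrad_AE[OF assms(1,2)] by eventually_elim simp
qed (use assms(1) in auto)

lemma W11D:
  assumes "open \<Omega>" "u \<in> W11 \<Omega>"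
  shows "integrable (lebesgue_on \<Omega>) u" "integrable (lebesgue_on \<Omega>) (wgrad \<Omega> u)"
    "weak_gradient \<Omega> u (wgrad \<Omega> u)"
  using assms wgrad_integrable weak_gradient_wgrad unfolding W11_def by auto

lemma compact_support_integrable_on:
  fixes f :: "real ^ 'n::finite \<Rightarrow> real"
  assumes "open \<Omega>" "continuous_on UNIV f" "compact K" "\<And>x. x \<notin> K \<Longrightarrow> f x = 0"
  shows "integrable (lebesgue_on \<Omega>) f"
proof -
  have "integrable lborel f" by (rule compact_support_continuous_integrable[OF assms(2,3)]) (erule assms(4))
  then have "integrable lebesgue f" using integrable_completion[of f lborel] by simp
  then have "integrable lebesgue (\<lambda>x. indicator \<Omega> x *\<^sub>R f x)"
    by (rule integrable_mult_indicator[rotated]) (use assms(1) in auto)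
  then show ?thesis using assms(1) by (subst integrable_lebesgue_on_iff) auto
qed

lemma integrable_vec:
  fixes f :: "'a \<Rightarrow> real ^ 'n::finite"
  assumes "\<And>i. integrable M (\<lambda>x. f x $ i)" shows "integrable M f"
proof -
  have "integrable M (\<lambda>x. \<Sum>i\<in>UNIV. f x $ i *\<^sub>R axis i (1 :: real))"
    by (intro Bochner_Integration.integrable_sum integrable_scaleR_left assms)
  moreover have "(\<Sum>i\<in>UNIV. f x $ i *\<^sub>R axis i (1 :: real)) = f x" for x
    using basis_expansion[of "f x"] by (simp add: scalar_mult_eq_scaleR)
  ultimately show ?thesis by simp
qed

lemma test_function_weak_gradient:
  fixes \<phi> :: "real ^ 'n::finite \<Rightarrow> real"
  assumes \<Omega>: "open \<Omega>" and \<phi>: "\<phi> \<in> test_functions \<Omega>"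
  shows "weak_gradient \<Omega> \<phi> (grad \<phi>)" "integrable (lebesgue_on \<Omega>) \<phi>" "integrable (lebesgue_on \<Omega>) (grad \<phi>)"
proof -
  note D = test_functionsD[OF \<phi>]
  show i1: "integrable (lebesgue_on \<Omega>) \<phi>"
    by (rule compact_support_integrable_on[OF \<Omega> D(2) D(5)]) (erule D(7))
  show i2: "integrable (lebesgue_on \<Omega>) (grad \<phi>)"
  proof (rule integrable_vec)
    show "integrable (lebesgue_on \<Omega>) (\<lambda>x. grad \<phi> x $ i)" for i
      unfolding grad_def vec_lambda_beta
      by (rule compact_support_integrable_on[OF \<Omega> D(3) D(5)]) (erule D(8))
  qed
  show "weak_gradient \<Omega> \<phi> (grad \<phi>)"
    by (rule weak_gradientI[OF \<Omega> continuous_on_subset[OF D(2) subset_UNIV] i1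
        continuous_on_subset[OF smooth_on_grad_continuous[OF D(1)] subset_UNIV] i2 has_derivative_grad[OF D(4)]])
qed

text \<open>The norm involves the weak gradient chosen for the difference; this exchanges it for the
  difference of known gradients.\<close>

lemma W11_norm_diff_test:
  assumes \<Omega>: "open \<Omega>" and g: "weak_gradient \<Omega> u g" "integrable (lebesgue_on \<Omega>) g" and \<phi>: "\<phi> \<in> test_functions \<Omega>"
  shows "W11_norm \<Omega> (\<lambda>x. u x - \<phi> x) =
    (LINT x|lebesgue_on \<Omega>. \<bar>u x - \<phi> x\<bar>) + (LINT x|lebesgue_on \<Omega>. norm (g x - grad \<phi> x))"
proof -
  note T = test_function_weak_gradient[OF \<Omega> \<phi>]
  have w: "weak_gradient \<Omega> (\<lambda>x. u x - \<phi> x) (\<lambda>x. g x - grad \<phi> x)" by (rule weak_gradient_diff[OF \<Omega> g(1) T(1)])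
  have "(LINT x|lebesgue_on \<Omega>. norm (wgrad \<Omega> (\<lambda>x. u x - \<phi> x) x)) = (LINT x|lebesgue_on \<Omega>. norm (g x - grad \<phi> x))"
  proof (rule integrable_AE_eq(2))
    show "integrable (lebesgue_on \<Omega>) (\<lambda>x. norm (g x - grad \<phi> x))"
      by (intro integrable_norm Bochner_Integration.integrable_diff g T)
    show "AE x in lebesgue_on \<Omega>. norm (g x - grad \<phi> x) = norm (wgrad \<Omega> (\<lambda>x. u x - \<phi> x) x)"
      using wgrad_AE[OF \<Omega> w] by eventually_elim simp
  qed (use \<Omega> in auto)
  then show ?thesis unfolding W11_norm_def by simp
qed

lemma W11_0I:
  assumes \<Omega>: "open \<Omega>" and u: "integrable (lebesgue_on \<Omega>) u"
    and g: "weak_gradient \<Omega> u g" "integrable (lebesgue_on \<Omega>) g"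
    and \<phi>: "\<And>k. \<phi> k \<in> test_functions \<Omega>"
    and lim: "(\<lambda>k. LINT x|lebesgue_on \<Omega>. \<bar>u x - \<phi> k x\<bar>) \<longlonglongrightarrow> 0"
      "(\<lambda>k. LINT x|lebesgue_on \<Omega>. norm (g x - grad (\<phi> k) x)) \<longlonglongrightarrow> 0"
  shows "u \<in> W11_0 \<Omega>"
proof -
  have "(\<lambda>k. W11_norm \<Omega> (\<lambda>x. u x - \<phi> k x)) \<longlonglongrightarrow> 0"
    unfolding W11_norm_diff_test[OF \<Omega> g \<phi>] using tendsto_add[OF lim] by simp
  then show ?thesis unfolding W11_0_def W11_def using u g \<phi> by blast
qed

lemma W11_0E:
  assumes \<Omega>: "open \<Omega>" and u: "u \<in> W11_0 \<Omega>"
  obtains \<phi> where "\<And>k :: nat. \<phi> k \<in> test_functions \<Omega>"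
    "(\<lambda>k. LINT x|lebesgue_on \<Omega>. \<bar>u x - \<phi> k x\<bar>) \<longlonglongrightarrow> 0"
    "(\<lambda>k. LINT x|lebesgue_on \<Omega>. norm (wgrad \<Omega> u x - grad (\<phi> k) x)) \<longlonglongrightarrow> 0"
proof -
  obtain \<phi> where \<phi>: "\<And>k :: nat. \<phi> k \<in> test_functions \<Omega>" and lim: "(\<lambda>k. W11_norm \<Omega> (\<lambda>x. u x - \<phi> k x)) \<longlonglongrightarrow> 0"
    and "u \<in> W11 \<Omega>" using u unfolding W11_0_def by auto
  note U = W11D[OF \<Omega> \<open>u \<in> W11 \<Omega>\<close>]
  let ?a = "\<lambda>k. LINT x|lebesgue_on \<Omega>. \<bar>u x - \<phi> k x\<bar>"
  let ?b = "\<lambda>k. LINT x|lebesgue_on \<Omega>. norm (wgrad \<Omega> u x - grad (\<phi> k) x)"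
  have s: "(\<lambda>k. ?a k + ?b k) \<longlonglongrightarrow> 0" using lim unfolding W11_norm_diff_test[OF \<Omega> U(3,2) \<phi>] .
  have nn: "0 \<le> ?a k" "0 \<le> ?b k" for k by (auto intro: Bochner_Integration.integral_nonneg)
  have "?a \<longlonglongrightarrow> 0" by (rule tendsto_sandwich[OF _ _ tendsto_const s]) (use nn in auto)
  moreover have "?b \<longlonglongrightarrow> 0" by (rule tendsto_sandwich[OF _ _ tendsto_const s]) (use nn in auto)
  ultimately show thesis using \<phi> by (rule_tac that)
qed

text \<open>A bounded field defines a continuous functional on integrable gradients, so vanishing on
  test functions passes to their closure. With the Euler field this is the weak form of the
  Euler-Lagrange equation.\<close>

lemma integral_inner_W11_0:
  fixes \<sigma> :: "real ^ 'n::finite \<Rightarrow> real ^ 'n"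
  assumes \<Omega>: "open \<Omega>" and m: "\<sigma> \<in> borel_measurable (lebesgue_on \<Omega>)" and B: "\<And>x. x \<in> \<Omega> \<Longrightarrow> norm (\<sigma> x) \<le> 1"
    and test: "\<And>\<phi>. \<phi> \<in> test_functions \<Omega> \<Longrightarrow> (LINT x|lebesgue_on \<Omega>. \<sigma> x \<bullet> grad \<phi> x) = 0"
    and u: "u \<in> W11_0 \<Omega>"
  shows "integrable (lebesgue_on \<Omega>) (\<lambda>x. \<sigma> x \<bullet> wgrad \<Omega> u x)" "(LINT x|lebesgue_on \<Omega>. \<sigma> x \<bullet> wgrad \<Omega> u x) = 0"
proof -
  have "u \<in> W11 \<Omega>" using u unfolding W11_0_def by simp
  note U = W11D[OF \<Omega> this]
  have int: "integrable (lebesgue_on \<Omega>) (\<lambda>x. \<sigma> x \<bullet> f x)" and bnd: "\<bar>LINT x|lebesgue_on \<Omega>. \<sigma> x \<bullet> f x\<bar> \<le> (LINT x|lebesgue_on \<Omega>. norm (f x))"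
    if f: "integrable (lebesgue_on \<Omega>) f" for f
  proof -
    have le: "norm (\<sigma> x \<bullet> f x) \<le> norm (f x)" if "x \<in> \<Omega>" for x
    proof -
      have "\<bar>\<sigma> x \<bullet> f x\<bar> \<le> norm (\<sigma> x) * norm (f x)" by (rule Cauchy_Schwarz_ineq2)
      also have "\<dots> \<le> 1 * norm (f x)" using B[OF that] by (intro mult_right_mono) auto
      finally show ?thesis by simp
    qed
    have AE: "AE x in lebesgue_on \<Omega>. norm (\<sigma> x \<bullet> f x) \<le> norm (f x)"
      by (rule AE_I2) (use le in simp)
    show i: "integrable (lebesgue_on \<Omega>) (\<lambda>x. \<sigma> x \<bullet> f x)"
      by (rule Bochner_Integration.integrable_bound[OF integrable_norm[OF f]])
        (use AE in \<open>auto intro!: borel_measurable_inner m borel_measurable_integrable[OF f]\<close>)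
    show "\<bar>LINT x|lebesgue_on \<Omega>. \<sigma> x \<bullet> f x\<bar> \<le> (LINT x|lebesgue_on \<Omega>. norm (f x))"
      using order_trans[OF integral_norm_bound[of "lebesgue_on \<Omega>" "\<lambda>x. \<sigma> x \<bullet> f x"]
        integral_mono_AE[OF integrable_norm[OF i] integrable_norm[OF f] AE]] by (simp only: real_norm_def)
  qed
  show "integrable (lebesgue_on \<Omega>) (\<lambda>x. \<sigma> x \<bullet> wgrad \<Omega> u x)" by (rule int[OF U(2)])
  obtain \<phi> where \<phi>: "\<And>k :: nat. \<phi> k \<in> test_functions \<Omega>"
    and lim: "(\<lambda>k. LINT x|lebesgue_on \<Omega>. norm (wgrad \<Omega> u x - grad (\<phi> k) x)) \<longlonglongrightarrow> 0"
    by (rule W11_0E[OF \<Omega> u]) (rule that)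
  have "\<bar>LINT x|lebesgue_on \<Omega>. \<sigma> x \<bullet> wgrad \<Omega> u x\<bar> \<le> (LINT x|lebesgue_on \<Omega>. norm (wgrad \<Omega> u x - grad (\<phi> k) x))" for k
  proof -
    note T = test_function_weak_gradient(3)[OF \<Omega> \<phi>[of k]]
    have "(LINT x|lebesgue_on \<Omega>. \<sigma> x \<bullet> (wgrad \<Omega> u x - grad (\<phi> k) x)) = (LINT x|lebesgue_on \<Omega>. \<sigma> x \<bullet> wgrad \<Omega> u x)"
      using Bochner_Integration.integral_diff[OF int[OF U(2)] int[OF T]] test[OF \<phi>[of k]] by (simp add: inner_diff_right)
    then show ?thesis using bnd[OF Bochner_Integration.integrable_diff[OF U(2) T]] by simp
  qed
  then have "\<bar>LINT x|lebesgue_on \<Omega>. \<sigma> x \<bullet> wgrad \<Omega> u x\<bar> \<le> 0" by (intro LIMSEQ_le_const[OF lim]) auto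
  then show "(LINT x|lebesgue_on \<Omega>. \<sigma> x \<bullet> wgrad \<Omega> u x) = 0" by simp
qed

text \<open>Both sides are continuous in the norm, so the inequality for test functions extends. The
  sets A of interest bound \<open>x $ a\<close> away from 0, which direction b respects.\<close>

lemma W11_0_poincare:
  fixes u :: "real ^ 'n::finite \<Rightarrow> real"
  assumes \<Omega>: "open \<Omega>" "\<Omega> \<subseteq> ball 0 r" "r > 0" and A: "A \<in> sets borel"
    and inv: "\<And>x t. x + t *\<^sub>R axis b 1 \<in> A \<longleftrightarrow> x \<in> A" and u: "u \<in> W11_0 \<Omega>"
  shows "(LINT x|lebesgue_on \<Omega>. \<bar>u x\<bar> * indicator A x) \<le> 2 * r * (LINT x|lebesgue_on \<Omega>. norm (wgrad \<Omega> u x) * indicator A x)"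
proof -
  have "u \<in> W11 \<Omega>" using u unfolding W11_0_def by simp
  note U = W11D[OF \<Omega>(1) this]
  have m\<Omega>: "\<Omega> \<in> sets lebesgue" using \<Omega> by auto
  have Am: "A \<in> sets lebesgue" using A by auto
  have iA: "integrable (lebesgue_on \<Omega>) (\<lambda>x. f x * indicator A x)" if f: "integrable (lebesgue_on \<Omega>) f" for f :: "real ^ 'n \<Rightarrow> real"
  proof (rule Bochner_Integration.integrable_bound[OF f])
    have "(indicator A :: real ^ 'n \<Rightarrow> real) \<in> borel_measurable (lebesgue_on \<Omega>)"
      by (rule measurable_restrict_space1) (rule borel_measurable_indicator[OF Am])
    then show "(\<lambda>x. f x * indicator A x) \<in> borel_measurable (lebesgue_on \<Omega>)"
      by (rule borel_measurable_times[OF borel_measurable_integrable[OF f]])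
    show "AE x in lebesgue_on \<Omega>. norm (f x * indicator A x) \<le> norm (f x)"
      by (rule AE_I2) (auto split: split_indicator)
  qed
  have T: "(LINT x|lebesgue_on \<Omega>. \<bar>\<phi> x\<bar> * indicator A x) \<le> 2 * r * (LINT x|lebesgue_on \<Omega>. norm (grad \<phi> x) * indicator A x)"
    if \<phi>: "\<phi> \<in> test_functions \<Omega>" for \<phi>
  proof -
    note D = test_functionsD[OF \<phi>] and W = test_function_weak_gradient[OF \<Omega>(1) \<phi>]
    have out: "\<phi> x = 0" "pdiff b \<phi> x = 0" if "x \<notin> \<Omega>" for x
    proof -
      have "x \<notin> closure {x. \<phi> x \<noteq> 0}" using that D(6) by blast
      then show "\<phi> x = 0" "pdiff b \<phi> x = 0" by (rule D(7), rule D(8))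
    qed
    have "ennreal (LINT x|lebesgue_on \<Omega>. \<bar>\<phi> x\<bar> * indicator A x) = (\<integral>\<^sup>+x. ennreal (\<bar>\<phi> x\<bar> * indicator A x) \<partial>lebesgue_on \<Omega>)"
      by (rule nn_integral_eq_integral[symmetric]) (auto intro!: iA integrable_abs W)
    also have "\<dots> = (\<integral>\<^sup>+x. ennreal (\<bar>\<phi> x\<bar> * indicator A x) * indicator \<Omega> x \<partial>lebesgue)"
      by (rule nn_integral_restrict_space) (use m\<Omega> in simp)
    also have "\<dots> \<le> (\<integral>\<^sup>+x. ennreal \<bar>\<phi> x\<bar> * indicator A x \<partial>lebesgue)"
      by (rule nn_integral_mono) (auto split: split_indicator)
    also have "\<dots> = (\<integral>\<^sup>+x. ennreal \<bar>\<phi> x\<bar> * indicator A x \<partial>lborel)" by (rule nn_integral_completion)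
    also have "\<dots> \<le> ennreal (2 * r) * (\<integral>\<^sup>+x. ennreal \<bar>pdiff b \<phi> x\<bar> * indicator A x \<partial>lborel)"
      by (rule test_function_poincare[OF \<phi> \<Omega>(2) A inv])
    also have "(\<integral>\<^sup>+x. ennreal \<bar>pdiff b \<phi> x\<bar> * indicator A x \<partial>lborel) = (\<integral>\<^sup>+x. ennreal \<bar>pdiff b \<phi> x\<bar> * indicator A x \<partial>lebesgue)"
      by (rule nn_integral_completion[symmetric])
    also have "\<dots> = (\<integral>\<^sup>+x. ennreal (\<bar>pdiff b \<phi> x\<bar> * indicator A x) * indicator \<Omega> x \<partial>lebesgue)"
      by (rule nn_integral_cong) (use out in \<open>auto split: split_indicator\<close>)
    also have "\<dots> = (\<integral>\<^sup>+x. ennreal (\<bar>pdiff b \<phi> x\<bar> * indicator A x) \<partial>lebesgue_on \<Omega>)"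
      by (rule nn_integral_restrict_space[symmetric]) (use m\<Omega> in simp)
    also have "\<dots> \<le> (\<integral>\<^sup>+x. ennreal (norm (grad \<phi> x) * indicator A x) \<partial>lebesgue_on \<Omega>)"
      using component_le_norm_cart[of "grad \<phi> _" b]
      by (intro nn_integral_mono ennreal_leI mult_right_mono) (simp_all add: grad_def)
    also have "\<dots> = ennreal (LINT x|lebesgue_on \<Omega>. norm (grad \<phi> x) * indicator A x)"
      by (rule nn_integral_eq_integral) (auto intro!: iA integrable_norm W)
    finally have "ennreal (LINT x|lebesgue_on \<Omega>. \<bar>\<phi> x\<bar> * indicator A x) \<le> ennreal (2 * r) * ennreal (LINT x|lebesgue_on \<Omega>. norm (grad \<phi> x) * indicator A x)"
      by (simp add: mult_left_mono)
    also have "\<dots> = ennreal (2 * r * (LINT x|lebesgue_on \<Omega>. norm (grad \<phi> x) * indicator A x))"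
      using \<Omega>(3) by (intro ennreal_mult[symmetric] Bochner_Integration.integral_nonneg) auto
    finally show ?thesis
      using \<Omega>(3) by (subst (asm) ennreal_le_iff) (auto intro!: mult_nonneg_nonneg Bochner_Integration.integral_nonneg)
  qed
  obtain \<phi> where \<phi>: "\<And>k :: nat. \<phi> k \<in> test_functions \<Omega>"
    and la: "(\<lambda>k. LINT x|lebesgue_on \<Omega>. \<bar>u x - \<phi> k x\<bar>) \<longlonglongrightarrow> 0"
    and lb: "(\<lambda>k. LINT x|lebesgue_on \<Omega>. norm (wgrad \<Omega> u x - grad (\<phi> k) x)) \<longlonglongrightarrow> 0"
    by (rule W11_0E[OF \<Omega>(1) u]) (rule that)
  let ?a = "\<lambda>k. LINT x|lebesgue_on \<Omega>. \<bar>u x - \<phi> k x\<bar>"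
  let ?b = "\<lambda>k. LINT x|lebesgue_on \<Omega>. norm (wgrad \<Omega> u x - grad (\<phi> k) x)"
  let ?R = "LINT x|lebesgue_on \<Omega>. norm (wgrad \<Omega> u x) * indicator A x"
  have "(LINT x|lebesgue_on \<Omega>. \<bar>u x\<bar> * indicator A x) \<le> ?a k + 2 * r * (?b k + ?R)" for k
  proof -
    note W = test_function_weak_gradient[OF \<Omega>(1) \<phi>[of k]]
    note i1 = integrable_abs[OF Bochner_Integration.integrable_diff[OF U(1) W(2)]]
      and i2 = iA[OF integrable_abs[OF W(2)]]
      and i3 = integrable_norm[OF Bochner_Integration.integrable_diff[OF U(2) W(3)]]
      and i4 = iA[OF integrable_norm[OF U(2)]]
    have "(LINT x|lebesgue_on \<Omega>. \<bar>u x\<bar> * indicator A x) \<le> (LINT x|lebesgue_on \<Omega>. \<bar>u x - \<phi> k x\<bar> + \<bar>\<phi> k x\<bar> * indicator A x)"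
      by (intro integral_mono iA integrable_abs U(1) Bochner_Integration.integrable_add i1 i2)
        (auto split: split_indicator)
    also have "\<dots> = ?a k + (LINT x|lebesgue_on \<Omega>. \<bar>\<phi> k x\<bar> * indicator A x)"
      by (rule Bochner_Integration.integral_add[OF i1 i2])
    also have "\<dots> \<le> ?a k + 2 * r * (LINT x|lebesgue_on \<Omega>. norm (grad (\<phi> k) x) * indicator A x)"
      using T[OF \<phi>[of k]] by simp
    also have "(LINT x|lebesgue_on \<Omega>. norm (grad (\<phi> k) x) * indicator A x) \<le> (LINT x|lebesgue_on \<Omega>. norm (wgrad \<Omega> u x - grad (\<phi> k) x) + norm (wgrad \<Omega> u x) * indicator A x)"
    proof (rule integral_mono[OF iA[OF integrable_norm[OF W(3)]] Bochner_Integration.integrable_add[OF i3 i4]])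
      fix x
      have "norm (grad (\<phi> k) x) \<le> norm (wgrad \<Omega> u x - grad (\<phi> k) x) + norm (wgrad \<Omega> u x)"
        using norm_triangle_sub[of "grad (\<phi> k) x" "wgrad \<Omega> u x"] by (simp add: norm_minus_commute)
      then show "norm (grad (\<phi> k) x) * indicator A x \<le> norm (wgrad \<Omega> u x - grad (\<phi> k) x) + norm (wgrad \<Omega> u x) * indicator A x"
        by (auto split: split_indicator)
    qed
    also have "\<dots> = ?b k + ?R" by (rule Bochner_Integration.integral_add[OF i3 i4])
    finally show ?thesis using \<Omega>(3) by (simp add: mult_left_mono)
  qed
  note le = this
  have "(\<lambda>k. ?a k + 2 * r * (?b k + ?R)) \<longlonglongrightarrow> 0 + 2 * r * (0 + ?R)"
    by (intro tendsto_intros la lb)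
  then have "(LINT x|lebesgue_on \<Omega>. \<bar>u x\<bar> * indicator A x) \<le> 0 + 2 * r * (0 + ?R)"
    by (rule LIMSEQ_le_const) (intro exI[of _ 0] allI impI le)
  then show ?thesis by simp
qed

section \<open>The domain\<close>

definition tsq :: "'n \<Rightarrow> real ^ 'n::finite \<Rightarrow> real" where
  "tsq a x = (\<Sum>i\<in>UNIV - {a}. (x $ i)\<^sup>2)"

lemma tsq_nonneg: "tsq a x \<ge> 0" unfolding tsq_def by (intro sum_nonneg) auto

lemma norm_sq_tsq: "(norm x)\<^sup>2 = (x $ a)\<^sup>2 + tsq a x"
proof -
  have "(norm x)\<^sup>2 = (\<Sum>i\<in>UNIV. (x $ i)\<^sup>2)"
    unfolding power2_norm_eq_inner by (simp add: inner_vec_def power2_eq_square)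
  then show ?thesis unfolding tsq_def by (simp add: sum.remove[of UNIV a])
qed

lemma smooth_on_tsq: "open U \<Longrightarrow> smooth_on U (tsq a)"
  unfolding tsq_def[abs_def] by (intro smooth_on_sum smooth_on_power smooth_on_nth)

lemma tsq_cong: "(\<And>i. i \<noteq> a \<Longrightarrow> x $ i = y $ i) \<Longrightarrow> tsq a x = tsq a y"
  unfolding tsq_def by (intro sum.cong) auto

lemma tsq_axis [simp]: "tsq a (x + t *\<^sub>R axis a 1) = tsq a x"
  by (rule tsq_cong) (simp add: axis_def)

lemma continuous_on_tsq: "continuous_on S (tsq a)"
  unfolding tsq_def[abs_def] by (intro continuous_intros)

text \<open>In the coordinate \<open>x $ a\<close>, the domain is the unit ball sheared by \<open>shear\<close>. The upper boundary
  is the graph of \<open>upper\<close>, which crosses \<open>{x. x $ a = 0}\<close> flatly at \<open>tsq a x = 1/4\<close>: this makes the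
  boundary values of the singular solution smooth.\<close>

definition phi :: "real \<Rightarrow> real" where "phi s = flat 1 (1/4 - s) - flat 1 (s - 1/4)"
definition chi :: "real \<Rightarrow> real" where "chi s = smooth_step (4 * s - 2)"
definition shear :: "real \<Rightarrow> real" where "shear s = (1 - chi s) * (phi s - sqrt (1 - s)) - chi s"
definition upper :: "real \<Rightarrow> real" where "upper s = shear s + sqrt (1 - s)"

section \<open>Smoothness and size of the boundary profile\<close>

lemma smooth1_flat_comp: "open I \<Longrightarrow> c > 0 \<Longrightarrow> smooth1 I f \<Longrightarrow> smooth1 I (\<lambda>s. flat c (f s))"
  by (rule smooth1_compose[OF _ smooth1_flat]) auto

lemma smooth1_phi: "open I \<Longrightarrow> smooth1 I phi"
  unfolding phi_def[abs_def]
  by (intro smooth1_diff smooth1_flat_comp smooth1_const smooth1_ident) auto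

lemma smooth1_chi: "open I \<Longrightarrow> smooth1 I chi"
  unfolding chi_def[abs_def]
  by (rule smooth1_compose[OF _ smooth1_smooth_step]) (auto intro!: smooth1_diff smooth1_mult)

lemma chi_0: "s \<le> 1/2 \<Longrightarrow> chi s = 0" unfolding chi_def by (rule smooth_step_0) simp
lemma chi_1: "s \<ge> 3/4 \<Longrightarrow> chi s = 1" unfolding chi_def by (rule smooth_step_1) simp
lemma chi_bounds: "0 \<le> chi s" "chi s \<le> 1" unfolding chi_def by (rule smooth_step_bounds)+

lemma shear_1: "s \<ge> 3/4 \<Longrightarrow> shear s = - 1" by (simp add: shear_def chi_1)

lemma smooth1_sqrt_comp: "smooth1 {..<1} (\<lambda>s. sqrt (1 - s))"
  by (rule smooth1_compose[OF _ smooth1_sqrt]) (auto intro!: smooth1_diff)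

text \<open>The square root is not smooth at s = 1, but \<open>chi\<close> is 1 from s = 3/4 on and
  removes it. Near the equator the shear is therefore the constant -1, and the domain is there a
  translated ball.\<close>

lemma smooth1_shear: "smooth1 UNIV shear"
proof (rule smooth1_local)
  fix x :: real
  show "\<exists>J g. open J \<and> x \<in> J \<and> smooth1 J g \<and> (\<forall>y\<in>J. shear y = g y)"
  proof (cases "x < 1")
    case True
    have "smooth1 {..<1} shear" unfolding shear_def[abs_def]
      by (intro smooth1_diff smooth1_mult smooth1_const smooth1_chi smooth1_phi smooth1_sqrt_comp) auto
    then show ?thesis using True by (intro exI[of _ "{..<1}"] exI[of _ shear]) auto
  next
    case False
    then show ?thesis by (intro exI[of _ "{3/4<..}"] exI[of _ "\<lambda>_. - 1"]) (auto simp: shear_1)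
  qed
qed

lemma smooth_on_shear: "open U \<Longrightarrow> smooth_on U (\<lambda>x. shear (tsq a x))"
  by (rule smooth_on_compose1[OF _ smooth1_shear smooth_on_tsq]) auto

lemma smooth1_upper: "smooth1 {..<1} upper"
  unfolding upper_def[abs_def]
  by (intro smooth1_add smooth1_sqrt_comp smooth1_subset[OF smooth1_shear]) auto

lemma flat_le: "flat 1 t \<le> max t 0"
proof (cases "t > 0")
  case True
  have "1 / t \<le> exp (1 / t)" using exp_ge_add_one_self[of "1 / t"] by linarith
  then have "exp (- (1 / t)) \<le> t" using True by (simp add: exp_minus field_simps)
  then show ?thesis using True by (simp add: flat_def)
qed (simp add: flat_def)

lemma phi_le: "0 \<le> s \<Longrightarrow> phi s \<le> 1/4"
  using flat_le[of "1/4 - s"] flat_nonneg[of 1 "s - 1/4"] by (simp add: phi_def max_def split: if_splits)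

lemma phi_ge: "s \<le> 1 \<Longrightarrow> phi s \<ge> - 1"
  using flat_le[of "s - 1/4"] flat_nonneg[of 1 "1/4 - s"] by (simp add: phi_def max_def split: if_splits)

lemma phi_pos: "s < 1/4 \<Longrightarrow> phi s > 0" and phi_neg: "s > 1/4 \<Longrightarrow> phi s < 0"
  by (auto simp: phi_def flat_def)

text \<open>As a convex combination, \<open>upper\<close> takes over common bounds of the flat
  profile and of the spherical cap.\<close>

lemma upper_eq: "upper s = (1 - chi s) * phi s + chi s * (sqrt (1 - s) - 1)"
  by (simp add: upper_def shear_def algebra_simps)

lemma convex_le: "0 \<le> c \<Longrightarrow> c \<le> 1 \<Longrightarrow> (c < 1 \<Longrightarrow> x \<le> z) \<Longrightarrow> y \<le> z \<Longrightarrow> (1 - c) * x + c * y \<le> (z :: real)"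
proof -
  assume c: "0 \<le> c" "c \<le> 1" and x: "c < 1 \<Longrightarrow> x \<le> z" and y: "y \<le> z"
  have "(1 - c) * x \<le> (1 - c) * z" using c x by (cases "c < 1") (auto intro: mult_left_mono)
  moreover have "c * y \<le> c * z" using c y by (rule_tac mult_left_mono)
  ultimately show ?thesis by (simp add: algebra_simps)
qed

lemma upper_bounds: "0 \<le> s \<Longrightarrow> s \<le> 1 \<Longrightarrow> upper s \<le> 1" "0 \<le> s \<Longrightarrow> s \<le> 1 \<Longrightarrow> - 1 \<le> upper s"
proof -
  assume s: "0 \<le> s" "s \<le> 1"
  have q: "0 \<le> sqrt (1 - s)" "sqrt (1 - s) \<le> 1" using s by auto
  have "phi s \<le> 1" "sqrt (1 - s) - 1 \<le> 1" "- phi s \<le> 1" "1 - sqrt (1 - s) \<le> 1"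
    using phi_le[OF s(1)] phi_ge[OF s(2)] q by linarith+
  note b = this
  show "upper s \<le> 1" unfolding upper_eq by (rule convex_le[OF chi_bounds b(1,2)])
  have "(1 - chi s) * (- phi s) + chi s * (1 - sqrt (1 - s)) \<le> 1" by (rule convex_le[OF chi_bounds b(3,4)])
  then show "- 1 \<le> upper s" unfolding upper_eq by (simp add: algebra_simps)
qed

text \<open>Beyond the flat crossing at s = 1/4 the upper boundary stays below the hyperplane, where
  \<open>zeta\<close> is smooth. Thus s = 1/4 is the only delicate value.\<close>

lemma upper_neg: "1/4 < s \<Longrightarrow> s \<le> 1 \<Longrightarrow> upper s < 0"
proof -
  assume s: "1/4 < s" "s \<le> 1"
  have q: "sqrt (1 - s) < 1" using s by simp
  define m where "m = max (phi s) (sqrt (1 - s) - 1)"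
  have "m < 0" using q phi_neg[OF s(1)] by (simp add: m_def)
  moreover have "upper s \<le> m" unfolding upper_eq m_def
    using chi_bounds[of s] by (intro convex_le) auto
  ultimately show ?thesis by simp
qed

text \<open>Keeps the lower boundary far from the hyperplane. For s <= 1/4 the root is at least 5/8,
  which compensates \<open>phi\<close> <= 1/4; for larger s \<open>phi\<close> is negative and, as
  long as \<open>chi\<close> < 1, the root is at least 1/2.\<close>

lemma lower_le: "0 \<le> s \<Longrightarrow> s \<le> 1 \<Longrightarrow> shear s - sqrt (1 - s) \<le> - 1"
proof -
  assume s: "0 \<le> s" "s \<le> 1"
  have "shear s - sqrt (1 - s) = (1 - chi s) * (phi s - 2 * sqrt (1 - s)) + chi s * (- 1 - sqrt (1 - s))"
    by (simp add: shear_def algebra_simps)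
  also have "\<dots> \<le> - 1"
  proof (intro convex_le chi_bounds)
    assume "chi s < 1"
    then have s': "s < 3/4" using chi_1[of s] by force
    have "sqrt ((1/2)\<^sup>2) \<le> sqrt (1 - s)" using s' by (intro real_sqrt_le_mono) (simp add: power2_eq_square)
    then have 1: "1/2 \<le> sqrt (1 - s)" by simp
    show "phi s - 2 * sqrt (1 - s) \<le> - 1"
    proof (cases "s \<le> 1/4")
      case True
      have "sqrt ((5/8)\<^sup>2) \<le> sqrt (1 - s)" using True by (intro real_sqrt_le_mono) (simp add: power2_eq_square)
      then show ?thesis using phi_le[OF s(1)] by simp
    next
      case False then show ?thesis using 1 phi_neg[of s] by simp
    qed
  qed (use s in simp)
  finally show ?thesis .
qed

section \<open>The sheared ball and its boundary\<close>

definition dom :: "'n \<Rightarrow> (real ^ 'n::finite) set" where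
  "dom a = {x. (x $ a - shear (tsq a x))\<^sup>2 + tsq a x < 1}"

lemma continuous_shear: "continuous_on S (\<lambda>x. shear (tsq a x))"
  by (rule continuous_on_subset[OF smooth_on_continuous[OF smooth_on_shear[OF open_UNIV]] subset_UNIV])

lemma continuous_dom_fun: "continuous_on S (\<lambda>x. (x $ a - shear (tsq a x))\<^sup>2 + tsq a x)"
  by (intro continuous_intros continuous_shear continuous_on_tsq)

lemma open_dom: "open (dom a)"
  unfolding dom_def by (rule open_Collect_less[OF continuous_dom_fun continuous_on_const])

lemma closure_dom: "closure (dom a) \<subseteq> {x. (x $ a - shear (tsq a x))\<^sup>2 + tsq a x \<le> 1}"
  by (rule closure_minimal) (auto simp: dom_def intro!: closed_Collect_le continuous_dom_fun)

lemma frontier_dom: "frontier (dom a) \<subseteq> {x. (x $ a - shear (tsq a x))\<^sup>2 + tsq a x = 1}"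
  using closure_dom[of a] open_dom[of a] unfolding frontier_def by (auto simp: dom_def interior_open)

text \<open>The closure lies between two graphs. The bound 3 places it inside the ball of radius 4
  on which the singular solution is constructed.\<close>

lemma closure_domD:
  assumes "x \<in> closure (dom a)"
  shows "tsq a x \<le> 1" "shear (tsq a x) - sqrt (1 - tsq a x) \<le> x $ a" "x $ a \<le> upper (tsq a x)" "norm x \<le> 3"
proof -
  let ?s = "tsq a x" let ?y = "x $ a - shear ?s"
  have le: "?y\<^sup>2 + ?s \<le> 1" using assms closure_dom by blast
  then show s: "?s \<le> 1" using zero_le_power2[of ?y] by linarith
  have "\<bar>?y\<bar> \<le> sqrt (1 - ?s)" using le by (intro real_le_rsqrt) simp
  then show l: "shear ?s - sqrt (1 - ?s) \<le> x $ a" and u: "x $ a \<le> upper ?s" by (auto simp: upper_def)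
  have q: "sqrt (1 - ?s) \<le> 1" using tsq_nonneg[of a x] by simp
  have "- 1 \<le> upper ?s" "upper ?s \<le> 1" using upper_bounds[OF tsq_nonneg s] by auto
  note ub = this
  have xa: "x $ a \<le> 1" using u ub by linarith
  have xa': "- 1 - 2 * sqrt (1 - ?s) \<le> x $ a" using l ub(1) unfolding upper_def by linarith
  have q0: "0 \<le> sqrt (1 - ?s)" using s by simp
  have "\<bar>x $ a\<bar> \<le> 1 + 2 * sqrt (1 - ?s)" using xa xa' q0 by linarith
  then have "\<bar>x $ a\<bar>\<^sup>2 \<le> (1 + 2 * sqrt (1 - ?s))\<^sup>2" by (intro power_mono) auto
  also have "\<dots> = 1 + 4 * sqrt (1 - ?s) + 4 * (1 - ?s)" using s by (simp add: power2_sum)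
  finally have "(norm x)\<^sup>2 \<le> 1 + 4 * sqrt (1 - ?s) + 4 * (1 - ?s) + ?s" unfolding norm_sq_tsq[of x a] by simp
  also have "\<dots> \<le> 9"
  proof -
    have "1 + 4 * t + 4 * (1 - s) + s \<le> 9" if "t \<le> 1" "0 \<le> s" for t s :: real
      using that by argo
    from this[OF q tsq_nonneg] show ?thesis .
  qed
  finally have "(norm x)\<^sup>2 \<le> 3\<^sup>2" by simp
  then show "norm x \<le> 3" by (rule power2_le_imp_le) simp
qed

lemma zero_in_dom: "0 \<in> dom a"
proof -
  have t: "tsq a 0 = 0" by (simp add: tsq_def)
  have "phi 0 > 0" "phi 0 \<le> 1/4" using phi_pos[of 0] phi_le[of 0] by simp_all
  then have "(1 - phi 0)\<^sup>2 < 1\<^sup>2" by (intro power_strict_mono) auto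
  then show ?thesis by (simp add: dom_def t shear_def chi_0 power2_commute)
qed

lemma bounded_domain_dom: "bounded_domain (dom a)"
  unfolding bounded_domain_def
proof (intro conjI)
  show "open (dom a)" by (rule open_dom)
  show "dom a \<noteq> {}" using zero_in_dom by blast
  show "bounded (dom a)" unfolding bounded_iff
    using closure_domD(4) closure_subset[of "dom a"] by (intro exI[of _ 3]) blast
  \<comment> \<open>The shear leaves \<open>tsq a\<close> unchanged, so the opposite shift inverts
    it; the domain is a continuous image of the ball and hence connected.\<close>
  define F where "F x = x + shear (tsq a x) *\<^sub>R axis a 1" for x
  have "dom a = F ` ball 0 1"
  proof (intro equalityI subsetI)
    fix x assume x: "x \<in> dom a"
    define y where "y = x + (- shear (tsq a x)) *\<^sub>R axis a 1"
    have ty: "tsq a y = tsq a x" unfolding y_def by (rule tsq_axis)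
    have "(norm y)\<^sup>2 = (x $ a - shear (tsq a x))\<^sup>2 + tsq a x"
      unfolding norm_sq_tsq[of y a] ty by (simp add: y_def axis_def)
    then have "(norm y)\<^sup>2 < 1\<^sup>2" using x by (simp add: dom_def)
    then have "norm y < 1" by (rule power2_less_imp_less) simp
    moreover have "F y = x" unfolding F_def ty by (simp add: y_def)
    ultimately show "x \<in> F ` ball 0 1" by force
  next
    fix x assume "x \<in> F ` ball 0 1"
    then obtain y where y: "norm y < 1" "x = F y" by auto
    have "(norm y)\<^sup>2 < 1\<^sup>2" using y by (intro power_strict_mono) auto
    moreover have "tsq a x = tsq a y" unfolding y(2) F_def by simp
    moreover have "x $ a = y $ a + shear (tsq a y)" unfolding y(2) F_def by (simp add: axis_def)
    ultimately show "x \<in> dom a" using norm_sq_tsq[of y a] unfolding dom_def by simp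
  qed
  moreover have "connected (F ` ball 0 1)"
    unfolding F_def by (intro connected_continuous_image convex_connected convex_ball continuous_intros continuous_shear)
  ultimately show "connected (dom a)" by simp
qed

lemma sq_less_iff_less_sqrt: "0 < y \<Longrightarrow> y\<^sup>2 < w \<longleftrightarrow> y < sqrt w"
  using real_sqrt_less_iff[of "y\<^sup>2" w] by simp

lemma smooth_on_sqrt: "open U \<Longrightarrow> smooth_on U f \<Longrightarrow> (\<And>x. x \<in> U \<Longrightarrow> f x > 0) \<Longrightarrow> smooth_on U (\<lambda>x. sqrt (f x))"
  by (rule smooth_on_compose1[OF _ smooth1_sqrt]) auto

text \<open>Where \<open>tsq\<close> < 1 the boundary is one of two graphs in direction a. At the
  equator \<open>tsq\<close> = 1 this direction is tangential, but there the domain is locally a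
  unit ball around a point of the axis, and its sphere is a graph in a direction i with
  \<open>x0 $ i\<close> nonzero.\<close>

lemma smooth_boundary_dom:
  fixes a :: "'n::finite"
  shows "smooth_boundary (dom a)"
  unfolding smooth_boundary_def
proof
  fix x0 assume "x0 \<in> frontier (dom a)"
  then have x0: "(x0 $ a - shear (tsq a x0))\<^sup>2 + tsq a x0 = 1" using frontier_dom by blast
  let ?P = "\<lambda>r i \<sigma> \<gamma>. (\<forall>x t. \<gamma> (x + t *\<^sub>R axis i 1) = \<gamma> x) \<and> smooth_on (ball x0 r) \<gamma> \<and>
     dom a \<inter> ball x0 r = {x \<in> ball x0 r. \<sigma> * x $ i > \<gamma> x}"
  have s0: "tsq a x0 \<le> 1" using x0 zero_le_power2[of "x0 $ a - shear (tsq a x0)"] by linarith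
  consider "tsq a x0 < 1" "x0 $ a - shear (tsq a x0) > 0" | "tsq a x0 < 1" "x0 $ a - shear (tsq a x0) < 0" | "tsq a x0 = 1"
    using s0 x0 by (cases "x0 $ a - shear (tsq a x0) = 0") force+
  then show "\<exists>r>0. \<exists>i. \<exists>\<sigma>\<in>{-1, 1}. \<exists>\<gamma>. ?P r i \<sigma> \<gamma>"
  proof cases
    case 1
    define N where "N = {x. tsq a x < 1} \<inter> {x. x $ a - shear (tsq a x) > 0}"
    have "open N" unfolding N_def
      by (intro open_Int open_Collect_less continuous_intros continuous_on_tsq continuous_shear)
    moreover have "x0 \<in> N" using 1 by (simp add: N_def)
    ultimately obtain r where r: "r > 0" "ball x0 r \<subseteq> N" unfolding open_contains_ball by blast
    define \<gamma> where "\<gamma> x = - (shear (tsq a x) + sqrt (1 - tsq a x))" for x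
    have "smooth_on (ball x0 r) \<gamma>" unfolding \<gamma>_def[abs_def]
      by (intro smooth_on_minus smooth_on_add smooth_on_shear smooth_on_sqrt smooth_on_diff smooth_on_const smooth_on_tsq open_ball)
        (use r(2) in \<open>auto simp: N_def\<close>)
    moreover have "x \<in> dom a \<longleftrightarrow> - 1 * x $ a > \<gamma> x" if "x \<in> ball x0 r" for x
    proof -
      have "0 < x $ a - shear (tsq a x)" using that r(2) by (auto simp: N_def)
      from sq_less_iff_less_sqrt[OF this, of "1 - tsq a x"] show ?thesis by (auto simp: dom_def \<gamma>_def)
    qed
    then have "dom a \<inter> ball x0 r = {x \<in> ball x0 r. - 1 * x $ a > \<gamma> x}" by blast
    moreover have "\<forall>x t. \<gamma> (x + t *\<^sub>R axis a 1) = \<gamma> x" by (simp add: \<gamma>_def)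
    ultimately show ?thesis using r(1) by (intro exI[of _ r] conjI exI[of _ a] bexI[of _ "- 1"] exI[of _ \<gamma>]) auto
  next
    case 2
    define N where "N = {x. tsq a x < 1} \<inter> {x. x $ a - shear (tsq a x) < 0}"
    have "open N" unfolding N_def
      by (intro open_Int open_Collect_less continuous_intros continuous_on_tsq continuous_shear)
    moreover have "x0 \<in> N" using 2 by (simp add: N_def)
    ultimately obtain r where r: "r > 0" "ball x0 r \<subseteq> N" unfolding open_contains_ball by blast
    define \<gamma> where "\<gamma> x = shear (tsq a x) - sqrt (1 - tsq a x)" for x
    have "smooth_on (ball x0 r) \<gamma>" unfolding \<gamma>_def[abs_def]
      by (intro smooth_on_diff smooth_on_shear smooth_on_sqrt smooth_on_const smooth_on_tsq open_ball)
        (use r(2) in \<open>auto simp: N_def\<close>)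
    moreover have "x \<in> dom a \<longleftrightarrow> 1 * x $ a > \<gamma> x" if "x \<in> ball x0 r" for x
    proof -
      have "0 < shear (tsq a x) - x $ a" using that r(2) by (auto simp: N_def)
      from sq_less_iff_less_sqrt[OF this, of "1 - tsq a x"] show ?thesis by (auto simp: dom_def \<gamma>_def power2_commute)
    qed
    then have "dom a \<inter> ball x0 r = {x \<in> ball x0 r. 1 * x $ a > \<gamma> x}" by blast
    moreover have "\<forall>x t. \<gamma> (x + t *\<^sub>R axis a 1) = \<gamma> x" by (simp add: \<gamma>_def)
    ultimately show ?thesis using r(1) by (intro exI[of _ r] conjI exI[of _ a] bexI[of _ "1"] exI[of _ \<gamma>]) auto
  next
    case 3
    have xa: "x0 $ a = - 1" using x0 3 by (simp add: shear_1)
    have "\<exists>i\<in>UNIV - {a}. (x0 $ i)\<^sup>2 \<noteq> 0"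
    proof (rule ccontr)
      assume "\<not> ?thesis" then have "tsq a x0 = 0" unfolding tsq_def by (intro sum.neutral) auto
      then show False using 3 by simp
    qed
    then obtain i where i: "i \<noteq> a" "x0 $ i \<noteq> 0" by auto
    define \<tau> where "\<tau> = sgn (x0 $ i)"
    have \<tau>: "\<tau> \<in> {-1, 1}" "\<tau> * x0 $ i > 0" "\<tau> * \<tau> = 1" using i(2) by (auto simp: \<tau>_def sgn_if)
    define Q where "Q x = 1 - (x $ a + 1)\<^sup>2 - (\<Sum>j\<in>UNIV - {a, i}. (x $ j)\<^sup>2)" for x :: "real ^ 'n"
    have tsq_i: "tsq a x = (x $ i)\<^sup>2 + (\<Sum>j\<in>UNIV - {a, i}. (x $ j)\<^sup>2)" for x
    proof -
      have "UNIV - {a} - {i} = UNIV - {a, i}" by blast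
      then show ?thesis unfolding tsq_def using i(1) sum.remove[of "UNIV - {a}" i "\<lambda>j. (x $ j)\<^sup>2"] by simp
    qed
    have "(x0 $ i)\<^sup>2 > 0" using i(2) by simp
    moreover have "Q x0 = (x0 $ i)\<^sup>2" using tsq_i[of x0] 3 xa by (simp add: Q_def)
    ultimately have Q0: "Q x0 > 0" by simp
    have smQ: "smooth_on U Q" if "open U" for U unfolding Q_def[abs_def]
      by (intro smooth_on_diff smooth_on_power smooth_on_add smooth_on_sum smooth_on_const smooth_on_nth that)
    define N where "N = {x. 3/4 < tsq a x} \<inter> {x. \<tau> * x $ i > 0} \<inter> {x. Q x > 0}"
    have "open N" unfolding N_def
      by (intro open_Int open_Collect_less continuous_intros continuous_on_tsq smooth_on_continuous[OF smQ[OF open_UNIV]])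
    moreover have "x0 \<in> N" using 3 Q0 \<tau> by (simp add: N_def)
    ultimately obtain r where r: "r > 0" "ball x0 r \<subseteq> N" unfolding open_contains_ball by blast
    define \<gamma> where "\<gamma> x = - sqrt (Q x)" for x
    have "smooth_on (ball x0 r) \<gamma>" unfolding \<gamma>_def[abs_def]
      by (intro smooth_on_minus smooth_on_sqrt smQ open_ball) (use r(2) in \<open>auto simp: N_def\<close>)
    moreover have "x \<in> dom a \<longleftrightarrow> - \<tau> * x $ i > \<gamma> x" if "x \<in> ball x0 r" for x
    proof -
      have xN: "3/4 < tsq a x" "0 < \<tau> * x $ i" using that r(2) by (auto simp: N_def)
      have "(\<tau> * x $ i)\<^sup>2 = (x $ i)\<^sup>2" using \<tau>(3) by (simp add: power2_eq_square)
      then have "(x $ i)\<^sup>2 < Q x \<longleftrightarrow> \<tau> * x $ i < sqrt (Q x)" using sq_less_iff_less_sqrt[OF xN(2), of "Q x"] by simp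
      moreover have "x \<in> dom a \<longleftrightarrow> (x $ i)\<^sup>2 < Q x"
        using xN(1) tsq_i[of x] by (auto simp: dom_def shear_1 Q_def)
      ultimately show ?thesis by (auto simp: \<gamma>_def)
    qed
    then have "dom a \<inter> ball x0 r = {x \<in> ball x0 r. - \<tau> * x $ i > \<gamma> x}" by blast
    moreover have "\<forall>x t. \<gamma> (x + t *\<^sub>R axis i 1) = \<gamma> x"
      using i(1) by (auto simp: \<gamma>_def Q_def axis_def intro!: sum.cong)
    moreover have "- \<tau> \<in> {-1, 1}" using \<tau>(1) by auto
    ultimately show ?thesis using r(1) by (intro exI[of _ r] conjI exI[of _ i] bexI[of _ "- \<tau>"] exI[of _ \<gamma>]) simp_all
  qed
qed

section \<open>The integrand\<close>

definition energy :: "real \<Rightarrow> real \<Rightarrow> real" where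
  "energy p t = (1 + t powr p) powr (1 / p)"

text \<open>The derivative of \<open>energy\<close>, in the form that shows monotonicity and the
  bound 1, and that becomes (1 + eps^2) powr (1/p - 1) at t = |eps| powr (-2/p).\<close>

definition slope :: "real \<Rightarrow> real \<Rightarrow> real" where
  "slope p t = (t powr p / (1 + t powr p)) powr (1 - 1 / p)"

lemma energy_deriv:
  assumes "p > 1" "t > 0"
  shows "(energy p has_real_derivative slope p t) (at t)"
proof -
  have pos: "1 + t powr p > 0" by (simp add: add_pos_nonneg)
  have "((\<lambda>t. (1 + t powr p) powr (1 / p)) has_real_derivative
      (1 / p) * (1 + t powr p) powr (1 / p - 1) * (p * t powr (p - 1))) (at t)"
    using assms pos by (auto intro!: derivative_eq_intros simp: powr_diff)
  moreover have "(1 / p) * (1 + t powr p) powr (1 / p - 1) * (p * t powr (p - 1)) = slope p t"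
  proof -
    have "p * (1 - 1 / p) = p - 1" using assms by (simp add: right_diff_distrib)
    then have "(t powr p) powr (1 - 1 / p) = t powr (p - 1)" using assms by (simp add: powr_powr)
    moreover have "slope p t = (t powr p) powr (1 - 1 / p) / (1 + t powr p) powr (1 - 1 / p)"
      using pos by (simp add: slope_def powr_divide)
    moreover have "(1 + t powr p) powr (1 / p - 1) = inverse ((1 + t powr p) powr (1 - 1 / p))"
      by (simp add: powr_minus[symmetric])
    ultimately show ?thesis using assms by (simp add: divide_inverse)
  qed
  ultimately show ?thesis unfolding energy_def[abs_def] by simp
qed

lemma slope_strict_mono:
  assumes "p > 1" "0 < s" "s < t" shows "slope p s < slope p t"
proof -
  have "s powr p < t powr p" using assms by (intro powr_less_mono2) auto
  then have "s powr p / (1 + s powr p) < t powr p / (1 + t powr p)"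
    by (simp add: field_simps add_pos_nonneg)
  then show ?thesis unfolding slope_def using assms by (intro powr_less_mono2) (auto simp: field_simps)
qed

lemma energy_ge: "p > 0 \<Longrightarrow> t \<ge> 0 \<Longrightarrow> energy p t \<ge> t"
proof -
  assume p: "p > 0" and t: "t \<ge> 0"
  have "(t powr p) powr (1 / p) \<le> (1 + t powr p) powr (1 / p)" using p by (intro powr_mono2) auto
  then show "energy p t \<ge> t" using p t by (simp add: energy_def powr_powr)
qed

lemma energy_le: "p > 1 \<Longrightarrow> t \<ge> 0 \<Longrightarrow> energy p t \<le> 2 * (1 + t)"
proof -
  assume p: "p > 1" and t: "t \<ge> 0"
  have "1 \<le> (1 + t) powr p" "t powr p \<le> (1 + t) powr p"
    using p t ge_one_powr_ge_zero[of "1 + t" p] by (auto intro!: powr_mono2)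
  then have "1 + t powr p \<le> 2 * (1 + t) powr p" by simp
  then have "energy p t \<le> (2 * (1 + t) powr p) powr (1 / p)"
    unfolding energy_def using p by (intro powr_mono2) (auto simp: add_nonneg_nonneg)
  also have "\<dots> = 2 powr (1 / p) * (1 + t)" using p t by (simp add: powr_mult powr_powr)
  also have "\<dots> \<le> 2 powr 1 * (1 + t)" using p t by (intro mult_right_mono powr_mono) auto
  finally show ?thesis by simp
qed

lemma slope_pos: "q > 0 \<Longrightarrow> slope p q > 0"
proof -
  assume "q > 0"
  then have "q powr p / (1 + q powr p) > 0" by (intro divide_pos_pos add_pos_nonneg) auto
  then show ?thesis unfolding slope_def by (simp only: powr_gt_zero)
qed

lemma slope_less_1:
  assumes "p > 1" "q > 0" shows "slope p q < 1"
proof -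
  have "q powr p / (1 + q powr p) < 1" by (simp add: add_pos_nonneg)
  then have "slope p q < 1 powr (1 - 1 / p)" unfolding slope_def using assms by (intro powr_less_mono2) auto
  then show ?thesis by simp
qed

text \<open>Strict convexity through the mean value theorem and the strictly increasing
  slope.\<close>

lemma energy_tangent_strict:
  assumes p: "p > 1" and q: "q > 0" and t: "t \<ge> 0" "t \<noteq> q"
  shows "energy p q + slope p q * (t - q) < energy p t"
proof -
  consider "t > q" | "0 < t" "t < q" | "t = 0" using t by linarith
  then show ?thesis
  proof cases
    case 1
    obtain z where z: "q < z" "z < t" "energy p t - energy p q = (t - q) * slope p z"
      using MVT2[of q t "energy p" "slope p"] energy_deriv[OF p] 1 q by auto
    have "(t - q) * slope p q < (t - q) * slope p z"
      using slope_strict_mono[OF p q z(1)] 1 by simp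
    then show ?thesis using z(3) by (simp add: mult.commute)
  next
    case 2
    obtain z where z: "t < z" "z < q" "energy p q - energy p t = (q - t) * slope p z"
      using MVT2[of t q "energy p" "slope p"] energy_deriv[OF p] 2 by auto
    have "(q - t) * slope p z < (q - t) * slope p q"
      using slope_strict_mono[OF p _ z(2)] z(1) 2 by simp
    then show ?thesis using z(3) by (simp add: algebra_simps)
  next
    \<comment> \<open>The derivative formula covers t > 0 only. At t = 0 the height of the tangent
      is computed exactly: it is w powr (1/p - 1) with w = 1 + q powr p > 1, hence below
      \<open>energy p 0\<close> = 1.\<close>
    case 3
    let ?w = "1 + q powr p"
    have w: "?w > 1" using q by simp
    then have nz: "?w \<noteq> 0" "\<bar>?w\<bar> = ?w" by linarith+
    have pe: "p * (1 - 1 / p) = p - 1" using p by (simp add: right_diff_distrib)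
    have "slope p q = (q powr p) powr (1 - 1 / p) / ?w powr (1 - 1 / p)"
      using w by (simp add: slope_def powr_divide)
    also have "\<dots> = q powr (p - 1) * ?w powr (1 / p - 1)"
      using pe by (simp add: powr_powr powr_minus[symmetric] divide_inverse)
    finally have "q * slope p q = q powr p * ?w powr (1 / p - 1)"
      using q by (simp add: powr_diff)
    moreover have "energy p q = ?w * ?w powr (1 / p - 1)"
      using w nz by (simp add: energy_def powr_diff)
    ultimately have "energy p q - q * slope p q = ?w powr (1 / p - 1)" by (simp add: algebra_simps)
    also have "\<dots> < ?w powr 0" using w p by (intro powr_less_mono) auto
    also have "\<dots> = 1" using nz by simp
    finally show ?thesis using 3 p by (simp add: energy_def mult.commute)
  qed
qed

text \<open>If b differs from q * e, it differs in length, where the scalar inequality is strict, or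
  it has the same length and another direction, where Cauchy-Schwarz is strict.\<close>

lemma energy_tangent_vec:
  fixes b e :: "'a::real_inner"
  assumes p: "p > 1" and q: "q > 0" and e: "norm e = 1" and b: "b \<noteq> q *\<^sub>R e"
  shows "energy p q + slope p q * (e \<bullet> b - q) < energy p (norm b)"
proof -
  have le: "e \<bullet> b \<le> norm b" using norm_cauchy_schwarz[of e b] e by simp
  show ?thesis
  proof (cases "norm b = q")
    case True
    have "e \<bullet> b \<noteq> norm b"
      using norm_cauchy_schwarz_eq[of e b] e b True by auto
    then have "slope p q * (e \<bullet> b - q) < slope p q * 0" using le True slope_pos[OF q] by (intro mult_strict_left_mono) auto
    then show ?thesis using True by simp
  next
    case False
    have "energy p q + slope p q * (e \<bullet> b - q) \<le> energy p q + slope p q * (norm b - q)"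
      using le slope_pos[OF q, of p] by (intro add_left_mono mult_left_mono) auto
    also have "\<dots> < energy p (norm b)" by (rule energy_tangent_strict[OF p q norm_ge_zero False])
    finally show ?thesis .
  qed
qed

lemma energy_tangent_le:
  fixes b e :: "'a::real_inner"
  assumes "p > 1" "q > 0" "norm e = 1"
  shows "energy p q + slope p q * (e \<bullet> b - q) \<le> energy p (norm b)"
proof (cases "b = q *\<^sub>R e")
  case True
  then have "e \<bullet> b = q" "norm b = q" using assms by (simp_all add: norm_eq_1)
  then show ?thesis by simp
next
  case False then show ?thesis using energy_tangent_vec[OF assms False] by simp
qed

lemma continuous_on_energy:
  assumes "p > 0" "continuous_on S f" "\<And>x. x \<in> S \<Longrightarrow> f x \<ge> 0"
  shows "continuous_on S (\<lambda>x. energy p (f x))"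
proof -
  have c: "continuous_on S (\<lambda>x. f x powr p)"
    by (rule continuous_on_powr'[OF assms(2) continuous_on_const]) (use assms in auto)
  have "1 + f x powr p \<noteq> 0" for x using powr_ge_zero[of "f x" p] by linarith
  then show ?thesis unfolding energy_def by (intro continuous_on_powr continuous_on_add continuous_on_const c) auto
qed

lemma continuous_on_slope:
  assumes "p > 0" "continuous_on S f" "\<And>x. x \<in> S \<Longrightarrow> f x > 0"
  shows "continuous_on S (\<lambda>x. slope p (f x))"
proof -
  have nz: "1 + f x powr p \<noteq> 0" "f x > 0 \<Longrightarrow> f x powr p / (1 + f x powr p) \<noteq> 0" for x
    using powr_ge_zero[of "f x" p] by (auto simp: add_nonneg_eq_0_iff)
  have fx: "f x \<noteq> 0" if "x \<in> S" for x using assms(3)[OF that] by simp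
  have c: "continuous_on S (\<lambda>x. f x powr p)"
    by (rule continuous_on_powr[OF assms(2) continuous_on_const]) (use assms(3) in force)
  show ?thesis unfolding slope_def
    by (rule continuous_on_powr[OF continuous_on_divide[OF c continuous_on_add[OF continuous_on_const c]] continuous_on_const])
      (use nz fx in auto)
qed

text \<open>Bounded b at distance at least \<eta> from the contact point form a compact set together
  with C, on which the strict tangent inequality has a positive minimum. For large b the integrand
  grows with slope 1, the tangent with slope at most \<tau> < 1. The \<eta> excludes the
  neighbourhood where the gap is only quadratic.\<close>

lemma energy_coercive:
  fixes e :: "'b::metric_space \<Rightarrow> 'a::euclidean_space"
  assumes p: "p > 1" and C: "compact C" and q: "continuous_on C q" "\<And>x. x \<in> C \<Longrightarrow> q x > 0"
    and e: "continuous_on C e" "\<And>x. x \<in> C \<Longrightarrow> norm (e x) = 1" and \<eta>: "\<eta> > 0"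
  obtains c where "c > 0" "\<And>x b. x \<in> C \<Longrightarrow> norm (b - q x *\<^sub>R e x) \<ge> \<eta> \<Longrightarrow>
    c * norm (b - q x *\<^sub>R e x) \<le> energy p (norm b) - (energy p (q x) + slope p (q x) * (e x \<bullet> b - q x))"
proof (cases "C = {}")
  case True then show ?thesis using that[of 1] by simp
next
  case False
  obtain xm where xm: "xm \<in> C" "\<And>x. x \<in> C \<Longrightarrow> q x \<le> q xm"
    using continuous_attains_sup[OF C False q(1)] by blast
  define B where "B = q xm"
  have B: "B > 0" "\<And>x. x \<in> C \<Longrightarrow> q x \<le> B" using xm q(2) by (auto simp: B_def)
  define \<tau> where "\<tau> = slope p B"
  have \<tau>: "\<tau> < 1" "\<tau> > 0" using slope_less_1[OF p B(1)] slope_pos[OF B(1)] by (auto simp: \<tau>_def)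
  have slope_le: "slope p (q x) \<le> \<tau>" "slope p (q x) > 0" if "x \<in> C" for x
  proof -
    show "slope p (q x) \<le> \<tau>"
      using slope_strict_mono[OF p q(2)[OF that], of B] B(2)[OF that] by (cases "q x = B") (auto simp: \<tau>_def)
    show "slope p (q x) > 0" by (rule slope_pos[OF q(2)[OF that]])
  qed
  define A where "A = 2 * (1 + B)"
  \<comment> \<open>A bounds the energy at the contact point and B its length. For norm b > M they
    use up at most half of (1 - \<tau>) * norm b, which leaves room for the constant (1 - \<tau>) /
    4.\<close>
  define M where "M = 2 * (A + B) / (1 - \<tau>) + 1"
  have A: "A > 0" using B by (simp add: A_def)
  have M: "M > 0" using A B \<tau> unfolding M_def by (intro add_nonneg_pos divide_nonneg_pos) auto
  let ?E = "\<lambda>x b. energy p (norm b) - (energy p (q x) + slope p (q x) * (e x \<bullet> b - q x))"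
  have nV: "norm (q x *\<^sub>R e x) \<le> B" if "x \<in> C" for x using e(2)[OF that] q(2)[OF that] B(2)[OF that] by simp
  define S where "S = {z \<in> C \<times> cball 0 M. \<eta> \<le> norm (snd z - q (fst z) *\<^sub>R e (fst z))}"
  have contV: "continuous_on (C \<times> cball 0 M) (\<lambda>z. q (fst z))" "continuous_on (C \<times> cball 0 M) (\<lambda>z. e (fst z))"
    by (rule continuous_on_compose2[OF q(1)] continuous_on_compose2[OF e(1)]; auto intro: continuous_intros)+
  have cS: "compact S"
  proof -
    have "closedin (top_of_set (C \<times> cball 0 M)) ((C \<times> cball 0 M) \<inter> (\<lambda>z. norm (snd z - q (fst z) *\<^sub>R e (fst z))) -` {\<eta>..})"
      by (rule continuous_closedin_preimage) (auto intro!: continuous_intros contV)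
    moreover have "(C \<times> cball 0 M) \<inter> (\<lambda>z. norm (snd z - q (fst z) *\<^sub>R e (fst z))) -` {\<eta>..} = S"
      by (auto simp: S_def)
    ultimately show ?thesis using closedin_compact[OF compact_Times[OF C compact_cball[of 0 M]]] by simp
  qed
  have contE: "continuous_on S (\<lambda>z. ?E (fst z) (snd z))"
  proof (rule continuous_on_subset[where s = "C \<times> cball 0 M"])
    show "continuous_on (C \<times> cball 0 M) (\<lambda>z. ?E (fst z) (snd z))"
      using p q(2) by (intro continuous_on_diff continuous_on_add continuous_on_mult continuous_on_inner
          continuous_on_energy continuous_on_slope contV continuous_intros) (auto intro: less_imp_le)
  qed (auto simp: S_def)
  obtain c2 where c2: "c2 > 0" "\<And>x b. (x, b) \<in> S \<Longrightarrow> c2 \<le> ?E x b"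
  proof (cases "S = {}")
    case True then show ?thesis using that[of 1] by simp
  next
    case False
    obtain z where z: "z \<in> S" "\<And>y. y \<in> S \<Longrightarrow> ?E (fst z) (snd z) \<le> ?E (fst y) (snd y)"
      using continuous_attains_inf[OF cS False contE] by blast
    have zC: "fst z \<in> C" "snd z \<noteq> q (fst z) *\<^sub>R e (fst z)" using z(1) \<eta> by (auto simp: S_def)
    have "?E (fst z) (snd z) > 0"
      using energy_tangent_vec[OF p q(2)[OF zC(1)] e(2)[OF zC(1)] zC(2)] by simp
    then show ?thesis using that[of "?E (fst z) (snd z)"] z(2) by fastforce
  qed
  define c where "c = min ((1 - \<tau>) / 4) (c2 / (M + B))"
  show ?thesis
  proof (rule that)
    show "c > 0" using \<tau> c2(1) M B by (simp add: c_def)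
    fix x b assume x: "x \<in> C" and b: "\<eta> \<le> norm (b - q x *\<^sub>R e x)"
    have tri: "norm (b - q x *\<^sub>R e x) \<le> norm b + B" using norm_triangle_ineq4[of b "q x *\<^sub>R e x"] nV[OF x] by linarith
    show "c * norm (b - q x *\<^sub>R e x) \<le> ?E x b"
    proof (cases "norm b \<le> M")
      case True
      have "c * norm (b - q x *\<^sub>R e x) \<le> (c2 / (M + B)) * (M + B)"
        using tri True c2(1) M B \<open>c > 0\<close> by (intro mult_mono) (auto simp: c_def)
      also have "\<dots> = c2" using M B by simp
      also have "\<dots> \<le> ?E x b" using x b True by (intro c2(2)) (auto simp: S_def)
      finally show ?thesis .
    next
      case False
      have 1: "energy p (norm b) \<ge> norm b" using p by (intro energy_ge) auto
      have "energy p (q x) \<le> A" using energy_le[OF p, of "q x"] q(2)[OF x] B(2)[OF x] by (simp add: A_def)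
      moreover have "slope p (q x) * (e x \<bullet> b - q x) \<le> \<tau> * norm b"
      proof -
        have "slope p (q x) * (e x \<bullet> b - q x) \<le> slope p (q x) * norm b"
          using norm_cauchy_schwarz[of "e x" b] e(2)[OF x] q(2)[OF x] slope_le(2)[OF x] by (intro mult_left_mono) auto
        also have "\<dots> \<le> \<tau> * norm b" using slope_le(1)[OF x] by (intro mult_right_mono) auto
        finally show ?thesis .
      qed
      ultimately have 2: "?E x b \<ge> (1 - \<tau>) * norm b - A" using 1 by (simp add: algebra_simps)
      have "2 * (A + B) / (1 - \<tau>) \<le> norm b" using False by (simp add: M_def)
      then have 3: "2 * (A + B) \<le> (1 - \<tau>) * norm b" using \<tau> by (simp add: field_simps)
      have "c \<le> (1 - \<tau>) / 4" unfolding c_def by (rule min.cobounded1)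
      then have "c * norm (b - q x *\<^sub>R e x) \<le> ((1 - \<tau>) / 4) * (norm b + B)"
        using tri \<tau> B(1) by (intro mult_mono) auto
      also have "\<dots> \<le> (1 - \<tau>) * norm b / 4 + B"
        using \<tau> B(1) by (simp add: field_simps)
      also have "\<dots> \<le> (1 - \<tau>) * norm b - A" using 3 B(1) A by argo
      finally show ?thesis using 2 by simp
    qed
  qed
qed

section \<open>Singular integrals and Hausdorff measure\<close>

lemma zeta_eq_sgn: "zeta p t = sgn t * \<bar>t\<bar> powr (1 - 2 / p)"
  using zeta_pos[of t p] zeta_pos[of "- t" p] zeta_minus[of p t] by (cases "t = 0") (auto simp: sgn_if)

lemma continuous_on_zeta: "p > 2 \<Longrightarrow> continuous_on S (zeta p)"
proof -
  assume p: "p > 2"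
  have abs: "\<bar>zeta p t\<bar> = \<bar>t\<bar> powr (1 - 2 / p)" for t by (simp add: zeta_eq_sgn abs_mult abs_sgn_eq)
  have "isCont (zeta p) t" for t
  proof (cases "t = 0")
    case False
    then show ?thesis using zeta_deriv[OF False] DERIV_isCont by blast
  next
    case True
    have "((\<lambda>t. \<bar>t\<bar> powr (1 - 2 / p)) \<longlongrightarrow> \<bar>0\<bar> powr (1 - 2 / p)) (at (0 :: real))"
      by (rule tendsto_powr') (use p tendsto_rabs_zero[OF tendsto_ident_at[of "0 :: real" UNIV]] in auto)
    then have "((\<lambda>t. \<bar>zeta p t\<bar>) \<longlongrightarrow> 0) (at 0)" unfolding abs using p by simp
    then show ?thesis unfolding True isCont_def zeta_0 by (rule tendsto_rabs_zero_cancel)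
  qed
  then show ?thesis by (simp add: continuous_at_imp_continuous_on)
qed

lemma abs_zeta: "\<bar>zeta p t\<bar> = \<bar>t\<bar> powr (1 - 2 / p)"
  by (simp add: zeta_eq_sgn abs_mult abs_sgn_eq)

text \<open>Dividing by x powr d reduces this to r <= r powr d on {0..1}, applied to the two parts
  (x - y)/x and y/x of 1.\<close>

lemma powr_diff_le:
  fixes x y :: real assumes "0 \<le> y" "y \<le> x" "0 < d" "d \<le> 1"
  shows "x powr d - y powr d \<le> (x - y) powr d"
proof (cases "x = 0")
  case False
  then have x: "x > 0" using assms by simp
  have u: "r \<le> r powr d" if "0 \<le> r" "r \<le> 1" for r
    using powr_mono'[of d 1 r] that assms by (cases "r = 0") auto
  have "1 = (x - y) / x + y / x" using x by (simp add: field_simps)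
  also have "\<dots> \<le> ((x - y) / x) powr d + (y / x) powr d"
    using assms x by (intro add_mono u) auto
  also have "\<dots> = ((x - y) powr d + y powr d) / x powr d"
    using assms x by (simp add: powr_divide add_divide_distrib)
  finally show ?thesis using x by (simp add: field_simps)
qed (use assms in simp)

text \<open>For arguments of equal sign this is subadditivity of the power. For opposite signs each
  of the two values is bounded by the power of the distance, which produces the factor 2.\<close>

lemma zeta_holder:
  assumes p: "p > 2"
  shows "\<bar>zeta p s - zeta p t\<bar> \<le> 2 * \<bar>s - t\<bar> powr (1 - 2 / p)"
proof -
  define d where "d = 1 - 2 / p"
  have d: "0 < d" "d \<le> 1" using p by (auto simp: d_def)
  have pos: "\<bar>zeta p s - zeta p t\<bar> \<le> 2 * \<bar>s - t\<bar> powr d" if "0 \<le> t" "t \<le> s" for s t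
  proof -
    have "zeta p s = s powr d" "zeta p t = t powr d" using that zeta_eq_sgn[of p] by (auto simp: d_def sgn_if)
    moreover have "s powr d - t powr d \<le> (s - t) powr d" by (rule powr_diff_le[OF that d])
    moreover have "t powr d \<le> s powr d" using that d by (intro powr_mono2) auto
    moreover have "\<bar>s - t\<bar> powr d = (s - t) powr d" "0 \<le> (s - t) powr d" using that by simp_all
    ultimately show ?thesis by argo
  qed
  have mixed: "\<bar>zeta p s - zeta p t\<bar> \<le> 2 * \<bar>s - t\<bar> powr d" if "t \<le> 0" "0 \<le> s" for s t
  proof -
    have "\<bar>zeta p s\<bar> \<le> \<bar>s - t\<bar> powr d" "\<bar>zeta p t\<bar> \<le> \<bar>s - t\<bar> powr d"
      unfolding abs_zeta d_def[symmetric] using that d by (auto intro!: powr_mono2)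
    then show ?thesis by linarith
  qed
  have main: "\<bar>zeta p s - zeta p t\<bar> \<le> 2 * \<bar>s - t\<bar> powr d" if "t \<le> s" for s t
  proof -
    consider "0 \<le> t" | "t \<le> 0" "0 \<le> s" | "s \<le> 0" using that by linarith
    then show ?thesis
    proof cases
      case 3
      then have "\<bar>zeta p (- t) - zeta p (- s)\<bar> \<le> 2 * \<bar>- t - - s\<bar> powr d" using that by (intro pos) auto
      moreover have "\<bar>zeta p (- t) - zeta p (- s)\<bar> = \<bar>zeta p s - zeta p t\<bar>" "\<bar>- t - - s\<bar> = \<bar>s - t\<bar>"
        unfolding zeta_minus by arith+
      ultimately show ?thesis by (simp only:)
    next
      case 1 then show ?thesis using that by (rule pos)
    next
      case 2 then show ?thesis by (rule mixed)
    qed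
  qed
  show ?thesis unfolding d_def[symmetric]
  proof (cases "t \<le> s")
    case True then show "\<bar>zeta p s - zeta p t\<bar> \<le> 2 * \<bar>s - t\<bar> powr d" by (rule main)
  next
    case False
    then have "\<bar>zeta p t - zeta p s\<bar> \<le> 2 * \<bar>t - s\<bar> powr d" by (intro main) simp
    then show "\<bar>zeta p s - zeta p t\<bar> \<le> 2 * \<bar>s - t\<bar> powr d"
      unfolding abs_minus_commute[of s t] abs_minus_commute[of "zeta p s"] .
  qed
qed

text \<open>Up to a factor \<open>zeta\<close> is an antiderivative that stays continuous at the
  singularity, so the fundamental theorem with one exceptional point applies; its Hoelder bound
  gives a value independent of the position of the singularity.\<close>

lemma nn_integral_powr_line:
  fixes c r :: real
  assumes p: "p > 2" and c: "\<bar>c\<bar> \<le> r"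
  shows "(\<integral>\<^sup>+t. ennreal (\<bar>c + t\<bar> powr (- 2 / p)) * indicator {0..1} t \<partial>lborel) \<le> ennreal (2 * inverse (1 - 2 / p) * (r + 1))"
proof -
  define d where "d = 1 - 2 / p"
  have d: "0 < d" "d \<le> 1" using p by (auto simp: d_def)
  have "((\<lambda>t. d * \<bar>c + t\<bar> powr (- 2 / p)) has_integral zeta p (c + 1) - zeta p (c + 0)) {0..1}"
  proof (rule fundamental_theorem_of_calculus_interior_strong[where S = "{- c}"])
    show "continuous_on {0..1} (\<lambda>t. zeta p (c + t))"
      by (rule continuous_on_compose2[OF continuous_on_zeta[OF p, of UNIV]]) (auto intro!: continuous_intros)
    fix t assume "t \<in> {0<..<1} - {- c}"
    then have "c + t \<noteq> 0" by auto
    have "((\<lambda>t. zeta p (c + t)) has_real_derivative (1 - 2 / p) * \<bar>c + t\<bar> powr (- 2 / p) * 1) (at t)"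
    proof (rule DERIV_chain2[where f = "zeta p" and g = "\<lambda>t. c + t"])
      show "(zeta p has_real_derivative (1 - 2 / p) * \<bar>c + t\<bar> powr (- 2 / p)) (at (c + t))"
        by (rule zeta_deriv[OF \<open>c + t \<noteq> 0\<close>])
    qed (auto intro!: derivative_eq_intros)
    then show "((\<lambda>t. zeta p (c + t)) has_vector_derivative d * \<bar>c + t\<bar> powr (- 2 / p)) (at t)"
      by (simp add: has_real_derivative_iff_has_vector_derivative[symmetric] d_def)
  qed auto
  then have "((\<lambda>t. inverse d * (d * \<bar>c + t\<bar> powr (- 2 / p))) has_integral inverse d * (zeta p (c + 1) - zeta p c)) {0..1}"
    by (intro has_integral_mult_right) simp
  then have "((\<lambda>t. \<bar>c + t\<bar> powr (- 2 / p)) has_integral inverse d * (zeta p (c + 1) - zeta p c)) {0..1}"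
    using d by (simp add: mult.assoc[symmetric])
  then have "((\<lambda>t. indicator {0..1} t * \<bar>c + t\<bar> powr (- 2 / p)) has_integral inverse d * (zeta p (c + 1) - zeta p c)) UNIV"
  proof -
    assume "((\<lambda>t. \<bar>c + t\<bar> powr (- 2 / p)) has_integral inverse d * (zeta p (c + 1) - zeta p c)) {0..1}"
    moreover have "(\<lambda>t. indicator {0..1} t * \<bar>c + t\<bar> powr (- 2 / p)) = (\<lambda>t. if t \<in> {0..1} then \<bar>c + t\<bar> powr (- 2 / p) else 0)"
      by auto
    ultimately show ?thesis by (simp only: has_integral_restrict_UNIV)
  qed
  then have A: "(\<integral>\<^sup>+t. ennreal (indicator {0..1} t * \<bar>c + t\<bar> powr (- 2 / p)) \<partial>lborel) = ennreal (inverse d * (zeta p (c + 1) - zeta p c))"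
    by (intro nn_integral_has_integral_lborel) auto
  have B: "(\<integral>\<^sup>+t. ennreal (indicator {0..1} t * \<bar>c + t\<bar> powr (- 2 / p)) \<partial>lborel) = (\<integral>\<^sup>+t. ennreal (\<bar>c + t\<bar> powr (- 2 / p)) * indicator {0..1} t \<partial>lborel)"
    by (intro nn_integral_cong) (auto split: split_indicator)
  have C: "inverse d * (zeta p (c + 1) - zeta p c) \<le> 2 * inverse d * (r + 1)"
  proof -
    have "zeta p (c + 1) - zeta p c \<le> 2 * \<bar>c + 1 - c\<bar> powr (1 - 2 / p)" using zeta_holder[OF p, of "c + 1" c] by linarith
    also have "\<dots> \<le> 2 * (r + 1)" using c by simp
    finally have "inverse d * (zeta p (c + 1) - zeta p c) \<le> inverse d * (2 * (r + 1))" using d by (intro mult_left_mono) auto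
    then show ?thesis by (simp add: mult_ac)
  qed
  show ?thesis unfolding B[symmetric] A d_def[symmetric] by (rule ennreal_leI[OF C])
qed

lemma nn_integral_powr_hyperplane:
  fixes a :: "'n::finite"
  assumes p: "p > 2" and B: "B \<in> sets borel" "B \<subseteq> ball 0 r"
  shows "(\<integral>\<^sup>+x. ennreal (\<bar>x $ a\<bar> powr (- 2 / p)) * indicator B x \<partial>lborel) < \<infinity>"
proof -
  note [measurable] = B(1)
  let ?f = "\<lambda>x :: real ^ 'n. ennreal (\<bar>x $ a\<bar> powr (- 2 / p)) * indicator B x"
  have "(\<lambda>x :: real ^ 'n. x $ a) \<in> borel_measurable borel"
    by (intro borel_measurable_continuous_onI continuous_intros)
  then have m: "?f \<in> borel_measurable borel" by measurable
  let ?K = "ennreal (2 * inverse (1 - 2 / p) * (r + 1 + 1))"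
  have "(\<integral>\<^sup>+x. ?f x \<partial>lborel) = (\<integral>\<^sup>+x. (\<integral>\<^sup>+t. ?f (x + t *\<^sub>R axis a 1) * indicator {0..1} t \<partial>lborel) \<partial>lborel)"
    using nn_integral_lines[OF m, of "{0..1}" "axis a 1"] by simp
  also have "\<dots> \<le> (\<integral>\<^sup>+x. ?K * indicator (ball (0 :: real ^ 'n) (r + 1)) x \<partial>lborel)"
  proof (rule nn_integral_mono)
    fix x :: "real ^ 'n"
    show "(\<integral>\<^sup>+t. ?f (x + t *\<^sub>R axis a 1) * indicator {0..1} t \<partial>lborel) \<le> ?K * indicator (ball 0 (r + 1)) x"
    proof (cases "norm x < r + 1")
      case True
      have "\<bar>x $ a\<bar> \<le> r + 1" using True component_le_norm_cart[of x a] by linarith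
      have "(\<integral>\<^sup>+t. ?f (x + t *\<^sub>R axis a 1) * indicator {0..1} t \<partial>lborel) \<le> (\<integral>\<^sup>+t. ennreal (\<bar>x $ a + t\<bar> powr (- 2 / p)) * indicator {0..1} t \<partial>lborel)"
        by (intro nn_integral_mono) (auto simp: axis_def split: split_indicator)
      also have "\<dots> \<le> ?K" by (rule nn_integral_powr_line[OF p \<open>\<bar>x $ a\<bar> \<le> r + 1\<close>])
      finally show ?thesis using True by simp
    next
      case False
      have z: "?f (x + t *\<^sub>R axis a 1) * indicator {0..1} t = 0" for t
      proof (cases "t \<in> {0..1}")
        case True
        have "norm x \<le> norm (x + t *\<^sub>R axis a 1) + norm (t *\<^sub>R axis a (1 :: real) :: real ^ 'n)"
          using norm_triangle_ineq4[of "x + t *\<^sub>R axis a 1" "t *\<^sub>R axis a 1"] by simp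
        then have "r \<le> norm (x + t *\<^sub>R axis a 1)" using True False by (simp add: norm_axis_1)
        then have "x + t *\<^sub>R axis a 1 \<notin> B" using B(2) by auto
        then show ?thesis by simp
      qed simp
      show ?thesis unfolding z by simp
    qed
  qed
  also have "\<dots> = ?K * emeasure lborel (ball (0 :: real ^ 'n) (r + 1))" by (simp add: nn_integral_cmult_indicator)
  also have "\<dots> < \<infinity>" using emeasure_lborel_ball_finite[of "0 :: real ^ 'n" "r + 1"] by (simp add: ennreal_mult_less_top)
  finally show ?thesis .
qed

section \<open>Null zero sets, and Hausdorff measure of a flat piece\<close>

lemma countable_isolated_zeros:
  fixes T :: "real set"
  assumes "\<And>t. t \<in> T \<Longrightarrow> \<exists>\<epsilon>>0. \<forall>s. s \<noteq> t \<and> \<bar>s - t\<bar> < \<epsilon> \<longrightarrow> s \<notin> T"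
  shows "countable T"
proof -
  have "\<exists>q1 q2 :: rat. of_rat q1 < t \<and> t < of_rat q2 \<and> (\<forall>s\<in>T. of_rat q1 < s \<and> s < of_rat q2 \<longrightarrow> s = t)" if t: "t \<in> T" for t
  proof -
    obtain \<epsilon> where \<epsilon>: "\<epsilon> > 0" "\<And>s. s \<noteq> t \<Longrightarrow> \<bar>s - t\<bar> < \<epsilon> \<Longrightarrow> s \<notin> T" using assms[OF t] by auto
    obtain q1 where q1: "t - \<epsilon> < of_rat q1" "of_rat q1 < t" using of_rat_dense[of "t - \<epsilon>" t] \<epsilon>(1) by auto
    obtain q2 where q2: "t < of_rat q2" "of_rat q2 < t + \<epsilon>" using of_rat_dense[of t "t + \<epsilon>"] \<epsilon>(1) by auto
    have "s = t" if "s \<in> T" "of_rat q1 < s" "s < of_rat q2" for s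
    proof (rule ccontr)
      assume "s \<noteq> t"
      moreover have "\<bar>s - t\<bar> < \<epsilon>" using that q1 q2 by linarith
      ultimately show False using \<epsilon>(2) that(1) by blast
    qed
    then show ?thesis using q1 q2 by (intro exI[of _ q1] exI[of _ q2]) auto
  qed
  then obtain q1 q2 :: "real \<Rightarrow> rat" where q: "\<And>t. t \<in> T \<Longrightarrow> of_rat (q1 t) < t \<and> t < of_rat (q2 t) \<and> (\<forall>s\<in>T. of_rat (q1 t) < s \<and> s < of_rat (q2 t) \<longrightarrow> s = t)"
    by metis
  have "inj_on (\<lambda>t. (q1 t, q2 t)) T"
  proof (rule inj_onI)
    fix s t assume "s \<in> T" "t \<in> T" "(q1 s, q2 s) = (q1 t, q2 t)"
    then show "s = t" using q[of s] q[of t] by auto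
  qed
  then show ?thesis by (rule countableI')
qed

text \<open>Along direction i every such zero is isolated. This will discard the points where v and
  its boundary extension coincide while their gradients do not.\<close>

lemma zero_set_null:
  fixes W :: "real ^ 'n::finite \<Rightarrow> real"
  assumes S: "open S" and W: "\<And>x. x \<in> S \<Longrightarrow> W differentiable (at x)" and c: "continuous_on S (pdiff i W)"
  shows "{x \<in> S. W x = 0 \<and> pdiff i W x \<noteq> 0} \<in> null_sets lborel"
proof (rule null_set_lines[where e = "axis i 1"])
  have cW: "continuous_on S W"
    using W by (meson continuous_at_imp_continuous_on differentiable_imp_continuous_within)
  have o: "open (S \<inter> W -` (- {0}))" "open (S \<inter> pdiff i W -` (- {0}))"
    using continuous_open_preimage[OF cW S, of "- {0}"] continuous_open_preimage[OF c S, of "- {0}"] by auto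
  have "{x \<in> S. W x = 0 \<and> pdiff i W x \<noteq> 0} = (S \<inter> pdiff i W -` (- {0})) - (S \<inter> W -` (- {0}))" by auto
  then show "{x \<in> S. W x = 0 \<and> pdiff i W x \<noteq> 0} \<in> sets borel" using o by simp
  show "countable {t. x + t *\<^sub>R axis i 1 \<in> {x \<in> S. W x = 0 \<and> pdiff i W x \<noteq> 0}}" for x
  proof (rule countable_isolated_zeros)
    fix t assume "t \<in> {t. x + t *\<^sub>R axis i 1 \<in> {x \<in> S. W x = 0 \<and> pdiff i W x \<noteq> 0}}"
    then have y: "x + t *\<^sub>R axis i 1 \<in> S" "W (x + t *\<^sub>R axis i 1) = 0" "pdiff i W (x + t *\<^sub>R axis i 1) \<noteq> 0" by auto
    from line_has_vector_derivative[OF has_derivative_grad[OF W[OF y(1)]]]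
    have "((\<lambda>t. W (x + t *\<^sub>R axis i 1)) has_real_derivative pdiff i W (x + t *\<^sub>R axis i 1)) (at t)"
      by (simp add: has_real_derivative_iff_has_vector_derivative grad_def)
    then have "((\<lambda>s. (W (x + s *\<^sub>R axis i 1) - W (x + t *\<^sub>R axis i 1)) / (s - t)) \<longlongrightarrow> pdiff i W (x + t *\<^sub>R axis i 1)) (at t)"
      by (simp add: has_field_derivative_iff)
    from tendsto_imp_eventually_ne[OF this y(3)]
    have "\<forall>\<^sub>F s in at t. W (x + s *\<^sub>R axis i 1) \<noteq> 0" by eventually_elim (use y(2) in auto)
    then obtain \<epsilon> where "\<epsilon> > 0" "\<And>s. s \<noteq> t \<Longrightarrow> dist s t < \<epsilon> \<Longrightarrow> W (x + s *\<^sub>R axis i 1) \<noteq> 0"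
      unfolding eventually_at by auto
    then show "\<exists>\<epsilon>>0. \<forall>s. s \<noteq> t \<and> \<bar>s - t\<bar> < \<epsilon> \<longrightarrow> s \<notin> {t. x + t *\<^sub>R axis i 1 \<in> {x \<in> S. W x = 0 \<and> pdiff i W x \<noteq> 0}}"
      by (intro exI[of _ \<epsilon>]) (auto simp: dist_real_def)
  qed
qed

lemma emeasure_cbox_cart:
  fixes l u :: "real ^ 'n::finite"
  assumes "\<And>i. l $ i \<le> u $ i"
  shows "emeasure lborel (cbox l u) = ennreal (\<Prod>i\<in>UNIV. u $ i - l $ i)"
proof -
  have "cbox l u \<noteq> {}" using assms by (simp add: interval_ne_empty_cart)
  then have "measure lborel (cbox l u) = (\<Prod>i\<in>UNIV. u $ i - l $ i)" by (rule content_cbox_cart)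
  then show ?thesis using emeasure_eq_ennreal_measure[of lborel "cbox l u"] emeasure_lborel_cbox_finite[of l u]
    by (simp add: less_top)
qed

lemma prod_split_coordinate:
  fixes a :: "'n::finite"
  shows "(\<Prod>i\<in>UNIV. if i = a then s else t) = s * t ^ (CARD('n) - 1)"
proof -
  have "(\<Prod>i\<in>UNIV. if i = a then s else t) = s * (\<Prod>i\<in>UNIV - {a}. t)"
    by (subst prod.remove[of UNIV a]) (auto intro!: prod.cong)
  then show ?thesis by (simp add: card_Diff_singleton)
qed

text \<open>Each set of a cover of the flat piece is thickened in direction a to a box of fixed
  height. These boxes cover a cube, so countable subadditivity of Lebesgue measure bounds the sum of
  powers of the diameters from below, uniformly in the cover.\<close>

lemma hausdorff_measure_pos:
  fixes a :: "'n::finite"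
  assumes r: "r > 0" and A: "\<And>x. x \<in> ball 0 r \<Longrightarrow> x $ a = 0 \<Longrightarrow> x \<in> A"
  shows "hausdorff_measure (CARD('n) - 1) A > 0"
proof -
  define k where "k = CARD('n) - 1"
  \<comment> \<open>The sum of the coordinates of a point of the cube is at most n * \<rho> = r/2,
    so its projection to the hyperplane lies in the ball.\<close>
  define \<rho> where "\<rho> = r / (2 * real CARD('n))"
  have \<rho>: "\<rho> > 0" using r by (simp add: \<rho>_def)
  define Z where "Z = cbox (\<chi> i. - \<rho>) (\<chi> i. \<rho> :: real ^ 'n)"
  define \<omega> where "\<omega> = unit_ball_vol (real k)"
  have \<omega>: "\<omega> > 0" by (simp add: \<omega>_def)
  \<comment> \<open>Chosen so that C0 times the volume 2 \<rho> (2 D)^k of a thickened set is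
    exactly \<omega> (D/2)^k, its contribution to the Hausdorff sum.\<close>
  define C0 where "C0 = \<omega> / (2 * \<rho> * 4 ^ k)"
  have C0: "C0 > 0" using \<omega> \<rho> by (simp add: C0_def)
  have Zpos: "ennreal C0 * emeasure lborel Z > 0"
  proof -
    have "emeasure lborel Z = ennreal (\<Prod>i\<in>(UNIV :: 'n set). \<rho> - - \<rho>)"
      unfolding Z_def using \<rho> by (subst emeasure_cbox_cart) auto
    then show ?thesis using C0 \<rho> by (simp add: ennreal_zero_less_mult_iff)
  qed
  have "ennreal C0 * emeasure lborel Z \<le> hausdorff_pre k 1 A"
    unfolding hausdorff_pre_def
  proof (rule Inf_greatest, clarify)
    fix C :: "nat \<Rightarrow> (real ^ 'n) set"
    assume cover: "A \<subseteq> (\<Union>j. C j)" and C: "\<forall>j. bounded (C j) \<and> diameter (C j) \<le> 1"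
    define c where "c j = (SOME x. x \<in> C j)" for j
    have c: "c j \<in> C j" if "C j \<noteq> {}" for j unfolding c_def using that by (simp add: some_in_eq)
    define D where "D j = diameter (C j)" for j
    have D: "D j \<ge> 0" for j using C diameter_ge_0[of "C j"] by (simp add: D_def)
    define Q where "Q j = (if C j = {} then {} else
      cbox (\<chi> i. if i = a then - \<rho> else c j $ i - D j) (\<chi> i. if i = a then \<rho> else c j $ i + D j))" for j
    have trm: "(if C j = {} then 0 else ennreal (\<omega> * (D j / 2) ^ k)) = ennreal C0 * emeasure lborel (Q j)" for j
    proof (cases "C j = {}")
      case False
      have e: "(if i = a then \<rho> else c j $ i + D j) - (if i = a then - \<rho> else c j $ i - D j) = (if i = a then 2 * \<rho> else 2 * D j)" for i
        by simp
      have le: "(if i = a then - \<rho> else c j $ i - D j) \<le> (if i = a then \<rho> else c j $ i + D j)" for i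
        using \<rho> D[of j] by simp
      have "emeasure lborel (Q j) = ennreal (\<Prod>i\<in>UNIV. if i = a then 2 * \<rho> else 2 * D j)"
        unfolding Q_def if_not_P[OF False] by (subst emeasure_cbox_cart) (use le in \<open>auto simp only: vec_lambda_beta e\<close>)
      also have "\<dots> = ennreal (2 * \<rho> * (2 * D j) ^ k)" unfolding k_def by (simp only: prod_split_coordinate)
      finally have eQ: "emeasure lborel (Q j) = ennreal (2 * \<rho> * (2 * D j) ^ k)" .
      have "ennreal C0 * emeasure lborel (Q j) = ennreal (C0 * (2 * \<rho> * (2 * D j) ^ k))"
        unfolding eQ using C0 \<rho> D[of j] by (intro ennreal_mult[symmetric] mult_nonneg_nonneg zero_le_power) auto
      also have "C0 * (2 * \<rho> * (2 * D j) ^ k) = \<omega> * (D j / 2) ^ k"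
      proof -
        have "(2 * D j) ^ k = (4 * (D j / 2)) ^ k" by simp
        also have "\<dots> = 4 ^ k * (D j / 2) ^ k" by (rule power_mult_distrib)
        finally have D4: "(2 * D j) ^ k = 4 ^ k * (D j / 2) ^ k" .
        show ?thesis unfolding D4 C0_def using \<rho> by (simp add: field_simps del: power_divide)
      qed
      finally show ?thesis using False by simp
    qed (simp add: Q_def)
    have "Z \<subseteq> (\<Union>j. Q j)"
    proof
      fix x assume x: "x \<in> Z"
      define y where "y = (\<chi> i. if i = a then 0 else x $ i)"
      have "\<bar>x $ i\<bar> \<le> \<rho>" for i using x unfolding Z_def mem_box_cart by (simp add: abs_le_iff minus_le_iff)
      then have "\<bar>y $ i\<bar> \<le> \<rho>" for i using \<rho> by (simp add: y_def)
      then have "norm y \<le> (\<Sum>i\<in>(UNIV :: 'n set). \<rho>)" by (intro order_trans[OF norm_le_l1_cart] sum_mono)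
      also have "\<dots> < r" using r by (simp add: \<rho>_def)
      finally have "y \<in> A" by (intro A) (auto simp: y_def)
      then obtain j where j: "y \<in> C j" using cover by blast
      have dist: "\<bar>y $ i - c j $ i\<bar> \<le> D j" for i
      proof -
        have "\<bar>(y - c j) $ i\<bar> \<le> norm (y - c j)" by (rule component_le_norm_cart)
        also have "\<dots> \<le> D j" unfolding D_def dist_norm[symmetric]
          using C j c[of j] by (intro diameter_bounded_bound) auto
        finally show ?thesis by simp
      qed
      have "x \<in> Q j"
      proof -
        have ne: "C j \<noteq> {}" using j by auto
        have off: "c j $ i - D j \<le> x $ i \<and> x $ i \<le> c j $ i + D j" if "i \<noteq> a" for i
        proof -
          have "y $ i = x $ i" using that by (simp add: y_def)
          then show ?thesis using dist[of i] by linarith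
        qed
        have on: "- \<rho> \<le> x $ a \<and> x $ a \<le> \<rho>" using x by (simp add: Z_def mem_box_cart)
        show ?thesis unfolding Q_def if_not_P[OF ne] mem_box_cart vec_lambda_beta
        proof
          fix i show "(if i = a then - \<rho> else c j $ i - D j) \<le> x $ i \<and> x $ i \<le> (if i = a then \<rho> else c j $ i + D j)"
          proof (cases "i = a")
            case True
            show ?thesis unfolding True if_P[OF refl] by (rule on)
          next
            case False
            show ?thesis unfolding if_not_P[OF False] by (rule off[OF False])
          qed
        qed
      qed
      then show "x \<in> (\<Union>j. Q j)" by blast
    qed
    have Qb: "Q j \<in> sets lborel" for j by (cases "C j = {}") (simp_all add: Q_def)
    then have Qs: "range Q \<subseteq> sets lborel" by blast
    have "emeasure lborel Z \<le> emeasure lborel (\<Union>j. Q j)"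
      by (rule emeasure_mono[OF \<open>Z \<subseteq> _\<close> sets.countable_UN[OF Qs]])
    also have "\<dots> \<le> (\<Sum>j. emeasure lborel (Q j))" by (rule emeasure_subadditive_countably[OF Qs])
    finally have "ennreal C0 * emeasure lborel Z \<le> ennreal C0 * (\<Sum>j. emeasure lborel (Q j))" by (rule mult_left_mono) simp
    also have "\<dots> = (\<Sum>j. ennreal C0 * emeasure lborel (Q j))" by (rule ennreal_suminf_cmult[symmetric])
    also have "\<dots> = (\<Sum>j. if C j = {} then 0 else ennreal (unit_ball_vol (real k) * (diameter (C j) / 2) ^ k))"
      by (rule suminf_cong) (rule trm[unfolded D_def \<omega>_def, symmetric])
    finally show "ennreal C0 * emeasure lborel Z \<le> (\<Sum>j. if C j = {} then 0 else ennreal (unit_ball_vol (real k) * (diameter (C j) / 2) ^ k))" .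
  qed
  also have "\<dots> \<le> hausdorff_measure k A"
    unfolding hausdorff_measure_def by (rule SUP_upper) simp
  finally show ?thesis using Zpos unfolding k_def by simp
qed

section \<open>The field of the singular solution\<close>

lemma bounded_continuous_integrable_on:
  fixes f :: "real ^ 'n::finite \<Rightarrow> 'b::euclidean_space"
  assumes "open \<Omega>" "bounded \<Omega>" "continuous_on \<Omega> f" "\<And>x. x \<in> \<Omega> \<Longrightarrow> norm (f x) \<le> B"
  shows "integrable (lebesgue_on \<Omega>) f"
proof -
  have m: "\<Omega> \<in> sets lebesgue" using assms(1) by auto
  have fin: "emeasure lebesgue \<Omega> < \<infinity>"
    using fmeasurableD2[OF lmeasurable_open[OF assms(2,1)]] by (simp only: less_top infinity_ennreal_def)
  have meas: "f \<in> borel_measurable (lebesgue_on \<Omega>)"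
    by (rule continuous_imp_measurable_on_sets_lebesgue[OF assms(3) m])
  have "emeasure (lebesgue_on \<Omega>) (space (lebesgue_on \<Omega>)) = emeasure lebesgue \<Omega>"
    using m by (subst emeasure_restrict_space) auto
  then interpret finite_measure "lebesgue_on \<Omega>"
    using fin by (intro finite_measureI) (simp only: less_top infinity_ennreal_def)
  show ?thesis
    by (rule integrable_const_bound[of _ B]) (use assms(4) meas in auto)
qed

lemma W11_0_diff:
  assumes \<Omega>: "open \<Omega>" and u: "u \<in> W11_0 \<Omega>" and v: "v \<in> W11_0 \<Omega>"
  shows "(\<lambda>x. u x - v x) \<in> W11_0 \<Omega>"
proof -
  have "u \<in> W11 \<Omega>" "v \<in> W11 \<Omega>" using u v unfolding W11_0_def by auto
  note U = W11D[OF \<Omega> this(1)] and V = W11D[OF \<Omega> this(2)]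
  obtain \<phi> where \<phi>: "\<And>k :: nat. \<phi> k \<in> test_functions \<Omega>"
    and la: "(\<lambda>k. LINT x|lebesgue_on \<Omega>. \<bar>u x - \<phi> k x\<bar>) \<longlonglongrightarrow> 0"
    and lb: "(\<lambda>k. LINT x|lebesgue_on \<Omega>. norm (wgrad \<Omega> u x - grad (\<phi> k) x)) \<longlonglongrightarrow> 0"
    by (rule W11_0E[OF \<Omega> u]) (rule that)
  obtain \<psi> where \<psi>: "\<And>k :: nat. \<psi> k \<in> test_functions \<Omega>"
    and lc: "(\<lambda>k. LINT x|lebesgue_on \<Omega>. \<bar>v x - \<psi> k x\<bar>) \<longlonglongrightarrow> 0"
    and ld: "(\<lambda>k. LINT x|lebesgue_on \<Omega>. norm (wgrad \<Omega> v x - grad (\<psi> k) x)) \<longlonglongrightarrow> 0"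
    by (rule W11_0E[OF \<Omega> v]) (rule that)
  have gd: "grad (\<lambda>x. \<phi> k x - \<psi> k x) x = grad (\<phi> k) x - grad (\<psi> k) x" for k x
    using test_functionsD(4)[OF \<phi>] test_functionsD(4)[OF \<psi>] by (simp add: grad_def vec_eq_iff pdiff_diff)
  have T: "(\<lambda>x. \<phi> k x - \<psi> k x) \<in> test_functions \<Omega>" for k
  proof -
    have sub: "closure {x. \<phi> k x - \<psi> k x \<noteq> 0} \<subseteq> closure {x. \<phi> k x \<noteq> 0} \<union> closure {x. \<psi> k x \<noteq> 0}"
      unfolding closure_Un[symmetric] by (rule closure_mono) auto
    note F = test_functionsD[OF \<phi>[of k]] and G = test_functionsD[OF \<psi>[of k]]
    have "compact (closure {x. \<phi> k x - \<psi> k x \<noteq> 0})"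
      using compact_Int_closed[OF compact_Un[OF F(5) G(5)] closed_closure[of "{x. \<phi> k x - \<psi> k x \<noteq> 0}"]] sub
      by (simp add: Int_absorb1)
    then show ?thesis unfolding test_functions_def
      using smooth_on_diff[OF open_UNIV F(1) G(1)] sub F(6) G(6) by auto
  qed
  have i: "integrable (lebesgue_on \<Omega>) (\<lambda>x. \<bar>u x - \<phi> k x\<bar>)" "integrable (lebesgue_on \<Omega>) (\<lambda>x. \<bar>v x - \<psi> k x\<bar>)"
    "integrable (lebesgue_on \<Omega>) (\<lambda>x. norm (wgrad \<Omega> u x - grad (\<phi> k) x))" "integrable (lebesgue_on \<Omega>) (\<lambda>x. norm (wgrad \<Omega> v x - grad (\<psi> k) x))" for k
    by (intro integrable_abs integrable_norm Bochner_Integration.integrable_diff U(1,2) V(1,2)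
        test_function_weak_gradient(2,3)[OF \<Omega> \<phi>] test_function_weak_gradient(2,3)[OF \<Omega> \<psi>])+
  show ?thesis
  proof (rule W11_0I[OF \<Omega> Bochner_Integration.integrable_diff[OF U(1) V(1)] weak_gradient_diff[OF \<Omega> U(3) V(3)]
        Bochner_Integration.integrable_diff[OF U(2) V(2)] T])
    show "(\<lambda>k. LINT x|lebesgue_on \<Omega>. \<bar>u x - v x - (\<phi> k x - \<psi> k x)\<bar>) \<longlonglongrightarrow> 0"
    proof (rule tendsto_sandwich[OF _ _ tendsto_const])
      show "(\<lambda>k. (LINT x|lebesgue_on \<Omega>. \<bar>u x - \<phi> k x\<bar>) + (LINT x|lebesgue_on \<Omega>. \<bar>v x - \<psi> k x\<bar>)) \<longlonglongrightarrow> 0"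
        using tendsto_add[OF la lc] by simp
      show "\<forall>\<^sub>F k in sequentially. (LINT x|lebesgue_on \<Omega>. \<bar>u x - v x - (\<phi> k x - \<psi> k x)\<bar>)
          \<le> (LINT x|lebesgue_on \<Omega>. \<bar>u x - \<phi> k x\<bar>) + (LINT x|lebesgue_on \<Omega>. \<bar>v x - \<psi> k x\<bar>)"
        unfolding Bochner_Integration.integral_add[OF i(1,2), symmetric]
        by (intro always_eventually allI integral_mono Bochner_Integration.integrable_add i integrable_abs
            Bochner_Integration.integrable_diff U(1) V(1) test_function_weak_gradient(2)[OF \<Omega> \<phi>] test_function_weak_gradient(2)[OF \<Omega> \<psi>]) auto
    qed (auto intro!: always_eventually Bochner_Integration.integral_nonneg)
    show "(\<lambda>k. LINT x|lebesgue_on \<Omega>. norm (wgrad \<Omega> u x - wgrad \<Omega> v x - grad (\<lambda>x. \<phi> k x - \<psi> k x) x)) \<longlonglongrightarrow> 0"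
      unfolding gd
    proof (rule tendsto_sandwich[OF _ _ tendsto_const])
      show "(\<lambda>k. (LINT x|lebesgue_on \<Omega>. norm (wgrad \<Omega> u x - grad (\<phi> k) x)) + (LINT x|lebesgue_on \<Omega>. norm (wgrad \<Omega> v x - grad (\<psi> k) x))) \<longlonglongrightarrow> 0"
        using tendsto_add[OF lb ld] by simp
      have "norm (wgrad \<Omega> u x - wgrad \<Omega> v x - (grad (\<phi> k) x - grad (\<psi> k) x)) \<le>
          norm (wgrad \<Omega> u x - grad (\<phi> k) x) + norm (wgrad \<Omega> v x - grad (\<psi> k) x)" for k x
        using norm_triangle_ineq4[of "wgrad \<Omega> u x - grad (\<phi> k) x" "wgrad \<Omega> v x - grad (\<psi> k) x"] by (simp add: algebra_simps)
      then show "\<forall>\<^sub>F k in sequentially. (LINT x|lebesgue_on \<Omega>. norm (wgrad \<Omega> u x - wgrad \<Omega> v x - (grad (\<phi> k) x - grad (\<psi> k) x)))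
          \<le> (LINT x|lebesgue_on \<Omega>. norm (wgrad \<Omega> u x - grad (\<phi> k) x)) + (LINT x|lebesgue_on \<Omega>. norm (wgrad \<Omega> v x - grad (\<psi> k) x))"
        unfolding Bochner_Integration.integral_add[OF i(3,4), symmetric]
        by (intro always_eventually allI integral_mono Bochner_Integration.integrable_add i integrable_norm
            Bochner_Integration.integrable_diff U(2) V(2) test_function_weak_gradient(3)[OF \<Omega> \<phi>] test_function_weak_gradient(3)[OF \<Omega> \<psi>])
    qed (auto intro!: always_eventually Bochner_Integration.integral_nonneg)
  qed
qed

text \<open>The interface between construction and variational argument: from here on the singular
  solution enters through these properties only.\<close>

locale singular_field =
  fixes p :: real and a b :: "'n::finite" and eps om mm g :: "real ^ 'n \<Rightarrow> real"
  assumes p: "p > 2" and ab: "a \<noteq> b"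
    and sm_eps: "smooth_on (ball 0 4) eps" and sm_om: "smooth_on (ball 0 4) om"
    and sm_mm: "smooth_on (ball 0 4) mm" and sm_g: "smooth_on (ball 0 4) g"
    and rel: "\<And>x. x \<in> ball 0 4 \<Longrightarrow> x $ a = eps x * mm x \<and> mm x > 0 \<and> g x > 0"
    and deriv: "\<And>x. x \<in> ball 0 4 \<Longrightarrow> x $ a \<noteq> 0 \<Longrightarrow> ((\<lambda>x. zeta p (x $ a) * g x) has_derivative
        (\<lambda>h. \<bar>eps x\<bar> powr (- 2 / p) * (cos (om x) * h $ a + sin (om x) * h $ b))) (at x)"
    and divergence: "\<And>x. x \<in> ball 0 4 \<Longrightarrow> pdiff a (\<lambda>x. (1 + (eps x)\<^sup>2) powr (1 / p - 1) * cos (om x)) x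
        + pdiff b (\<lambda>x. (1 + (eps x)\<^sup>2) powr (1 / p - 1) * sin (om x)) x = 0"
begin

abbreviation "\<Omega> \<equiv> dom a"

section \<open>Gradient and Euler field of the singular solution\<close>

definition v :: "real ^ 'n \<Rightarrow> real" where "v x = zeta p (x $ a) * g x"
definition dir :: "real ^ 'n \<Rightarrow> real ^ 'n" where "dir x = cos (om x) *\<^sub>R axis a 1 + sin (om x) *\<^sub>R axis b 1"
definition q :: "real ^ 'n \<Rightarrow> real" where "q x = \<bar>eps x\<bar> powr (- 2 / p)"
text \<open>The classical gradient of v off the hyperplane. On it eps = 0 and
  \<open>0 powr (- 2/p)\<close> is 0, so V takes the value 0 there, on a null set.\<close>

definition V :: "real ^ 'n \<Rightarrow> real ^ 'n" where "V x = q x *\<^sub>R dir x"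
text \<open>Written in terms of eps, it is smooth across the hyperplane;
  \<open>slope p (q x)\<close> would take the wrong value 0 there, because of the default value of
  \<open>q\<close>.\<close>

definition sig :: "real ^ 'n \<Rightarrow> real ^ 'n" where "sig x = (1 + (eps x)\<^sup>2) powr (1 / p - 1) *\<^sub>R dir x"

lemma dir_inner: "dir x \<bullet> h = cos (om x) * h $ a + sin (om x) * h $ b"
  by (simp add: dir_def inner_add_left inner_axis')

lemma norm_dir: "norm (dir x) = 1"
proof -
  have "dir x $ a = cos (om x)" "dir x $ b = sin (om x)" using ab by (auto simp: dir_def axis_def)
  then have "dir x \<bullet> dir x = 1" unfolding dir_inner by simp
  then show ?thesis by (simp add: norm_eq_1)
qed

lemma cl_ball: "closure \<Omega> \<subseteq> ball 0 4" "\<Omega> \<subseteq> ball 0 4" "closure \<Omega> \<subseteq> cball 0 3"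
  using closure_domD(4)[of _ a] closure_subset[of \<Omega>] by force+

lemma bounded_dom: "bounded \<Omega>" using bounded_domain_dom[of a] by (simp add: bounded_domain_def)

lemma compact_cl: "compact (closure \<Omega>)" using bounded_dom by (simp add: compact_closure)

lemma open_strip: "open {x :: real ^ 'n. x $ a \<noteq> 0}"
  by (intro open_Collect_neq continuous_intros)

lemma eps_nz: "x \<in> ball 0 4 \<Longrightarrow> x $ a \<noteq> 0 \<Longrightarrow> eps x \<noteq> 0" using rel[of x] by auto
lemma eps_z: "x \<in> ball 0 4 \<Longrightarrow> x $ a = 0 \<Longrightarrow> eps x = 0" using rel[of x] by auto

lemma v_deriv: "x \<in> ball 0 4 \<Longrightarrow> x $ a \<noteq> 0 \<Longrightarrow> (v has_derivative (\<lambda>h. V x \<bullet> h)) (at x)"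
  using deriv[of x] by (simp add: v_def[abs_def] V_def q_def dir_inner)

lemma q_pos: "x \<in> ball 0 4 \<Longrightarrow> x $ a \<noteq> 0 \<Longrightarrow> q x > 0" using eps_nz by (simp add: q_def)

lemma norm_V: "norm (V x) = q x" by (simp add: V_def norm_dir q_def)

lemma V_zero: "x \<in> ball 0 4 \<Longrightarrow> x $ a = 0 \<Longrightarrow> V x = 0" using eps_z by (simp add: V_def q_def)

lemma sig_eq: "x \<in> ball 0 4 \<Longrightarrow> x $ a \<noteq> 0 \<Longrightarrow> sig x = slope p (q x) *\<^sub>R dir x"
proof -
  assume x: "x \<in> ball 0 4" "x $ a \<noteq> 0"
  have e: "eps x \<noteq> 0" by (rule eps_nz[OF x])
  have "q x powr p = \<bar>eps x\<bar> powr (- 2)" using p by (simp add: q_def powr_powr)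
  also have "\<dots> = inverse ((eps x)\<^sup>2)" using e by (simp add: powr_minus powr_numeral)
  finally have qp: "q x powr p = inverse ((eps x)\<^sup>2)" .
  have pos: "1 + (eps x)\<^sup>2 > 0" by (simp add: add_pos_nonneg)
  have "q x powr p / (1 + q x powr p) = inverse (1 + (eps x)\<^sup>2)"
    unfolding qp using e pos by (simp add: field_simps)
  then have "slope p (q x) = inverse (1 + (eps x)\<^sup>2) powr (1 - 1 / p)" by (simp add: slope_def)
  also have "\<dots> = (1 + (eps x)\<^sup>2) powr (- (1 - 1 / p))" using pos by (simp only: powr_minus inverse_powr)
  finally show ?thesis by (simp add: sig_def)
qed

lemma norm_sig_le: "norm (sig x) \<le> 1"
proof -
  have "(1 + (eps x)\<^sup>2) powr (1 / p - 1) \<le> (1 + (eps x)\<^sup>2) powr 0" using p by (intro powr_mono) auto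
  also have "\<dots> = 1" by (simp add: add_nonneg_eq_0_iff)
  finally show ?thesis by (simp add: sig_def norm_dir)
qed

text \<open>q equals mm powr (2/p) times |x_a| powr (-2/p), and mm is continuous and positive on the
  compact closure. Both singularity and integrability of the gradient are read off from
  this.\<close>

lemma q_bounds:
  obtains c1 c2 where "c1 > 0" "c2 > 0"
    "\<And>x. x \<in> closure \<Omega> \<Longrightarrow> x $ a \<noteq> 0 \<Longrightarrow> c1 * \<bar>x $ a\<bar> powr (- 2 / p) \<le> q x \<and> q x \<le> c2 * \<bar>x $ a\<bar> powr (- 2 / p)"
proof -
  have cont: "continuous_on (closure \<Omega>) mm"
    by (rule continuous_on_subset[OF smooth_on_continuous[OF sm_mm] cl_ball(1)])
  have ne: "closure \<Omega> \<noteq> {}" using zero_in_dom closure_subset by blast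
  obtain xm where xm: "xm \<in> closure \<Omega>" "\<And>y. y \<in> closure \<Omega> \<Longrightarrow> mm xm \<le> mm y"
    using continuous_attains_inf[OF compact_cl ne cont] by blast
  obtain xM where xM: "xM \<in> closure \<Omega>" "\<And>y. y \<in> closure \<Omega> \<Longrightarrow> mm y \<le> mm xM"
    using continuous_attains_sup[OF compact_cl ne cont] by blast
  have mpos: "mm x > 0" if "x \<in> closure \<Omega>" for x using rel cl_ball(1) that by blast
  show thesis
  proof (rule that)
    show "mm xm powr (2 / p) > 0" "mm xM powr (2 / p) > 0" using mpos[OF xm(1)] mpos[OF xM(1)] by simp_all
    fix x assume x: "x \<in> closure \<Omega>" "x $ a \<noteq> 0"
    have m: "mm x > 0" by (rule mpos[OF x(1)])
    have "x $ a = eps x * mm x" using rel cl_ball(1) x(1) by blast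
    then have "\<bar>x $ a\<bar> powr (- 2 / p) = \<bar>eps x\<bar> powr (- 2 / p) * mm x powr (- 2 / p)"
      using m by (simp add: abs_mult powr_mult)
    then have qe: "q x = mm x powr (2 / p) * \<bar>x $ a\<bar> powr (- 2 / p)"
      using m by (simp add: q_def powr_minus)
    have "mm xm powr (2 / p) \<le> mm x powr (2 / p)" "mm x powr (2 / p) \<le> mm xM powr (2 / p)"
      using xm(2)[OF x(1)] xM(2)[OF x(1)] m mpos[OF xm(1)] p by (auto intro!: powr_mono2)
    then show "mm xm powr (2 / p) * \<bar>x $ a\<bar> powr (- 2 / p) \<le> q x \<and> q x \<le> mm xM powr (2 / p) * \<bar>x $ a\<bar> powr (- 2 / p)"
      unfolding qe by (auto intro!: mult_right_mono)
  qed
qed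

lemma cont_dir: "continuous_on (ball 0 4) dir"
  unfolding dir_def[abs_def] by (intro continuous_intros smooth_on_continuous sm_om)

lemma cont_q: "continuous_on (ball 0 4 - {x. x $ a = 0}) q"
  unfolding q_def[abs_def]
  by (rule continuous_on_powr[OF continuous_on_rabs[OF continuous_on_subset[OF smooth_on_continuous[OF sm_eps]]] continuous_on_const])
    (use eps_nz in auto)

lemma cont_V: "continuous_on (ball 0 4 - {x. x $ a = 0}) V"
  unfolding V_def[abs_def] by (intro continuous_on_scaleR cont_q continuous_on_subset[OF cont_dir]) auto

lemma cont_v: "continuous_on (ball 0 4) v"
  unfolding v_def[abs_def]
  by (intro continuous_on_mult smooth_on_continuous[OF sm_g] continuous_on_compose2[OF continuous_on_zeta[OF p, of UNIV]] continuous_intros) auto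

lemma v_nz: "x \<in> ball 0 4 \<Longrightarrow> x $ a \<noteq> 0 \<Longrightarrow> v x \<noteq> 0"
  using rel[of x] by (auto simp: v_def zeta_eq_0_iff)

lemma V_integrable: "integrable (lebesgue_on \<Omega>) V"
proof -
  obtain c1 c2 where c: "c1 > 0" "c2 > 0"
    "\<And>x. x \<in> closure \<Omega> \<Longrightarrow> x $ a \<noteq> 0 \<Longrightarrow> c1 * \<bar>x $ a\<bar> powr (- 2 / p) \<le> q x \<and> q x \<le> c2 * \<bar>x $ a\<bar> powr (- 2 / p)"
    by (rule q_bounds) (rule that)
  define S where "S = \<Omega> \<inter> {x. x $ a \<noteq> 0}"
  have S: "S \<in> sets borel" unfolding S_def using open_Int[OF open_dom open_strip] by auto
  have eq: "indicator \<Omega> x *\<^sub>R V x = indicator S x *\<^sub>R V x" for x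
    using V_zero[of x] cl_ball(2) by (auto simp: S_def split: split_indicator)
  have m: "(\<lambda>x. indicator S x *\<^sub>R V x) \<in> borel_measurable borel"
    by (rule borel_measurable_continuous_on_indicator[OF S continuous_on_subset[OF cont_V]]) (use cl_ball(2) in \<open>auto simp: S_def\<close>)
  have "integrable lborel (\<lambda>x. indicator S x *\<^sub>R V x)"
  proof (rule integrableI_bounded)
    have "(\<integral>\<^sup>+x. ennreal (norm (indicator S x *\<^sub>R V x)) \<partial>lborel) \<le> (\<integral>\<^sup>+x. ennreal c2 * (ennreal (\<bar>x $ a\<bar> powr (- 2 / p)) * indicator S x) \<partial>lborel)"
    proof (rule nn_integral_mono)
      fix x
      show "ennreal (norm (indicator S x *\<^sub>R V x)) \<le> ennreal c2 * (ennreal (\<bar>x $ a\<bar> powr (- 2 / p)) * indicator S x)"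
      proof (cases "x \<in> S")
        case True
        then have "q x \<le> c2 * \<bar>x $ a\<bar> powr (- 2 / p)" using c(3) closure_subset[of \<Omega>] by (auto simp: S_def)
        then show ?thesis using True c(2) by (simp add: norm_V ennreal_mult[symmetric] ennreal_leI)
      qed simp
    qed
    also have "\<dots> = ennreal c2 * (\<integral>\<^sup>+x. ennreal (\<bar>x $ a\<bar> powr (- 2 / p)) * indicator S x \<partial>lborel)"
    proof (rule nn_integral_cmult)
      note [measurable] = S
      have [measurable]: "(\<lambda>x :: real ^ 'n. x $ a) \<in> borel_measurable borel"
        by (intro borel_measurable_continuous_onI continuous_intros)
      show "(\<lambda>x. ennreal (\<bar>x $ a\<bar> powr (- 2 / p)) * indicator S x) \<in> borel_measurable lborel" by measurable
    qed
    also have "\<dots> < \<infinity>"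
      using nn_integral_powr_hyperplane[OF p S, of 4 a] cl_ball(2) by (auto simp: S_def ennreal_mult_less_top)
    finally show "(\<integral>\<^sup>+x. ennreal (norm (indicator S x *\<^sub>R V x)) \<partial>lborel) < \<infinity>" .
  qed (use m in simp)
  then have "integrable lebesgue (\<lambda>x. indicator S x *\<^sub>R V x)" by (subst integrable_completion) (use m in simp_all)
  then show ?thesis using open_dom[of a] by (subst integrable_lebesgue_on_iff) (auto simp: eq)
qed

lemma bounded_on_cl:
  fixes f :: "real ^ 'n \<Rightarrow> 'b::real_normed_vector"
  assumes "continuous_on (closure \<Omega>) f"
  obtains B where "B > 0" "\<And>x. x \<in> closure \<Omega> \<Longrightarrow> norm (f x) \<le> B"
proof -
  have "bounded (f ` closure \<Omega>)" by (rule compact_imp_bounded[OF compact_continuous_image[OF assms compact_cl]])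
  then obtain B where "\<And>x. x \<in> closure \<Omega> \<Longrightarrow> norm (f x) \<le> B" unfolding bounded_iff by auto
  then show thesis using that[of "max B 1"] by fastforce
qed

lemma v_integrable: "integrable (lebesgue_on \<Omega>) v"
proof -
  obtain B where B: "B > 0" "\<And>x. x \<in> closure \<Omega> \<Longrightarrow> norm (v x) \<le> B"
    by (rule bounded_on_cl[OF continuous_on_subset[OF cont_v cl_ball(1)]]) (rule that)
  show ?thesis
    by (rule bounded_continuous_integrable_on[OF open_dom bounded_dom continuous_on_subset[OF cont_v cl_ball(2)], of B])
      (use B closure_subset[of \<Omega>] in auto)
qed

lemma weak_gradient_v: "weak_gradient \<Omega> v V"
proof (rule weak_gradientI[OF open_dom continuous_on_subset[OF cont_v cl_ball(2)] v_integrable _ V_integrable])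
  show "continuous_on (\<Omega> - {x. x $ a = 0}) V" by (rule continuous_on_subset[OF cont_V]) (use cl_ball(2) in auto)
  show "(v has_derivative (\<lambda>h. V x \<bullet> h)) (at x)" if "x \<in> \<Omega>" "x $ a \<noteq> 0" for x
    using v_deriv that cl_ball(2) by blast
qed

lemma v_W11: "v \<in> W11 \<Omega>" unfolding W11_def using v_integrable weak_gradient_v V_integrable by blast

lemma wgrad_v: "AE x in lebesgue_on \<Omega>. wgrad \<Omega> v x = V x"
  by (rule wgrad_AE[OF open_dom weak_gradient_v])

lemma smooth_near_closure:
  assumes U: "open U" "closure \<Omega> \<subseteq> U" and s: "smooth_on U s"
  shows "weak_gradient \<Omega> s (grad s)" "integrable (lebesgue_on \<Omega>) s" "integrable (lebesgue_on \<Omega>) (grad s)"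
proof -
  have sub: "\<Omega> \<subseteq> U" using U(2) closure_subset by blast
  obtain B1 where B1: "\<And>x. x \<in> closure \<Omega> \<Longrightarrow> norm (s x) \<le> B1"
    by (rule bounded_on_cl[OF continuous_on_subset[OF smooth_on_continuous[OF s] U(2)]]) (rule that)
  obtain B2 where B2: "\<And>x. x \<in> closure \<Omega> \<Longrightarrow> norm (grad s x) \<le> B2"
    by (rule bounded_on_cl[OF continuous_on_subset[OF smooth_on_grad_continuous[OF s] U(2)]]) (rule that)
  have c: "continuous_on \<Omega> s" "continuous_on \<Omega> (grad s)"
    using continuous_on_subset[OF smooth_on_continuous[OF s] sub] continuous_on_subset[OF smooth_on_grad_continuous[OF s] sub] .
  show i: "integrable (lebesgue_on \<Omega>) s" "integrable (lebesgue_on \<Omega>) (grad s)"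
    using bounded_continuous_integrable_on[OF open_dom bounded_dom c(1), of B1] bounded_continuous_integrable_on[OF open_dom bounded_dom c(2), of B2]
      B1 B2 closure_subset[of \<Omega>] by blast+
  show "weak_gradient \<Omega> s (grad s)"
    by (rule weak_gradientI[OF open_dom c(1) i(1) continuous_on_subset[OF c(2)] i(2), of a])
      (use sub in \<open>auto intro!: has_derivative_grad smooth_on_imp_differentiable[OF s]\<close>)
qed

text \<open>Both components are smooth on a neighbourhood of the closure, so each is its own weakly
  differentiable function; moving the derivative from the test function to the field leaves the
  divergence, which vanishes pointwise.\<close>

lemma sig_test: 
  assumes \<phi>: "\<phi> \<in> test_functions \<Omega>" shows "(LINT x|lebesgue_on \<Omega>. sig x \<bullet> grad \<phi> x) = 0"
proof -
  define s1 where "s1 x = (1 + (eps x)\<^sup>2) powr (1 / p - 1) * cos (om x)" for x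
  define s2 where "s2 x = (1 + (eps x)\<^sup>2) powr (1 / p - 1) * sin (om x)" for x
  have pos: "1 + (eps x)\<^sup>2 \<in> {0<..}" for x by (simp add: add_pos_nonneg)
  have smr: "smooth_on (ball 0 4) (\<lambda>x. (1 + (eps x)\<^sup>2) powr (1 / p - 1))"
    by (intro smooth_on_compose1[OF _ smooth1_powr] smooth_on_add smooth_on_const smooth_on_power sm_eps open_ball pos)
  have sm: "smooth_on (ball 0 4) s1" "smooth_on (ball 0 4) s2" unfolding s1_def[abs_def] s2_def[abs_def]
    by (intro smooth_on_mult smr open_ball smooth_on_compose1[OF _ smooth1_sin_cos(1) sm_om]
        smooth_on_compose1[OF _ smooth1_sin_cos(2) sm_om] UNIV_I)+
  note w = smooth_near_closure(1)[OF open_ball cl_ball(1)]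
  have loc: "locally_integrable \<Omega> s" "locally_integrable \<Omega> (\<lambda>x. grad s x $ i)" if "smooth_on (ball 0 4) s" for s i
    using w[OF that] locally_integrable_nth unfolding weak_gradient_def by blast+
  note D = test_functionsD[OF \<phi>]
  note I = locally_integrable_test[OF open_dom _ D(5,6)]
  have i1: "integrable (lebesgue_on \<Omega>) (\<lambda>x. s1 x * pdiff a \<phi> x)" "integrable (lebesgue_on \<Omega>) (\<lambda>x. s2 x * pdiff b \<phi> x)"
    by (rule I[OF loc(1)[OF sm(1)] D(3) D(8)], assumption, rule I[OF loc(1)[OF sm(2)] D(3) D(8)], assumption)
  have i2: "integrable (lebesgue_on \<Omega>) (\<lambda>x. grad s1 x $ a * \<phi> x)" "integrable (lebesgue_on \<Omega>) (\<lambda>x. grad s2 x $ b * \<phi> x)"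
    by (rule I[OF loc(2)[OF sm(1)] D(2) D(7)], assumption, rule I[OF loc(2)[OF sm(2)] D(2) D(7)], assumption)
  have "sig x \<bullet> grad \<phi> x = s1 x * pdiff a \<phi> x + s2 x * pdiff b \<phi> x" for x
    by (simp add: sig_def dir_inner grad_def s1_def s2_def distrib_left)
  then have "(LINT x|lebesgue_on \<Omega>. sig x \<bullet> grad \<phi> x) = (LINT x|lebesgue_on \<Omega>. s1 x * pdiff a \<phi> x) + (LINT x|lebesgue_on \<Omega>. s2 x * pdiff b \<phi> x)"
    using Bochner_Integration.integral_add[OF i1] by simp
  also have "\<dots> = - ((LINT x|lebesgue_on \<Omega>. grad s1 x $ a * \<phi> x) + (LINT x|lebesgue_on \<Omega>. grad s2 x $ b * \<phi> x))"
    using w[OF sm(1)] w[OF sm(2)] \<phi> unfolding weak_gradient_def by simp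
  also have "(LINT x|lebesgue_on \<Omega>. grad s1 x $ a * \<phi> x) + (LINT x|lebesgue_on \<Omega>. grad s2 x $ b * \<phi> x)
      = (LINT x|lebesgue_on \<Omega>. (grad s1 x $ a + grad s2 x $ b) * \<phi> x)"
    using Bochner_Integration.integral_add[OF i2] by (simp add: distrib_right)
  also have "\<dots> = (LINT x|lebesgue_on \<Omega>. 0)"
  proof (rule Bochner_Integration.integral_cong)
    fix x assume "x \<in> space (lebesgue_on \<Omega>)"
    then have "x \<in> ball 0 4" using cl_ball(2) by auto
    then show "(grad s1 x $ a + grad s2 x $ b) * \<phi> x = 0"
      using divergence[of x] by (simp add: grad_def s1_def[abs_def] s2_def[abs_def])
  qed simp
  finally show ?thesis by simp
qed

lemma sig_measurable: "sig \<in> borel_measurable (lebesgue_on \<Omega>)"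
proof (rule continuous_imp_measurable_on_sets_lebesgue)
  have "1 + (eps x)\<^sup>2 \<noteq> 0" for x using zero_le_power2[of "eps x"] by linarith
  then have "continuous_on (ball 0 4) sig" unfolding sig_def[abs_def]
    by (intro continuous_on_scaleR cont_dir continuous_on_powr continuous_intros smooth_on_continuous[OF sm_eps]) auto
  then show "continuous_on \<Omega> sig" by (rule continuous_on_subset[OF _ cl_ball(2)])
qed (use open_dom[of a] in auto)

end

section \<open>Boundary values\<close>

lemma grad_eq: "(f has_derivative (\<lambda>h. G \<bullet> h)) (at x) \<Longrightarrow> grad f x = G"
  by (simp add: grad_def vec_eq_iff pdiff_eq inner_axis)

lemma AE_lebesgue_on_not_in:
  assumes "N \<in> null_sets lborel" "\<Omega> \<in> sets lebesgue"
  shows "AE x in lebesgue_on \<Omega>. x \<in> \<Omega> \<and> x \<notin> N"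
proof -
  have "AE x in lebesgue. x \<notin> N" by (rule AE_not_in[OF null_sets_completionI[OF assms(1)]])
  then have "AE x in lebesgue. x \<in> \<Omega> \<longrightarrow> x \<in> \<Omega> \<and> x \<notin> N" by eventually_elim blast
  then show ?thesis using assms(2) by (subst AE_restrict_space_iff) auto
qed

text \<open>A smooth dead zone: values in {-1..1} are erased, values beyond 2 in modulus are kept.
  The argument is squared to treat both signs by one step function.\<close>

definition cutoff :: "real \<Rightarrow> real" where "cutoff s = s * smooth_step (s\<^sup>2 - 1)"

lemma smooth1_cutoff: "smooth1 UNIV cutoff"
  unfolding cutoff_def[abs_def] power2_eq_square
  by (intro smooth1_mult smooth1_ident smooth1_compose[OF _ smooth1_smooth_step] smooth1_diff smooth1_const) auto

lemma cutoff_0: "\<bar>s\<bar> \<le> 1 \<Longrightarrow> cutoff s = 0"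
  by (simp add: cutoff_def smooth_step_0 abs_square_le_1)

lemma cutoff_id: "2 \<le> \<bar>s\<bar> \<Longrightarrow> cutoff s = s"
proof -
  assume "2 \<le> \<bar>s\<bar>"
  then have "2\<^sup>2 \<le> \<bar>s\<bar>\<^sup>2" by (intro power_mono) auto
  then show ?thesis by (simp add: cutoff_def smooth_step_1)
qed

lemma cutoff_diff_le: "\<bar>cutoff s - s\<bar> \<le> 2"
proof (cases "2 \<le> \<bar>s\<bar>")
  case False
  have "cutoff s - s = - (s * (1 - smooth_step (s\<^sup>2 - 1)))" by (simp add: cutoff_def algebra_simps)
  moreover have "\<bar>1 - smooth_step (s\<^sup>2 - 1)\<bar> = 1 - smooth_step (s\<^sup>2 - 1)"
    using smooth_step_bounds(2)[of "s\<^sup>2 - 1"] by linarith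
  ultimately have "\<bar>cutoff s - s\<bar> = \<bar>s\<bar> * (1 - smooth_step (s\<^sup>2 - 1))"
    by (simp only: abs_minus_cancel abs_mult)
  also have "\<dots> \<le> \<bar>s\<bar> * 1" using smooth_step_bounds(1)[of "s\<^sup>2 - 1"] by (intro mult_left_mono) auto
  finally show ?thesis using False by simp
qed (simp add: cutoff_id)

lemma cutoff_deriv: "(cutoff has_real_derivative deriv cutoff s) (at s)"
  by (rule smooth1_deriv(1)[OF smooth1_cutoff]) simp

lemma deriv_cutoff_1: "2 < \<bar>s\<bar> \<Longrightarrow> deriv cutoff s = 1"
proof (rule DERIV_unique[OF cutoff_deriv])
  assume s: "2 < \<bar>s\<bar>"
  have "\<forall>\<^sub>F y in nhds s. cutoff y = y"
    unfolding eventually_nhds_metric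
    by (rule exI[of _ "\<bar>s\<bar> - 2"]) (use s in \<open>auto simp: dist_real_def intro!: cutoff_id\<close>)
  then have "(cutoff has_real_derivative 1) (at s) \<longleftrightarrow> ((\<lambda>s. s) has_real_derivative 1) (at s)"
    by (intro DERIV_cong_ev) auto
  then show "(cutoff has_real_derivative 1) (at s)" by simp
qed

lemma deriv_cutoff_bounded: obtains M where "M > 0" "\<And>s. \<bar>deriv cutoff s\<bar> \<le> M"
proof -
  have "continuous_on {-2..2} (deriv cutoff)"
    by (rule continuous_on_subset[OF smooth1_continuous_on[OF smooth1_deriv(2)[OF smooth1_cutoff UNIV_I open_UNIV]]]) simp
  then have "bounded (deriv cutoff ` {-2..2})" by (intro compact_imp_bounded compact_continuous_image) auto
  then obtain B where "\<forall>y\<in>deriv cutoff ` {-2..2}. norm y \<le> B" unfolding bounded_iff by blast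
  then have B: "\<bar>deriv cutoff s\<bar> \<le> B" if "s \<in> {-2..2}" for s using that by simp
  show thesis
  proof (rule that[of "max 1 B"])
    fix s show "\<bar>deriv cutoff s\<bar> \<le> max 1 B"
    proof (cases "2 < \<bar>s\<bar>")
      case False
      then have "s \<in> {-2..2}" by auto
      from B[OF this] show ?thesis by simp
    qed (simp add: deriv_cutoff_1)
  qed simp
qed

text \<open>The scaling shrinks the dead zone to size 1/k while the derivative keeps the same range,
  so gradients of cut-off functions are bounded uniformly in k.\<close>

definition scaled_cutoff :: "real \<Rightarrow> real \<Rightarrow> real" where
  "scaled_cutoff k s = cutoff (k * s) / k"

lemma smooth1_scaled_cutoff: "smooth1 UNIV (scaled_cutoff k)"
  unfolding scaled_cutoff_def[abs_def] divide_inverse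
  by (intro smooth1_mult smooth1_const smooth1_compose[OF _ smooth1_cutoff] smooth1_ident) auto

lemma scaled_cutoff_0: "k > 0 \<Longrightarrow> \<bar>s\<bar> \<le> 1 / k \<Longrightarrow> scaled_cutoff k s = 0"
  by (simp add: scaled_cutoff_def cutoff_0 abs_mult field_simps)

lemma scaled_cutoff_id: "k > 0 \<Longrightarrow> 2 \<le> k * \<bar>s\<bar> \<Longrightarrow> scaled_cutoff k s = s"
  by (simp add: scaled_cutoff_def cutoff_id abs_mult)

lemma scaled_cutoff_diff_le: "k > 0 \<Longrightarrow> \<bar>scaled_cutoff k s - s\<bar> \<le> 2 / k"
proof -
  assume k: "k > 0"
  have "\<bar>scaled_cutoff k s - s\<bar> = \<bar>cutoff (k * s) - k * s\<bar> / k"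
    using k by (simp add: scaled_cutoff_def field_simps)
  also have "\<dots> \<le> 2 / k" using k cutoff_diff_le by (intro divide_right_mono) auto
  finally show ?thesis .
qed

lemma scaled_cutoff_deriv:
  assumes "k > 0" shows "(scaled_cutoff k has_real_derivative deriv cutoff (k * s)) (at s)"
proof -
  have "((\<lambda>s. cutoff (k * s)) has_real_derivative deriv cutoff (k * s) * k) (at s)"
    by (rule DERIV_chain2[OF cutoff_deriv]) (auto intro!: derivative_eq_intros)
  from DERIV_cdivide[OF this, of k] show ?thesis using assms by (simp add: scaled_cutoff_def[abs_def])
qed

text \<open>It is 1 near the lower boundary and 0 from x_a = -1/4 on, so multiplication by it
  restricts v to a region where v is smooth.\<close>

definition eta :: "real \<Rightarrow> real" where "eta t = smooth_step (- 4 * t - 1)"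

lemma eta_1: "t \<le> - 1/2 \<Longrightarrow> eta t = 1" and eta_0: "t \<ge> - 1/4 \<Longrightarrow> eta t = 0"
  by (simp_all add: eta_def smooth_step_1 smooth_step_0)

lemma smooth1_eta: "smooth1 UNIV eta"
  unfolding eta_def[abs_def]
  by (intro smooth1_compose[OF _ smooth1_smooth_step] smooth1_diff smooth1_mult smooth1_const smooth1_ident) auto

lemma smooth1_zeta_pos_neg: "smooth1 {0<..} (zeta p)" "smooth1 {..<0} (zeta p)"
proof -
  show "smooth1 {0<..} (zeta p)"
    by (rule smooth1_cong[OF _ smooth1_powr[of "1 - 2 / p"]]) (auto simp: zeta_eq_sgn)
  have "smooth1 {..<0} (\<lambda>t. - ((- t) powr (1 - 2 / p)))"
    by (intro smooth1_minus smooth1_compose[OF _ smooth1_powr] smooth1_ident) auto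
  then show "smooth1 {..<0} (zeta p)"
    by (rule smooth1_cong[OF open_lessThan]) (simp add: zeta_eq_sgn)
qed

lemma zeta_exp: "zeta p (exp r) = exp (r * (1 - 2 / p))"
  by (simp add: zeta_eq_sgn exp_powr_real)

text \<open>For s < 1/2 the profile is \<open>phi\<close>, and \<open>zeta\<close> turns exp (-1/w)
  into exp (-d/w) with d = 1 - 2/p, so the composition is again a difference of flat functions. For
  s > 1/4 the profile is negative and \<open>zeta\<close> is smooth at its values.\<close>

lemma smooth1_zeta_upper:
  assumes p: "p > 2" shows "smooth1 {..<1} (\<lambda>s. zeta p (upper s))"
proof (rule smooth1_local)
  fix s :: real assume s: "s \<in> {..<1}"
  define d where "d = 1 - 2 / p"
  have d: "d > 0" using p by (simp add: d_def)
  show "\<exists>J g. open J \<and> s \<in> J \<and> smooth1 J g \<and> (\<forall>y\<in>J. zeta p (upper y) = g y)"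
  proof (cases "s < 1/2")
    case True
    have "zeta p (upper y) = flat d (1/4 - y) - flat d (y - 1/4)" if "y < 1/2" for y
    proof -
      have u: "upper y = phi y" using that by (simp add: upper_eq chi_0)
      have e: "zeta p (exp (- 1 / w)) = exp (- d / w)" for w
        unfolding zeta_exp d_def[symmetric] times_divide_eq_left mult_minus1 ..
      consider "y < 1/4" | "y = 1/4" | "y > 1/4" by linarith
      then show ?thesis
      proof cases
        case 1
        then have s: "1/4 - y > 0" "\<not> y - 1/4 > 0" by linarith+
        have f: "flat c (1/4 - y) = exp (- c / (1/4 - y))" "flat c (y - 1/4) = 0" for c
          unfolding flat_def if_P[OF s(1)] if_not_P[OF s(2)] by (rule refl)+
        show ?thesis unfolding u phi_def f diff_0_right e by (rule refl)
      next
        case 3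
        then have s: "y - 1/4 > 0" "\<not> 1/4 - y > 0" by linarith+
        have f: "flat c (y - 1/4) = exp (- c / (y - 1/4))" "flat c (1/4 - y) = 0" for c
          unfolding flat_def if_P[OF s(1)] if_not_P[OF s(2)] by (rule refl)+
        show ?thesis unfolding u phi_def f diff_0 zeta_minus e by (rule refl)
      next
        case 2
        have f: "flat c (1/4 - 1/4) = 0" for c by (simp add: flat_def)
        show ?thesis unfolding u unfolding phi_def unfolding 2 unfolding f by simp
      qed
    qed
    moreover have "smooth1 {..<1/2} (\<lambda>y. flat d (1/4 - y) - flat d (y - 1/4))"
      by (rule smooth1_diff[OF open_lessThan smooth1_flat_comp[OF open_lessThan d smooth1_diff[OF open_lessThan smooth1_const[OF open_lessThan] smooth1_ident[OF open_lessThan]]]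
          smooth1_flat_comp[OF open_lessThan d smooth1_diff[OF open_lessThan smooth1_ident[OF open_lessThan] smooth1_const[OF open_lessThan]]]])
    ultimately show ?thesis using True
      by (intro exI[of _ "{..<1/2}"] exI[of _ "\<lambda>y. flat d (1/4 - y) - flat d (y - 1/4)"] conjI open_lessThan ballI) simp_all
  next
    case False
    have "smooth1 {1/4<..<1} (\<lambda>s. zeta p (upper s))"
      by (rule smooth1_compose[OF _ smooth1_zeta_pos_neg(2) smooth1_subset[OF smooth1_upper]])
        (auto intro!: upper_neg)
    then show ?thesis using s False by (intro exI[of _ "{1/4<..<1}"] exI conjI) auto
  qed
qed

context singular_field
begin

section \<open>Smooth boundary data\<close>

definition lift :: "real ^ 'n \<Rightarrow> real ^ 'n" where
  "lift x = (\<chi> i. if i = a then upper (tsq a x) else x $ i)"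

text \<open>Below, v itself; above, the value of v at the point of the upper boundary over or under
  x, where \<open>zeta\<close> is composed with the flat profile. Both terms equal v on the upper
  boundary, and the lower boundary sees the first term only.\<close>

definition v0 :: "real ^ 'n \<Rightarrow> real" where
  "v0 x = eta (x $ a) * v x + (1 - eta (x $ a)) * (zeta p (upper (tsq a x)) * g (lift x))"

text \<open>A neighbourhood of the closure on which v0 is smooth. The profile is smooth for
  \<open>tsq\<close> < 1; the remaining points of the closure have x_a at most -1, where v0 is
  v.\<close>

definition O0 :: "(real ^ 'n) set" where
  "O0 = ball 0 4 \<inter> ({x. tsq a x < 1} \<union> {x. x $ a < - 1/2})"

lemma open_tsq: "open {x. tsq a x < 1}"
  by (intro open_Collect_less continuous_on_tsq continuous_intros)

lemma open_half: "open {x :: real ^ 'n. x $ a < c}" "open {x :: real ^ 'n. x $ a > c}"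
  by (intro open_Collect_less continuous_intros)+

lemma open_O0: "open O0"
  unfolding O0_def by (intro open_Int open_Un open_tsq open_half open_ball)

lemma smooth_on_v: "smooth_on (ball 0 4 \<inter> {x. x $ a < 0}) v" "smooth_on (ball 0 4 \<inter> {x. x $ a > 0}) v"
proof -
  have *: "open (ball 0 4 \<inter> {x :: real ^ 'n. x $ a < 0})" "open (ball 0 4 \<inter> {x :: real ^ 'n. x $ a > 0})"
    by (intro open_Int open_half open_ball)+
  show "smooth_on (ball 0 4 \<inter> {x. x $ a < 0}) v" "smooth_on (ball 0 4 \<inter> {x. x $ a > 0}) v"
    unfolding v_def[abs_def]
    by (intro smooth_on_mult[OF *(1)] smooth_on_compose1[OF *(1) smooth1_zeta_pos_neg(2)] smooth_on_nth * smooth_on_subset[OF sm_g], auto)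
      (intro smooth_on_mult[OF *(2)] smooth_on_compose1[OF *(2) smooth1_zeta_pos_neg(1)] smooth_on_nth * smooth_on_subset[OF sm_g], auto)
qed

lemma lift_ball: assumes "tsq a x < 1" shows "lift x \<in> ball 0 4"
proof -
  have "tsq a (lift x) = tsq a x" by (rule tsq_cong) (simp add: lift_def)
  then have "(norm (lift x))\<^sup>2 = (upper (tsq a x))\<^sup>2 + tsq a x" by (simp add: norm_sq_tsq[of _ a] lift_def)
  also have "\<dots> < 1 + 1"
  proof -
    have "\<bar>upper (tsq a x)\<bar> \<le> 1" using upper_bounds[of "tsq a x"] tsq_nonneg[of a x] assms by linarith
    then have "(upper (tsq a x))\<^sup>2 \<le> 1" by (simp only: abs_square_le_1)
    then show ?thesis using assms by linarith
  qed
  also have "(1 :: real) + 1 < 4\<^sup>2" by simp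
  finally have "norm (lift x) < 4" by (rule power_less_imp_less_base) simp
  then show ?thesis by simp
qed

lemma smooth_on_v0: "smooth_on O0 v0"
proof (rule smooth_on_local)
  fix x assume x: "x \<in> O0"
  show "\<exists>W h. open W \<and> x \<in> W \<and> smooth_on W h \<and> (\<forall>y\<in>W. v0 y = h y)"
  proof (cases "x $ a < - 1/2")
    case True
    have "smooth_on (ball 0 4 \<inter> {x. x $ a < - 1/2}) v"
      by (rule smooth_on_subset[OF smooth_on_v(1)]) auto
    moreover have "open (ball 0 4 \<inter> {x :: real ^ 'n. x $ a < - 1/2})" by (intro open_Int open_half open_ball)
    ultimately show ?thesis using True x
      by (intro exI[of _ "ball 0 4 \<inter> {x. x $ a < - 1/2}"] exI[of _ v]) (auto simp: v0_def eta_1 O0_def)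
  next
    case False
    define W where "W = ball 0 4 \<inter> {x. tsq a x < 1}"
    have W: "open W" unfolding W_def by (intro open_Int open_tsq open_ball)
    have xW: "x \<in> W" using x False by (auto simp: W_def O0_def)
    have e: "smooth_on U (\<lambda>x. eta (x $ a))" if "open U" for U :: "(real ^ 'n) set"
      by (rule smooth_on_compose1[OF that smooth1_eta smooth_on_nth[OF that]]) simp
    have z: "smooth_on W (\<lambda>x. zeta p (upper (tsq a x)))"
      by (rule smooth_on_compose1[OF W smooth1_zeta_upper[OF p] smooth_on_tsq[OF W]]) (auto simp: W_def)
    have up: "smooth_on W (\<lambda>x. upper (tsq a x))"
      by (rule smooth_on_compose1[OF W smooth1_upper smooth_on_tsq[OF W]]) (auto simp: W_def)
    have gl: "smooth_on W (\<lambda>x. g (lift x))" unfolding lift_def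
    proof (rule smooth_on_compose[OF W sm_g])
      show "smooth_on W (\<lambda>x. if k = a then upper (tsq a x) else x $ k)" for k
        using up smooth_on_nth[OF W, of k] by (cases "k = a") simp_all
      show "(\<chi> k. if k = a then upper (tsq a x) else x $ k) \<in> ball 0 4" if "x \<in> W" for x
        using lift_ball[of x] that by (simp add: W_def lift_def)
    qed
    have ev: "smooth_on W (\<lambda>x. eta (x $ a) * v x)"
    proof (rule smooth_on_local)
      fix y assume y: "y \<in> W"
      show "\<exists>X h. open X \<and> y \<in> X \<and> smooth_on X h \<and> (\<forall>z\<in>X. eta (z $ a) * v z = h z)"
      proof (cases "y $ a < 0")
        case True
        have o: "open (ball 0 4 \<inter> {x :: real ^ 'n. x $ a < 0})" by (intro open_Int open_half open_ball)
        show ?thesis using True y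
          by (intro exI[of _ "ball 0 4 \<inter> {x. x $ a < 0}"] exI[of _ "\<lambda>x. eta (x $ a) * v x"] conjI o smooth_on_mult e smooth_on_v)
            (auto simp: W_def)
      next
        case False
        have o: "open {x :: real ^ 'n. x $ a > - 1/4}" by (rule open_half)
        show ?thesis using False
          by (intro exI[of _ "{x. x $ a > - 1/4}"] exI[of _ "\<lambda>x. 0"] conjI o smooth_on_const) (auto simp: eta_0)
      qed
    qed
    have "smooth_on W v0" unfolding v0_def[abs_def]
      by (rule smooth_on_add[OF W ev smooth_on_mult[OF W smooth_on_diff[OF W smooth_on_const[OF W] e[OF W]] smooth_on_mult[OF W z gl]]])
    then show ?thesis using W xW by blast
  qed
qed

lemma cl_O0: "closure \<Omega> \<subseteq> O0"
proof
  fix x assume x: "x \<in> closure \<Omega>"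
  note D = closure_domD[OF x]
  have "x $ a < - 1/2" if "\<not> tsq a x < 1"
  proof -
    have "tsq a x = 1" using D(1) that by simp
    then have "upper (tsq a x) = - 1" using shear_1[of 1] by (simp add: upper_def)
    then show ?thesis using D(3) by simp
  qed
  then show "x \<in> O0" using D(4) unfolding O0_def by force
qed

lemma v0_smooth_closure: "v0 \<in> smooth_closure \<Omega>"
proof -
  have "smooth_on \<Omega> v0" using smooth_on_subset[OF smooth_on_v0] cl_O0 closure_subset by blast
  moreover have c: "continuous_on (closure \<Omega>) (pdiffs is v0)" for "is"
    by (rule continuous_on_subset[OF smooth_on_continuous[OF smooth_on_pdiffs[OF smooth_on_v0]] cl_O0])
  ultimately show ?thesis unfolding smooth_closure_def
    using c[of "[]"] c by auto
qed

lemma v0_frontier: assumes "x \<in> frontier \<Omega>" shows "v0 x = v x"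
proof -
  define s where "s = tsq a x"
  have eq: "(x $ a - shear s)\<^sup>2 + s = 1" using assms frontier_dom[of a] by (auto simp: s_def)
  have s: "0 \<le> s" "s \<le> 1" using eq tsq_nonneg[of a x] zero_le_power2[of "x $ a - shear s"] unfolding s_def by linarith+
  have "\<bar>x $ a - shear s\<bar> = sqrt (1 - s)" using eq by (metis add_diff_cancel_right' real_sqrt_abs)
  then consider "x $ a = upper s" | "x $ a = shear s - sqrt (1 - s)" by (auto simp: upper_def abs_if split: if_splits)
  then show ?thesis
  proof cases
    case 1
    then have "lift x = x" by (auto simp: lift_def vec_eq_iff s_def)
    then show ?thesis using 1 by (simp add: v0_def v_def s_def[symmetric] left_diff_distrib)
  next
    case 2
    then have "x $ a \<le> - 1/2" using lower_le[OF s] by linarith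
    then show ?thesis by (simp add: v0_def eta_1)
  qed
qed

section \<open>Zero trace of the difference of v and v0\<close>

lemmas v0_weak = smooth_near_closure[OF open_O0 cl_O0 smooth_on_v0]

text \<open>Cutting off \<open>v\<close> near \<open>0\<close> first makes the inner difference smooth across \<open>{x. x $ a = 0}\<close>;
  the outer cutoff then has compact support, since \<open>v = v0\<close> on the boundary.\<close>

definition approx :: "nat \<Rightarrow> real ^ 'n \<Rightarrow> real" where
  "approx n x = (let k = real (Suc n) in
     if x \<in> \<Omega> then scaled_cutoff k (scaled_cutoff (4 * k) (v x) - v0 x) else 0)"

lemma cont_v_v0: "continuous_on (closure \<Omega>) (\<lambda>x. \<bar>v x - v0 x\<bar>)"
  by (intro continuous_on_rabs continuous_on_diff continuous_on_subset[OF cont_v cl_ball(1)]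
      continuous_on_subset[OF smooth_on_continuous[OF smooth_on_v0] cl_O0])

text \<open>v is continuous and zero on the hyperplane, so the dead zone of the cutoff contains its
  values on a neighbourhood, and there the composition is 0; elsewhere v is smooth.\<close>

lemma smooth_on_cutoff_v:
  assumes k: "k > 0" shows "smooth_on (ball 0 4) (\<lambda>x. scaled_cutoff k (v x))"
proof (rule smooth_on_local)
  fix x :: "real ^ 'n" assume x: "x \<in> ball 0 4"
  have sm: "smooth_on U (\<lambda>x. scaled_cutoff k (v x))" if "smooth_on U v" "open U" for U
    by (rule smooth_on_compose1[OF that(2) smooth1_scaled_cutoff that(1)]) simp
  have o: "open (ball 0 4 \<inter> {x :: real ^ 'n. x $ a < 0})" "open (ball 0 4 \<inter> {x :: real ^ 'n. x $ a > 0})"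
    by (intro open_Int open_half open_ball)+
  consider "x $ a < 0" | "x $ a > 0" | "x $ a = 0" by linarith
  then show "\<exists>W h. open W \<and> x \<in> W \<and> smooth_on W h \<and> (\<forall>y\<in>W. scaled_cutoff k (v y) = h y)"
  proof cases
    case 1
    have "x \<in> ball 0 4 \<inter> {x. x $ a < 0}" using 1 x by simp
    then show ?thesis using o(1) sm[OF smooth_on_v(1) o(1)] by blast
  next
    case 2
    have "x \<in> ball 0 4 \<inter> {x. x $ a > 0}" using 2 x by simp
    then show ?thesis using o(2) sm[OF smooth_on_v(2) o(2)] by blast
  next
    case 3
    define W where "W = ball 0 4 \<inter> v -` ball 0 (1 / k)"
    have W: "open W" unfolding W_def by (rule continuous_open_preimage[OF cont_v open_ball open_ball])
    have "v x = 0" using 3 by (simp add: v_def)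
    then have "x \<in> W" using x k by (simp add: W_def)
    moreover have "scaled_cutoff k (v y) = 0" if "y \<in> W" for y
      using that by (intro scaled_cutoff_0[OF k]) (auto simp: W_def)
    ultimately show ?thesis using W smooth_on_const[OF W, of 0] by blast
  qed
qed

lemma approx_test: "approx n \<in> test_functions \<Omega>"
proof -
  define k where "k = real (Suc n)"
  have k: "k > 0" by (simp add: k_def)
  define F where "F x = scaled_cutoff k (scaled_cutoff (4 * k) (v x) - v0 x)" for x
  have ap: "approx n x = (if x \<in> \<Omega> then F x else 0)" for x
    by (simp add: approx_def k_def F_def Let_def)
  \<comment> \<open>The outer cutoff vanishes up to modulus 1/k, and the inner one, at scale 4k,
    moves v by at most 2/(4k) = 1/(2k). The support thus needs |v - v0| >= 1/(2k), which excludes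
    the boundary.\<close>
  define K where "K = {x \<in> closure \<Omega>. 1 / (2 * k) \<le> \<bar>v x - v0 x\<bar>}"
  have clK: "closed K" unfolding K_def
    by (rule continuous_on_closed_Collect_le[OF continuous_on_const cont_v_v0 closed_closure])
  have sub: "K \<subseteq> \<Omega>"
  proof
    fix x assume x: "x \<in> K"
    then have "v x \<noteq> v0 x" using k by (auto simp: K_def)
    then have "x \<notin> frontier \<Omega>" using v0_frontier[of x] by auto
    then show "x \<in> \<Omega>" using x interior_open[OF open_dom[of a]] by (auto simp: frontier_def K_def)
  qed
  have zero: "x \<in> K" if "x \<in> \<Omega>" "F x \<noteq> 0" for x
  proof -
    have "\<not> \<bar>scaled_cutoff (4 * k) (v x) - v0 x\<bar> \<le> 1 / k"
      using scaled_cutoff_0[OF k] that(2) unfolding F_def by blast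
    moreover have "\<bar>scaled_cutoff (4 * k) (v x) - v x\<bar> \<le> 2 / (4 * k)"
      using k by (intro scaled_cutoff_diff_le) simp
    moreover have "1 / k = 1 / (2 * k) + 2 / (4 * k)" using k by (simp add: field_simps)
    ultimately have "1 / (2 * k) \<le> \<bar>v x - v0 x\<bar>" by linarith
    then show ?thesis using that(1) closure_subset[of \<Omega>] by (auto simp: K_def)
  qed
  have supp: "closure {x. approx n x \<noteq> 0} \<subseteq> K"
    by (rule closure_minimal[OF _ clK]) (use zero in \<open>auto simp: ap split: if_splits\<close>)
  have "K \<inter> closure \<Omega> = K" by (auto simp: K_def)
  then have "compact K" using closed_Int_compact[OF clK compact_cl] by simp
  then have cs: "compact (closure {x. approx n x \<noteq> 0})"
    using compact_Int_closed[OF _ closed_closure[of "{x. approx n x \<noteq> 0}"], of K] supp by (simp only: Int_absorb1)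
  have smF: "smooth_on \<Omega> F" unfolding F_def[abs_def]
  proof (rule smooth_on_compose1[OF open_dom smooth1_scaled_cutoff])
    show "smooth_on \<Omega> (\<lambda>x. scaled_cutoff (4 * k) (v x) - v0 x)"
    proof (rule smooth_on_diff[OF open_dom])
      show "smooth_on \<Omega> (\<lambda>x. scaled_cutoff (4 * k) (v x))"
        by (rule smooth_on_subset[OF smooth_on_cutoff_v cl_ball(2)]) (use k in simp)
      show "smooth_on \<Omega> v0" using smooth_on_subset[OF smooth_on_v0] cl_O0 closure_subset[of \<Omega>] by blast
    qed
  qed simp
  have "smooth_on UNIV (approx n)"
  proof (rule smooth_on_local)
    fix x :: "real ^ 'n"
    show "\<exists>W h. open W \<and> x \<in> W \<and> smooth_on W h \<and> (\<forall>y\<in>W. approx n y = h y)"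
    proof (cases "x \<in> \<Omega>")
      case True
      show ?thesis by (rule exI[of _ \<Omega>], rule exI[of _ F]) (use True smF open_dom[of a] in \<open>simp add: ap\<close>)
    next
      case False
      have o: "open (- K)" using clK by (simp add: open_Compl)
      have z: "approx n y = 0" if "y \<in> - K" for y using zero[of y] that by (auto simp: ap)
      show ?thesis
        by (rule exI[of _ "- K"], rule exI[of _ "\<lambda>x. 0"]) (use False sub o z smooth_on_const[OF o, of 0] in auto)
    qed
  qed
  then show ?thesis unfolding test_functions_def using cs supp sub by blast
qed

lemma grad_approx:
  assumes x: "x \<in> \<Omega>" "x $ a \<noteq> 0"
  shows "grad (approx n) x = deriv cutoff (real (Suc n) * (scaled_cutoff (4 * real (Suc n)) (v x) - v0 x)) *\<^sub>R
    (deriv cutoff (4 * real (Suc n) * v x) *\<^sub>R V x - grad v0 x)"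
proof (rule grad_eq)
  define k where "k = real (Suc n)"
  have k: "k > 0" by (simp add: k_def)
  define D where "D = deriv cutoff (k * (scaled_cutoff (4 * k) (v x) - v0 x)) *\<^sub>R (deriv cutoff (4 * k * v x) *\<^sub>R V x - grad v0 x)"
  have b: "x \<in> ball 0 4" "x \<in> O0" using x cl_ball(2) cl_O0 closure_subset[of \<Omega>] by blast+
  have "((\<lambda>x. scaled_cutoff (4 * k) (v x)) has_derivative (\<lambda>h. (V x \<bullet> h) *\<^sub>R deriv cutoff (4 * k * v x))) (at x)"
    by (rule has_derivative_compose[OF v_deriv[OF b(1) x(2)] has_field_derivative_imp_has_derivative[OF scaled_cutoff_deriv], THEN has_derivative_eq_rhs])
      (use k in \<open>auto simp: mult.commute\<close>)
  then have "((\<lambda>x. scaled_cutoff (4 * k) (v x) - v0 x) has_derivative (\<lambda>h. (V x \<bullet> h) * deriv cutoff (4 * k * v x) - grad v0 x \<bullet> h)) (at x)"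
    by (intro has_derivative_diff has_derivative_grad smooth_on_imp_differentiable[OF smooth_on_v0 b(2)]) simp
  from has_derivative_compose[OF this, of "scaled_cutoff k", OF has_field_derivative_imp_has_derivative[OF scaled_cutoff_deriv[OF k]]]
  have "((\<lambda>x. scaled_cutoff k (scaled_cutoff (4 * k) (v x) - v0 x)) has_derivative (\<lambda>h. D \<bullet> h)) (at x)"
    by (rule has_derivative_eq_rhs) (simp add: D_def inner_diff_left mult_ac)
  moreover have ap: "approx n y = scaled_cutoff k (scaled_cutoff (4 * k) (v y) - v0 y)" if "y \<in> \<Omega>" for y
    unfolding approx_def Let_def k_def[symmetric] using that by (rule if_P)
  ultimately show "(approx n has_derivative (\<lambda>h. (deriv cutoff (real (Suc n) * (scaled_cutoff (4 * real (Suc n)) (v x) - v0 x)) *\<^sub>R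
    (deriv cutoff (4 * real (Suc n) * v x) *\<^sub>R V x - grad v0 x)) \<bullet> h)) (at x)"
    unfolding k_def[symmetric] D_def[symmetric]
    by (subst has_derivative_cong_open[OF open_dom x(1) ap])
qed

text \<open>At a point where v = v0 the outer cutoff erases the gradient of the difference for large
  k; the limit is right only if this gradient is 0 there.\<close>

lemma bad_null: "{x. x $ a = 0} \<union> (\<Union>i. {x \<in> \<Omega> \<inter> {x. x $ a \<noteq> 0}. v x - v0 x = 0 \<and> pdiff i (\<lambda>x. v x - v0 x) x \<noteq> 0}) \<in> null_sets lborel"
proof (rule null_sets.Un[OF hyperplane_null null_sets_UN])
  fix i
  have op: "open (\<Omega> \<inter> {x. x $ a \<noteq> 0})" by (intro open_Int open_dom open_strip)
  have d: "((\<lambda>x. v x - v0 x) has_derivative (\<lambda>h. (V x - grad v0 x) \<bullet> h)) (at x)" if "x \<in> \<Omega> \<inter> {x. x $ a \<noteq> 0}" for x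
  proof -
    have b: "x \<in> ball 0 4" "x \<in> O0" "x $ a \<noteq> 0" using that cl_ball(2) cl_O0 closure_subset[of \<Omega>] by blast+
    show ?thesis unfolding inner_diff_left
      by (intro has_derivative_diff v_deriv has_derivative_grad smooth_on_imp_differentiable[OF smooth_on_v0] b)
  qed
  show "{x \<in> \<Omega> \<inter> {x. x $ a \<noteq> 0}. v x - v0 x = 0 \<and> pdiff i (\<lambda>x. v x - v0 x) x \<noteq> 0} \<in> null_sets lborel"
  proof (rule zero_set_null[OF op])
    show "(\<lambda>x. v x - v0 x) differentiable at x" if "x \<in> \<Omega> \<inter> {x. x $ a \<noteq> 0}" for x
      using d[OF that] by (auto simp: differentiable_def)
    have "continuous_on (\<Omega> \<inter> {x. x $ a \<noteq> 0}) (\<lambda>x. (V x - grad v0 x) $ i)"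
      by (intro continuous_on_component continuous_on_diff continuous_on_subset[OF cont_V] continuous_on_subset[OF smooth_on_grad_continuous[OF smooth_on_v0]])
        (use cl_ball(2) cl_O0 closure_subset[of \<Omega>] in blast)+
    moreover have "pdiff i (\<lambda>x. v x - v0 x) x = (V x - grad v0 x) $ i" if "x \<in> \<Omega> \<inter> {x. x $ a \<noteq> 0}" for x
      using pdiff_eq[OF d[OF that]] by (simp add: inner_axis)
    ultimately show "continuous_on (\<Omega> \<inter> {x. x $ a \<noteq> 0}) (pdiff i (\<lambda>x. v x - v0 x))"
      by (subst continuous_on_cong[OF refl, where g = "\<lambda>x. (V x - grad v0 x) $ i"]) auto
  qed
qed

text \<open>Dominated convergence. Where v and v0 differ, both cutoffs are eventually the identity
  near the point; where they agree, the gradients agree off the null set of \<open>bad_null\<close>,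
  and every multiple of their difference is 0. The bounded derivative of \<open>cutoff\<close> gives
  an integrable majorant, since V is integrable.\<close>

lemma v_minus_v0: "(\<lambda>x. v x - v0 x) \<in> W11_0 \<Omega>"
proof -
  have meas: "\<Omega> \<in> sets lebesgue" using open_dom[of a] by auto
  obtain M where M: "M > 0" "\<And>s. \<bar>deriv cutoff s\<bar> \<le> M" by (rule deriv_cutoff_bounded) (rule that)
  have iu: "integrable (lebesgue_on \<Omega>) (\<lambda>x. v x - v0 x)" by (rule Bochner_Integration.integrable_diff[OF v_integrable v0_weak(2)])
  have ig: "integrable (lebesgue_on \<Omega>) (\<lambda>x. V x - grad v0 x)" by (rule Bochner_Integration.integrable_diff[OF V_integrable v0_weak(3)])
  have ia: "integrable (lebesgue_on \<Omega>) (approx n)" "integrable (lebesgue_on \<Omega>) (grad (approx n))" for n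
    by (rule test_function_weak_gradient(2,3)[OF open_dom approx_test])+
  show ?thesis
  proof (rule W11_0I[OF open_dom iu weak_gradient_diff[OF open_dom weak_gradient_v v0_weak(1)] ig approx_test])
    have bd: "\<bar>v x - v0 x - approx n x\<bar> \<le> 3 / real (Suc n)" if "x \<in> \<Omega>" for x n
    proof -
      define k where "k = real (Suc n)"
      have k: "k > 0" by (simp add: k_def)
      have "approx n x = scaled_cutoff k (scaled_cutoff (4 * k) (v x) - v0 x)" using that by (simp add: approx_def k_def Let_def)
      moreover have "\<bar>scaled_cutoff k (scaled_cutoff (4 * k) (v x) - v0 x) - (scaled_cutoff (4 * k) (v x) - v0 x)\<bar> \<le> 2 / k"
        by (rule scaled_cutoff_diff_le[OF k])
      moreover have "\<bar>scaled_cutoff (4 * k) (v x) - v x\<bar> \<le> 2 / (4 * k)" using k by (intro scaled_cutoff_diff_le) simp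
      moreover have "2 / (4 * k) \<le> 1 / k" using k by (simp add: field_simps)
      moreover have "3 / k = 2 / k + 1 / k" by (simp add: field_simps)
      ultimately show ?thesis unfolding k_def[symmetric] by linarith
    qed
    have lim3: "(\<lambda>n. 3 / real (Suc n)) \<longlonglongrightarrow> 0" using LIMSEQ_Suc[OF lim_const_over_n[of 3]] by simp
    have "(\<lambda>n. LINT x|lebesgue_on \<Omega>. \<bar>v x - v0 x - approx n x\<bar>) \<longlonglongrightarrow> (LINT x|lebesgue_on \<Omega>. 0)"
    proof (rule integral_dominated_convergence[where w = "\<lambda>x. 3"])
      show "(\<lambda>x. \<bar>v x - v0 x - approx n x\<bar>) \<in> borel_measurable (lebesgue_on \<Omega>)" for n
        by (intro borel_measurable_integrable integrable_abs Bochner_Integration.integrable_diff[OF iu ia(1)])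
      show "integrable (lebesgue_on \<Omega>) (\<lambda>x. 3 :: real)"
        by (rule bounded_continuous_integrable_on[OF open_dom bounded_dom continuous_on_const, of _ 3]) simp
      show "AE x in lebesgue_on \<Omega>. (\<lambda>n. \<bar>v x - v0 x - approx n x\<bar>) \<longlonglongrightarrow> 0"
      proof (rule AE_I2)
        fix x assume "x \<in> space (lebesgue_on \<Omega>)"
        then have x: "x \<in> \<Omega>" by simp
        show "(\<lambda>n. \<bar>v x - v0 x - approx n x\<bar>) \<longlonglongrightarrow> 0"
          by (rule tendsto_sandwich[OF _ _ tendsto_const lim3]) (use bd[OF x] in \<open>auto intro!: always_eventually\<close>)
      qed
      show "AE x in lebesgue_on \<Omega>. norm \<bar>v x - v0 x - approx n x\<bar> \<le> 3" for n
      proof (rule AE_I2)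
        fix x assume "x \<in> space (lebesgue_on \<Omega>)"
        then have "\<bar>v x - v0 x - approx n x\<bar> \<le> 3 / real (Suc n)" by (intro bd) simp
        also have "\<dots> \<le> 3 / 1" by (rule divide_left_mono) auto
        finally show "norm \<bar>v x - v0 x - approx n x\<bar> \<le> 3" by simp
      qed
    qed simp
    then show "(\<lambda>n. LINT x|lebesgue_on \<Omega>. \<bar>v x - v0 x - approx n x\<bar>) \<longlonglongrightarrow> 0" by simp
    have ae: "AE x in lebesgue_on \<Omega>. x \<in> \<Omega> \<and> x \<notin> {x. x $ a = 0} \<union> (\<Union>i. {x \<in> \<Omega> \<inter> {x. x $ a \<noteq> 0}. v x - v0 x = 0 \<and> pdiff i (\<lambda>x. v x - v0 x) x \<noteq> 0})"
      by (rule AE_lebesgue_on_not_in[OF bad_null meas])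
    have "(\<lambda>n. LINT x|lebesgue_on \<Omega>. norm (V x - grad v0 x - grad (approx n) x)) \<longlonglongrightarrow> (LINT x|lebesgue_on \<Omega>. 0)"
    proof (rule integral_dominated_convergence[where w = "\<lambda>x. (1 + M * M) * norm (V x) + (1 + M) * norm (grad v0 x)"])
      show "(\<lambda>x. norm (V x - grad v0 x - grad (approx n) x)) \<in> borel_measurable (lebesgue_on \<Omega>)" for n
        by (intro borel_measurable_integrable integrable_norm Bochner_Integration.integrable_diff[OF ig ia(2)])
      show "integrable (lebesgue_on \<Omega>) (\<lambda>x. (1 + M * M) * norm (V x) + (1 + M) * norm (grad v0 x))"
        by (intro Bochner_Integration.integrable_add integrable_mult_right integrable_norm V_integrable v0_weak(3))
      show "AE x in lebesgue_on \<Omega>. norm (norm (V x - grad v0 x - grad (approx n) x)) \<le> (1 + M * M) * norm (V x) + (1 + M) * norm (grad v0 x)" for n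
        using ae
      proof eventually_elim
        fix x assume x: "x \<in> \<Omega> \<and> x \<notin> {x. x $ a = 0} \<union> (\<Union>i. {x \<in> \<Omega> \<inter> {x. x $ a \<noteq> 0}. v x - v0 x = 0 \<and> pdiff i (\<lambda>x. v x - v0 x) x \<noteq> 0})"
        then have x: "x \<in> \<Omega>" "x $ a \<noteq> 0" by auto
        define s where "s = deriv cutoff (real (Suc n) * (scaled_cutoff (4 * real (Suc n)) (v x) - v0 x))"
        define t where "t = deriv cutoff (4 * real (Suc n) * v x)"
        have st: "\<bar>s\<bar> \<le> M" "\<bar>t\<bar> \<le> M" by (simp_all add: s_def t_def M(2))
        have "norm (V x - grad v0 x - grad (approx n) x) \<le> norm (V x) + norm (grad v0 x) + norm (grad (approx n) x)"
          using norm_triangle_ineq4[of "V x - grad v0 x" "grad (approx n) x"] norm_triangle_ineq4[of "V x" "grad v0 x"] by linarith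
        also have "norm (grad (approx n) x) \<le> M * (M * norm (V x) + norm (grad v0 x))"
        proof -
          have gr: "grad (approx n) x = s *\<^sub>R (t *\<^sub>R V x - grad v0 x)" unfolding s_def t_def by (rule grad_approx[OF x])
          have "norm (t *\<^sub>R V x - grad v0 x) \<le> \<bar>t\<bar> * norm (V x) + norm (grad v0 x)"
            using norm_triangle_ineq4[of "t *\<^sub>R V x" "grad v0 x"] by simp
          also have "\<dots> \<le> M * norm (V x) + norm (grad v0 x)" using st by (intro add_right_mono mult_right_mono) auto
          finally show ?thesis using st M(1) unfolding gr norm_scaleR by (intro mult_mono) auto
        qed
        finally show "norm (norm (V x - grad v0 x - grad (approx n) x)) \<le> (1 + M * M) * norm (V x) + (1 + M) * norm (grad v0 x)"
          by (simp add: algebra_simps)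
      qed
      show "AE x in lebesgue_on \<Omega>. (\<lambda>n. norm (V x - grad v0 x - grad (approx n) x)) \<longlonglongrightarrow> 0"
        using ae
      proof eventually_elim
        fix x assume A: "x \<in> \<Omega> \<and> x \<notin> {x. x $ a = 0} \<union> (\<Union>i. {x \<in> \<Omega> \<inter> {x. x $ a \<noteq> 0}. v x - v0 x = 0 \<and> pdiff i (\<lambda>x. v x - v0 x) x \<noteq> 0})"
        then have x: "x \<in> \<Omega>" "x $ a \<noteq> 0" by auto
        have b: "x \<in> ball 0 4" "x \<in> O0" using x cl_ball(2) cl_O0 closure_subset[of \<Omega>] by blast+
        have gt: "\<forall>\<^sub>F n in sequentially. C < real (Suc n) * c" if "c > 0" for c C :: real
        proof -
          have "filterlim (\<lambda>n. real (Suc n) * c) at_top sequentially"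
            by (rule filterlim_at_top_mult_tendsto_pos[OF tendsto_const that filterlim_compose[OF filterlim_real_sequentially filterlim_Suc]])
          then show ?thesis by (simp add: filterlim_at_top_dense)
        qed
        have "\<bar>v x\<bar> > 0" using v_nz[OF b(1) x(2)] by simp
        from gt[OF this, of 2] have e1: "\<forall>\<^sub>F n in sequentially. grad (approx n) x = deriv cutoff (real (Suc n) * (v x - v0 x)) *\<^sub>R (V x - grad v0 x)"
        proof eventually_elim
          fix n assume n: "2 < real (Suc n) * \<bar>v x\<bar>"
          then have n2: "2 < 4 * real (Suc n) * \<bar>v x\<bar>" by linarith
          have "scaled_cutoff (4 * real (Suc n)) (v x) = v x" using n2 by (intro scaled_cutoff_id) auto
          moreover have "deriv cutoff (4 * real (Suc n) * v x) = 1" using n2 by (intro deriv_cutoff_1) (simp add: abs_mult)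
          ultimately show "grad (approx n) x = deriv cutoff (real (Suc n) * (v x - v0 x)) *\<^sub>R (V x - grad v0 x)"
            using grad_approx[OF x, of n] by simp
        qed
        have "\<forall>\<^sub>F n in sequentially. norm (V x - grad v0 x - grad (approx n) x) = 0"
        proof (cases "v x - v0 x = 0")
          case True
          have "((\<lambda>x. v x - v0 x) has_derivative (\<lambda>h. (V x - grad v0 x) \<bullet> h)) (at x)"
            unfolding inner_diff_left
            by (intro has_derivative_diff v_deriv has_derivative_grad smooth_on_imp_differentiable[OF smooth_on_v0] b x)
          from pdiff_eq[OF this] have pd: "pdiff i (\<lambda>x. v x - v0 x) x = (V x - grad v0 x) $ i" for i by (simp add: inner_axis)
          have "pdiff i (\<lambda>x. v x - v0 x) x = 0" for i using A True by blast
          then have z: "V x - grad v0 x = 0" unfolding pd vec_eq_iff by simp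
          from e1 show ?thesis by eventually_elim (simp add: z)
        next
          case False
          then have "\<bar>v x - v0 x\<bar> > 0" by simp
          from gt[OF this, of 2] e1 show ?thesis
          proof eventually_elim
            fix n assume n: "2 < real (Suc n) * \<bar>v x - v0 x\<bar>" and e: "grad (approx n) x = deriv cutoff (real (Suc n) * (v x - v0 x)) *\<^sub>R (V x - grad v0 x)"
            have "deriv cutoff (real (Suc n) * (v x - v0 x)) = 1" using n by (intro deriv_cutoff_1) (simp add: abs_mult)
            then show "norm (V x - grad v0 x - grad (approx n) x) = 0" unfolding e by simp
          qed
        qed
        then show "(\<lambda>n. norm (V x - grad v0 x - grad (approx n) x)) \<longlonglongrightarrow> 0" by (rule tendsto_eventually)
      qed
    qed simp
    then show "(\<lambda>n. LINT x|lebesgue_on \<Omega>. norm (V x - grad v0 x - grad (approx n) x)) \<longlonglongrightarrow> 0" by simp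
  qed
qed

section \<open>Minimality and uniqueness\<close>


text \<open>For the competitor v + z, the Bregman remainder of the integrand at Dv: the energy
  density minus its affine tangent.\<close>

definition excess :: "(real ^ 'n \<Rightarrow> real) \<Rightarrow> real ^ 'n \<Rightarrow> real" where
  "excess z x = energy p (norm (V x + wgrad \<Omega> z x)) - (energy p (norm (V x)) + sig x \<bullet> wgrad \<Omega> z x)"

lemma meas_dom: "\<Omega> \<in> sets lebesgue" using open_dom[of a] by auto

lemma AE_off_hyperplane: "AE x in lebesgue_on \<Omega>. x \<in> \<Omega> \<and> x $ a \<noteq> 0"
  using AE_lebesgue_on_not_in[OF hyperplane_null meas_dom, of a] by simp

lemma const_integrable: "integrable (lebesgue_on \<Omega>) (\<lambda>x. c :: real)"
  by (rule bounded_continuous_integrable_on[OF open_dom bounded_dom continuous_on_const, of _ "\<bar>c\<bar>"]) simp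

lemma energy_integrable:
  assumes f: "integrable (lebesgue_on \<Omega>) f"
  shows "integrable (lebesgue_on \<Omega>) (\<lambda>x. energy p (norm (f x :: real ^ 'n)))"
proof (rule Bochner_Integration.integrable_bound)
  show "integrable (lebesgue_on \<Omega>) (\<lambda>x. 2 * (1 + norm (f x)))"
    by (intro integrable_mult_right Bochner_Integration.integrable_add integrable_norm f const_integrable)
  have [measurable]: "f \<in> borel_measurable (lebesgue_on \<Omega>)" using f by (rule borel_measurable_integrable)
  show "(\<lambda>x. energy p (norm (f x))) \<in> borel_measurable (lebesgue_on \<Omega>)" unfolding energy_def by measurable
  show "AE x in lebesgue_on \<Omega>. norm (energy p (norm (f x))) \<le> norm (2 * (1 + norm (f x)))"
  proof (rule AE_I2)
    fix x
    have "0 \<le> energy p (norm (f x))" by (simp add: energy_def)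
    then show "norm (energy p (norm (f x))) \<le> norm (2 * (1 + norm (f x)))"
      using energy_le[of p "norm (f x)"] p by simp
  qed
qed

lemma A_fun_eq_integral:
  assumes f: "integrable (lebesgue_on \<Omega>) f" and ae: "AE x in lebesgue_on \<Omega>. wgrad \<Omega> w x = f x"
  shows "A_fun p \<Omega> w = ennreal (LINT x|lebesgue_on \<Omega>. energy p (norm (f x)))"
proof -
  have "A_fun p \<Omega> w = (\<integral>\<^sup>+x. ennreal (energy p (norm (f x))) \<partial>lebesgue_on \<Omega>)"
    unfolding A_fun_def energy_def[symmetric] by (rule nn_integral_cong_AE) (use ae in eventually_elim, simp)
  also have "\<dots> = ennreal (LINT x|lebesgue_on \<Omega>. energy p (norm (f x)))"
    by (rule nn_integral_eq_integral[OF energy_integrable[OF f]]) (simp add: energy_def)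
  finally show ?thesis .
qed

text \<open>Brings the remainder into the form of the tangent inequalities, with contact point q *
  dir.\<close>

lemma excess_eq: "x \<in> \<Omega> \<Longrightarrow> x $ a \<noteq> 0 \<Longrightarrow>
    excess z x = energy p (norm (V x + wgrad \<Omega> z x)) - (energy p (q x) + slope p (q x) * (dir x \<bullet> (V x + wgrad \<Omega> z x) - q x))"
proof -
  assume x: "x \<in> \<Omega>" "x $ a \<noteq> 0"
  then have b: "x \<in> ball 0 4" using cl_ball(2) by blast
  have "dir x \<bullet> dir x = 1" using norm_dir[of x] by (simp add: norm_eq_1)
  then have "dir x \<bullet> (V x + h) - q x = dir x \<bullet> h" for h by (simp add: V_def inner_add_right)
  then show ?thesis by (simp add: excess_def sig_eq[OF b x(2)] norm_V)
qed

lemma excess_nonneg: "AE x in lebesgue_on \<Omega>. excess z x \<ge> 0"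
  using AE_off_hyperplane
proof eventually_elim
  fix x assume x: "x \<in> \<Omega> \<and> x $ a \<noteq> 0"
  then have "q x > 0" using q_pos cl_ball(2) by blast
  then show "excess z x \<ge> 0" using energy_tangent_le[of p "q x" "dir x" "V x + wgrad \<Omega> z x"] x p norm_dir[of x]
    by (simp add: excess_eq)
qed

text \<open>The linear term of the remainder integrates to 0 against gradients with zero boundary
  values, so the energy of a competitor is exactly that of v plus the integrated excess. All terms
  are finite because V is integrable and the integrand has linear growth.\<close>

lemma class_decomp:
  assumes w: "w \<in> dirichlet_class v0 \<Omega>"
  shows "(\<lambda>x. w x - v x) \<in> W11_0 \<Omega>" "integrable (lebesgue_on \<Omega>) w" "integrable (lebesgue_on \<Omega>) (wgrad \<Omega> (\<lambda>x. w x - v x))"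
    "integrable (lebesgue_on \<Omega>) (excess (\<lambda>x. w x - v x))"
    "A_fun p \<Omega> w = A_fun p \<Omega> v + ennreal (LINT x|lebesgue_on \<Omega>. excess (\<lambda>x. w x - v x) x)"
proof -
  define z where "z = (\<lambda>x. w x - v x)"
  have "(\<lambda>x. (w x - v0 x) - (v x - v0 x)) \<in> W11_0 \<Omega>"
    using w by (intro W11_0_diff[OF open_dom _ v_minus_v0]) (simp add: dirichlet_class_def)
  then show z0: "(\<lambda>x. w x - v x) \<in> W11_0 \<Omega>" by simp
  have "z \<in> W11 \<Omega>" using z0 by (simp add: W11_0_def z_def)
  note Z = W11D[OF open_dom this]
  have wz: "(\<lambda>x. v x + z x) = w" by (simp add: z_def)
  show "integrable (lebesgue_on \<Omega>) w" using Bochner_Integration.integrable_add[OF v_integrable Z(1)] unfolding wz .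
  show iz: "integrable (lebesgue_on \<Omega>) (wgrad \<Omega> (\<lambda>x. w x - v x))" using Z(2) unfolding z_def .
  have iw: "integrable (lebesgue_on \<Omega>) (\<lambda>x. V x + wgrad \<Omega> z x)" by (rule Bochner_Integration.integrable_add[OF V_integrable Z(2)])
  have "AE x in lebesgue_on \<Omega>. wgrad \<Omega> w x = V x + wgrad \<Omega> z x"
    using wgrad_AE[OF open_dom weak_gradient_add[OF open_dom weak_gradient_v Z(3)]] unfolding wz .
  note Aw = A_fun_eq_integral[OF iw this]
  note Av = A_fun_eq_integral[OF V_integrable wgrad_v]
  have S: "integrable (lebesgue_on \<Omega>) (\<lambda>x. sig x \<bullet> wgrad \<Omega> z x)" "(LINT x|lebesgue_on \<Omega>. sig x \<bullet> wgrad \<Omega> z x) = 0"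
    unfolding z_def by (rule integral_inner_W11_0[OF open_dom sig_measurable norm_sig_le sig_test z0], assumption)+
  have i1: "integrable (lebesgue_on \<Omega>) (\<lambda>x. energy p (norm (V x)) + sig x \<bullet> wgrad \<Omega> z x)"
    by (rule Bochner_Integration.integrable_add[OF energy_integrable[OF V_integrable] S(1)])
  show "integrable (lebesgue_on \<Omega>) (excess (\<lambda>x. w x - v x))"
    unfolding excess_def[abs_def] z_def[symmetric] by (rule Bochner_Integration.integrable_diff[OF energy_integrable[OF iw] i1])
  have "(LINT x|lebesgue_on \<Omega>. excess z x) = (LINT x|lebesgue_on \<Omega>. energy p (norm (V x + wgrad \<Omega> z x)))
      - (LINT x|lebesgue_on \<Omega>. energy p (norm (V x)) + sig x \<bullet> wgrad \<Omega> z x)"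
    unfolding excess_def by (rule Bochner_Integration.integral_diff[OF energy_integrable[OF iw] i1])
  also have "(LINT x|lebesgue_on \<Omega>. energy p (norm (V x)) + sig x \<bullet> wgrad \<Omega> z x) = (LINT x|lebesgue_on \<Omega>. energy p (norm (V x)))"
    unfolding Bochner_Integration.integral_add[OF energy_integrable[OF V_integrable] S(1)] S(2) by simp
  finally have "(LINT x|lebesgue_on \<Omega>. energy p (norm (V x + wgrad \<Omega> z x))) = (LINT x|lebesgue_on \<Omega>. energy p (norm (V x))) + (LINT x|lebesgue_on \<Omega>. excess z x)"
    by simp
  moreover have "(LINT x|lebesgue_on \<Omega>. energy p (norm (V x))) \<ge> 0" by (rule Bochner_Integration.integral_nonneg) (simp add: energy_def)
  moreover have "(LINT x|lebesgue_on \<Omega>. excess z x) \<ge> 0" by (rule integral_nonneg_AE[OF excess_nonneg])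
  ultimately show "A_fun p \<Omega> w = A_fun p \<Omega> v + ennreal (LINT x|lebesgue_on \<Omega>. excess (\<lambda>x. w x - v x) x)"
    unfolding Aw Av z_def[symmetric] by simp
qed

lemma v_class: "v \<in> dirichlet_class v0 \<Omega>"
  using v_minus_v0 by (simp add: dirichlet_class_def)

lemma A_fun_v_finite: "A_fun p \<Omega> v < \<infinity>"
  unfolding A_fun_eq_integral[OF V_integrable wgrad_v] by simp

lemma A_fun_v_le: "w \<in> dirichlet_class v0 \<Omega> \<Longrightarrow> A_fun p \<Omega> v \<le> A_fun p \<Omega> w"
  by (simp add: class_decomp(5))

lemma v_solution: "dirichlet_solution p v0 \<Omega> v"
  unfolding dirichlet_solution_def using v_class A_fun_v_le by blast

text \<open>Formulated for limits in L^1 of nearly minimizing competitors, in order to treat both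
  notions at once: a solution approximates itself, and a generalized minimizer is approximated by a
  sequence that nearly attains its relaxed energy.\<close>

lemma minimizing_unique:
  assumes u: "integrable (lebesgue_on \<Omega>) u"
    and min: "\<And>\<eta>. \<eta> > 0 \<Longrightarrow> \<exists>w \<in> dirichlet_class v0 \<Omega>. A_fun p \<Omega> w < A_fun p \<Omega> v + ennreal \<eta> \<and> (LINT x|lebesgue_on \<Omega>. \<bar>w x - u x\<bar>) < \<eta>"
  shows "AE x in lebesgue_on \<Omega>. u x = v x"
proof -
  have strip: "AE x in lebesgue_on \<Omega>. \<bar>u x - v x\<bar> * indicator {x. \<delta> \<le> \<bar>x $ a\<bar>} x = 0" if \<delta>: "\<delta> > 0" for \<delta>
  proof -
    define A where "A = {x :: real ^ 'n. \<delta> \<le> \<bar>x $ a\<bar>}"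
    have clA: "closed A" unfolding A_def by (intro closed_Collect_le continuous_intros)
    then have Ab: "A \<in> sets borel" by auto
    have Al: "A \<in> sets lebesgue" using Ab by simp
    have Am: "A \<inter> \<Omega> \<in> sets lebesgue" using Al meas_dom by auto
    have iA: "integrable (lebesgue_on \<Omega>) (\<lambda>x. f x * indicator A x)" if "integrable (lebesgue_on \<Omega>) f" for f :: "real ^ 'n \<Rightarrow> real"
    proof -
      have "A \<inter> \<Omega> \<in> sets (lebesgue_on \<Omega>)" using Am meas_dom by (simp add: sets_restrict_space_iff)
      from integrable_mult_indicator[OF this that] show ?thesis
        by (rule Bochner_Integration.integrable_cong[THEN iffD1, rotated 2]) (auto split: split_indicator)
    qed
    have inv: "x + t *\<^sub>R axis b 1 \<in> A \<longleftrightarrow> x \<in> A" for x t using ab by (simp add: A_def axis_def)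
    define C where "C = closure \<Omega> \<inter> A"
    have C: "compact C" unfolding C_def by (rule compact_Int_closed[OF compact_cl clA])
    have Csub: "C \<subseteq> ball 0 4 - {x. x $ a = 0}" using cl_ball(1) \<delta> by (auto simp: C_def A_def)
    have Csub2: "C \<subseteq> ball 0 4" using Csub by blast
    have qC: "q x > 0" if "x \<in> C" for x using q_pos Csub that by blast
    define m where "m = (LINT x|lebesgue_on \<Omega>. (1 :: real))"
    have m: "m \<ge> 0" unfolding m_def by (rule Bochner_Integration.integral_nonneg) simp
    have iuv: "integrable (lebesgue_on \<Omega>) (\<lambda>x. \<bar>u x - v x\<bar>)" by (intro integrable_abs Bochner_Integration.integrable_diff u v_integrable)
    have small: "(LINT x|lebesgue_on \<Omega>. \<bar>u x - v x\<bar> * indicator A x) \<le> 0 + \<epsilon>" if \<epsilon>: "\<epsilon> > 0" for \<epsilon>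
    proof -
      have p1: "1 < p" using p by simp
      \<comment> \<open>Gradient differences below \<theta> are not controlled by the excess, but
        contribute at most \<theta> times the volume m of the domain. The Poincare constant is 2 *
        4, so this part costs at most \<epsilon>/2; m + 1 avoids a division by 0.\<close>
      define \<theta> where "\<theta> = \<epsilon> / (16 * (m + 1))"
      have \<theta>: "\<theta> > 0" using \<epsilon> m by (simp add: \<theta>_def)
      obtain c where c: "c > 0" and coe: "\<And>x b. x \<in> C \<Longrightarrow> norm (b - q x *\<^sub>R dir x) \<ge> \<theta> \<Longrightarrow>
          c * norm (b - q x *\<^sub>R dir x) \<le> energy p (norm b) - (energy p (q x) + slope p (q x) * (dir x \<bullet> b - q x))"
        by (rule energy_coercive[OF p1 C continuous_on_subset[OF cont_q Csub] qC continuous_on_subset[OF cont_dir Csub2] norm_dir \<theta>])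
          (assumption, rule that)
      \<comment> \<open>The coercivity constant c depends on the strip and on \<theta>, so \<eta> is
        chosen last. The error in L^1 costs \<eta>, and the excess costs 8 \<eta> / c by coercivity
        and Poincare; together this is \<epsilon>/2.\<close>
      define \<eta> where "\<eta> = \<epsilon> / (2 * (1 + 8 / c))"
      have \<eta>: "\<eta> > 0" using \<epsilon> c by (simp add: \<eta>_def add_pos_pos)
      obtain w where w: "w \<in> dirichlet_class v0 \<Omega>" and wA: "A_fun p \<Omega> w < A_fun p \<Omega> v + ennreal \<eta>"
        and wu: "(LINT x|lebesgue_on \<Omega>. \<bar>w x - u x\<bar>) < \<eta>" using min[OF \<eta>] by blast
      define z where "z = (\<lambda>x. w x - v x)"
      note D = class_decomp[OF w, folded z_def]
      have E: "(LINT x|lebesgue_on \<Omega>. excess z x) < \<eta>"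
      proof -
        have "A_fun p \<Omega> v + ennreal (LINT x|lebesgue_on \<Omega>. excess z x) < A_fun p \<Omega> v + ennreal \<eta>"
          using wA unfolding D(5) .
        then have "ennreal (LINT x|lebesgue_on \<Omega>. excess z x) < ennreal \<eta>" by (simp add: ennreal_add_left_cancel_less)
        then show ?thesis using \<eta> by (simp add: ennreal_less_iff integral_nonneg_AE[OF excess_nonneg])
      qed
      have "(LINT x|lebesgue_on \<Omega>. norm (wgrad \<Omega> z x) * indicator A x) \<le> (LINT x|lebesgue_on \<Omega>. \<theta> * 1 + inverse c * excess z x)"
      proof (rule integral_mono_AE)
        show "integrable (lebesgue_on \<Omega>) (\<lambda>x. norm (wgrad \<Omega> z x) * indicator A x)" by (intro iA integrable_norm D(3))
        show "integrable (lebesgue_on \<Omega>) (\<lambda>x. \<theta> * 1 + inverse c * excess z x)"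
          by (intro Bochner_Integration.integrable_add integrable_mult_right const_integrable D(4))
        show "AE x in lebesgue_on \<Omega>. norm (wgrad \<Omega> z x) * indicator A x \<le> \<theta> * 1 + inverse c * excess z x"
          using AE_off_hyperplane excess_nonneg[of z]
        proof eventually_elim
          fix x assume x: "x \<in> \<Omega> \<and> x $ a \<noteq> 0" and e: "0 \<le> excess z x"
          have n: "0 \<le> inverse c * excess z x" using c e by simp
          show "norm (wgrad \<Omega> z x) * indicator A x \<le> \<theta> * 1 + inverse c * excess z x"
          proof (cases "x \<in> A \<and> \<theta> \<le> norm (wgrad \<Omega> z x)")
            case True
            then have "x \<in> C" using x closure_subset[of \<Omega>] by (auto simp: C_def)
            from coe[OF this, of "V x + wgrad \<Omega> z x"] have "c * norm (wgrad \<Omega> z x) \<le> excess z x"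
              using True x by (simp add: V_def excess_eq[unfolded V_def])
            then have "norm (wgrad \<Omega> z x) \<le> inverse c * excess z x" using c by (simp add: field_simps)
            then show ?thesis using True \<theta> by simp
          next
            case False
            then show ?thesis using n \<theta> by (auto split: split_indicator)
          qed
        qed
      qed
      also have "\<dots> = \<theta> * m + inverse c * (LINT x|lebesgue_on \<Omega>. excess z x)"
        unfolding m_def by (subst Bochner_Integration.integral_add) (simp_all add: D(4) const_integrable)
      also have "\<dots> \<le> \<theta> * m + inverse c * \<eta>" using E c by simp
      finally have g: "(LINT x|lebesgue_on \<Omega>. norm (wgrad \<Omega> z x) * indicator A x) \<le> \<theta> * m + inverse c * \<eta>" .
      have poin: "(LINT x|lebesgue_on \<Omega>. \<bar>z x\<bar> * indicator A x) \<le> 2 * 4 * (LINT x|lebesgue_on \<Omega>. norm (wgrad \<Omega> z x) * indicator A x)"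
        by (rule W11_0_poincare[OF open_dom cl_ball(2) _ Ab inv D(1)]) simp
      have iz: "integrable (lebesgue_on \<Omega>) (\<lambda>x. \<bar>z x\<bar> * indicator A x)" unfolding z_def
        by (intro iA integrable_abs Bochner_Integration.integrable_diff D(2) v_integrable)
      have iwu: "integrable (lebesgue_on \<Omega>) (\<lambda>x. \<bar>w x - u x\<bar>)" by (intro integrable_abs Bochner_Integration.integrable_diff D(2) u)
      have "(LINT x|lebesgue_on \<Omega>. \<bar>u x - v x\<bar> * indicator A x) \<le> (LINT x|lebesgue_on \<Omega>. \<bar>w x - u x\<bar> + \<bar>z x\<bar> * indicator A x)"
        by (intro integral_mono iA iuv Bochner_Integration.integrable_add iwu iz) (auto simp: z_def split: split_indicator)
      also have "\<dots> = (LINT x|lebesgue_on \<Omega>. \<bar>w x - u x\<bar>) + (LINT x|lebesgue_on \<Omega>. \<bar>z x\<bar> * indicator A x)"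
        by (rule Bochner_Integration.integral_add[OF iwu iz])
      also have "\<dots> \<le> \<eta> + 8 * (\<theta> * m + inverse c * \<eta>)"
        using add_mono[OF less_imp_le[OF wu] order_trans[OF poin mult_left_mono[OF g, of "2 * 4"]]] by simp
      also have "\<dots> = 8 * (\<theta> * m) + \<eta> * (1 + 8 / c)" by (simp add: algebra_simps divide_inverse)
      also have "\<eta> * (1 + 8 / c) = \<epsilon> / 2"
      proof -
        have "1 + 8 / c \<noteq> 0" using c by (simp add: add_pos_pos less_imp_neq[symmetric])
        moreover have "\<epsilon> / (2 * d) * d = \<epsilon> / 2" if "d \<noteq> 0" for d :: real using that by simp
        ultimately show ?thesis unfolding \<eta>_def by blast
      qed
      also have "8 * (\<theta> * m) \<le> 8 * (\<theta> * (m + 1))" using \<theta> by simp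
      also have "8 * (\<theta> * (m + 1)) = \<epsilon> / 2"
      proof -
        have "8 * (\<epsilon> / (16 * d) * d) = \<epsilon> / 2" if "d \<noteq> 0" for d :: real using that by simp
        moreover have "m + 1 \<noteq> 0" using m by linarith
        ultimately show ?thesis unfolding \<theta>_def by blast
      qed
      finally show ?thesis by simp
    qed
    have "(LINT x|lebesgue_on \<Omega>. \<bar>u x - v x\<bar> * indicator A x) \<le> 0" by (rule field_le_epsilon) (rule small)
    moreover have "(LINT x|lebesgue_on \<Omega>. \<bar>u x - v x\<bar> * indicator A x) \<ge> 0"
      by (rule Bochner_Integration.integral_nonneg) simp
    ultimately have "(LINT x|lebesgue_on \<Omega>. \<bar>u x - v x\<bar> * indicator A x) = 0" by linarith
    then show ?thesis using integral_nonneg_eq_0_iff_AE[OF iA[OF iuv]] unfolding A_def by simp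
  qed
  have "AE x in lebesgue_on \<Omega>. \<forall>n :: nat. \<bar>u x - v x\<bar> * indicator {x. inverse (real (Suc n)) \<le> \<bar>x $ a\<bar>} x = 0"
    unfolding AE_all_countable by (intro allI strip) simp
  then show ?thesis using AE_off_hyperplane
  proof eventually_elim
    fix x assume al: "\<forall>n :: nat. \<bar>u x - v x\<bar> * indicator {x. inverse (real (Suc n)) \<le> \<bar>x $ a\<bar>} x = 0" and x: "x \<in> \<Omega> \<and> x $ a \<noteq> 0"
    obtain n where n: "inverse (real (Suc n)) < \<bar>x $ a\<bar>" using reals_Archimedean[of "\<bar>x $ a\<bar>"] x by auto
    from al have "\<bar>u x - v x\<bar> * indicator {x. inverse (real (Suc n)) \<le> \<bar>x $ a\<bar>} x = 0" ..
    then show "u x = v x" using n by (simp add: indicator_def)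
  qed
qed

lemma solution_unique:
  assumes u: "dirichlet_solution p v0 \<Omega> u" shows "AE x in lebesgue_on \<Omega>. u x = v x"
proof (rule minimizing_unique)
  have c: "u \<in> dirichlet_class v0 \<Omega>" and le: "A_fun p \<Omega> u \<le> A_fun p \<Omega> v"
    using u v_class by (auto simp: dirichlet_solution_def)
  show "integrable (lebesgue_on \<Omega>) u" by (rule class_decomp(2)[OF c])
  fix \<eta> :: real assume "\<eta> > 0"
  then have lt: "A_fun p \<Omega> v + 0 < A_fun p \<Omega> v + ennreal \<eta>"
    using A_fun_v_finite by (simp only: ennreal_add_left_cancel_less infinity_ennreal_def) (simp add: less_top)
  have "A_fun p \<Omega> u < A_fun p \<Omega> v + ennreal \<eta>" by (rule le_less_trans[OF le lt[unfolded add_0_right]])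
  then show "\<exists>w\<in>dirichlet_class v0 \<Omega>. A_fun p \<Omega> w < A_fun p \<Omega> v + ennreal \<eta> \<and> (LINT x|lebesgue_on \<Omega>. \<bar>w x - u x\<bar>) < \<eta>"
    using c \<open>\<eta> > 0\<close> by (intro bexI[of _ u]) auto
qed

lemma v_BV: "v \<in> BV \<Omega>"
proof -
  have "(LINT x|lebesgue_on \<Omega>. v x * (\<Sum>i\<in>UNIV. pdiff i (\<lambda>y. \<phi> y $ i) x)) \<le> (\<Sum>i\<in>UNIV. LINT x|lebesgue_on \<Omega>. \<bar>V x $ i\<bar>)"
    if \<phi>: "\<And>i. (\<lambda>x. \<phi> x $ i) \<in> test_functions \<Omega>" "\<And>x. norm (\<phi> x) \<le> 1" for \<phi> :: "real ^ 'n \<Rightarrow> real ^ 'n"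
  proof -
    note T = test_functionsD[OF \<phi>(1)]
    have lv: "locally_integrable \<Omega> v" and lV: "locally_integrable \<Omega> (\<lambda>x. V x $ i)" for i
      using weak_gradient_v locally_integrable_nth unfolding weak_gradient_def by blast+
    have i1: "integrable (lebesgue_on \<Omega>) (\<lambda>x. v x * pdiff i (\<lambda>y. \<phi> y $ i) x)" for i
      by (rule locally_integrable_test[OF open_dom lv T(5,6) T(3) T(8)])
    have i2: "integrable (lebesgue_on \<Omega>) (\<lambda>x. V x $ i * \<phi> x $ i)" for i
      by (rule locally_integrable_test[OF open_dom lV T(5,6) T(2) T(7)])
    have i3: "integrable (lebesgue_on \<Omega>) (\<lambda>x. \<bar>V x $ i\<bar>)" for i
    proof -
      have "integrable (lebesgue_on \<Omega>) (\<lambda>x. V x \<bullet> axis i 1)" by (rule integrable_inner_left) (rule V_integrable)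
      then show ?thesis by (intro integrable_abs) (simp add: inner_axis)
    qed
    have "(LINT x|lebesgue_on \<Omega>. v x * (\<Sum>i\<in>UNIV. pdiff i (\<lambda>y. \<phi> y $ i) x)) = (\<Sum>i\<in>UNIV. LINT x|lebesgue_on \<Omega>. v x * pdiff i (\<lambda>y. \<phi> y $ i) x)"
      unfolding sum_distrib_left by (rule Bochner_Integration.integral_sum) (rule i1)
    also have "\<dots> = (\<Sum>i\<in>UNIV. - (LINT x|lebesgue_on \<Omega>. V x $ i * \<phi> x $ i))"
      using weak_gradient_v \<phi>(1) unfolding weak_gradient_def by simp
    also have "\<dots> \<le> (\<Sum>i\<in>UNIV. LINT x|lebesgue_on \<Omega>. \<bar>V x $ i\<bar>)"
    proof (rule sum_mono)
      fix i
      have "- (V x $ i * \<phi> x $ i) \<le> \<bar>V x $ i\<bar>" for x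
      proof -
        have "\<bar>\<phi> x $ i\<bar> \<le> 1" using component_le_norm_cart[of "\<phi> x" i] \<phi>(2)[of x] by linarith
        then have "\<bar>V x $ i\<bar> * \<bar>\<phi> x $ i\<bar> \<le> \<bar>V x $ i\<bar> * 1" by (intro mult_left_mono) auto
        then show ?thesis unfolding abs_mult[symmetric] by linarith
      qed
      then have "(LINT x|lebesgue_on \<Omega>. - (V x $ i * \<phi> x $ i)) \<le> (LINT x|lebesgue_on \<Omega>. \<bar>V x $ i\<bar>)"
        by (intro integral_mono i3 Bochner_Integration.integrable_minus i2)
      then show "- (LINT x|lebesgue_on \<Omega>. V x $ i * \<phi> x $ i) \<le> (LINT x|lebesgue_on \<Omega>. \<bar>V x $ i\<bar>)" by simp
    qed
    finally show ?thesis .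
  qed
  then show ?thesis unfolding BV_def using v_integrable by blast
qed

section \<open>Generalized minimizers\<close>

lemma A_fun_v_le_relaxed: "A_fun p \<Omega> v \<le> A_relaxed p v0 \<Omega> w"
  unfolding A_relaxed_def
  by (rule Inf_greatest) (auto intro!: Liminf_bounded always_eventually A_fun_v_le)

lemma A_relaxed_v_le: "A_relaxed p v0 \<Omega> v \<le> A_fun p \<Omega> v"
  unfolding A_relaxed_def
  by (rule Inf_lower, rule CollectI, rule exI[of _ "\<lambda>_. v"]) (simp add: v_class Liminf_const)

lemma v_generalized_minimizer: "generalized_minimizer p v0 \<Omega> v"
  unfolding generalized_minimizer_def using v_BV A_relaxed_v_le A_fun_v_le_relaxed order_trans by blast

lemma generalized_minimizer_unique:
  assumes u: "generalized_minimizer p v0 \<Omega> u" shows "AE x in lebesgue_on \<Omega>. u x = v x"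
proof (rule minimizing_unique)
  show "integrable (lebesgue_on \<Omega>) u" using u by (simp add: generalized_minimizer_def BV_def)
  fix \<eta> :: real assume \<eta>: "\<eta> > 0"
  have "A_relaxed p v0 \<Omega> u \<le> A_relaxed p v0 \<Omega> v" using u v_BV by (auto simp: generalized_minimizer_def)
  also have "\<dots> \<le> A_fun p \<Omega> v + 0" using A_relaxed_v_le by simp
  also have "\<dots> < A_fun p \<Omega> v + ennreal \<eta>"
    using A_fun_v_finite \<eta> by (simp only: ennreal_add_left_cancel_less infinity_ennreal_def) (simp add: less_top)
  finally obtain W where W: "\<And>k. W k \<in> dirichlet_class v0 \<Omega>"
    and lim: "(\<lambda>k. LINT x|lebesgue_on \<Omega>. \<bar>W k x - u x\<bar>) \<longlonglongrightarrow> 0"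
    and li: "liminf (\<lambda>k. A_fun p \<Omega> (W k)) < A_fun p \<Omega> v + ennreal \<eta>"
    unfolding A_relaxed_def Inf_less_iff by blast
  \<comment> \<open>A small limes inferior provides small energy for infinitely many indices only;
    closeness in L^1 holds for all large ones, so some index has both.\<close>
  have "\<not> (\<forall>\<^sub>F k in sequentially. A_fun p \<Omega> v + ennreal \<eta> \<le> A_fun p \<Omega> (W k))"
    using li Liminf_bounded[of "A_fun p \<Omega> v + ennreal \<eta>" "\<lambda>k. A_fun p \<Omega> (W k)" sequentially] by (auto simp: not_le[symmetric])
  then have "\<exists>\<^sub>F k in sequentially. A_fun p \<Omega> (W k) < A_fun p \<Omega> v + ennreal \<eta>"
    unfolding not_eventually not_le .
  moreover have "\<forall>\<^sub>F k in sequentially. (LINT x|lebesgue_on \<Omega>. \<bar>W k x - u x\<bar>) < \<eta>"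
    using order_tendstoD(2)[OF lim \<eta>] .
  ultimately have "\<exists>\<^sub>F k in sequentially. A_fun p \<Omega> (W k) < A_fun p \<Omega> v + ennreal \<eta> \<and> (LINT x|lebesgue_on \<Omega>. \<bar>W k x - u x\<bar>) < \<eta>"
    by (rule frequently_eventually_frequently)
  then obtain k where "A_fun p \<Omega> (W k) < A_fun p \<Omega> v + ennreal \<eta>" "(LINT x|lebesgue_on \<Omega>. \<bar>W k x - u x\<bar>) < \<eta>"
    using frequently_ex by blast
  then show "\<exists>w\<in>dirichlet_class v0 \<Omega>. A_fun p \<Omega> w < A_fun p \<Omega> v + ennreal \<eta> \<and> (LINT x|lebesgue_on \<Omega>. \<bar>w x - u x\<bar>) < \<eta>"
    using W by blast
qed

section \<open>Regularity\<close>


lemma g_lipschitz: obtains L where "L > 0" "\<And>x y. x \<in> closure \<Omega> \<Longrightarrow> y \<in> closure \<Omega> \<Longrightarrow> \<bar>g x - g y\<bar> \<le> L * dist x y"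
proof -
  have sub: "cball (0 :: real ^ 'n) 3 \<subseteq> ball 0 4" by auto
  have "compact (grad g ` cball 0 3)"
    by (intro compact_continuous_image continuous_on_subset[OF smooth_on_grad_continuous[OF sm_g] sub] compact_cball)
  from compact_imp_bounded[OF this] obtain B where B: "\<forall>y \<in> grad g ` cball 0 3. norm y \<le> B"
    unfolding bounded_iff by blast
  define L where "L = max B 1"
  have lip: "norm (g x - g y) \<le> L * norm (x - y)" if "x \<in> cball 0 3" "y \<in> cball 0 3" for x y
  proof (rule differentiable_bound[OF convex_cball _ _ that])
    fix x :: "real ^ 'n" assume x: "x \<in> cball 0 3"
    have "g differentiable (at x)" by (rule smooth_on_imp_differentiable[OF sm_g subsetD[OF sub x]])
    then show "(g has_derivative (\<lambda>h. grad g x \<bullet> h)) (at x within cball 0 3)"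
      by (rule has_derivative_at_withinI[OF has_derivative_grad])
    have nb: "norm (grad g x) \<le> L" using B x unfolding L_def by (intro max.coboundedI1) blast
    show "onorm (\<lambda>h. grad g x \<bullet> h) \<le> L"
    proof (rule onorm_le)
      fix h
      have "norm (grad g x \<bullet> h) \<le> norm (grad g x) * norm h" by (simp add: Cauchy_Schwarz_ineq2)
      also have "\<dots> \<le> L * norm h" using nb by (intro mult_right_mono) auto
      finally show "norm (grad g x \<bullet> h) \<le> L * norm h" .
    qed
  qed
  show thesis
  proof (rule that[of L])
    show "\<bar>g x - g y\<bar> \<le> L * dist x y" if "x \<in> closure \<Omega>" "y \<in> closure \<Omega>" for x y
      using lip[OF subsetD[OF cl_ball(3) that(1)] subsetD[OF cl_ball(3) that(2)]] unfolding dist_norm real_norm_def .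
  qed (simp add: L_def)
qed

lemma v_holder: "v \<in> holder_closure (1 - 2 / p) \<Omega>"
proof -
  define d where "d = 1 - 2 / p"
  have d: "0 < d" "d \<le> 1" using p by (auto simp: d_def)
  obtain G where G: "G > 0" "\<And>x. x \<in> closure \<Omega> \<Longrightarrow> norm (g x) \<le> G"
    by (rule bounded_on_cl[OF continuous_on_subset[OF smooth_on_continuous[OF sm_g] cl_ball(1)]]) (rule that)
  obtain L where L: "L > 0" "\<And>x y. x \<in> closure \<Omega> \<Longrightarrow> y \<in> closure \<Omega> \<Longrightarrow> \<bar>g x - g y\<bar> \<le> L * dist x y"
    by (rule g_lipschitz) (rule that)
  \<comment> \<open>v is \<open>zeta\<close> of one coordinate times a Lipschitz function. On the
    ball of radius 3, |zeta| is at most 3; distances are at most 6, hence at most 6 times their d-th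
    power.\<close>
  have "\<bar>v x - v y\<bar> \<le> (2 * G + 3 * (L * 6)) * dist x y powr d" if x: "x \<in> closure \<Omega>" and y: "y \<in> closure \<Omega>" for x y
  proof -
    have nx: "norm x \<le> 3" "norm y \<le> 3" using x y cl_ball(3) by auto
    have z1: "\<bar>zeta p (x $ a) - zeta p (y $ a)\<bar> \<le> 2 * dist x y powr d"
    proof -
      have "\<bar>x $ a - y $ a\<bar> \<le> dist x y" using component_le_norm_cart[of "x - y" a] by (simp add: dist_norm)
      then have "\<bar>x $ a - y $ a\<bar> powr d \<le> dist x y powr d" using d by (intro powr_mono2) auto
      then show ?thesis using zeta_holder[OF p, of "x $ a" "y $ a"] unfolding d_def by linarith
    qed
    have pow_le: "r powr e \<le> c" if "0 \<le> r" "r \<le> c" "1 \<le> c" "0 \<le> e" "e \<le> 1" for r c e :: real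
    proof -
      have "r powr e \<le> c powr e" using that by (intro powr_mono2) auto
      also have "\<dots> \<le> c powr 1" using that by (intro powr_mono) auto
      finally show ?thesis using that by simp
    qed
    have z2: "\<bar>zeta p (y $ a)\<bar> \<le> 3"
      unfolding abs_zeta d_def[symmetric]
      by (rule pow_le) (use component_le_norm_cart[of y a] nx d in auto)
    have dd: "dist x y \<le> 6 * dist x y powr d"
    proof (cases "x = y")
      case False
      have "dist x y \<le> 6" using norm_triangle_ineq4[of x y] nx unfolding dist_norm by linarith
      then have "dist x y powr (2 / p) \<le> 6" using p by (intro pow_le) auto
      then have "dist x y powr (2 / p) * dist x y powr d \<le> 6 * dist x y powr d" by (intro mult_right_mono) auto
      then show ?thesis using False unfolding powr_add[symmetric] d_def by simp
    qed simp
    have "v x - v y = (zeta p (x $ a) - zeta p (y $ a)) * g x + zeta p (y $ a) * (g x - g y)" by (simp add: v_def algebra_simps)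
    then have "\<bar>v x - v y\<bar> \<le> \<bar>zeta p (x $ a) - zeta p (y $ a)\<bar> * \<bar>g x\<bar> + \<bar>zeta p (y $ a)\<bar> * \<bar>g x - g y\<bar>"
      unfolding abs_mult[symmetric] by linarith
    also have "\<dots> \<le> (2 * dist x y powr d) * G + 3 * (L * (6 * dist x y powr d))"
    proof (intro add_mono mult_mono z1 z2)
      show "\<bar>g x\<bar> \<le> G" using G(2)[OF x] by simp
      have "L * dist x y \<le> L * (6 * dist x y powr d)" using dd L(1) by (intro mult_left_mono) auto
      then show "\<bar>g x - g y\<bar> \<le> L * (6 * dist x y powr d)" using L(2)[OF x y] by linarith
    qed auto
    finally show ?thesis by (simp add: algebra_simps)
  qed
  then show ?thesis unfolding holder_closure_def d_def[symmetric] by blast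
qed

lemma AE_dom: "(AE x in lebesgue_on \<Omega>. P x) \<longleftrightarrow> (AE x in lebesgue. x \<in> \<Omega> \<longrightarrow> P x)"
  using open_dom[of a] by (subst AE_restrict_space_iff) auto

lemma AE_wgrad_v: "AE x in lebesgue. x \<in> \<Omega> \<longrightarrow> wgrad \<Omega> v x = V x \<and> x $ a \<noteq> 0"
proof -
  have "{x :: real ^ 'n. x $ a = 0} \<in> null_sets lebesgue" by (rule null_sets_completionI[OF hyperplane_null])
  from AE_not_in[OF this] wgrad_v[unfolded AE_dom] show ?thesis by eventually_elim simp
qed

text \<open>The set where |Dv| > t lies, up to a null set, in a slab of half-width (c2/t) powr (p/2)
  inside a cube of half-side 3. Its volume to the power 2/p is a constant over t, so t
  cancels.\<close>

lemma v_marcinkiewicz: "v \<in> W1_marcinkiewicz (p / 2) \<Omega>"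
proof -
  obtain c1 c2 where c: "c1 > 0" "c2 > 0"
    "\<And>x. x \<in> closure \<Omega> \<Longrightarrow> x $ a \<noteq> 0 \<Longrightarrow> c1 * \<bar>x $ a\<bar> powr (- 2 / p) \<le> q x \<and> q x \<le> c2 * \<bar>x $ a\<bar> powr (- 2 / p)"
    by (rule q_bounds) (rule that)
  define N where "N = 2 * (6 :: real) ^ (CARD('n) - 1)"
  have N: "N > 0" by (simp add: N_def)
  have "t * measure lebesgue {x \<in> \<Omega>. norm (wgrad \<Omega> v x) > t} powr (1 / (p / 2)) \<le> N powr (2 / p) * c2" if t: "t > 0" for t
  proof -
    define h where "h = (c2 / t) powr (p / 2)"
    have h: "h > 0" using c t by (simp add: h_def)
    define B where "B = cbox (\<chi> i. if i = a then - h else - 3) (\<chi> i. if i = a then h else 3 :: real ^ 'n)"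
    have e: "(if i = a then h else 3) - (if i = a then - h else - 3) = (if i = a then 2 * h else 6)" for i by simp
    have "emeasure lborel B = ennreal (\<Prod>i\<in>UNIV. if i = a then 2 * h else 6)"
      unfolding B_def by (subst emeasure_cbox_cart) (use h in \<open>auto simp only: vec_lambda_beta e split: if_splits\<close>)
    also have "\<dots> = ennreal (N * h)" by (simp only: prod_split_coordinate N_def) (simp add: mult_ac)
    finally have eB: "emeasure lebesgue B = ennreal (N * h)" by (simp add: B_def)
    have "emeasure lebesgue {x \<in> \<Omega>. norm (wgrad \<Omega> v x) > t} \<le> emeasure lebesgue B"
    proof (rule emeasure_mono_AE)
      show "AE x in lebesgue. x \<in> {x \<in> \<Omega>. norm (wgrad \<Omega> v x) > t} \<longrightarrow> x \<in> B"
        using AE_wgrad_v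
      proof eventually_elim
        fix x assume A: "x \<in> \<Omega> \<longrightarrow> wgrad \<Omega> v x = V x \<and> x $ a \<noteq> 0"
        show "x \<in> {x \<in> \<Omega>. norm (wgrad \<Omega> v x) > t} \<longrightarrow> x \<in> B"
        proof
          assume "x \<in> {x \<in> \<Omega>. norm (wgrad \<Omega> v x) > t}"
          then have x: "x \<in> \<Omega>" "t < q x" "x $ a \<noteq> 0" using A by (auto simp: norm_V)
          then have cl: "x \<in> closure \<Omega>" using closure_subset by blast
          then have "t < c2 * \<bar>x $ a\<bar> powr (- 2 / p)" using c(3)[OF cl x(3)] x(2) by linarith
          then have "t * \<bar>x $ a\<bar> powr (2 / p) < c2" using x(3) by (simp add: powr_minus field_simps)
          then have "\<bar>x $ a\<bar> powr (2 / p) \<le> c2 / t" using t by (simp add: field_simps)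
          then have "(\<bar>x $ a\<bar> powr (2 / p)) powr (p / 2) \<le> h" unfolding h_def using p by (intro powr_mono2) auto
          then have xa: "\<bar>x $ a\<bar> \<le> h" using p x(3) by (simp add: powr_powr)
          have "\<bar>x $ i\<bar> \<le> 3" for i using component_le_norm_cart[of x i] cl_ball(3) cl by force
          then show "x \<in> B" using xa unfolding B_def mem_box_cart by (auto simp: abs_le_iff minus_le_iff)
        qed
      qed
      show "B \<in> sets lebesgue" by (simp add: B_def)
    qed
    then have "measure lebesgue {x \<in> \<Omega>. norm (wgrad \<Omega> v x) > t} \<le> N * h"
      unfolding measure_def eB using N h by (metis enn2real_leI less_imp_le mult_pos_pos)
    then have "measure lebesgue {x \<in> \<Omega>. norm (wgrad \<Omega> v x) > t} powr (2 / p) \<le> (N * h) powr (2 / p)"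
      using p by (intro powr_mono2) auto
    also have "\<dots> = N powr (2 / p) * (c2 / t)" using N c t p by (simp add: powr_mult h_def powr_powr)
    finally have "t * measure lebesgue {x \<in> \<Omega>. norm (wgrad \<Omega> v x) > t} powr (2 / p) \<le> t * (N powr (2 / p) * (c2 / t))"
      using t by (intro mult_left_mono) auto
    then show ?thesis using t by simp
  qed
  then have "marcinkiewicz (p / 2) \<Omega> (wgrad \<Omega> v) \<le> ennreal (N powr (2 / p) * c2)"
    unfolding marcinkiewicz_def by (intro SUP_least ennreal_leI) auto
  also have "\<dots> < \<infinity>" by simp
  finally show ?thesis using v_W11 by (simp add: W1_marcinkiewicz_def)
qed

section \<open>Blow-up of the gradient at the hyperplane\<close>

lemma V_large:
  obtains h where "h > 0" "\<And>x. x \<in> \<Omega> \<Longrightarrow> x $ a \<noteq> 0 \<Longrightarrow> \<bar>x $ a\<bar> < h \<Longrightarrow> M < norm (V x)"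
proof -
  obtain c1 c2 where c: "c1 > 0" "c2 > 0"
    "\<And>x. x \<in> closure \<Omega> \<Longrightarrow> x $ a \<noteq> 0 \<Longrightarrow> c1 * \<bar>x $ a\<bar> powr (- 2 / p) \<le> q x \<and> q x \<le> c2 * \<bar>x $ a\<bar> powr (- 2 / p)"
    by (rule q_bounds) (rule that)
  \<comment> \<open>Solves c1 * h powr (-2/p) = |M| + 1, the lower bound for q at distance
    h.\<close>
  define h where "h = ((\<bar>M\<bar> + 1) / c1) powr (- p / 2)"
  have pos: "(\<bar>M\<bar> + 1) / c1 > 0" using c by (simp add: add_nonneg_pos)
  show thesis
  proof (rule that[of h])
    show "h > 0" using pos unfolding h_def by (metis powr_gt_zero less_irrefl)
    fix x assume x: "x \<in> \<Omega>" "x $ a \<noteq> 0" "\<bar>x $ a\<bar> < h"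
    have "(y powr (- p / 2)) powr (- 2 / p) = y" if "y > 0" for y using that p by (simp add: powr_powr)
    from this[OF pos] have "h powr (- 2 / p) = (\<bar>M\<bar> + 1) / c1" unfolding h_def .
    moreover have "h powr (- 2 / p) \<le> \<bar>x $ a\<bar> powr (- 2 / p)" using x p by (intro powr_mono2') auto
    ultimately have "c1 * ((\<bar>M\<bar> + 1) / c1) \<le> c1 * \<bar>x $ a\<bar> powr (- 2 / p)" using c(1) by (intro mult_left_mono) auto
    also have "\<dots> \<le> q x" using c(3)[of x] x closure_subset by blast
    finally show "M < norm (V x)" using c(1) by (simp add: norm_V)
  qed
qed

text \<open>Any bound for the gradient near the origin is violated on a nonempty open set next to
  the hyperplane, and such a set is not null; the choice of the weak gradient does not affect
  this.\<close>

lemma v_not_W1inf: "v \<notin> W1inf_loc \<Omega>"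
proof
  assume "v \<in> W1inf_loc \<Omega>"
  then obtain G where G: "weak_gradient \<Omega> v G"
    and bd: "\<And>K. compact K \<Longrightarrow> K \<subseteq> \<Omega> \<Longrightarrow> \<exists>M. AE x in lebesgue_on K. \<bar>v x\<bar> \<le> M \<and> norm (G x) \<le> M"
    unfolding W1inf_loc_def by blast
  obtain r where r: "r > 0" "cball 0 r \<subseteq> \<Omega>" using open_dom[of a] zero_in_dom[of a] open_contains_cball by blast
  obtain M where M: "AE x in lebesgue_on (cball 0 r). \<bar>v x\<bar> \<le> M \<and> norm (G x) \<le> M" using bd[OF compact_cball r(2)] by blast
  have "AE x in lebesgue. x \<in> cball 0 r \<longrightarrow> \<bar>v x\<bar> \<le> M \<and> norm (G x) \<le> M"
    using M by (subst (asm) AE_restrict_space_iff) auto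
  moreover have "AE x in lebesgue. x \<in> \<Omega> \<longrightarrow> G x = V x"
    using weak_gradient_unique[OF open_dom G weak_gradient_v] unfolding AE_dom .
  ultimately have bd: "AE x in lebesgue. x \<in> cball 0 r \<longrightarrow> norm (V x) \<le> M"
    by eventually_elim (use r(2) in force)
  obtain h where h: "h > 0" "\<And>x. x \<in> \<Omega> \<Longrightarrow> x $ a \<noteq> 0 \<Longrightarrow> \<bar>x $ a\<bar> < h \<Longrightarrow> M < norm (V x)" by (rule V_large[of M]) (rule that)
  define U where "U = ball 0 r \<inter> ({x :: real ^ 'n. x $ a > 0} \<inter> {x. x $ a < h})"
  have U: "open U" unfolding U_def by (intro open_Int open_half open_ball)
  have "AE x in lebesgue. x \<notin> U" using bd
  proof eventually_elim
    fix x assume A: "x \<in> cball 0 r \<longrightarrow> norm (V x) \<le> M"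
    show "x \<notin> U"
    proof
      assume "x \<in> U"
      then have "x \<in> cball 0 r" "x $ a \<noteq> 0" "\<bar>x $ a\<bar> < h" by (auto simp: U_def)
      then show False using h(2)[of x] A r(2) by fastforce
    qed
  qed
  then have "U \<in> null_sets lebesgue" using AE_iff_null_sets[of U lebesgue] U by auto
  then have "negligible U" by (simp add: negligible_iff_null_sets)
  moreover have "norm (axis a 1 :: real ^ 'n) = 1" "(axis a 1 :: real ^ 'n) $ a = 1" by (rule norm_axis_1) (simp add: axis_def)
  then have "(min r h / 2) *\<^sub>R axis a 1 \<in> U" using r(1) h(1) by (auto simp: U_def)
  ultimately show False using open_not_negligible[OF U] by blast
qed

text \<open>Whatever vector A is proposed, |Dv| exceeds |A| + 1 almost everywhere in all
  sufficiently small balls around the point, so the averages stay above 1.\<close>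

lemma not_lebesgue_point:
  assumes x0: "x0 \<in> \<Omega>" "x0 $ a = 0"
  shows "\<not> lebesgue_point (wgrad \<Omega> v) x0"
proof
  assume "lebesgue_point (wgrad \<Omega> v) x0"
  then obtain A where lim: "((\<lambda>r. (LINT x|lebesgue_on (ball x0 r). norm (wgrad \<Omega> v x - A)) / measure lebesgue (ball x0 r)) \<longlongrightarrow> 0) (at_right 0)"
    unfolding lebesgue_point_def by blast
  obtain r0 where r0: "r0 > 0" "ball x0 r0 \<subseteq> \<Omega>" using open_dom[of a] x0(1) open_contains_ball by blast
  obtain h where h: "h > 0" "\<And>x. x \<in> \<Omega> \<Longrightarrow> x $ a \<noteq> 0 \<Longrightarrow> \<bar>x $ a\<bar> < h \<Longrightarrow> norm A + 1 < norm (V x)"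
    by (rule V_large[of "norm A + 1"]) (rule that)
  have ge1: "(LINT x|lebesgue_on (ball x0 r). norm (wgrad \<Omega> v x - A)) / measure lebesgue (ball x0 r) \<ge> 1"
    if r: "0 < r" "r < min r0 h" for r
  proof -
    define B where "B = ball x0 r"
    have B: "B \<subseteq> \<Omega>" "open B" "bounded B" using r r0(2) by (auto simp: B_def)
    have Bm: "B \<in> sets lebesgue" using B(2) by auto
    have mpos: "measure lebesgue B > 0"
      using content_ball_pos[OF r(1), of x0] by (simp add: B_def)
    have Om: "\<Omega> \<in> sets lebesgue" using open_dom[of a] by auto
    have i1: "integrable (lebesgue_on B) (wgrad \<Omega> v)"
    proof -
      have "set_integrable lebesgue \<Omega> (wgrad \<Omega> v)"
        using wgrad_integrable[OF open_dom weak_gradient_v V_integrable]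
        unfolding set_integrable_def integrable_lebesgue_on_iff[OF Om] .
      from set_integrable_subset[OF this Bm B(1)] show ?thesis
        unfolding set_integrable_def integrable_lebesgue_on_iff[OF Bm] .
    qed
    have ic: "integrable (lebesgue_on B) (\<lambda>x. c)" for c :: "'c :: euclidean_space"
      by (rule bounded_continuous_integrable_on[OF B(2,3) continuous_on_const, of _ "norm c"]) simp
    have "measure lebesgue B = (LINT x|lebesgue_on B. 1)"
      using Bm by (simp add: measure_restrict_space)
    also have "\<dots> \<le> (LINT x|lebesgue_on B. norm (wgrad \<Omega> v x - A))"
    proof (rule integral_mono_AE)
      show "integrable (lebesgue_on B) (\<lambda>x. 1 :: real)" by (rule ic)
      show "integrable (lebesgue_on B) (\<lambda>x. norm (wgrad \<Omega> v x - A))"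
        by (intro integrable_norm Bochner_Integration.integrable_diff i1 ic)
      have "AE x in lebesgue. x \<in> B \<longrightarrow> 1 \<le> norm (wgrad \<Omega> v x - A)" using AE_wgrad_v
      proof eventually_elim
        fix x assume W: "x \<in> \<Omega> \<longrightarrow> wgrad \<Omega> v x = V x \<and> x $ a \<noteq> 0"
        show "x \<in> B \<longrightarrow> 1 \<le> norm (wgrad \<Omega> v x - A)"
        proof
          assume x: "x \<in> B"
          have "\<bar>(x - x0) $ a\<bar> \<le> norm (x - x0)" by (rule component_le_norm_cart)
          also have "\<dots> < h" using x r by (simp add: B_def dist_norm norm_minus_commute)
          finally have "\<bar>x $ a\<bar> < h" using x0(2) by simp
          then have "norm A + 1 < norm (V x)" using W x B(1) h(2) by blast
          moreover have "norm (V x) - norm A \<le> norm (V x - A)" by (rule norm_triangle_ineq2)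
          ultimately have "1 \<le> norm (V x - A)" by linarith
          then show "1 \<le> norm (wgrad \<Omega> v x - A)" using W x B(1) by auto
        qed
      qed
      then show "AE x in lebesgue_on B. 1 \<le> norm (wgrad \<Omega> v x - A)" using Bm by (subst AE_restrict_space_iff) auto
    qed
    finally show ?thesis using mpos by (simp add: B_def)
  qed
  have "\<forall>\<^sub>F r in at_right 0. (LINT x|lebesgue_on (ball x0 r). norm (wgrad \<Omega> v x - A)) / measure lebesgue (ball x0 r) < 1"
    by (rule order_tendstoD(2)[OF lim]) simp
  moreover have "\<forall>\<^sub>F r in at_right 0. 0 < r \<and> r < min r0 h"
    unfolding eventually_at_right_field using r0(1) h(1) by (intro exI[of _ "min r0 h"]) auto
  ultimately have "\<forall>\<^sub>F r in at_right (0 :: real). False"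
  proof eventually_elim
    fix r :: real assume "(LINT x|lebesgue_on (ball x0 r). norm (wgrad \<Omega> v x - A)) / measure lebesgue (ball x0 r) < 1" "0 < r \<and> r < min r0 h"
    then show False using ge1[of r] by simp
  qed
  then show False by simp
qed

lemma hausdorff_non_lebesgue: "hausdorff_measure (CARD('n) - 1) {x \<in> \<Omega>. \<not> lebesgue_point (wgrad \<Omega> v) x} > 0"
proof -
  obtain r where r: "r > 0" "ball 0 r \<subseteq> \<Omega>" using open_dom[of a] zero_in_dom[of a] open_contains_ball by blast
  show ?thesis by (rule hausdorff_measure_pos[where a = a, OF r(1)]) (use r(2) not_lebesgue_point in auto)
qed

end

theorem theorem1p1:
  fixes p :: real
  assumes "CARD('n::finite) \<ge> 2" and "p > 2"
  shows "\<exists>(\<Omega> :: (real ^ 'n) set) v0.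
    bounded_domain \<Omega> \<and> smooth_boundary \<Omega> \<and> v0 \<in> smooth_closure \<Omega> \<and>
    (\<exists>v. dirichlet_solution p v0 \<Omega> v \<and>
         (\<forall>u. dirichlet_solution p v0 \<Omega> u \<longrightarrow> (AE x in lebesgue_on \<Omega>. u x = v x)) \<and>
         generalized_minimizer p v0 \<Omega> v \<and>
         (\<forall>u. generalized_minimizer p v0 \<Omega> u \<longrightarrow> (AE x in lebesgue_on \<Omega>. u x = v x)) \<and>
         v \<in> (holder_closure (1 - 2 / p) \<Omega> \<inter> W1_marcinkiewicz (p / 2) \<Omega>) - W1inf_loc \<Omega> \<and>
         hausdorff_measure (CARD('n) - 1) {x \<in> \<Omega>. \<not> lebesgue_point (wgrad \<Omega> v) x} > 0)"
proof -
  obtain a b :: 'n where ab: "a \<noteq> b" using assms(1) card_le_Suc0_iff_eq[of "UNIV :: 'n set"] by fastforce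
  obtain eps om mm g :: "real ^ 'n \<Rightarrow> real"
    where S: "smooth_on (ball 0 4) eps" "smooth_on (ball 0 4) om" "smooth_on (ball 0 4) mm" "smooth_on (ball 0 4) g"
    "\<And>x. x \<in> ball 0 4 \<Longrightarrow> x $ a = eps x * mm x \<and> mm x > 0 \<and> g x > 0"
    "\<And>x. x \<in> ball 0 4 \<Longrightarrow> x $ a \<noteq> 0 \<Longrightarrow> ((\<lambda>x. zeta p (x $ a) * g x) has_derivative
        (\<lambda>h. \<bar>eps x\<bar> powr (- 2 / p) * (cos (om x) * h $ a + sin (om x) * h $ b))) (at x)"
    "\<And>x. x \<in> ball 0 4 \<Longrightarrow> pdiff a (\<lambda>x. (1 + (eps x)\<^sup>2) powr (1 / p - 1) * cos (om x)) x
        + pdiff b (\<lambda>x. (1 + (eps x)\<^sup>2) powr (1 / p - 1) * sin (om x)) x = 0"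
    by (rule singular_solution[OF assms(2) ab]) (rule that)
  interpret singular_field p a b eps om mm g
    by (rule singular_field.intro[OF assms(2) ab S])
  have "v \<in> (holder_closure (1 - 2 / p) (dom a) \<inter> W1_marcinkiewicz (p / 2) (dom a)) - W1inf_loc (dom a)"
    using v_holder v_marcinkiewicz v_not_W1inf by blast
  then have "\<exists>v. dirichlet_solution p v0 (dom a) v \<and>
         (\<forall>u. dirichlet_solution p v0 (dom a) u \<longrightarrow> (AE x in lebesgue_on (dom a). u x = v x)) \<and>
         generalized_minimizer p v0 (dom a) v \<and>
         (\<forall>u. generalized_minimizer p v0 (dom a) u \<longrightarrow> (AE x in lebesgue_on (dom a). u x = v x)) \<and>
         v \<in> (holder_closure (1 - 2 / p) (dom a) \<inter> W1_marcinkiewicz (p / 2) (dom a)) - W1inf_loc (dom a) \<and>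
         hausdorff_measure (CARD('n) - 1) {x \<in> dom a. \<not> lebesgue_point (wgrad (dom a) v) x} > 0"
    by (intro exI[of _ v] conjI allI impI v_solution solution_unique v_generalized_minimizer
        generalized_minimizer_unique hausdorff_non_lebesgue)
  then show ?thesis
    using bounded_domain_dom[of a] smooth_boundary_dom[of a] v0_smooth_closure by blast
qed

end
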